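(* Let $E$ be a maximal (with respect to inclusion) $t$-analytic set for $H^\infty+C$ containing a thin point $x\in M(H^\infty+C)$. Then $E=\overline{P(x)}$, the closure of the Gleason part of $x$.
   Context: Let $\mathbb D$ be the open unit disk, $\mathbb T$ the unit circle, $L^\infty(\mathbb T)$ the algebra of (equivalence classes of) essentially bounded measurable functions on $\mathbb T$ with the essential supremum norm, $H^\infty(\mathbb T)$ the closed subalgebra of those functions in $L^\infty(\mathbb T)$ whose negative Fourier coefficients vanish (identified isometrically with the algebra $H^\infty$ of bounded analytic functions in $\mathbb D$ with the supremum norm), and $C(\mathbb T)$ the continuous functions on $\mathbb T$. $H^\infty+C$ denotes the (closed) algebra $H^\infty(\mathbb T)+C(\mathbb T)\subseteq L^\infty(\mathbb T)$. For a commutative unital semisimple Banach algebra $A$, $M(A)$ is its character space with the Gelfand (weak-$*$) topology, and elements of $A$ are regarded as continuous functions on $M(A)$ via the Gelfand transform. $\mathbb D$ is regarded as a subset of $M(H^\infty)$ via point evaluations, and $M(H^\infty+C)$ is identified (by restriction of characters to $H^\infty$) with $M(H^\infty)\setminus\mathbb D$. A set $E\subseteq M(A)$ is a $t$-analytic set for $A$ if for every $f\in A$ and every non-empty relatively open subset $U$ of $E$, $f\equiv 0$ on $U$ implies $f\equiv 0$ on $E$. A sequence $(z_n)$ in $\mathbb D$ is thin if $\inf_{k}\prod_{j\neq k}\left|\frac{z_j-z_k}{1-\overline{z}_jz_k}\right|>0$ and $\lim_{k\to\infty}\prod_{j\neq k}\left|\frac{z_j-z_k}{1-\overline{z}_jz_k}\right|=1$.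 A point $x\in M(H^\infty+C)$ is a thin point if it belongs to the closure in $M(H^\infty)$ of some thin sequence. For a uniform algebra $A$ and $m\in M(A)$, the Gleason part of $m$ is $P(m)=\{x\in M(A):\rho(x,m)<1\}$, where $\rho(x,m)=\sup\{|f(x)|: f\in A,\ \|f\|\le 1,\ f(m)=0\}$. For $m\in M(H^\infty+C)$ the Gleason parts computed in $H^\infty$ and in $H^\infty+C$ coincide. *)

theory Defs
  imports "HOL-Probability.Probability"
begin

section \<open>The Banach algebra of essentially bounded functions on the unit circle\<close>

text \<open>Normalised arc length, on the Borel sets of the unit circle.  Since the underlying space is
  the circle itself, the values of a function \<open>complex \<Rightarrow> complex\<close> off the circle are irrelevant
  for measurability and for statements holding almost everywhere.\<close>

definition circle :: "complex measure" where
  "circle = distr (uniform_measure lborel {0..2 * pi}) (restrict_space borel (sphere 0 1)) cis"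

lemma cis_measurable_circle:
  "cis \<in> uniform_measure lborel {0..2 * pi} \<rightarrow>\<^sub>M restrict_space borel (sphere 0 1)"
proof -
  have "cis \<in> borel_measurable borel"
    by (intro borel_measurable_continuous_onI) (intro continuous_intros)
  then have "cis \<in> borel_measurable (uniform_measure lborel {0..2 * pi})"
    by simp
  then show ?thesis
    by (intro measurable_restrict_space2) auto
qed

lemma prob_space_circle: "prob_space circle"
  unfolding circle_def
  by (intro prob_space.prob_space_distr prob_space_uniform_measure cis_measurable_circle) auto

lemma space_circle [simp]: "space circle = sphere 0 1"
  by (simp add: circle_def space_restrict_space)

lemma sets_circle [measurable_cong]: "sets circle = sets (restrict_space borel (sphere 0 1))"
  by (simp add: circle_def)

definition ess_bdd :: "(complex \<Rightarrow> complex) \<Rightarrow> bool" where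
  "ess_bdd f \<longleftrightarrow> f \<in> borel_measurable circle \<and> (\<exists>C. AE z in circle. cmod (f z) \<le> C)"

definition Linf_rel :: "(complex \<Rightarrow> complex) \<Rightarrow> (complex \<Rightarrow> complex) \<Rightarrow> bool" where
  "Linf_rel f g \<longleftrightarrow> ess_bdd f \<and> ess_bdd g \<and> (AE z in circle. f z = g z)"

definition ess_norm :: "(complex \<Rightarrow> complex) \<Rightarrow> real" where
  "ess_norm f = real_of_ereal (esssup circle (\<lambda>z. ereal (cmod (f z))))"

lemma ess_bddI: "f \<in> borel_measurable circle \<Longrightarrow> AE z in circle. cmod (f z) \<le> C \<Longrightarrow> ess_bdd f"
  unfolding ess_bdd_def by blast

lemma ess_bdd_measurable: "ess_bdd f \<Longrightarrow> f \<in> borel_measurable circle"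
  unfolding ess_bdd_def by blast

lemma ess_bdd_const: "ess_bdd (\<lambda>_. c)"
  by (rule ess_bddI[where C = "cmod c"]) auto

lemma ess_bdd_add:
  assumes "ess_bdd f" "ess_bdd g"
  shows "ess_bdd (\<lambda>z. f z + g z)"
proof -
  from assms obtain C D where "AE z in circle. cmod (f z) \<le> C" "AE z in circle. cmod (g z) \<le> D"
    unfolding ess_bdd_def by blast
  then have "AE z in circle. cmod (f z + g z) \<le> C + D"
    by eventually_elim (rule norm_triangle_mono)
  then show ?thesis
    by (rule ess_bddI[OF borel_measurable_add[OF assms[THEN ess_bdd_measurable]]])
qed

lemma ess_bdd_mult:
  assumes "ess_bdd f" "ess_bdd g"
  shows "ess_bdd (\<lambda>z. f z * g z)"
proof -
  from assms obtain C D where "AE z in circle. cmod (f z) \<le> C" "AE z in circle. cmod (g z) \<le> D"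
    unfolding ess_bdd_def by blast
  then have "AE z in circle. cmod (f z * g z) \<le> C * D"
    by eventually_elim (simp add: norm_mult mult_mono')
  then show ?thesis
    by (rule ess_bddI[OF borel_measurable_times[OF assms[THEN ess_bdd_measurable]]])
qed

lemma ess_bdd_cmult: "ess_bdd f \<Longrightarrow> ess_bdd (\<lambda>z. c * f z)"
  by (rule ess_bdd_mult[OF ess_bdd_const])

lemma ess_bdd_minus: "ess_bdd f \<Longrightarrow> ess_bdd (\<lambda>z. - f z)"
  using ess_bdd_cmult[of f "- 1"] by simp

lemma ess_bdd_diff: "ess_bdd f \<Longrightarrow> ess_bdd g \<Longrightarrow> ess_bdd (\<lambda>z. f z - g z)"
  using ess_bdd_add[OF _ ess_bdd_minus, of f g] by simp

lemma ess_norm_le: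
  assumes "ess_bdd f" "AE z in circle. cmod (f z) \<le> C"
  shows "ess_norm f \<le> C"
    and "0 \<le> ess_norm f"
    and "AE z in circle. cmod (f z) \<le> ess_norm f"
proof -
  interpret prob_space circle by (rule prob_space_circle)
  let ?g = "\<lambda>z. ereal (cmod (f z))"
  have [measurable]: "f \<in> borel_measurable circle"
    using assms(1) by (rule ess_bdd_measurable)
  have le: "esssup circle ?g \<le> ereal C"
    using assms(2) by (intro esssup_I) auto
  have "esssup circle (\<lambda>_. 0 :: ereal) \<le> esssup circle ?g"
    by (rule esssup_mono) auto
  then have ge: "0 \<le> esssup circle ?g"
    by (simp add: esssup_const emeasure_space_1[simplified])
  have eq: "esssup circle ?g = ereal (ess_norm f)"
    using le ge unfolding ess_norm_def
    by (cases "esssup circle ?g") auto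
  show "ess_norm f \<le> C" "0 \<le> ess_norm f"
    using le ge by (simp_all add: eq)
  show "AE z in circle. cmod (f z) \<le> ess_norm f"
    using esssup_AE[of ?g circle] by (simp add: eq)
qed

lemma ess_norm_AE: "ess_bdd f \<Longrightarrow> AE z in circle. cmod (f z) \<le> ess_norm f"
  using ess_norm_le(3) ess_bdd_def by metis

lemma ess_norm_nonneg: "ess_bdd f \<Longrightarrow> 0 \<le> ess_norm f"
  using ess_norm_le(2) ess_bdd_def by metis

lemma ess_norm_cong:
  assumes "Linf_rel f g"
  shows "ess_norm f = ess_norm g"
proof -
  have [measurable]: "f \<in> borel_measurable circle" "g \<in> borel_measurable circle"
    and ae: "AE z in circle. f z = g z"
    using assms by (auto simp: Linf_rel_def ess_bdd_measurable)
  from ae have ae': "AE z in circle. ereal (cmod (f z)) = ereal (cmod (g z))"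
    by eventually_elim simp
  have "esssup circle (\<lambda>z. ereal (cmod (f z))) = esssup circle (\<lambda>z. ereal (cmod (g z)))"
    by (rule esssup_AE_cong[OF _ _ ae']) measurable
  then show ?thesis
    unfolding ess_norm_def by (rule arg_cong)
qed

lemma ess_norm_scaleR:
  assumes "ess_bdd f"
  shows "ess_norm (\<lambda>z. complex_of_real r * f z) = \<bar>r\<bar> * ess_norm f"
proof (rule antisym)
  have le: "ess_norm (\<lambda>z. complex_of_real s * g z) \<le> \<bar>s\<bar> * ess_norm g" if "ess_bdd g" for s g
  proof -
    have "AE z in circle. cmod (complex_of_real s * g z) \<le> \<bar>s\<bar> * ess_norm g"
      using ess_norm_AE[OF that] by eventually_elim (auto simp: norm_mult intro!: mult_left_mono)
    then show ?thesis
      by (rule ess_norm_le(1)[OF ess_bdd_cmult[OF that]])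
  qed
  show "ess_norm (\<lambda>z. complex_of_real r * f z) \<le> \<bar>r\<bar> * ess_norm f"
    using assms by (rule le)
  show "\<bar>r\<bar> * ess_norm f \<le> ess_norm (\<lambda>z. complex_of_real r * f z)"
  proof (cases "r = 0")
    case True
    then show ?thesis
      using ess_norm_nonneg[OF ess_bdd_const[of 0]] by simp
  next
    case False
    have "(\<lambda>z. complex_of_real (inverse r) * (complex_of_real r * f z)) = f"
      using False by (simp add: mult.assoc[symmetric] of_real_mult[symmetric] del: of_real_mult)
    then have le': "ess_norm f \<le> \<bar>inverse r\<bar> * ess_norm (\<lambda>z. complex_of_real r * f z)"
      using le[OF ess_bdd_cmult[OF assms, of "complex_of_real r"], of "inverse r"] by metis
    have "\<bar>r\<bar> * ess_norm f \<le> \<bar>r\<bar> * (\<bar>inverse r\<bar> * ess_norm (\<lambda>z. complex_of_real r * f z))"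
      using le' by (rule mult_left_mono) simp
    also have "\<dots> = ess_norm (\<lambda>z. complex_of_real r * f z)"
      using False by (simp add: mult.assoc[symmetric] abs_mult[symmetric])
    finally show ?thesis .
  qed
qed

lemma Linf_relI:
  "ess_bdd f \<Longrightarrow> ess_bdd g \<Longrightarrow> AE z in circle. f z = g z \<Longrightarrow> Linf_rel f g"
  unfolding Linf_rel_def by blast

lemma Linf_rel_refl: "Linf_rel f f \<longleftrightarrow> ess_bdd f"
  unfolding Linf_rel_def by auto

quotient_type Linf = "complex \<Rightarrow> complex" / partial: Linf_rel
proof (rule part_equivpI)
  show "\<exists>f. Linf_rel f f"
    by (rule exI[where x = "\<lambda>_. 0"]) (simp add: Linf_rel_refl ess_bdd_const)
  show "symp Linf_rel"
    by (rule sympI) (simp add: Linf_rel_def eq_commute)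
  show "transp Linf_rel"
  proof (rule transpI)
    fix f g h
    assume fg: "Linf_rel f g" and gh: "Linf_rel g h"
    then have "AE z in circle. f z = g z" "AE z in circle. g z = h z"
      by (simp_all add: Linf_rel_def)
    then have "AE z in circle. f z = h z"
      by eventually_elim simp
    with fg gh show "Linf_rel f h"
      by (simp add: Linf_rel_def)
  qed
qed

lift_definition Linf_cscale :: "complex \<Rightarrow> Linf \<Rightarrow> Linf" is "\<lambda>c f z. c * f z"
  unfolding Linf_rel_def by (auto intro: ess_bdd_cmult)

instantiation Linf :: comm_ring_1
begin

lift_definition zero_Linf :: Linf is "\<lambda>_. 0"
  by (simp add: Linf_rel_refl ess_bdd_const)

lift_definition one_Linf :: Linf is "\<lambda>_. 1"
  by (simp add: Linf_rel_refl ess_bdd_const)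

lift_definition plus_Linf :: "Linf \<Rightarrow> Linf \<Rightarrow> Linf" is "\<lambda>f g z. f z + g z"
  unfolding Linf_rel_def by (auto intro: ess_bdd_add)

lift_definition minus_Linf :: "Linf \<Rightarrow> Linf \<Rightarrow> Linf" is "\<lambda>f g z. f z - g z"
  unfolding Linf_rel_def by (auto intro: ess_bdd_diff)

lift_definition uminus_Linf :: "Linf \<Rightarrow> Linf" is "\<lambda>f z. - f z"
  unfolding Linf_rel_def by (auto intro: ess_bdd_minus)

lift_definition times_Linf :: "Linf \<Rightarrow> Linf \<Rightarrow> Linf" is "\<lambda>f g z. f z * g z"
  unfolding Linf_rel_def by (auto intro: ess_bdd_mult)

instance
proof
  fix a b c :: Linf
  show "a * b * c = a * (b * c)"
    by transfer (auto simp: mult.assoc Linf_rel_refl intro!: ess_bdd_mult)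
  show "a * b = b * a"
    by transfer (auto simp: mult.commute Linf_rel_refl intro!: ess_bdd_mult)
  show "1 * a = a"
    by transfer (auto simp: Linf_rel_refl)
  show "a + b + c = a + (b + c)"
    by transfer (auto simp: add.assoc Linf_rel_refl intro!: ess_bdd_add)
  show "a + b = b + a"
    by transfer (auto simp: add.commute Linf_rel_refl intro!: ess_bdd_add)
  show "0 + a = a"
    by transfer (auto simp: Linf_rel_refl)
  show "- a + a = 0"
    by transfer (auto simp: Linf_rel_refl ess_bdd_const)
  show "a - b = a + - b"
    by transfer (auto simp: Linf_rel_refl intro!: ess_bdd_diff)
  show "(a + b) * c = a * c + b * c"
    by transfer (auto simp: distrib_right Linf_rel_refl intro!: ess_bdd_add ess_bdd_mult)
  show "(0 :: Linf) \<noteq> 1"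
  proof transfer
    interpret prob_space circle by (rule prob_space_circle)
    show "\<not> Linf_rel (\<lambda>_. 0) (\<lambda>_. 1)"
      by (simp add: Linf_rel_def AE_False)
  qed
qed

end

instantiation Linf :: real_normed_algebra_1
begin

definition scaleR_Linf :: "real \<Rightarrow> Linf \<Rightarrow> Linf" where
  "scaleR_Linf r f = Linf_cscale (complex_of_real r) f"

lift_definition norm_Linf :: "Linf \<Rightarrow> real" is ess_norm
  by (rule ess_norm_cong)

definition dist_Linf :: "Linf \<Rightarrow> Linf \<Rightarrow> real" where
  "dist_Linf f g = norm (f - g)"

definition sgn_Linf :: "Linf \<Rightarrow> Linf" where
  "sgn_Linf f = inverse (norm f) *\<^sub>R f"

definition uniformity_Linf :: "(Linf \<times> Linf) filter" where
  "uniformity_Linf = (INF e\<in>{0 <..}. principal {(x, y). dist x y < e})"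

definition open_Linf :: "Linf set \<Rightarrow> bool" where
  "open_Linf S = (\<forall>x\<in>S. \<forall>\<^sub>F (x', y) in uniformity. x' = x \<longrightarrow> y \<in> S)"

instance
proof
  fix a b :: real and f g :: Linf and S :: "Linf set"
  show "a *\<^sub>R (f + g) = a *\<^sub>R f + a *\<^sub>R g"
    unfolding scaleR_Linf_def
    by transfer (auto simp: distrib_left Linf_rel_refl intro!: ess_bdd_add ess_bdd_cmult)
  show "(a + b) *\<^sub>R f = a *\<^sub>R f + b *\<^sub>R f"
    unfolding scaleR_Linf_def
    by transfer (auto simp: distrib_right Linf_rel_refl intro!: ess_bdd_add ess_bdd_cmult)
  show "a *\<^sub>R b *\<^sub>R f = (a * b) *\<^sub>R f"
    unfolding scaleR_Linf_def
    by transfer (auto simp: mult.assoc Linf_rel_refl intro!: ess_bdd_cmult)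
  show "1 *\<^sub>R f = f"
    unfolding scaleR_Linf_def by transfer (auto simp: Linf_rel_refl)
  show "a *\<^sub>R f * g = a *\<^sub>R (f * g)"
    unfolding scaleR_Linf_def
    by transfer (auto simp: mult.assoc Linf_rel_refl intro!: ess_bdd_mult ess_bdd_cmult)
  show "f * a *\<^sub>R g = a *\<^sub>R (f * g)"
    unfolding scaleR_Linf_def
    by transfer (auto simp: mult.left_commute Linf_rel_refl intro!: ess_bdd_mult ess_bdd_cmult)
  show "dist f g = norm (f - g)"
    by (rule dist_Linf_def)
  show "sgn f = inverse (norm f) *\<^sub>R f"
    by (rule sgn_Linf_def)
  show "uniformity = (INF e\<in>{0 <..}. principal {(x, y). dist x (y :: Linf) < e})"
    by (rule uniformity_Linf_def)
  show "open S \<longleftrightarrow> (\<forall>x\<in>S. \<forall>\<^sub>F (x', y) in uniformity. x' = x \<longrightarrow> y \<in> S)"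
    by (rule open_Linf_def)
  show "norm f = 0 \<longleftrightarrow> f = 0"
  proof transfer
    fix f assume "Linf_rel f f"
    then have f: "ess_bdd f" by (simp add: Linf_rel_refl)
    show "ess_norm f = 0 \<longleftrightarrow> Linf_rel f (\<lambda>_. 0)"
    proof
      assume "ess_norm f = 0"
      then have "AE z in circle. f z = 0"
        using ess_norm_AE[OF f] by simp
      then show "Linf_rel f (\<lambda>_. 0)"
        by (intro Linf_relI f ess_bdd_const)
    next
      assume "Linf_rel f (\<lambda>_. 0)"
      then have "AE z in circle. cmod (f z) \<le> 0"
        by (simp add: Linf_rel_def)
      then show "ess_norm f = 0"
        using ess_norm_le(1,2)[OF f] by (intro antisym)
    qed
  qed
  show "norm (f + g) \<le> norm f + norm g"
  proof transfer
    fix f g assume "Linf_rel f f" "Linf_rel g g"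
    then have fg: "ess_bdd f" "ess_bdd g" by (simp_all add: Linf_rel_refl)
    have "AE z in circle. cmod (f z + g z) \<le> ess_norm f + ess_norm g"
      using fg[THEN ess_norm_AE] by eventually_elim (rule norm_triangle_mono)
    then show "ess_norm (\<lambda>z. f z + g z) \<le> ess_norm f + ess_norm g"
      by (rule ess_norm_le(1)[OF ess_bdd_add[OF fg]])
  qed
  show "norm (a *\<^sub>R f) = \<bar>a\<bar> * norm f"
    unfolding scaleR_Linf_def by transfer (simp add: ess_norm_scaleR Linf_rel_refl)
  show "norm (f * g) \<le> norm f * norm g"
  proof transfer
    fix f g assume "Linf_rel f f" "Linf_rel g g"
    then have fg: "ess_bdd f" "ess_bdd g" by (simp_all add: Linf_rel_refl)
    have "AE z in circle. cmod (f z * g z) \<le> ess_norm f * ess_norm g"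
      using fg[THEN ess_norm_AE] by eventually_elim (auto simp: norm_mult intro!: mult_mono')
    then show "ess_norm (\<lambda>z. f z * g z) \<le> ess_norm f * ess_norm g"
      by (rule ess_norm_le(1)[OF ess_bdd_mult[OF fg]])
  qed
  show "norm (1 :: Linf) = 1"
  proof transfer
    interpret prob_space circle by (rule prob_space_circle)
    show "ess_norm (\<lambda>_. 1) = 1"
      by (simp add: ess_norm_def esssup_const emeasure_space_1[simplified] one_ereal_def[symmetric])
  qed
qed

end


section \<open>The algebras \<open>H\<^sup>\<infinity>\<close> and \<open>H\<^sup>\<infinity> + C\<close>\<close>

lift_definition fourier :: "Linf \<Rightarrow> int \<Rightarrow> complex"
  is "\<lambda>f n. LINT z|circle. f z * z powi (- n)"
proof
  fix f g :: "complex \<Rightarrow> complex" and n :: int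
  assume "Linf_rel f g"
  then have [measurable]: "f \<in> borel_measurable circle" "g \<in> borel_measurable circle"
    and ae: "AE z in circle. f z = g z"
    by (auto simp: Linf_rel_def ess_bdd_measurable)
  have "continuous_on (sphere 0 1) (\<lambda>z :: complex. z powi (- n))"
    by (intro continuous_intros) auto
  then have [measurable]: "(\<lambda>z. z powi (- n)) \<in> borel_measurable circle"
    by (simp add: borel_measurable_continuous_on_restrict measurable_cong_sets[OF sets_circle refl])
  show "(LINT z|circle. f z * z powi (- n)) = (LINT z|circle. g z * z powi (- n))"
    by (rule integral_cong_AE) (use ae in auto)
qed

definition Hinf :: "Linf set" where
  "Hinf = {f. \<forall>n<0. fourier f n = 0}"

text \<open>A continuous function on the circle is measurable and bounded, so it is the representative
  of an element of \<^typ>\<open>Linf\<close>.\<close>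

lemma ess_bdd_continuous:
  assumes "continuous_on (sphere 0 1) g"
  shows "ess_bdd g"
proof -
  have "bounded (g ` sphere 0 1)"
    using assms by (intro compact_imp_bounded compact_continuous_image) auto
  then obtain C where "\<And>z. z \<in> sphere 0 1 \<Longrightarrow> cmod (g z) \<le> C"
    unfolding bounded_iff by blast
  then have "AE z in circle. cmod (g z) \<le> C"
    by (intro AE_I2) simp
  moreover have "g \<in> borel_measurable circle"
    using assms
    by (simp add: borel_measurable_continuous_on_restrict measurable_cong_sets[OF sets_circle refl])
  ultimately show ?thesis
    by (rule ess_bddI[rotated])
qed

definition CT :: "Linf set" where
  "CT = {abs_Linf g | g. continuous_on (sphere 0 1) g}"

definition HinfC :: "Linf set" where
  "HinfC = {f + g | f g. f \<in> Hinf \<and> g \<in> CT}"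


section \<open>Character spaces\<close>

text \<open>Characters of a subalgebra \<open>A\<close> of \<^typ>\<open>Linf\<close> are functions on the whole type, so they are
  normalised to be \<^const>\<open>undefined\<close> outside \<open>A\<close>.\<close>

definition characters :: "Linf set \<Rightarrow> (Linf \<Rightarrow> complex) set" where
  "characters A = {\<phi> \<in> extensional A. \<phi> 1 = 1 \<and>
     (\<forall>f\<in>A. \<forall>g\<in>A. \<phi> (f + g) = \<phi> f + \<phi> g \<and> \<phi> (f * g) = \<phi> f * \<phi> g) \<and>
     (\<forall>c. \<forall>f\<in>A. \<phi> (Linf_cscale c f) = c * \<phi> f)}"

text \<open>The weak-* (Gelfand) topology is the topology of pointwise convergence on \<open>A\<close>.\<close>

definition gelfand :: "Linf set \<Rightarrow> (Linf \<Rightarrow> complex) topology" where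
  "gelfand A = subtopology (product_topology (\<lambda>_. euclidean) A) (characters A)"

definition t_analytic :: "Linf set \<Rightarrow> (Linf \<Rightarrow> complex) set \<Rightarrow> bool" where
  "t_analytic A E \<longleftrightarrow> E \<subseteq> characters A \<and>
     (\<forall>f\<in>A. \<forall>U. openin (subtopology (gelfand A) E) U \<longrightarrow> U \<noteq> {} \<longrightarrow>
        (\<forall>\<phi>\<in>U. \<phi> f = 0) \<longrightarrow> (\<forall>\<phi>\<in>E. \<phi> f = 0))"

definition maximal_t_analytic :: "Linf set \<Rightarrow> (Linf \<Rightarrow> complex) set \<Rightarrow> bool" where
  "maximal_t_analytic A E \<longleftrightarrow> t_analytic A E \<and> (\<forall>F. t_analytic A F \<longrightarrow> E \<subseteq> F \<longrightarrow> F = E)"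

definition gleason_dist :: "Linf set \<Rightarrow> (Linf \<Rightarrow> complex) \<Rightarrow> (Linf \<Rightarrow> complex) \<Rightarrow> real" where
  "gleason_dist A x m = (SUP f\<in>{f \<in> A. norm f \<le> 1 \<and> m f = 0}. cmod (x f))"

definition gleason_part :: "Linf set \<Rightarrow> (Linf \<Rightarrow> complex) \<Rightarrow> (Linf \<Rightarrow> complex) set" where
  "gleason_part A m = {x \<in> characters A. gleason_dist A x m < 1}"


section \<open>Thin points\<close>

text \<open>The bounded analytic function on the unit disk that corresponds to \<open>f \<in> H\<^sup>\<infinity>\<close> has the
  nonnegative Fourier coefficients of \<open>f\<close> as its Taylor coefficients; \<open>disk_eval z\<close> is the
  evaluation of that function at \<open>z\<close>, which embeds the disk into \<open>characters Hinf\<close>.\<close>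

definition disk_ext :: "Linf \<Rightarrow> complex \<Rightarrow> complex" where
  "disk_ext f z = (\<Sum>n. fourier f (int n) * z ^ n)"

definition disk_eval :: "complex \<Rightarrow> Linf \<Rightarrow> complex" where
  "disk_eval z = restrict (\<lambda>f. disk_ext f z) Hinf"

text \<open>The product over all \<open>j \<noteq> k\<close> is the limit of the (decreasing) finite products; it may be
  \<open>0\<close>, a value that \<^const>\<open>prodinf\<close> does not assign to a product with nonzero factors.\<close>

definition thin_prod :: "(nat \<Rightarrow> complex) \<Rightarrow> nat \<Rightarrow> real" where
  "thin_prod z k =
     lim (\<lambda>N. \<Prod>j\<in>{..<N} - {k}. cmod ((z j - z k) / (1 - cnj (z j) * z k)))"

definition thin_sequence :: "(nat \<Rightarrow> complex) \<Rightarrow> bool" where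
  "thin_sequence z \<longleftrightarrow> range z \<subseteq> ball 0 1 \<and> (INF k. thin_prod z k) > 0 \<and>
     thin_prod z \<longlonglongrightarrow> 1"

text \<open>A character of \<open>H\<^sup>\<infinity> + C\<close> is regarded as a character of \<open>H\<^sup>\<infinity>\<close> by restriction.\<close>

definition thin_point :: "(Linf \<Rightarrow> complex) \<Rightarrow> bool" where
  "thin_point x \<longleftrightarrow> x \<in> characters HinfC \<and>
     (\<exists>z. thin_sequence z \<and>
        restrict x Hinf \<in> gelfand Hinf closure_of range (\<lambda>n. disk_eval (z n)))"

end

theory Submission
  imports Defs "HOL-Complex_Analysis.Complex_Analysis" "HOL-Real_Asymp.Real_Asymp"
begin

text \<open>Let the thin sequence \<open>z\<close> tend to \<open>x\<close> along an ultrafilter \<open>U\<close>. The limits along \<open>U\<close> of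
  \<open>f ((w + z k) / (1 + cnj (z k) * w))\<close> define a disk of characters \<open>Lam w\<close> that depends
  analytically on \<open>w\<close> and is the Gleason part of \<open>x\<close>; by analytic continuation its closure \<open>K\<close>
  is t-analytic. So it is enough to show that every t-analytic set \<open>E\<close> containing \<open>x\<close> lies in \<open>K\<close>.

  Thinness leaves room for multiplicities \<open>p k\<close> that tend slowly to infinity: the Blaschke product
  with zeros \<open>z k\<close> of multiplicity \<open>q k \<le> p k\<close> is still bounded below away from
  pseudohyperbolic disks around the \<open>z k\<close>, even of radius tending to \<open>1\<close>, while it vanishes at
  \<open>Lam w\<close> if \<open>q\<close> tends to infinity along \<open>U\<close>. The first use of such products shows that near \<open>x\<close>
  the set \<open>E\<close> lies in the disk; hence a function that vanishes on the disk
  vanishes on \<open>E\<close>. If \<open>y\<close> is not in \<open>K\<close>, the radii can be chosen so that the disks avoid a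
  neighbourhood of \<open>y\<close>, so a second product vanishes on the disk but not at \<open>y\<close>, and \<open>y\<close> is
  not in \<open>E\<close>.

  To estimate a product at a character, the character is approximated by points of the open disk.
  This is the corona theorem, proved here by Wolff's method; instead of solving a
  d-bar equation one extends linear functionals by the Hahn--Banach theorem, the bounds
  coming from Green's formula.\<close>


section \<open>Green's formula on the disk\<close>

text \<open>The obstacle is that t-analyticity gives no direct access to points of \<open>E\<close>
  far from \<open>x\<close>: it only carries zeros on a neighbourhood of \<open>x\<close> in
  \<open>E\<close> over to all of \<open>E\<close>. A product with a simple zero at each
  \<open>z k\<close> does not produce such zeros, since its limit on the disk vanishes at the centre
  only; unbounded multiplicities give a zero of infinite order, hence the zero function on the disk.
  They are affordable because the sums over \<open>j \<noteq> k\<close> of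
  \<open>1 - cmod (bl (z j) (z k))\<close> tend to \<open>0\<close> with growing \<open>k\<close>
  and have uniformly small tails, so weights that grow slowly enough keep them small. For a merely
  interpolating sequence these sums only stay bounded.

  Neighbourhoods of \<open>x\<close> also meet the disks of ultrafilters \<open>V\<close> other than
  \<open>U\<close>. Such points are removed from \<open>E\<close> by a set \<open>A\<close> of
  indices that belongs to \<open>U\<close> but not to \<open>V\<close>: a product with growing
  multiplicities on \<open>A\<close> alone vanishes at all points of \<open>E\<close> close to
  \<open>x\<close>, hence on \<open>E\<close>, and is unimodular on the disk of
  \<open>V\<close>.\<close>

text \<open>\<open>a\<close> and \<open>b\<close> are the Wirtinger derivatives of \<open>u\<close> with respect to \<open>z\<close> and \<open>cnj z\<close>.\<close>

definition wirt :: "real \<Rightarrow> (complex \<Rightarrow> complex) \<Rightarrow> (complex \<Rightarrow> complex) \<Rightarrow> (complex \<Rightarrow> complex) \<Rightarrow> bool" where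
  "wirt R u a b \<longleftrightarrow> (\<forall>z\<in>ball 0 R. (u has_derivative (\<lambda>h. a z * h + b z * cnj h)) (at z)) \<and>
     continuous_on (ball 0 R) a \<and> continuous_on (ball 0 R) b"

lemma wirtD:
  assumes "wirt R u a b"
  shows "z \<in> ball 0 R \<Longrightarrow> (u has_derivative (\<lambda>h. a z * h + b z * cnj h)) (at z)"
    and "continuous_on (ball 0 R) a" "continuous_on (ball 0 R) b" "continuous_on (ball 0 R) u"
proof -
  show 1: "z \<in> ball 0 R \<Longrightarrow> (u has_derivative (\<lambda>h. a z * h + b z * cnj h)) (at z)" for z
    using assms by (auto simp: wirt_def)
  show "continuous_on (ball 0 R) a" "continuous_on (ball 0 R) b"
    using assms by (auto simp: wirt_def)
  show "continuous_on (ball 0 R) u"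
    using 1 by (meson has_derivative_continuous continuous_at_imp_continuous_on)
qed

lemma wirt_cong:
  assumes "wirt R u a b" "\<And>z. z \<in> ball 0 R \<Longrightarrow> u' z = u z" "\<And>z. z \<in> ball 0 R \<Longrightarrow> a' z = a z" "\<And>z. z \<in> ball 0 R \<Longrightarrow> b' z = b z"
  shows "wirt R u' a' b'"
  unfolding wirt_def
proof (intro conjI ballI)
  fix z :: complex assume z: "z \<in> ball 0 R"
  have "(u has_derivative (\<lambda>h. a' z * h + b' z * cnj h)) (at z)"
    using wirtD(1)[OF assms(1) z] assms(3,4)[OF z] by simp
  then show "(u' has_derivative (\<lambda>h. a' z * h + b' z * cnj h)) (at z)"
    by (rule has_derivative_transform_within_open[OF _ open_ball z]) (simp add: assms)
next
  show "continuous_on (ball 0 R) a'" "continuous_on (ball 0 R) b'"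
    by (rule continuous_on_eq[OF wirtD(2)[OF assms(1)] assms(3)[symmetric]], assumption)
       (rule continuous_on_eq[OF wirtD(3)[OF assms(1)] assms(4)[symmetric]], assumption)
qed

lemma wirt_holomorphic:
  assumes "f holomorphic_on ball 0 R"
  shows "wirt R f (deriv f) (\<lambda>_. 0)"
  unfolding wirt_def
proof (intro conjI ballI)
  fix z :: complex assume "z \<in> ball 0 R"
  then have "(f has_field_derivative deriv f z) (at z)"
    using assms holomorphic_derivI by blast
  then show "(f has_derivative (\<lambda>h. deriv f z * h + 0 * cnj h)) (at z)"
    by (simp add: has_field_derivative_def)
qed (use assms in \<open>auto intro!: holomorphic_on_imp_continuous_on holomorphic_deriv\<close>)

lemma wirt_cnj:
  assumes "wirt R u a b"
  shows "wirt R (\<lambda>z. cnj (u z)) (\<lambda>z. cnj (b z)) (\<lambda>z. cnj (a z))"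
  unfolding wirt_def
proof (intro conjI ballI)
  fix z :: complex assume "z \<in> ball 0 R"
  from has_derivative_cnj[OF wirtD(1)[OF assms this]]
  show "((\<lambda>z. cnj (u z)) has_derivative (\<lambda>h. cnj (b z) * h + cnj (a z) * cnj h)) (at z)"
    by (rule has_derivative_eq_rhs) (auto simp: fun_eq_iff)
qed (use wirtD[OF assms] in \<open>auto intro!: continuous_intros\<close>)

lemma wirt_add:
  assumes "wirt R u a b" "wirt R v c d"
  shows "wirt R (\<lambda>z. u z + v z) (\<lambda>z. a z + c z) (\<lambda>z. b z + d z)"
  unfolding wirt_def
proof (intro conjI ballI)
  fix z :: complex assume z: "z \<in> ball 0 R"
  from has_derivative_add[OF wirtD(1)[OF assms(1) z] wirtD(1)[OF assms(2) z]]
  show "((\<lambda>z. u z + v z) has_derivative (\<lambda>h. (a z + c z) * h + (b z + d z) * cnj h)) (at z)"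
    by (rule has_derivative_eq_rhs) (auto simp: fun_eq_iff algebra_simps)
qed (use wirtD[OF assms(1)] wirtD[OF assms(2)] in \<open>auto intro!: continuous_intros\<close>)

lemma wirt_mult:
  assumes "wirt R u a b" "wirt R v c d"
  shows "wirt R (\<lambda>z. u z * v z) (\<lambda>z. a z * v z + u z * c z) (\<lambda>z. b z * v z + u z * d z)"
  unfolding wirt_def
proof (intro conjI ballI)
  fix z :: complex assume z: "z \<in> ball 0 R"
  from has_derivative_mult[OF wirtD(1)[OF assms(1) z] wirtD(1)[OF assms(2) z]]
  show "((\<lambda>z. u z * v z) has_derivative (\<lambda>h. (a z * v z + u z * c z) * h + (b z * v z + u z * d z) * cnj h)) (at z)"
    by (rule has_derivative_eq_rhs) (auto simp: fun_eq_iff algebra_simps)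
qed (use wirtD[OF assms(1)] wirtD[OF assms(2)] in \<open>auto intro!: continuous_intros\<close>)

lemma wirt_const: "wirt R (\<lambda>_. c) (\<lambda>_. 0) (\<lambda>_. 0)"
  unfolding wirt_def by auto

lemma wirt_sum:
  assumes "finite I" "\<And>i. i \<in> I \<Longrightarrow> wirt R (u i) (a i) (b i)"
  shows "wirt R (\<lambda>z. \<Sum>i\<in>I. u i z) (\<lambda>z. \<Sum>i\<in>I. a i z) (\<lambda>z. \<Sum>i\<in>I. b i z)"
  using assms by (induction I rule: finite_induct) (auto intro: wirt_const wirt_add)

lemma wirt_inverse:
  assumes "wirt R u a b" and nz: "\<And>z. z \<in> ball 0 R \<Longrightarrow> u z \<noteq> 0"
  shows "wirt R (\<lambda>z. inverse (u z)) (\<lambda>z. - a z / (u z)\<^sup>2) (\<lambda>z. - b z / (u z)\<^sup>2)"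
  unfolding wirt_def
proof (intro conjI ballI)
  fix z :: complex assume z: "z \<in> ball 0 R"
  from Deriv.has_derivative_inverse[OF nz[OF z] wirtD(1)[OF assms(1) z]]
  show "((\<lambda>z. inverse (u z)) has_derivative (\<lambda>h. - a z / (u z)\<^sup>2 * h + - b z / (u z)\<^sup>2 * cnj h)) (at z)"
    by (rule has_derivative_eq_rhs) (auto simp: fun_eq_iff field_simps power2_eq_square nz[OF z])
qed (use wirtD[OF assms(1)] nz in \<open>auto intro!: continuous_intros\<close>)

lemma wirt_sqrt:
  fixes v :: "complex \<Rightarrow> real"
  assumes "wirt R (\<lambda>z. of_real (v z)) a b" and pos: "\<And>z. z \<in> ball 0 R \<Longrightarrow> v z > 0"
  shows "wirt R (\<lambda>z. of_real (sqrt (v z))) (\<lambda>z. a z / (2 * of_real (sqrt (v z)))) (\<lambda>z. b z / (2 * of_real (sqrt (v z))))"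
proof -
  have cv: "continuous_on (ball 0 R) v"
    using continuous_on_Re[OF wirtD(4)[OF assms(1)]] by simp
  show ?thesis
    unfolding wirt_def
  proof (intro conjI ballI)
    fix z :: complex assume z: "z \<in> ball 0 R"
    have d: "((\<lambda>z. of_real (v z) :: complex) has_derivative (\<lambda>h. a z * h + b z * cnj h)) (at z)"
      by (rule wirtD(1)[OF assms(1) z])
    have dv: "(v has_derivative (\<lambda>h. Re (a z * h + b z * cnj h))) (at z)"
      using has_derivative_Re[OF d] by simp
    \<comment> \<open>The function is real valued, so its differential has no imaginary part. Hence
      the real chain rule for \<open>sqrt\<close> may be written with the complex coefficients
      \<open>a\<close> and \<open>b\<close>.\<close>
    have im: "a z * h + b z * cnj h = of_real (Re (a z * h + b z * cnj h))" for h
    proof -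
      have "((\<lambda>z. 0::real) has_derivative (\<lambda>h. Im (a z * h + b z * cnj h))) (at z)"
        using has_derivative_Im[OF d] by simp
      then have "(\<lambda>h. Im (a z * h + b z * cnj h)) = (\<lambda>h. 0)"
        using has_derivative_unique has_derivative_const by blast
      then have "Im (a z * h + b z * cnj h) = 0" by meson
      then show ?thesis by (simp add: complex_eq_iff)
    qed
    have "(sqrt has_derivative (\<lambda>x. inverse (sqrt (v z)) / 2 * x)) (at (v z))"
      using DERIV_real_sqrt[OF pos[OF z]] unfolding has_field_derivative_def
      by (rule has_derivative_eq_rhs) (simp add: fun_eq_iff)
    from has_derivative_compose[OF dv this]
    have "((\<lambda>z. of_real (sqrt (v z)) :: complex) has_derivative (\<lambda>h. of_real (inverse (sqrt (v z)) / 2 * Re (a z * h + b z * cnj h)))) (at z)"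
      by (rule has_derivative_of_real)
    moreover have "of_real (inverse (sqrt (v z)) / 2 * Re (a z * h + b z * cnj h)) =
       a z / (2 * of_real (sqrt (v z))) * h + b z / (2 * of_real (sqrt (v z))) * cnj h" for h
    proof -
      have "of_real (inverse (sqrt (v z)) / 2 * Re (a z * h + b z * cnj h)) = of_real (inverse (sqrt (v z)) / 2) * (a z * h + b z * cnj h)"
        using im[of h] by (metis of_real_mult)
      then show ?thesis by (simp add: field_simps add_divide_distrib)
    qed
    ultimately show "((\<lambda>z. of_real (sqrt (v z)) :: complex) has_derivative (\<lambda>h. a z / (2 * of_real (sqrt (v z))) * h + b z / (2 * of_real (sqrt (v z))) * cnj h)) (at z)"
      by (simp only:)
  next
    have nz: "\<forall>z\<in>ball 0 R. 2 * complex_of_real (sqrt (v z)) \<noteq> 0" using pos by fastforce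
    show "continuous_on (ball 0 R) (\<lambda>z. a z / (2 * of_real (sqrt (v z))))"
      by (rule continuous_on_divide[OF wirtD(2)[OF assms(1)] _ nz]) (intro continuous_intros cv)
    show "continuous_on (ball 0 R) (\<lambda>z. b z / (2 * of_real (sqrt (v z))))"
      by (rule continuous_on_divide[OF wirtD(3)[OF assms(1)] _ nz]) (intro continuous_intros cv)
  qed
qed

section \<open>Circular means and Green's formula in polar coordinates\<close>

definition cmean :: "(complex \<Rightarrow> complex) \<Rightarrow> real \<Rightarrow> complex" where
  "cmean v r = integral {0..2*pi} (\<lambda>t. v (of_real r * cis t)) / (2*pi)"

lemma polar_in_ball: "R > 1 \<Longrightarrow> r \<in> {0..1} \<Longrightarrow> of_real r * cis t \<in> ball 0 R"
  by (auto simp: norm_mult)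

lemma continuous_on_polar:
  fixes v :: "complex \<Rightarrow> 'a::topological_space"
  assumes "continuous_on (cball 0 1) v"
  shows "continuous_on ({0..1} \<times> {0..2*pi}) (\<lambda>(r,t). v (of_real r * cis t))"
  unfolding split_beta
  by (rule continuous_on_compose2[OF assms]) (auto intro!: continuous_intros simp: norm_mult)

lemma wirt_polar_r:
  assumes "wirt R u a b" "R > 1" "r \<in> {0..1}"
  shows "((\<lambda>r. u (of_real r * cis t)) has_vector_derivative
     (a (of_real r * cis t) * cis t + b (of_real r * cis t) * cis (-t))) (at r within S)"
proof -
  have d: "((\<lambda>r. of_real r * cis t) has_derivative (\<lambda>h. of_real h * cis t)) (at r within S)"
    by (intro derivative_eq_intros refl) auto
  have "((\<lambda>r. u (of_real r * cis t)) has_derivative (\<lambda>h. a (of_real r * cis t) * (of_real h * cis t) + b (of_real r * cis t) * cnj (of_real h * cis t))) (at r within S)"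
    by (rule has_derivative_compose[OF d wirtD(1)[OF assms(1) polar_in_ball[OF assms(2,3)]]])
  then show ?thesis
    unfolding has_vector_derivative_def
    by (rule has_derivative_eq_rhs) (auto simp: fun_eq_iff algebra_simps scaleR_conv_of_real cis_cnj)
qed

lemma wirt_polar_t:
  assumes "wirt R u a b" "R > 1" "r \<in> {0..1}"
  shows "((\<lambda>t. u (of_real r * cis t)) has_vector_derivative
     (\<i> * of_real r * (a (of_real r * cis t) * cis t - b (of_real r * cis t) * cis (-t)))) (at t within S)"
proof -
  have d: "((\<lambda>t. of_real r * cis t) has_derivative (\<lambda>h. of_real r * (of_real h * (\<i> * cis t)))) (at t within S)"
    by (rule derivative_eq_intros refl)+ (auto simp: fun_eq_iff scaleR_conv_of_real)
  have "((\<lambda>t. u (of_real r * cis t)) has_derivative (\<lambda>h. a (of_real r * cis t) * (of_real r * (of_real h * (\<i> * cis t))) + b (of_real r * cis t) * cnj (of_real r * (of_real h * (\<i> * cis t))))) (at t within S)"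
    by (rule has_derivative_compose[OF d wirtD(1)[OF assms(1) polar_in_ball[OF assms(2,3)]]])
  then show ?thesis
    unfolding has_vector_derivative_def
    by (rule has_derivative_eq_rhs) (auto simp: fun_eq_iff algebra_simps scaleR_conv_of_real cis_cnj)
qed

lemma continuous_on_circle_path:
  assumes "continuous_on (ball 0 R) v" "R > 1" "r \<in> {0..1}"
  shows "continuous_on S (\<lambda>t. v (of_real r * cis t))"
  by (rule continuous_on_compose2[OF assms(1)])
     (use polar_in_ball[OF assms(2,3)] in \<open>auto intro!: continuous_intros\<close>)

text \<open>Up to the factor \<open>\<i> * of_real r\<close>, the difference of the two sides is the
  integral of the angular derivative of \<open>u\<close> over a full period.\<close>

lemma wirt_mean_eq:
  assumes "wirt R u a b" "R > 1" "r \<in> {0<..1}"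
  shows "integral {0..2*pi} (\<lambda>t. a (of_real r * cis t) * cis t) = integral {0..2*pi} (\<lambda>t. b (of_real r * cis t) * cis (-t))"
proof -
  have r: "r \<in> {0..1}" using assms by auto
  have ci: "continuous_on {0..2*pi} cis" "continuous_on {0..2*pi} (\<lambda>t. cis (-t))"
    by (intro continuous_intros)+
  have i1: "(\<lambda>t. a (of_real r * cis t) * cis t) integrable_on {0..2*pi}"
    by (rule integrable_continuous_real[OF continuous_on_mult[OF continuous_on_circle_path[OF wirtD(2)[OF assms(1)] assms(2) r] ci(1)]])
  have i2: "(\<lambda>t. b (of_real r * cis t) * cis (-t)) integrable_on {0..2*pi}"
    by (rule integrable_continuous_real[OF continuous_on_mult[OF continuous_on_circle_path[OF wirtD(3)[OF assms(1)] assms(2) r] ci(2)]])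
  have "((\<lambda>t. \<i> * of_real r * (a (of_real r * cis t) * cis t - b (of_real r * cis t) * cis (-t))) has_integral
      (u (of_real r * cis (2*pi)) - u (of_real r * cis 0))) {0..2*pi}"
    by (rule fundamental_theorem_of_calculus) (auto intro!: wirt_polar_t assms(1,2) r)
  then have "((\<lambda>t. \<i> * of_real r * (a (of_real r * cis t) * cis t - b (of_real r * cis t) * cis (-t))) has_integral 0) {0..2*pi}"
    by simp
  then have "integral {0..2*pi} (\<lambda>t. \<i> * of_real r * (a (of_real r * cis t) * cis t - b (of_real r * cis t) * cis (-t))) = 0"
    by (rule integral_unique)
  then have "\<i> * of_real r * integral {0..2*pi} (\<lambda>t. (a (of_real r * cis t) * cis t - b (of_real r * cis t) * cis (-t))) = 0"
    unfolding integral_mult_right .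
  then have "integral {0..2*pi} (\<lambda>t. (a (of_real r * cis t) * cis t - b (of_real r * cis t) * cis (-t))) = 0"
    using assms by auto
  moreover have "integral {0..2*pi} (\<lambda>t. (a (of_real r * cis t) * cis t - b (of_real r * cis t) * cis (-t)))
     = integral {0..2*pi} (\<lambda>t. a (of_real r * cis t) * cis t) - integral {0..2*pi} (\<lambda>t. b (of_real r * cis t) * cis (-t))"
    by (rule integral_diff[OF i1 i2])
  ultimately show ?thesis by simp
qed

lemma continuous_on_polar':
  assumes "continuous_on (ball 0 R) v" "R > 1"
  shows "continuous_on ({0..1} \<times> S) (\<lambda>x. v (of_real (fst x) * cis (snd x)))"
  by (rule continuous_on_compose2[OF assms(1)])
     (use polar_in_ball[OF assms(2)] in \<open>auto intro!: continuous_intros\<close>)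

text \<open>The radial derivative of \<open>u\<close> is \<open>a * cis t + b * cis (- t)\<close>,
  and both summands have the same integral by \<open>wirt_mean_eq\<close>, so twice either of them
  may be used. Green's formula takes the form in \<open>b\<close> for \<open>u\<close> and the form
  in \<open>a\<close> for \<open>cnj z * q\<close>.\<close>

lemma cmean_deriv:
  assumes "wirt R u a b" "R > 1" "r \<in> {0<..1}"
  shows "(cmean u has_vector_derivative (2 * integral {0..2*pi} (\<lambda>t. b (of_real r * cis t) * cis (-t)) / (2*pi))) (at r within {0..1})"
    and "(cmean u has_vector_derivative (2 * integral {0..2*pi} (\<lambda>t. a (of_real r * cis t) * cis t) / (2*pi))) (at r within {0..1})"
proof -
  have r: "r \<in> {0..1}" using assms by auto
  note [continuous_intros] = continuous_on_circle_path[OF wirtD(2)[OF assms(1)] assms(2)]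
    continuous_on_circle_path[OF wirtD(3)[OF assms(1)] assms(2)]
    continuous_on_circle_path[OF wirtD(4)[OF assms(1)] assms(2)]
    continuous_on_polar'[OF wirtD(2)[OF assms(1)] assms(2)]
    continuous_on_polar'[OF wirtD(3)[OF assms(1)] assms(2)]
  have "((\<lambda>r. integral (cbox 0 (2*pi)) (\<lambda>t. u (of_real r * cis t))) has_vector_derivative
     integral (cbox 0 (2*pi)) (\<lambda>t. a (of_real r * cis t) * cis t + b (of_real r * cis t) * cis (-t))) (at r within {0..1})"
    by (rule leibniz_rule_vector_derivative)
       (use r in \<open>auto intro!: wirt_polar_r[OF assms(1,2)] integrable_continuous_real continuous_intros simp: split_beta\<close>)
  moreover have "integral {0..2*pi} (\<lambda>t. a (of_real r * cis t) * cis t + b (of_real r * cis t) * cis (-t))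
    = integral {0..2*pi} (\<lambda>t. a (of_real r * cis t) * cis t) + integral {0..2*pi} (\<lambda>t. b (of_real r * cis t) * cis (-t))"
    by (rule integral_add) (use r in \<open>auto intro!: integrable_continuous_real continuous_intros\<close>)
  ultimately have "((\<lambda>r. integral {0..2*pi} (\<lambda>t. u (of_real r * cis t))) has_vector_derivative
     2 * integral {0..2*pi} (\<lambda>t. b (of_real r * cis t) * cis (-t))) (at r within {0..1})"
    using wirt_mean_eq[OF assms] by simp
  from has_vector_derivative_divide[OF this, of "of_real (2*pi)"]
  show "(cmean u has_vector_derivative (2 * integral {0..2*pi} (\<lambda>t. b (of_real r * cis t) * cis (-t)) / (2*pi))) (at r within {0..1})"
    unfolding cmean_def by simp
  then show "(cmean u has_vector_derivative (2 * integral {0..2*pi} (\<lambda>t. a (of_real r * cis t) * cis t) / (2*pi))) (at r within {0..1})"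
    using wirt_mean_eq[OF assms] by simp
qed

lemma continuous_on_x_ln: "continuous_on {0..} (\<lambda>r::real. r * ln r)"
proof -
  have "continuous (at r within {0..}) (\<lambda>r::real. r * ln r)" if "r \<ge> 0" for r
  proof (cases "r = 0")
    case True
    have "((\<lambda>r::real. r * ln r) \<longlongrightarrow> 0) (at_right 0)" by real_asymp
    moreover have "at (0::real) within {0..} = at_right 0"
      by (auto simp: at_within_def intro!: arg_cong[where f="\<lambda>A. inf (nhds 0) (principal A)"])
    ultimately show ?thesis using True by (simp add: continuous_within)
  next
    case False
    then show ?thesis using that by (auto intro!: continuous_intros)
  qed
  then show ?thesis by (simp add: continuous_on_eq_continuous_within)
qed

text \<open>The integral, in polar coordinates, against four times the Green's function of the disk with
  pole \<open>0\<close>; the Laplacian is four times the mixed second Wirtinger derivative.\<close>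

definition Jint :: "(complex \<Rightarrow> complex) \<Rightarrow> complex" where
  "Jint v = integral (cbox (0,0) (1,2*pi)) (\<lambda>(r,t). of_real (-(2/pi) * (r * ln r)) * v (of_real r * cis t))"

lemma continuous_on_J_integrand:
  fixes v :: "complex \<Rightarrow> complex"
  assumes "continuous_on (cball 0 1) v"
  shows "continuous_on (cbox (0,0) (1,2*pi)) (\<lambda>(r,t). of_real (-(2/pi) * (r * ln r)) * v (of_real r * cis t))"
proof -
  have "continuous_on (cbox (0,0) (1,2*pi)) (\<lambda>x. fst x * ln (fst x) :: real)"
    by (rule continuous_on_compose2[OF continuous_on_x_ln]) (auto intro!: continuous_intros simp: cbox_Pair_eq)
  then have c: "continuous_on (cbox (0,0) (1,2*pi)) (\<lambda>x. of_real (-(2/pi) * (fst x * ln (fst x))) :: complex)"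
    by (rule continuous_on_of_real[OF continuous_on_mult[OF continuous_on_const]])
  have "continuous_on (cbox (0,0) (1,2*pi)) (\<lambda>x. v (of_real (fst x) * cis (snd x)))"
    using continuous_on_polar[OF assms] by (simp add: cbox_Pair_eq split_beta)
  from continuous_on_mult[OF c this]
  show ?thesis by (simp only: case_prod_unfold)
qed

text \<open>With \<open>N r\<close> the mean of \<open>q * cis (- t)\<close>, the derivative of
  \<open>cmean u\<close> is \<open>2 * N r\<close> and that of \<open>r * N r\<close> is
  \<open>2 * r * cmean q1 r\<close>: a radial equation of second order, which is integrated against
  the logarithm. The function \<open>q1\<close> is a quarter of the Laplacian of
  \<open>u\<close>.\<close>

lemma green:
  assumes u: "wirt R u p q" and q: "wirt R q q1 q2" and R: "R > 1"
  shows "cmean u 1 - u 0 = Jint q1"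
proof -
  have zq: "wirt R (\<lambda>z. cnj z * q z) (\<lambda>z. cnj z * q1 z) (\<lambda>z. q z + cnj z * q2 z)"
    using wirt_mult[OF wirt_cnj[OF wirt_holomorphic[of "\<lambda>z. z"]] q] by (auto simp: holomorphic_on_ident)
  define N where "N r = integral {0..2*pi} (\<lambda>t. q (of_real r * cis t) * cis (-t)) / (2*pi)" for r
  have n: "cmean (\<lambda>z. cnj z * q z) r = of_real r * N r" for r
    unfolding cmean_def N_def by (simp add: cis_cnj mult_ac flip: integral_mult_right)
  have contN: "continuous_on {0..1} N"
  proof -
    note [continuous_intros] = continuous_on_polar'[OF wirtD(4)[OF q] R]
    have "continuous_on {0..1} (\<lambda>r. integral (cbox 0 (2*pi)) (\<lambda>t. q (of_real r * cis t) * cis (-t)))"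
      by (rule integral_continuous_on_param) (auto simp: split_beta intro!: continuous_intros)
    then show ?thesis unfolding N_def by (auto intro!: continuous_intros)
  qed
  have contm: "continuous_on {0..1} (cmean u)"
  proof -
    note [continuous_intros] = continuous_on_polar'[OF wirtD(4)[OF u] R]
    have "continuous_on {0..1} (\<lambda>r. integral (cbox 0 (2*pi)) (\<lambda>t. u (of_real r * cis t)))"
      by (rule integral_continuous_on_param) (auto simp: split_beta intro!: continuous_intros)
    then show ?thesis unfolding cmean_def by (auto intro!: continuous_intros)
  qed
  \<comment> \<open>The boundary term of the integration by parts is built into \<open>W\<close>, so
    that \<open>N\<close> cancels in its derivative. This term vanishes at both ends, as
    \<open>r * ln r\<close> is \<open>0\<close> at \<open>0\<close> and at \<open>1\<close>.\<close>
  define W where "W r = cmean u r - 2 * of_real (r * ln r) * N r" for r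
  have contW: "continuous_on {0..1} W"
    unfolding W_def by (intro continuous_intros contN contm continuous_on_subset[OF continuous_on_x_ln]) auto
  have dW: "(W has_vector_derivative (of_real (- (4 * (r * ln r))) * cmean q1 r)) (at r)" if r: "r \<in> {0<..<1}" for r
  proof -
    have r': "r \<in> {0<..1}" using r by auto
    have at: "at r within {0..1} = at r" using r by (simp add: at_within_Icc_at)
    have d1: "(cmean u has_vector_derivative 2 * N r) (at r)"
      using cmean_deriv(1)[OF u R r'] unfolding at N_def by simp
    have cc: "cis t * (x * (cis (-t) * y)) = x * y" for t and x y :: complex
    proof -
      have "cis t * cis (-t) = 1" by (simp add: cis_mult)
      then show ?thesis by (metis mult.assoc mult.left_commute mult_1)
    qed
    have d2: "(cmean (\<lambda>z. cnj z * q z) has_vector_derivative 2 * of_real r * cmean q1 r) (at r)"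
      using cmean_deriv(2)[OF zq R r'] unfolding at
      by (simp add: cmean_def cis_cnj mult_ac cc flip: integral_mult_right)
    have d3: "((\<lambda>r. 2 * complex_of_real (ln r)) has_vector_derivative 2 * of_real (1 / r)) (at r)"
      using r by (auto intro!: derivative_eq_intros simp: has_vector_derivative_of_real has_real_derivative_iff_has_vector_derivative[symmetric] divide_inverse)
    have "((\<lambda>r. cmean u r - 2 * of_real (ln r) * cmean (\<lambda>z. cnj z * q z) r) has_vector_derivative
       (2 * N r - (2 * of_real (ln r) * (2 * of_real r * cmean q1 r) + 2 * of_real (1/r) * cmean (\<lambda>z. cnj z * q z) r))) (at r)"
      by (intro has_vector_derivative_diff has_vector_derivative_mult d1 d2 d3)
    moreover have "(\<lambda>r. cmean u r - 2 * of_real (ln r) * cmean (\<lambda>z. cnj z * q z) r) = W"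
      by (auto simp: fun_eq_iff W_def n)
    ultimately show ?thesis using r by (simp add: n mult_ac)
  qed
  have "((\<lambda>r. of_real (- (4 * (r * ln r))) * cmean q1 r) has_integral (W 1 - W 0)) {0..1}"
    by (rule fundamental_theorem_of_calculus_interior[OF _ contW dW]) auto
  moreover have "W 1 = cmean u 1" "W 0 = u 0" by (simp_all add: W_def cmean_def scaleR_conv_of_real)
  moreover have "Jint q1 = integral {0..1} (\<lambda>r. of_real (- (4 * (r * ln r))) * cmean q1 r)"
  proof -
    have "continuous_on (cball 0 1) q1"
      using wirtD(2)[OF q] by (rule continuous_on_subset) (use R in auto)
    then have "Jint q1 = integral {0..1} (\<lambda>r. integral {0..2*pi} (\<lambda>t. of_real (-(2/pi) * (r * ln r)) * q1 (of_real r * cis t)))"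
      unfolding Jint_def by (subst integral_prod_continuous) (rule continuous_on_J_integrand, assumption, simp)
    moreover have "integral {0..2*pi} (\<lambda>t. of_real (-(2/pi) * (r * ln r)) * q1 (of_real r * cis t)) = of_real (- (4 * (r * ln r))) * cmean q1 r" for r
      unfolding cmean_def integral_mult_right by (simp add: field_simps)
    ultimately show ?thesis by (simp only:)
  qed
  ultimately show ?thesis by (metis integral_unique)
qed


section \<open>Littlewood--Paley estimates\<close>

lemma complex_mult_cnj_cmod: "z * cnj z = complex_of_real ((cmod z)\<^sup>2)"
  by (rule complex_norm_square[symmetric])

definition rmean :: "(complex \<Rightarrow> real) \<Rightarrow> real" where
  "rmean g = integral {0..2*pi} (\<lambda>t. g (cis t)) / (2*pi)"

definition Jr :: "(complex \<Rightarrow> real) \<Rightarrow> real" where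
  "Jr g = integral (cbox (0,0) (1,2*pi)) (\<lambda>(r,t). (-(2/pi) * (r * ln r)) * g (of_real r * cis t))"

lemma log_weight_nonneg: "x \<in> cbox (0,0) (1,2*pi) \<Longrightarrow> -(2/pi) * (fst x * ln (fst x)) \<ge> 0"
proof -
  assume "x \<in> cbox (0,0) (1,2*pi)"
  then have "fst x * ln (fst x) \<le> 0" by (cases "fst x = 0") (auto simp: cbox_Pair_eq mult_nonneg_nonpos)
  then show ?thesis by (intro mult_nonpos_nonpos) auto
qed

lemma Jr_integrable:
  fixes g :: "complex \<Rightarrow> real"
  assumes "continuous_on (cball 0 1) g"
  shows "(\<lambda>(r,t). (-(2/pi) * (r * ln r)) * g (of_real r * cis t)) integrable_on cbox (0,0) (1,2*pi)"
proof -
  have "continuous_on (cball 0 1) (\<lambda>z. complex_of_real (g z))"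
    by (intro continuous_intros assms)
  from continuous_on_Re[OF continuous_on_J_integrand[OF this]]
  show ?thesis by (intro integrable_continuous) (simp add: case_prod_unfold)
qed

lemma Jint_integrable:
  fixes v :: "complex \<Rightarrow> complex"
  assumes "continuous_on (cball 0 1) v"
  shows "(\<lambda>(r,t). of_real (-(2/pi) * (r * ln r)) * v (of_real r * cis t)) integrable_on cbox (0,0) (1,2*pi)"
  by (intro integrable_continuous continuous_on_J_integrand assms)

lemma Jr_mono:
  assumes "continuous_on (cball 0 1) g" "continuous_on (cball 0 1) h" "\<And>z. z \<in> cball 0 1 \<Longrightarrow> g z \<le> h z"
  shows "Jr g \<le> Jr h"
  unfolding Jr_def
proof (rule integral_le[OF Jr_integrable[OF assms(1)] Jr_integrable[OF assms(2)]])
  fix x :: "real \<times> real" assume x: "x \<in> cbox (0,0) (1,2*pi)"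
  then have "of_real (fst x) * cis (snd x) \<in> cball 0 1"
    by (auto simp: cbox_Pair_eq norm_mult)
  then show "(case x of (r, t) \<Rightarrow> - (2 / pi) * (r * ln r) * g (of_real r * cis t)) \<le> (case x of (r, t) \<Rightarrow> - (2 / pi) * (r * ln r) * h (of_real r * cis t))"
    unfolding case_prod_unfold using log_weight_nonneg[OF x] assms(3) by (intro mult_left_mono)
qed

lemma Jr_add:
  assumes "continuous_on (cball 0 1) g" "continuous_on (cball 0 1) h"
  shows "Jr (\<lambda>z. g z + h z) = Jr g + Jr h"
  using integral_add[OF Jr_integrable[OF assms(1)] Jr_integrable[OF assms(2)]]
  unfolding Jr_def by (simp only: case_prod_unfold distrib_left)

lemma Jr_cmult: "Jr (\<lambda>z. c * g z) = c * Jr g"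
  unfolding Jr_def integral_mult_right[symmetric] by (simp only: case_prod_unfold mult.left_commute)

lemma Jr_sum:
  assumes "finite I" "\<And>i. i \<in> I \<Longrightarrow> continuous_on (cball 0 1) (g i)"
  shows "Jr (\<lambda>z. \<Sum>i\<in>I. g i z) = (\<Sum>i\<in>I. Jr (g i))"
  using assms
proof (induction I rule: finite_induct)
  case empty
  then show ?case by (simp add: Jr_def case_prod_unfold)
next
  case (insert i I)
  then show ?case by (simp add: Jr_add continuous_on_sum)
qed

lemma Jint_add:
  assumes "continuous_on (cball 0 1) g" "continuous_on (cball 0 1) h"
  shows "Jint (\<lambda>z. g z + h z) = Jint g + Jint h"
  using integral_add[OF Jint_integrable[OF assms(1)] Jint_integrable[OF assms(2)]]
  unfolding Jint_def by (simp only: case_prod_unfold distrib_left)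

lemma Jint_cmult: "Jint (\<lambda>z. c * g z) = c * Jint g"
  unfolding Jint_def integral_mult_right[symmetric] by (simp only: case_prod_unfold mult.left_commute)

lemma Jint_cong: "(\<And>z. z \<in> cball 0 1 \<Longrightarrow> g z = h z) \<Longrightarrow> Jint g = Jint h"
  unfolding Jint_def by (intro integral_cong) (auto simp: cbox_Pair_eq norm_mult)

lemma Jint_sum:
  assumes "finite I" "\<And>i. i \<in> I \<Longrightarrow> continuous_on (cball 0 1) (g i)"
  shows "Jint (\<lambda>z. \<Sum>i\<in>I. g i z) = (\<Sum>i\<in>I. Jint (g i))"
  using assms
proof (induction I rule: finite_induct)
  case empty
  then show ?case by (simp add: Jint_def case_prod_unfold)
next
  case (insert i I)
  then show ?case by (simp add: Jint_add continuous_on_sum)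
qed

lemma Re_Jint:
  assumes "continuous_on (cball 0 1) v"
  shows "Re (Jint v) = Jr (\<lambda>z. Re (v z))"
proof -
  have "integral (cbox (0,0) (1,2*pi)) (Re \<circ> (\<lambda>(r,t). of_real (-(2/pi) * (r * ln r)) * v (of_real r * cis t))) = Re (Jint v)"
    unfolding Jint_def by (rule integral_linear[OF Jint_integrable[OF assms] bounded_linear_Re])
  then show ?thesis
    unfolding Jr_def by (simp only: o_def case_prod_unfold Re_complex_of_real times_complex.sel Im_complex_of_real mult_zero_left diff_0_right)
qed

lemma norm_Jint_le:
  assumes "continuous_on (cball 0 1) v" "continuous_on (cball 0 1) g" "\<And>z. z \<in> cball 0 1 \<Longrightarrow> cmod (v z) \<le> g z"
  shows "cmod (Jint v) \<le> Jr g"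
  unfolding Jint_def Jr_def
proof (rule integral_norm_bound_integral[OF Jint_integrable[OF assms(1)] Jr_integrable[OF assms(2)]])
  fix x :: "real \<times> real" assume x: "x \<in> cbox (0,0) (1,2*pi)"
  then have z: "of_real (fst x) * cis (snd x) \<in> cball 0 1"
    by (auto simp: cbox_Pair_eq norm_mult)
  have "cmod (of_real (- (2 / pi) * (fst x * ln (fst x))) * v (of_real (fst x) * cis (snd x))) = (- (2 / pi) * (fst x * ln (fst x))) * cmod (v (of_real (fst x) * cis (snd x)))"
    using log_weight_nonneg[OF x] by (simp only: norm_mult norm_of_real abs_of_nonneg)
  also have "\<dots> \<le> (- (2 / pi) * (fst x * ln (fst x))) * g (of_real (fst x) * cis (snd x))"
    using log_weight_nonneg[OF x] assms(3)[OF z] by (intro mult_left_mono)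
  finally show "cmod (case x of (r, t) \<Rightarrow> complex_of_real (- (2 / pi) * (r * ln r)) * v (complex_of_real r * cis t)) \<le> (case x of (r, t) \<Rightarrow> - (2 / pi) * (r * ln r) * g (of_real r * cis t))"
    unfolding case_prod_unfold .
qed

lemma continuous_on_cis_comp:
  assumes "continuous_on (sphere 0 1) g"
  shows "continuous_on S (\<lambda>t. g (cis t))"
  by (rule continuous_on_compose2[OF assms]) (auto intro!: continuous_intros)

lemma rmean_integrable:
  fixes g :: "complex \<Rightarrow> 'a::banach"
  assumes "continuous_on (sphere 0 1) g"
  shows "(\<lambda>t. g (cis t)) integrable_on {0..2*pi}"
  by (intro integrable_continuous_real continuous_on_cis_comp assms)

lemma rmean_mono:
  assumes "continuous_on (sphere 0 1) g" "continuous_on (sphere 0 1) h" "\<And>z. z \<in> sphere 0 1 \<Longrightarrow> g z \<le> h z"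
  shows "rmean g \<le> rmean h"
  unfolding rmean_def using assms
  by (intro divide_right_mono integral_le rmean_integrable) auto

lemma rmean_add_const:
  assumes "continuous_on (sphere 0 1) g"
  shows "rmean (\<lambda>z. g z + c) = rmean g + c"
proof -
  have "integral {0..2*pi} (\<lambda>t. g (cis t) + c) = integral {0..2*pi} (\<lambda>t. g (cis t)) + integral {0..2*pi} (\<lambda>t. c)"
    by (rule integral_add[OF rmean_integrable[OF assms]]) auto
  then show ?thesis unfolding rmean_def by (simp add: add_divide_distrib)
qed

lemma Re_cmean:
  assumes "continuous_on (sphere 0 1) v"
  shows "Re (cmean v 1) = rmean (\<lambda>z. Re (v z))"
proof -
  have "integral {0..2*pi} (Re \<circ> (\<lambda>t. v (cis t))) = Re (integral {0..2*pi} (\<lambda>t. v (cis t)))"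
    by (rule integral_linear[OF rmean_integrable[OF assms] bounded_linear_Re])
  then show ?thesis unfolding cmean_def rmean_def by (simp add: o_def)
qed

context
  fixes R :: real and h f :: "complex \<Rightarrow> complex" and e :: real
  assumes R: "R > 1" and h: "h holomorphic_on ball 0 R" and f: "f holomorphic_on ball 0 R"
    and f1: "\<And>z. z \<in> ball 0 R \<Longrightarrow> cmod (f z) \<le> 1" and e: "e > 0"
begin

text \<open>A smooth substitute for \<open>cmod (h z)\<close>.\<close>

definition "sqh z = sqrt ((cmod (h z))\<^sup>2 + e)"

lemma sqh_pos: "sqh z > 0" and sqh_sq: "(sqh z)\<^sup>2 = (cmod (h z))\<^sup>2 + e" and sqh_ge: "cmod (h z) \<le> sqh z"
  using e by (auto simp: sqh_def add_nonneg_pos intro!: real_le_rsqrt)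

lemma wirt_sqh: "wirt R (\<lambda>z. of_real (sqh z)) (\<lambda>z. deriv h z * cnj (h z) / (2 * of_real (sqh z)))
   (\<lambda>z. h z * cnj (deriv h z) / (2 * of_real (sqh z)))"
proof -
  have "wirt R (\<lambda>z. h z * cnj (h z) + of_real e) (\<lambda>z. deriv h z * cnj (h z) + h z * cnj 0 + 0) (\<lambda>z. 0 * cnj (h z) + h z * cnj (deriv h z) + 0)"
    by (intro wirt_add wirt_mult wirt_cnj wirt_const wirt_holomorphic h)
  then have "wirt R (\<lambda>z. of_real ((cmod (h z))\<^sup>2 + e)) (\<lambda>z. deriv h z * cnj (h z)) (\<lambda>z. h z * cnj (deriv h z))"
    by (rule wirt_cong) (auto simp: complex_mult_cnj_cmod)
  from wirt_sqrt[OF this] show ?thesis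
    unfolding sqh_def using e by (simp add: add_nonneg_pos)
qed

lemma hol2: "deriv h holomorphic_on ball 0 R" "deriv f holomorphic_on ball 0 R"
  using h f by (auto intro: holomorphic_deriv)

lemma cont_R:
  "continuous_on (cball 0 1) h" "continuous_on (cball 0 1) f"
  "continuous_on (cball 0 1) (deriv h)" "continuous_on (cball 0 1) (deriv f)"
  "continuous_on (cball 0 1) sqh"
proof -
  have "cball 0 1 \<subseteq> ball (0::complex) R" using R by auto
  then show 1: "continuous_on (cball 0 1) h" "continuous_on (cball 0 1) f"
  "continuous_on (cball 0 1) (deriv h)" "continuous_on (cball 0 1) (deriv f)"
    using h f hol2 by (meson holomorphic_on_imp_continuous_on continuous_on_subset)+
  show "continuous_on (cball 0 1) sqh"
    unfolding sqh_def[abs_def] by (intro continuous_intros 1)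
qed

text \<open>The first derivative listed here is the density that Green's formula integrates. It is
  put in real form because the estimates compare it with
  \<open>(cmod (deriv h z))^2 / sqh z\<close>.\<close>

lemma wirt_sqh':
  "wirt R (\<lambda>z. h z * cnj (deriv h z) / (2 * of_real (sqh z)))
     (\<lambda>z. of_real ((cmod (deriv h z))\<^sup>2 / (2 * sqh z) - (cmod (h z))\<^sup>2 * (cmod (deriv h z))\<^sup>2 / (4 * sqh z ^ 3)))
     (\<lambda>z. h z * cnj (deriv (deriv h) z) * inverse (2 * of_real (sqh z)) + h z * cnj (deriv h z) * (- (2 * (h z * cnj (deriv h z) / (2 * of_real (sqh z)))) / (2 * of_real (sqh z))\<^sup>2))"
proof -
  have "wirt R (\<lambda>z. (h z * cnj (deriv h z)) * inverse (2 * of_real (sqh z)))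
    (\<lambda>z. (deriv h z * cnj (deriv h z) + h z * cnj 0) * inverse (2 * of_real (sqh z)) + h z * cnj (deriv h z) * (- (0 * of_real (sqh z) + 2 * (deriv h z * cnj (h z) / (2 * of_real (sqh z)))) / (2 * of_real (sqh z))\<^sup>2))
    (\<lambda>z. (0 * cnj (deriv h z) + h z * cnj (deriv (deriv h) z)) * inverse (2 * of_real (sqh z)) + h z * cnj (deriv h z) * (- (0 * of_real (sqh z) + 2 * (h z * cnj (deriv h z) / (2 * of_real (sqh z)))) / (2 * of_real (sqh z))\<^sup>2))"
    using sqh_pos by (intro wirt_mult wirt_cnj wirt_holomorphic wirt_inverse wirt_const wirt_sqh h hol2) (metis mult_eq_0_iff of_real_eq_0_iff less_irrefl zero_neq_numeral)
  then show ?thesis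
  proof (rule wirt_cong)
    fix z
    have nz: "complex_of_real (sqh z) \<noteq> 0" using sqh_pos[of z] by simp
    define a b s where "a = deriv h z" and "b = h z" and "s = complex_of_real (sqh z)"
    have s: "s \<noteq> 0" using nz by (simp add: s_def)
    have n: "complex_of_real ((cmod x)\<^sup>2) = x * cnj x" for x by (simp add: complex_mult_cnj_cmod)
    have "a * cnj a / (2 * s) - b * cnj b * (a * cnj a) / (4 * s ^ 3)
       = (a * cnj a + b * cnj 0) * inverse (2 * s) + b * cnj a * (- (0 * s + 2 * (a * cnj b / (2 * s))) / (2 * s)\<^sup>2)"
      using s by (simp add: divide_simps power2_eq_square power3_eq_cube)
    then show "of_real ((cmod (deriv h z))\<^sup>2 / (2 * sqh z) - (cmod (h z))\<^sup>2 * (cmod (deriv h z))\<^sup>2 / (4 * sqh z ^ 3)) =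
      (deriv h z * cnj (deriv h z) + h z * cnj 0) * inverse (2 * of_real (sqh z)) + h z * cnj (deriv h z) * (- (0 * of_real (sqh z) + 2 * (deriv h z * cnj (h z) / (2 * of_real (sqh z)))) / (2 * of_real (sqh z))\<^sup>2)"
      unfolding of_real_diff of_real_divide of_real_mult n of_real_power[of "sqh z" 3] of_real_numeral a_def b_def s_def .
  next
    fix z
    show "h z * cnj (deriv (deriv h) z) * inverse (2 * of_real (sqh z)) + h z * cnj (deriv h z) * (- (2 * (h z * cnj (deriv h z) / (2 * of_real (sqh z)))) / (2 * of_real (sqh z))\<^sup>2) =
      (0 * cnj (deriv h z) + h z * cnj (deriv (deriv h) z)) * inverse (2 * of_real (sqh z)) + h z * cnj (deriv h z) * (- (0 * of_real (sqh z) + 2 * (h z * cnj (deriv h z) / (2 * of_real (sqh z)))) / (2 * of_real (sqh z))\<^sup>2)"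
      by (simp only: mult_zero_left add_0)
    show "h z * cnj (deriv h z) / (2 * of_real (sqh z)) = h z * cnj (deriv h z) * inverse (2 * of_real (sqh z))"
      by (rule divide_inverse)
  qed
qed

text \<open>The difference of the two sides is
  \<open>e * (cmod (deriv h z))^2 / (4 * sqh z ^ 3)\<close>. So the regularised modulus keeps the
  lower bound that holds for \<open>cmod h\<close> itself away from the zeros of
  \<open>h\<close>.\<close>

lemma lap_sqh_ge:
  "(cmod (deriv h z))\<^sup>2 / (4 * sqh z) \<le> (cmod (deriv h z))\<^sup>2 / (2 * sqh z) - (cmod (h z))\<^sup>2 * (cmod (deriv h z))\<^sup>2 / (4 * sqh z ^ 3)"
proof -
  have p: "sqh z > 0" by (rule sqh_pos)
  have "(cmod (deriv h z))\<^sup>2 / (2 * sqh z) - (cmod (h z))\<^sup>2 * (cmod (deriv h z))\<^sup>2 / (4 * sqh z ^ 3) - (cmod (deriv h z))\<^sup>2 / (4 * sqh z)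
    = (cmod (deriv h z))\<^sup>2 * ((sqh z)\<^sup>2 - (cmod (h z))\<^sup>2) / (4 * sqh z ^ 3)"
    using p by (simp add: field_simps power2_eq_square power3_eq_cube)
  also have "\<dots> \<ge> 0" using p e by (simp add: sqh_sq)
  finally show ?thesis by simp
qed

text \<open>Green's formula for \<open>sqh\<close>: the value at \<open>0\<close> is positive and
  may be dropped, and the factor \<open>4\<close> comes from \<open>lap_sqh_ge\<close>.\<close>

lemma est1: "Jr (\<lambda>z. (cmod (deriv h z))\<^sup>2 / sqh z) \<le> 4 * rmean sqh"
proof -
  define L where "L z = (cmod (deriv h z))\<^sup>2 / (2 * sqh z) - (cmod (h z))\<^sup>2 * (cmod (deriv h z))\<^sup>2 / (4 * sqh z ^ 3)" for z
  have nz: "sqh z \<noteq> 0" for z using sqh_pos[of z] by simp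
  have cL: "continuous_on (cball 0 1) L"
    unfolding L_def by (intro continuous_intros cont_R) (auto simp: nz)
  have cs: "continuous_on (sphere 0 1) sqh" using cont_R(5) by (rule continuous_on_subset) auto
  have "cmean (\<lambda>z. of_real (sqh z)) 1 - of_real (sqh 0) = Jint (\<lambda>z. of_real (L z))"
    using green[OF wirt_sqh wirt_sqh' R] unfolding L_def .
  then have "Jr L = Re (cmean (\<lambda>z. of_real (sqh z)) 1 - of_real (sqh 0))"
    using Re_Jint[of "\<lambda>z. of_real (L z)"] cL by (simp add: continuous_on_of_real)
  also have "\<dots> \<le> rmean sqh"
    using Re_cmean[of "\<lambda>z. of_real (sqh z)"] cs sqh_pos[of 0] by (simp add: continuous_on_of_real)
  finally have 1: "Jr L \<le> rmean sqh" .
  have "Jr (\<lambda>z. (cmod (deriv h z))\<^sup>2 / sqh z) \<le> Jr (\<lambda>z. 4 * L z)"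
  proof (rule Jr_mono)
    show "continuous_on (cball 0 1) (\<lambda>z. (cmod (deriv h z))\<^sup>2 / sqh z)"
      by (intro continuous_intros cont_R) (auto simp: nz)
    show "(cmod (deriv h z))\<^sup>2 / sqh z \<le> 4 * L z" for z
    proof -
      have "(cmod (deriv h z))\<^sup>2 / sqh z = 4 * ((cmod (deriv h z))\<^sup>2 / (4 * sqh z))" by simp
      then show ?thesis using mult_left_mono[OF lap_sqh_ge[of z], of 4] unfolding L_def by (simp only:)
    qed
  qed (intro continuous_intros cL)
  also have "\<dots> = 4 * Jr L" by (rule Jr_cmult)
  finally show ?thesis using 1 by simp
qed

text \<open>Green's formula for \<open>sqh * (cmod f)^2\<close>. The density \<open>D\<close>
  consists of the wanted term, a nonnegative term and two cross terms, each at most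
  \<open>cmod (deriv h z) * cmod (deriv f z) / 2\<close>. The arithmetic-geometric mean inequality
  absorbs the cross terms into half of the wanted term and the integrand of \<open>est1\<close>;
  hence \<open>6 = 2 * 1 + 4\<close>.\<close>

lemma est2: "Jr (\<lambda>z. sqh z * (cmod (deriv f z))\<^sup>2) \<le> 6 * rmean sqh"
proof -
  have nz: "sqh z \<noteq> 0" for z using sqh_pos[of z] by simp
  define L where "L z = (cmod (deriv h z))\<^sup>2 / (2 * sqh z) - (cmod (h z))\<^sup>2 * (cmod (deriv h z))\<^sup>2 / (4 * sqh z ^ 3)" for z
  define p where "p z = deriv h z * cnj (h z) / (2 * of_real (sqh z))" for z
  define q where "q z = h z * cnj (deriv h z) / (2 * of_real (sqh z))" for z
  have wf: "wirt R (\<lambda>z. f z * cnj (f z)) (\<lambda>z. deriv f z * cnj (f z)) (\<lambda>z. f z * cnj (deriv f z))"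
  proof -
    have "wirt R (\<lambda>z. f z * cnj (f z)) (\<lambda>z. deriv f z * cnj (f z) + f z * cnj 0) (\<lambda>z. 0 * cnj (f z) + f z * cnj (deriv f z))"
      by (intro wirt_mult wirt_cnj wirt_holomorphic f)
    then show ?thesis by simp
  qed
  have w: "wirt R (\<lambda>z. of_real (sqh z)) p q" using wirt_sqh unfolding p_def q_def .
  obtain q2 where q2: "wirt R q (\<lambda>z. of_real (L z)) q2"
    using wirt_sqh' unfolding q_def L_def by blast
  have wf': "wirt R (\<lambda>z. f z * cnj (deriv f z)) (\<lambda>z. deriv f z * cnj (deriv f z)) (\<lambda>z. f z * cnj (deriv (deriv f) z))"
  proof -
    have "wirt R (\<lambda>z. f z * cnj (deriv f z)) (\<lambda>z. deriv f z * cnj (deriv f z) + f z * cnj 0) (\<lambda>z. 0 * cnj (deriv f z) + f z * cnj (deriv (deriv f) z))"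
      by (intro wirt_mult wirt_cnj wirt_holomorphic f hol2)
    then show ?thesis by simp
  qed
  define D where "D z = of_real (L z) * (f z * cnj (f z)) + q z * (deriv f z * cnj (f z)) +
      (p z * (f z * cnj (deriv f z)) + of_real (sqh z) * (deriv f z * cnj (deriv f z)))" for z
  have g: "cmean (\<lambda>z. of_real (sqh z) * (f z * cnj (f z))) 1 - of_real (sqh 0) * (f 0 * cnj (f 0)) = Jint D"
    unfolding D_def by (rule green[OF wirt_mult[OF w wf] wirt_add[OF wirt_mult[OF q2 wf] wirt_mult[OF w wf']] R])
  have cL: "continuous_on (cball 0 1) L"
    unfolding L_def by (intro continuous_intros cont_R) (auto simp: nz)
  have cp: "continuous_on (cball 0 1) p" and cq: "continuous_on (cball 0 1) q"
    unfolding p_def q_def by (intro continuous_intros cont_R; simp add: nz)+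
  have cD: "continuous_on (cball 0 1) D"
    unfolding D_def by (intro continuous_intros cont_R cL cp cq)
  have cs: "continuous_on (sphere 0 1) sqh" "continuous_on (sphere 0 1) f" using cont_R(2,5) by (auto elim: continuous_on_subset)
  have sub: "z \<in> cball 0 1 \<Longrightarrow> z \<in> ball 0 R" for z :: complex using R by auto
  have "Re (Jint D) \<le> rmean sqh"
  proof -
    have "Re (cmean (\<lambda>z. of_real (sqh z) * (f z * cnj (f z))) 1) = rmean (\<lambda>z. sqh z * (cmod (f z))\<^sup>2)"
      by (subst Re_cmean) (auto intro!: continuous_intros cs simp: complex_mult_cnj_cmod simp flip: of_real_mult of_real_power)
    also have "\<dots> \<le> rmean sqh"
    proof (rule rmean_mono)
      fix z :: complex assume "z \<in> sphere 0 1"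
      then have "cmod (f z) \<le> 1" by (intro f1 sub) auto
      then have "(cmod (f z))\<^sup>2 \<le> 1" by (simp add: power_le_one)
      then show "sqh z * (cmod (f z))\<^sup>2 \<le> sqh z" using sqh_pos[of z] by (simp add: mult_left_le)
    qed (intro continuous_intros cs)+
    finally have "Re (cmean (\<lambda>z. of_real (sqh z) * (f z * cnj (f z))) 1) \<le> rmean sqh" .
    moreover have "Re (of_real (sqh 0) * (f 0 * cnj (f 0))) \<ge> 0"
      using sqh_pos[of 0] by (simp add: complex_mult_cnj_cmod)
    ultimately show ?thesis using g[symmetric] by simp
  qed
  then have JD: "Jr (\<lambda>z. Re (D z)) \<le> rmean sqh" by (simp add: Re_Jint[OF cD])
  have "Jr (\<lambda>z. sqh z * (cmod (deriv f z))\<^sup>2) \<le> Jr (\<lambda>z. 2 * Re (D z) + (cmod (deriv h z))\<^sup>2 / sqh z)"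
  proof (rule Jr_mono)
    show "continuous_on (cball 0 1) (\<lambda>z. sqh z * (cmod (deriv f z))\<^sup>2)"
      by (intro continuous_intros cont_R)
    show "continuous_on (cball 0 1) (\<lambda>z. 2 * Re (D z) + (cmod (deriv h z))\<^sup>2 / sqh z)"
      by (intro continuous_intros cont_R cD) (auto simp: nz)
    fix z :: complex assume z: "z \<in> cball 0 1"
    have sp: "sqh z > 0" by (rule sqh_pos)
    have Lp: "L z \<ge> 0" using lap_sqh_ge[of z] sp unfolding L_def by (smt (verit) divide_nonneg_pos zero_le_power2)
    have fz: "cmod (f z) \<le> 1" using f1 sub z by auto
    have pb: "cmod (p z) \<le> cmod (deriv h z) / 2" "cmod (q z) \<le> cmod (deriv h z) / 2"
      using mult_right_mono[OF sqh_ge[of z] norm_ge_zero[of "deriv h z"]] sp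
      by (auto simp: p_def q_def norm_mult norm_divide field_simps)
    have a1: "cmod (q z * (deriv f z * cnj (f z))) \<le> cmod (deriv h z) / 2 * (cmod (deriv f z) * 1)"
      unfolding norm_mult complex_mod_cnj using pb fz by (intro mult_mono) auto
    have a2: "cmod (p z * (f z * cnj (deriv f z))) \<le> cmod (deriv h z) / 2 * (1 * cmod (deriv f z))"
      unfolding norm_mult complex_mod_cnj using pb fz by (intro mult_mono) auto
    have "Re (D z) = L z * (cmod (f z))\<^sup>2 + Re (q z * (deriv f z * cnj (f z))) + (Re (p z * (f z * cnj (deriv f z))) + sqh z * (cmod (deriv f z))\<^sup>2)"
      unfolding D_def plus_complex.sel complex_mult_cnj_cmod of_real_mult[symmetric] Re_complex_of_real ..
    moreover have "L z * (cmod (f z))\<^sup>2 \<ge> 0" using Lp by simp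
    moreover have "Re (q z * (deriv f z * cnj (f z))) \<ge> - (cmod (deriv h z) * cmod (deriv f z) / 2)"
      using a1 abs_Re_le_cmod[of "q z * (deriv f z * cnj (f z))"] by (simp add: abs_le_iff)
    moreover have "Re (p z * (f z * cnj (deriv f z))) \<ge> - (cmod (deriv h z) * cmod (deriv f z) / 2)"
      using a2 abs_Re_le_cmod[of "p z * (f z * cnj (deriv f z))"] by (simp add: abs_le_iff)
    moreover have "2 * (cmod (deriv h z) * cmod (deriv f z)) \<le> sqh z * (cmod (deriv f z))\<^sup>2 + (cmod (deriv h z))\<^sup>2 / sqh z"
    proof -
      have "0 \<le> (sqh z * cmod (deriv f z) - cmod (deriv h z))\<^sup>2 / sqh z" using sp by simp
      also have "\<dots> = sqh z * (cmod (deriv f z))\<^sup>2 + (cmod (deriv h z))\<^sup>2 / sqh z - 2 * (cmod (deriv h z) * cmod (deriv f z))"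
        using sp by (simp add: power2_eq_square field_simps)
      finally show ?thesis by simp
    qed
    ultimately show "sqh z * (cmod (deriv f z))\<^sup>2 \<le> 2 * Re (D z) + (cmod (deriv h z))\<^sup>2 / sqh z"
      by linarith
  qed
  also have "\<dots> = 2 * Jr (\<lambda>z. Re (D z)) + Jr (\<lambda>z. (cmod (deriv h z))\<^sup>2 / sqh z)"
    by (subst Jr_add) (auto intro!: continuous_intros cont_R cD simp: nz Jr_cmult)
  finally show ?thesis using JD est1 by simp
qed

text \<open>By the arithmetic-geometric mean inequality the integrand is at most the average of
  those of \<open>est2\<close> and \<open>est1\<close>, whence
  \<open>5 = (6 + 4) / 2\<close>.\<close>

lemma est3: "Jr (\<lambda>z. cmod (deriv h z) * cmod (deriv f z)) \<le> 5 * rmean sqh"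
proof -
  have nz: "sqh z \<noteq> 0" for z using sqh_pos[of z] by simp
  have "Jr (\<lambda>z. cmod (deriv h z) * cmod (deriv f z)) \<le> Jr (\<lambda>z. (1/2) * (sqh z * (cmod (deriv f z))\<^sup>2) + (1/2) * ((cmod (deriv h z))\<^sup>2 / sqh z))"
  proof (rule Jr_mono)
    fix z
    have sp: "sqh z > 0" by (rule sqh_pos)
      have "0 \<le> (sqh z * cmod (deriv f z) - cmod (deriv h z))\<^sup>2 / sqh z" using sp by simp
      also have "\<dots> = sqh z * (cmod (deriv f z))\<^sup>2 + (cmod (deriv h z))\<^sup>2 / sqh z - 2 * (cmod (deriv h z) * cmod (deriv f z))"
        using sp by (simp add: power2_eq_square field_simps)
    finally show "cmod (deriv h z) * cmod (deriv f z) \<le> (1/2) * (sqh z * (cmod (deriv f z))\<^sup>2) + (1/2) * ((cmod (deriv h z))\<^sup>2 / sqh z)"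
      by simp
  qed (intro continuous_intros cont_R; simp add: nz)+
  also have "\<dots> = (1/2) * Jr (\<lambda>z. sqh z * (cmod (deriv f z))\<^sup>2) + (1/2) * Jr (\<lambda>z. (cmod (deriv h z))\<^sup>2 / sqh z)"
    unfolding Jr_cmult[symmetric] by (rule Jr_add) (intro continuous_intros cont_R; simp add: nz)+
  finally show ?thesis using est1 est2 by simp
qed

lemma rmean_sqh_le: "rmean sqh \<le> rmean (\<lambda>z. cmod (h z)) + sqrt e"
proof -
  have ch: "continuous_on (sphere 0 1) h" "continuous_on (sphere 0 1) sqh" using cont_R(1,5) by (auto elim: continuous_on_subset)
  have "rmean sqh \<le> rmean (\<lambda>z. cmod (h z) + sqrt e)"
  proof (rule rmean_mono)
    show "sqh z \<le> cmod (h z) + sqrt e" for z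
      using sqrt_add_le_add_sqrt[of "(cmod (h z))\<^sup>2" e] e by (simp add: sqh_def)
  qed (intro continuous_intros ch)+
  also have "\<dots> = rmean (\<lambda>z. cmod (h z)) + sqrt e"
    by (rule rmean_add_const) (intro continuous_intros ch)
  finally show ?thesis .
qed

end

lemma le_all_sqrt:
  fixes a b c :: real
  assumes "\<And>e. e > 0 \<Longrightarrow> a \<le> c * (b + sqrt e)" "c \<ge> 0"
  shows "a \<le> c * b"
proof -
  have "((\<lambda>e. c * (b + sqrt e)) \<longlongrightarrow> c * (b + sqrt 0)) (at_right 0)"
    by (intro tendsto_intros) 
  then have "((\<lambda>e. c * (b + sqrt e)) \<longlongrightarrow> c * b) (at_right 0)" by simp
  then show ?thesis
    by (rule tendsto_lowerbound) (auto simp: eventually_at_right_less assms(1) eventually_at_filter)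
qed

text \<open>The limit of \<open>est2\<close> and \<open>est3\<close> as \<open>e\<close> tends to
  \<open>0\<close>. The first inequality says that \<open>(cmod (deriv f z))^2\<close> against the
  Green weight is the density of a Carleson measure; the second is its bilinear companion, which
  also admits the derivative of \<open>h\<close>.\<close>

lemma littlewood_paley:
  assumes "R > 1" "h holomorphic_on ball 0 R" "f holomorphic_on ball 0 R" "\<And>z. z \<in> ball 0 R \<Longrightarrow> cmod (f z) \<le> 1"
  shows "Jr (\<lambda>z. cmod (h z) * (cmod (deriv f z))\<^sup>2) \<le> 6 * rmean (\<lambda>z. cmod (h z))"
    and "Jr (\<lambda>z. cmod (deriv h z) * cmod (deriv f z)) \<le> 5 * rmean (\<lambda>z. cmod (h z))"
proof -
  note a = assms
  note c = cont_R[OF a zero_less_one] and ce = cont_R[OF a]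
  show "Jr (\<lambda>z. cmod (h z) * (cmod (deriv f z))\<^sup>2) \<le> 6 * rmean (\<lambda>z. cmod (h z))"
  proof (rule le_all_sqrt)
    fix e :: real assume e: "e > 0"
    have "Jr (\<lambda>z. cmod (h z) * (cmod (deriv f z))\<^sup>2) \<le> Jr (\<lambda>z. sqh h e z * (cmod (deriv f z))\<^sup>2)"
      by (rule Jr_mono) (auto intro!: continuous_intros c ce(5) e mult_right_mono sqh_ge[OF a e])
    also have "\<dots> \<le> 6 * rmean (sqh h e)" by (rule est2[OF a e])
    also have "\<dots> \<le> 6 * (rmean (\<lambda>z. cmod (h z)) + sqrt e)" using rmean_sqh_le[OF a e] by simp
    finally show "Jr (\<lambda>z. cmod (h z) * (cmod (deriv f z))\<^sup>2) \<le> 6 * (rmean (\<lambda>z. cmod (h z)) + sqrt e)" .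
  qed simp
  show "Jr (\<lambda>z. cmod (deriv h z) * cmod (deriv f z)) \<le> 5 * rmean (\<lambda>z. cmod (h z))"
  proof (rule le_all_sqrt)
    fix e :: real assume e: "e > 0"
    have "Jr (\<lambda>z. cmod (deriv h z) * cmod (deriv f z)) \<le> 5 * rmean (sqh h e)" by (rule est3[OF a e])
    also have "\<dots> \<le> 5 * (rmean (\<lambda>z. cmod (h z)) + sqrt e)" using rmean_sqh_le[OF a e] by simp
    finally show "Jr (\<lambda>z. cmod (deriv h z) * cmod (deriv f z)) \<le> 5 * (rmean (\<lambda>z. cmod (h z)) + sqrt e)" .
  qed simp
qed


section \<open>The Hahn--Banach theorem\<close>

text \<open>Zorn's lemma is applied to graphs: a partial functional is a subspace of the product
  space that lies below \<open>p\<close>. Being single-valued is then automatic, since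
  \<open>(0, a)\<close> and \<open>(0, - a)\<close> in such a subspace force both \<open>a\<close>
  and \<open>- a\<close> to be at most \<open>p 0 = 0\<close>.\<close>

lemma Hahn_Banach_sublinear:
  fixes p :: "'a::real_vector \<Rightarrow> real" and f :: "'a \<Rightarrow> real"
  assumes sub: "\<And>x y. p (x + y) \<le> p x + p y" and hom: "\<And>c x. c \<ge> 0 \<Longrightarrow> p (c *\<^sub>R x) = c * p x"
    and M: "subspace M" and fadd: "\<And>x y. x \<in> M \<Longrightarrow> y \<in> M \<Longrightarrow> f (x + y) = f x + f y"
    and fscale: "\<And>c x. x \<in> M \<Longrightarrow> f (c *\<^sub>R x) = c * f x"
    and le: "\<And>x. x \<in> M \<Longrightarrow> f x \<le> p x"
  obtains g where "linear g" "\<And>x. g x \<le> p x" "\<And>x. x \<in> M \<Longrightarrow> g x = f x"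
proof -
  define G0 where "G0 = (\<lambda>x. (x, f x)) ` M"
  define \<A> where "\<A> = {G. subspace G \<and> (\<forall>(v,a)\<in>G. a \<le> p v) \<and> G0 \<subseteq> G}"
  have "subspace G0"
    unfolding subspace_def
  proof (intro conjI ballI allI)
    have "f 0 = 0" using fscale[of 0 0] subspace_0[OF M] by simp
    then show "0 \<in> G0" using subspace_0[OF M] by (force simp: G0_def zero_prod_def)
  qed (auto simp: G0_def image_iff fadd fscale intro!: subspace_add[OF M] subspace_scale[OF M] bexI)
  then have "G0 \<in> \<A>" using le by (auto simp: \<A>_def G0_def)
  then have "\<exists>G\<in>\<A>. \<forall>X\<in>\<A>. G \<subseteq> X \<longrightarrow> X = G"
  proof (intro subset_Zorn_nonempty)
    fix \<C> assume C: "\<C> \<noteq> {}" "subset.chain \<A> \<C>"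
    then have CA: "\<And>X. X \<in> \<C> \<Longrightarrow> X \<in> \<A>" and lin: "\<And>X Y. X \<in> \<C> \<Longrightarrow> Y \<in> \<C> \<Longrightarrow> X \<subseteq> Y \<or> Y \<subseteq> X"
      by (auto simp: subset.chain_def)
    have "subspace (\<Union>\<C>)"
      unfolding subspace_def
    proof (intro conjI ballI allI)
      show "0 \<in> \<Union>\<C>" using C(1) CA by (auto simp: \<A>_def subspace_0)
      fix x y assume "x \<in> \<Union>\<C>" "y \<in> \<Union>\<C>"
      then obtain X Y where XY: "X \<in> \<C>" "Y \<in> \<C>" "x \<in> X" "y \<in> Y" by blast
      from lin[OF XY(1,2)] obtain Z where "Z \<in> \<C>" "x \<in> Z" "y \<in> Z" using XY by blast
      moreover from this have "subspace Z" using CA by (auto simp: \<A>_def)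
      ultimately show "x + y \<in> \<Union>\<C>" using subspace_add by blast
    next
      fix c x assume "x \<in> \<Union>\<C>"
      then obtain Z where Z: "Z \<in> \<C>" "x \<in> Z" by blast
      then have "subspace Z" using CA by (auto simp: \<A>_def)
      then show "c *\<^sub>R x \<in> \<Union>\<C>" using Z subspace_scale by blast
    qed
    then show "\<Union>\<C> \<in> \<A>" using C(1) CA unfolding \<A>_def by blast
  qed auto
  then obtain G where G: "G \<in> \<A>" and max: "\<And>X. X \<in> \<A> \<Longrightarrow> G \<subseteq> X \<Longrightarrow> X = G" by blast
  have sG: "subspace G" and Gp: "\<And>v a. (v,a) \<in> G \<Longrightarrow> a \<le> p v" and G0: "G0 \<subseteq> G"
    using G by (auto simp: \<A>_def)
  have Ga: "(v + w, a + b) \<in> G" if "(v,a) \<in> G" "(w,b) \<in> G" for v a w b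
    using subspace_add[OF sG that] by simp
  have Gs: "(c *\<^sub>R v, c * a) \<in> G" if "(v,a) \<in> G" for v a c
    using subspace_scale[OF sG that, of c] by simp
  have G00: "(0,0) \<in> G" using subspace_0[OF sG] by (simp add: zero_prod_def)
  have p0: "p 0 = 0" using hom[of 0 0] by simp
  have uniq: "a = b" if "(v,a) \<in> G" "(v,b) \<in> G" for v a b
  proof -
    have "(0, a - b) \<in> G" using Ga[OF that(1) Gs[OF that(2), of "-1"]] by simp
    then have "a - b \<le> 0" using Gp p0 by metis
    moreover have "(0, b - a) \<in> G" using Ga[OF that(2) Gs[OF that(1), of "-1"]] by simp
    then have "b - a \<le> 0" using Gp p0 by metis
    ultimately show ?thesis by simp
  qed
  have total: "\<exists>a. (v0,a) \<in> G" for v0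
  proof (rule ccontr)
    assume nex: "\<nexists>a. (v0,a) \<in> G"
    have key: "a - p (v - v0) \<le> p (w + v0) - b" if "(v,a) \<in> G" "(w,b) \<in> G" for v a w b
    proof -
      have "a + b \<le> p (v + w)" using Gp[OF Ga[OF that]] .
      also have "\<dots> \<le> p (v - v0) + p (w + v0)" using sub[of "v - v0" "w + v0"] by (simp add: algebra_simps)
      finally show ?thesis by simp
    qed
    \<comment> \<open>By \<open>key\<close> each of these lower values is at most each upper value,
      so the supremum fits in between; it becomes the value of the extension at
      \<open>v0\<close>.\<close>
    define c where "c = (SUP (v,a)\<in>G. a - p (v - v0))"
    have bdd: "bdd_above ((\<lambda>(v,a). a - p (v - v0)) ` G)"
      using key[OF _ G00] by (auto intro!: bdd_aboveI2)
    have c1: "a - p (v - v0) \<le> c" if "(v,a) \<in> G" for v a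
      unfolding c_def using cSUP_upper[OF that bdd] by simp
    have c2: "c \<le> p (w + v0) - b" if "(w,b) \<in> G" for w b
      unfolding c_def using G00 key[OF _ that] by (intro cSUP_least) auto
    define G' where "G' = {(v + t *\<^sub>R v0, a + t * c) | v a t. (v,a) \<in> G}"
    have G'I: "(v + t *\<^sub>R v0, a + t * c) \<in> G'" if "(v,a) \<in> G" for v a t
      unfolding G'_def using that by blast
    have "subspace G'"
      unfolding subspace_def
    proof (intro conjI ballI allI)
      show "0 \<in> G'" using G'I[OF G00, of 0] by (simp add: zero_prod_def)
      fix x y assume "x \<in> G'" "y \<in> G'"
      then obtain v a t w b s where "x = (v + t *\<^sub>R v0, a + t * c)" "y = (w + s *\<^sub>R v0, b + s * c)" "(v,a) \<in> G" "(w,b) \<in> G"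
        unfolding G'_def by blast
      with G'I[OF Ga[OF this(3,4)], of "t + s"] show "x + y \<in> G'" by (simp add: algebra_simps)
    next
      fix d x assume "x \<in> G'"
      then obtain v a t where "x = (v + t *\<^sub>R v0, a + t * c)" "(v,a) \<in> G"
        unfolding G'_def by blast
      with G'I[OF Gs[OF this(2), of d], of "d * t"] show "d *\<^sub>R x \<in> G'" by (simp add: algebra_simps)
    qed
    moreover have "a + t * c \<le> p (v + t *\<^sub>R v0)" if va: "(v,a) \<in> G" for v a t
    proof (cases t "0::real" rule: linorder_cases)
      case equal
      then show ?thesis using Gp[OF va] by simp
    next
      case greater
      have "c \<le> p ((1/t) *\<^sub>R v + v0) - (1/t) * a" by (rule c2[OF Gs[OF va]])
      then have "t * ((1/t) * a + c) \<le> t * p ((1/t) *\<^sub>R v + v0)" using greater by (intro mult_left_mono) auto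
      also have "\<dots> = p (v + t *\<^sub>R v0)" using greater hom[of t "(1/t) *\<^sub>R v + v0"] by (simp add: scaleR_add_right)
      finally show ?thesis using greater by (simp add: algebra_simps)
    next
      case less
      define s where "s = - t"
      have s: "s > 0" using less by (simp add: s_def)
      have "(1/s) * a - p ((1/s) *\<^sub>R v - v0) \<le> c" by (rule c1[OF Gs[OF va]])
      then have "s * ((1/s) * a - c) \<le> s * p ((1/s) *\<^sub>R v - v0)" using s by (intro mult_left_mono) auto
      also have "\<dots> = p (v - s *\<^sub>R v0)" using s hom[of s "(1/s) *\<^sub>R v - v0"] by (simp add: scaleR_diff_right)
      finally show ?thesis using s by (simp add: algebra_simps s_def)
    qed
    then have "\<forall>(v,a)\<in>G'. a \<le> p v" unfolding G'_def by auto
    moreover have GG': "G \<subseteq> G'" using G'I[of _ _ 0] by auto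
    ultimately have "G' \<in> \<A>" using G0 by (auto simp: \<A>_def)
    then have "G' = G" using max GG' by blast
    moreover have "(v0, c) \<in> G'" using G'I[OF G00, of 1] by simp
    ultimately show False using nex by blast
  qed
  define g where "g v = (THE a. (v,a) \<in> G)" for v
  have gG: "(v, g v) \<in> G" for v
    unfolding g_def using total[of v] uniq by (auto intro: theI2)
  have ge: "g v = a" if "(v,a) \<in> G" for v a using uniq[OF gG that] .
  show ?thesis
  proof
    show "linear g"
    proof (rule linearI)
      show "g (x + y) = g x + g y" for x y by (rule ge[OF Ga[OF gG gG]])
      show "g (r *\<^sub>R x) = r *\<^sub>R g x" for r x using ge[OF Gs[OF gG]] by simp
    qed
    show "g x \<le> p x" for x using Gp[OF gG] .
    show "g x = f x" if "x \<in> M" for x using ge G0 that by (auto simp: G0_def)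
  qed
qed

text \<open>Complex scalar multiplication is an explicit parameter \<open>sc\<close>, because the
  type \<open>Linf\<close> only carries a real vector space structure. The real part of
  \<open>l\<close> is extended, the imaginary part is recovered from the value at
  \<open>sc \<i> x\<close>, and the bound follows by rotating \<open>L x\<close> to a nonnegative
  real number.\<close>

lemma Hahn_Banach_complex:
  fixes p :: "'a::real_vector \<Rightarrow> real" and l :: "'a \<Rightarrow> complex" and sc :: "complex \<Rightarrow> 'a \<Rightarrow> 'a"
  assumes sc_add: "\<And>c x y. sc c (x + y) = sc c x + sc c y" and sc_add': "\<And>c d x. sc (c + d) x = sc c x + sc d x"
    and sc_sc: "\<And>c d x. sc c (sc d x) = sc (c * d) x" and sc_real: "\<And>r x. sc (of_real r) x = r *\<^sub>R x"
    and sub: "\<And>x y. p (x + y) \<le> p x + p y" and hom: "\<And>c x. p (sc c x) = cmod c * p x"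
    and M0: "0 \<in> M" and Madd: "\<And>x y. x \<in> M \<Longrightarrow> y \<in> M \<Longrightarrow> x + y \<in> M" and Msc: "\<And>c x. x \<in> M \<Longrightarrow> sc c x \<in> M"
    and ladd: "\<And>x y. x \<in> M \<Longrightarrow> y \<in> M \<Longrightarrow> l (x + y) = l x + l y"
    and lsc: "\<And>c x. x \<in> M \<Longrightarrow> l (sc c x) = c * l x"
    and le: "\<And>x. x \<in> M \<Longrightarrow> cmod (l x) \<le> p x"
  obtains L where "\<And>x y. L (x + y) = L x + L y" "\<And>c x. L (sc c x) = c * L x"
    "\<And>x. cmod (L x) \<le> p x" "\<And>x. x \<in> M \<Longrightarrow> L x = l x"
proof -
  have homr: "p (c *\<^sub>R x) = c * p x" if "c \<ge> 0" for c x
    using hom[of "of_real c" x] that by (simp add: sc_real)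
  have MR: "subspace M"
    unfolding subspace_def using M0 Madd Msc[of _ "of_real _"] by (auto simp: sc_real)
  have lR: "Re (l (c *\<^sub>R x)) = c * Re (l x)" if "x \<in> M" for c x
    using lsc[OF that, of "of_real c"] by (simp add: sc_real)
  have le': "Re (l x) \<le> p x" if "x \<in> M" for x
    using le[OF that] complex_Re_le_cmod[of "l x"] by linarith
  obtain g where g: "linear g" "\<And>x. g x \<le> p x" "\<And>x. x \<in> M \<Longrightarrow> g x = Re (l x)"
    using Hahn_Banach_sublinear[where p = p and f = "\<lambda>x. Re (l x)" and M = M, OF sub homr MR _ lR le']
    by (auto simp: ladd)
  define L where "L x = complex_of_real (g x) - \<i> * complex_of_real (g (sc \<i> x))" for x
  have gadd: "g (x + y) = g x + g y" and gs: "g (r *\<^sub>R x) = r * g x" for x y r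
    using g(1) by (auto simp: linear_add linear_scale)
  have Ladd: "L (x + y) = L x + L y" for x y
    by (simp add: L_def sc_add gadd algebra_simps)
  have Lr: "L (sc (of_real r) x) = of_real r * L x" for r x
  proof -
    have "sc \<i> (sc (of_real r) x) = r *\<^sub>R sc \<i> x"
      by (simp add: sc_sc sc_real[symmetric] mult.commute)
    then show ?thesis by (simp add: L_def sc_real gs algebra_simps)
  qed
  have Li: "L (sc \<i> x) = \<i> * L x" for x
  proof -
    have "sc \<i> (sc \<i> x) = (-1) *\<^sub>R x" using sc_real[of "-1" x] by (simp add: sc_sc)
    then show ?thesis using gs[of "-1" x] by (simp add: L_def algebra_simps)
  qed
  have Lsc: "L (sc c x) = c * L x" for c x
  proof -
    have "sc c x = sc (of_real (Re c)) x + sc (of_real (Im c)) (sc \<i> x)"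
      unfolding sc_sc sc_add'[symmetric] by (simp add: complex_eq[symmetric] mult.commute)
    then have "L (sc c x) = (of_real (Re c) + of_real (Im c) * \<i>) * L x" by (simp only: Ladd Lr Li distrib_right mult.assoc)
    then show ?thesis by (simp add: complex_eq[symmetric] mult.commute)
  qed
  show ?thesis
  proof
    show "L (x + y) = L x + L y" "L (sc c x) = c * L x" for x y c by (rule Ladd, rule Lsc)
    show "cmod (L x) \<le> p x" for x
    proof (cases "L x = 0")
      case True
      have "0 \<le> p x" using hom[of 0 x] sub[of x "sc (-1) x"] hom[of "-1" x] sc_real[of 0 x] sc_add'[of 1 "-1" x] sc_real[of 1 x]
        by simp
      then show ?thesis using True by simp
    next
      case False
      define c where "c = cnj (L x) / of_real (cmod (L x))"
      have c: "cmod c = 1" using False by (simp add: c_def norm_divide)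
      have "c * L x = of_real (cmod (L x))"
      proof -
        have "cnj (L x) * L x = of_real (cmod (L x)) * of_real (cmod (L x))"
          using complex_norm_square[of "L x"] by (simp add: power2_eq_square mult.commute)
        then show ?thesis using False by (simp add: c_def)
      qed
      then have "L (sc c x) = of_real (cmod (L x))" by (simp add: Lsc)
      then have "cmod (L x) = Re (L (sc c x))" by simp
      also have "\<dots> = g (sc c x)" by (simp add: L_def)
      also have "\<dots> \<le> p (sc c x)" by (rule g(2))
      finally show ?thesis by (simp add: hom c)
    qed
    show "L x = l x" if "x \<in> M" for x
      using g(3)[OF that] g(3)[OF Msc[OF that, of \<i>]] lsc[OF that, of \<i>]
      by (simp add: L_def complex_eq_iff)
  qed
qed


section \<open>Integration over the circle\<close>

interpretation circle: prob_space circle by (rule prob_space_circle)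

lemma borel_measurable_circle_continuous:
  fixes g :: "complex \<Rightarrow> 'a::topological_space"
  assumes "continuous_on (sphere 0 1) g"
  shows "g \<in> borel_measurable circle"
  using assms
  by (simp add: borel_measurable_continuous_on_restrict measurable_cong_sets[OF sets_circle refl])

lemma circle_integral_cis:
  fixes g :: "complex \<Rightarrow> 'a::euclidean_space"
  assumes g: "continuous_on (sphere 0 1) g"
  shows "(LINT z|circle. g z) = integral {0..2*pi} (\<lambda>t. g (cis t)) /\<^sub>R (2*pi)"
proof -
  have [measurable]: "g \<in> borel_measurable (restrict_space borel (sphere 0 1))"
    using g by (simp add: borel_measurable_continuous_on_restrict)
  have c: "continuous_on UNIV (\<lambda>t. g (cis t))" by (rule continuous_on_cis_comp[OF g])
  then have [measurable]: "(\<lambda>t. g (cis t)) \<in> borel_measurable borel"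
    by (rule borel_measurable_continuous_onI)
  have "(LINT z|circle. g z) = (LINT t|uniform_measure lborel {0..2*pi}. g (cis t))"
    unfolding circle_def by (rule integral_distr[OF cis_measurable_circle]) measurable
  also have "\<dots> = (LINT t|density lborel (\<lambda>t. ennreal (indicator {0..2*pi} t / (2*pi))). g (cis t))"
    unfolding uniform_measure_def
    by (intro arg_cong[where f="\<lambda>M. lebesgue_integral M (\<lambda>t. g (cis t))"] density_cong)
       (auto simp: indicator_def divide_ennreal[symmetric] ennreal_1[symmetric] simp del: ennreal_1)
  also have "\<dots> = (LINT t|lborel. (indicator {0..2*pi} t / (2*pi)) *\<^sub>R g (cis t))"
    by (rule integral_density) auto
  also have "\<dots> = (LINT t|lborel. inverse (2*pi) *\<^sub>R (indicator {0..2*pi} t *\<^sub>R g (cis t)))"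
    by (rule Bochner_Integration.integral_cong) (simp_all add: field_simps)
  also have "\<dots> = (LINT t|lborel. indicator {0..2*pi} t *\<^sub>R g (cis t)) /\<^sub>R (2*pi)"
    by (rule integral_scaleR_right)
  also have "(LINT t|lborel. indicator {0..2*pi} t *\<^sub>R g (cis t)) = integral {0..2*pi} (\<lambda>t. g (cis t))"
  proof -
    have "set_integrable lborel {0..2*pi} (\<lambda>t. g (cis t))"
      using borel_integrable_compact[of "{0..2*pi}" "\<lambda>t. g (cis t)"] continuous_on_subset[OF c]
      by (simp add: set_integrable_def)
    from set_borel_integral_eq_integral(2)[OF this] show ?thesis by (simp add: set_lebesgue_integral_def)
  qed
  finally show ?thesis .
qed

lemma circle_integral_cmean:
  "continuous_on (sphere 0 1) g \<Longrightarrow> (LINT z|circle. g z) = cmean g 1"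
  by (simp add: circle_integral_cis cmean_def scaleR_conv_of_real field_simps)

lemma circle_integral_rmean:
  "continuous_on (sphere 0 1) g \<Longrightarrow> (LINT z|circle. g z) = rmean g"
  by (simp add: circle_integral_cis rmean_def field_simps)

lemma ess_bdd_integrable: "ess_bdd f \<Longrightarrow> integrable circle f"
  unfolding ess_bdd_def using circle.integrable_const_bound by blast

lemma Linf_cases:
  obtains f where "ess_bdd f" "F = abs_Linf f"
  using Quotient_abs_rep[OF Quotient_Linf, of F] Quotient_rep_reflp[OF Quotient_Linf, of F]
  by (metis Linf_rel_refl)

lemma abs_Linf_eq_iff: "ess_bdd f \<Longrightarrow> ess_bdd g \<Longrightarrow> abs_Linf f = abs_Linf g \<longleftrightarrow> (AE z in circle. f z = g z)"
  using Quotient_rel_abs2[OF Quotient_Linf] Quotient_rel[OF Quotient_Linf, of f g]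
  by (auto simp: Linf_rel_def)

lemma abs_Linf_cong: "(\<And>z. z \<in> sphere 0 1 \<Longrightarrow> f z = g z) \<Longrightarrow> ess_bdd f \<Longrightarrow> ess_bdd g \<Longrightarrow> abs_Linf f = abs_Linf g"
  by (auto simp: abs_Linf_eq_iff intro!: AE_I2)

lemma abs_Linf_simps:
  "ess_bdd f \<Longrightarrow> ess_bdd g \<Longrightarrow> abs_Linf f + abs_Linf g = abs_Linf (\<lambda>z. f z + g z)"
  "ess_bdd f \<Longrightarrow> ess_bdd g \<Longrightarrow> abs_Linf f - abs_Linf g = abs_Linf (\<lambda>z. f z - g z)"
  "ess_bdd f \<Longrightarrow> ess_bdd g \<Longrightarrow> abs_Linf f * abs_Linf g = abs_Linf (\<lambda>z. f z * g z)"
  "ess_bdd f \<Longrightarrow> Linf_cscale c (abs_Linf f) = abs_Linf (\<lambda>z. c * f z)"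
  "ess_bdd f \<Longrightarrow> norm (abs_Linf f) = ess_norm f"
  "ess_bdd f \<Longrightarrow> fourier (abs_Linf f) n = (LINT z|circle. f z * z powi (- n))"
  by (simp_all add: Linf_rel_refl plus_Linf.abs_eq minus_Linf.abs_eq times_Linf.abs_eq Linf_cscale.abs_eq norm_Linf.abs_eq fourier.abs_eq)

lemma one_abs_Linf: "1 = abs_Linf (\<lambda>_. 1)" and zero_abs_Linf: "0 = abs_Linf (\<lambda>_. 0)"
  by (simp_all add: one_Linf_def zero_Linf_def)

lemma norm_abs_Linf_le_iff: "ess_bdd f \<Longrightarrow> norm (abs_Linf f) \<le> C \<longleftrightarrow> (AE z in circle. cmod (f z) \<le> C)"
  using ess_norm_AE[of f] ess_norm_le(1)[of f C]
  by (auto simp: abs_Linf_simps elim: AE_mp)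

lemma Linf_cscale_add: "Linf_cscale c (x + y) = Linf_cscale c x + Linf_cscale c y"
  and Linf_cscale_add': "Linf_cscale (c + d) x = Linf_cscale c x + Linf_cscale d x"
  and Linf_cscale_cscale: "Linf_cscale c (Linf_cscale d x) = Linf_cscale (c * d) x"
  and Linf_cscale_real: "Linf_cscale (of_real r) x = r *\<^sub>R x"
  and Linf_cscale_mult: "Linf_cscale c x * y = Linf_cscale c (x * y)"
proof -
  obtain f where f: "ess_bdd f" "x = abs_Linf f" by (rule Linf_cases)
  obtain g where g: "ess_bdd g" "y = abs_Linf g" by (rule Linf_cases)
  note [simp] = abs_Linf_simps ess_bdd_add ess_bdd_mult ess_bdd_cmult f g
  show "Linf_cscale c (x + y) = Linf_cscale c x + Linf_cscale c y" by (simp add: algebra_simps)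
  show "Linf_cscale (c + d) x = Linf_cscale c x + Linf_cscale d x" by (simp add: algebra_simps)
  show "Linf_cscale c (Linf_cscale d x) = Linf_cscale (c * d) x" by (simp add: algebra_simps)
  show "Linf_cscale (of_real r) x = r *\<^sub>R x" by (simp add: scaleR_Linf_def)
  show "Linf_cscale c x * y = Linf_cscale c (x * y)" by (simp add: algebra_simps)
qed

text \<open>The gauge for the Hahn-Banach extension: functionals dominated by the L1 norm stand for
  bounded functions on the circle.\<close>

lift_definition L1n :: "Linf \<Rightarrow> real" is "\<lambda>f. LINT z|circle. cmod (f z)"
proof -
  fix f g assume a: "Linf_rel f g"
  then have [measurable]: "f \<in> borel_measurable circle" "g \<in> borel_measurable circle"
    and ae: "AE z in circle. f z = g z"
    by (auto simp: Linf_rel_def ess_bdd_measurable)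
  show "(LINT z|circle. cmod (f z)) = (LINT z|circle. cmod (g z))"
    by (rule integral_cong_AE) (use ae in auto)
qed

lemma L1n_abs: "ess_bdd f \<Longrightarrow> L1n (abs_Linf f) = (LINT z|circle. cmod (f z))"
  by (simp add: L1n.abs_eq Linf_rel_refl)

lemma ess_bdd_norm_integrable: "ess_bdd f \<Longrightarrow> integrable circle (\<lambda>z. cmod (f z))"
  by (rule integrable_norm[OF ess_bdd_integrable])

lemma L1n_triangle: "L1n (x + y) \<le> L1n x + L1n y"
  and L1n_scale: "L1n (Linf_cscale c x) = cmod c * L1n x"
  and L1n_mult_le: "L1n (x * y) \<le> norm x * L1n y"
  and L1n_le_norm: "L1n x \<le> norm x"
  and L1n_nonneg: "L1n x \<ge> 0"
  and mean_le_L1n: "cmod (fourier x 0) \<le> L1n x"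
proof -
  obtain f where f: "ess_bdd f" "x = abs_Linf f" by (rule Linf_cases)
  obtain g where g: "ess_bdd g" "y = abs_Linf g" by (rule Linf_cases)
  note [simp] = abs_Linf_simps L1n_abs ess_bdd_add ess_bdd_mult ess_bdd_cmult f g
  note [intro] = ess_bdd_norm_integrable
  have "(LINT z|circle. cmod (f z + g z)) \<le> (LINT z|circle. cmod (f z) + cmod (g z))"
    using f(1) g(1) by (intro integral_mono Bochner_Integration.integrable_add) (auto intro: norm_triangle_ineq ess_bdd_add)
  also have "\<dots> = (LINT z|circle. cmod (f z)) + (LINT z|circle. cmod (g z))"
    using f g by (intro Bochner_Integration.integral_add) auto
  finally show "L1n (x + y) \<le> L1n x + L1n y" by simp
  show "L1n (Linf_cscale c x) = cmod c * L1n x" by (simp add: norm_mult)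
  have ae: "AE z in circle. cmod (f z) \<le> ess_norm f" by (rule ess_norm_AE[OF f(1)])
  have "(LINT z|circle. cmod (f z * g z)) \<le> (LINT z|circle. ess_norm f * cmod (g z))"
    using f(1) g(1) by (intro integral_mono_AE) (auto intro!: ess_bdd_mult AE_mp[OF ae AE_I2] mult_right_mono simp: norm_mult ess_bdd_norm_integrable[OF ess_bdd_mult, unfolded norm_mult])
  then show "L1n (x * y) \<le> norm x * L1n y" by simp
  have "(LINT z|circle. cmod (f z)) \<le> (LINT z|circle. ess_norm f)"
    using ae f(1) by (intro integral_mono_AE) auto
  then show "L1n x \<le> norm x" using circle.prob_space by simp
  show "L1n x \<ge> 0" by simp
  show "cmod (fourier x 0) \<le> L1n x" by (simp add: integral_norm_bound)
qed

lemma continuous_imp_ess_bdd_AE: "continuous_on (sphere 0 1) f \<Longrightarrow> (\<And>z. z \<in> sphere 0 1 \<Longrightarrow> cmod (f z) \<le> C) \<Longrightarrow> norm (abs_Linf f) \<le> C"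
  by (subst norm_abs_Linf_le_iff) (auto intro: ess_bdd_continuous)

lemma fourier_add: "fourier (x + y) n = fourier x n + fourier y n"
  and fourier_cscale: "fourier (Linf_cscale c x) n = c * fourier x n"
  and fourier_diff: "fourier (x - y) n = fourier x n - fourier y n"
proof -
  obtain f where f: "ess_bdd f" "x = abs_Linf f" by (rule Linf_cases)
  obtain g where g: "ess_bdd g" "y = abs_Linf g" by (rule Linf_cases)
  have c: "continuous_on (sphere 0 1) (\<lambda>z :: complex. z powi (- n))"
    by (intro continuous_intros) auto
  have i: "integrable circle (\<lambda>z. h z * z powi (-n))" if "ess_bdd h" for h
    using ess_bdd_integrable[OF ess_bdd_mult[OF that ess_bdd_continuous[OF c]]] .
  note [simp] = abs_Linf_simps ess_bdd_add ess_bdd_diff ess_bdd_cmult f g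
  show "fourier (x + y) n = fourier x n + fourier y n" using f(1) g(1) i by (simp add: distrib_right)
  show "fourier (x - y) n = fourier x n - fourier y n" using f(1) g(1) i by (simp add: left_diff_distrib)
  show "fourier (Linf_cscale c x) n = c * fourier x n" by (simp add: mult.assoc)
qed


section \<open>The corona theorem\<close>

lemma wirt_diff:
  assumes "wirt R u a b" "wirt R v c d"
  shows "wirt R (\<lambda>z. u z - v z) (\<lambda>z. a z - c z) (\<lambda>z. b z - d z)"
  unfolding wirt_def
proof (intro conjI ballI)
  fix z :: complex assume z: "z \<in> ball 0 R"
  from has_derivative_diff[OF wirtD(1)[OF assms(1) z] wirtD(1)[OF assms(2) z]]
  show "((\<lambda>z. u z - v z) has_derivative (\<lambda>h. (a z - c z) * h + (b z - d z) * cnj h)) (at z)"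
    by (rule has_derivative_eq_rhs) (auto simp: fun_eq_iff algebra_simps)
qed (use wirtD[OF assms(1)] wirtD[OF assms(2)] in \<open>auto intro!: continuous_intros\<close>)

lemma wirt_mono: "wirt R u a b \<Longrightarrow> r \<le> R \<Longrightarrow> wirt r u a b"
  unfolding wirt_def by (auto elim: continuous_on_subset)

lemma wirt_unique:
  assumes "wirt R u a b" "wirt R u c d" "z \<in> ball 0 R"
  shows "a z = c z" "b z = d z"
proof -
  have "(\<lambda>h. a z * h + b z * cnj h) = (\<lambda>h. c z * h + d z * cnj h)"
    using has_derivative_unique[OF wirtD(1)[OF assms(1,3)] wirtD(1)[OF assms(2,3)]] .
  then have e: "a z * h + b z * cnj h = c z * h + d z * cnj h" for h by meson
  from e[of 1] have 1: "a z + b z = c z + d z" by simp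
  from e[of \<i>] have "\<i> * (a z - b z) = \<i> * (c z - d z)" by (simp add: algebra_simps)
  then have 2: "a z - b z = c z - d z" by simp
  have "2 * a z = 2 * c z" using 1 2 by algebra
  then show "a z = c z" by simp
  then show "b z = d z" using 1 by simp
qed

text \<open>The data live on a disk of radius \<open>R > 1\<close>, so that all functions are smooth
  up to the unit circle and Green's formula applies. The bound that results depends on
  \<open>d\<close> and \<open>card I\<close> but not on \<open>R\<close>; this lets the general case
  follow by dilation.\<close>

locale corona_data =
  fixes R d :: real and I :: "'i set" and f :: "'i \<Rightarrow> complex \<Rightarrow> complex"
  assumes R: "R > 1" and fin: "finite I" and hol: "\<And>i. i \<in> I \<Longrightarrow> f i holomorphic_on ball 0 R"
    and f1: "\<And>i z. i \<in> I \<Longrightarrow> z \<in> ball 0 R \<Longrightarrow> cmod (f i z) \<le> 1"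
    and d: "d > 0" and low: "\<And>z. z \<in> ball 0 R \<Longrightarrow> d \<le> (\<Sum>i\<in>I. (cmod (f i z))\<^sup>2)"
begin

text \<open>The functions \<open>phi j\<close> solve the corona equation smoothly; \<open>psi\<close> is their derivative with
  respect to \<open>cnj z\<close>, and \<open>dphi\<close>, \<open>chi\<close>, \<open>dG\<close> are the derivatives of \<open>phi\<close>, \<open>psi\<close>, \<open>G\<close> with
  respect to \<open>z\<close>. Wolff corrects \<open>phi\<close> by means of solutions \<open>b j k\<close> of d-bar \<open>b j k = G j k\<close>.\<close>

definition "S z = (\<Sum>i\<in>I. f i z * cnj (f i z))"
definition "A z = (\<Sum>i\<in>I. deriv (f i) z * cnj (f i z))"
definition "B z = (\<Sum>i\<in>I. f i z * cnj (deriv (f i) z))"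
definition "T z = (\<Sum>i\<in>I. deriv (f i) z * cnj (deriv (f i) z))"
definition "s z = (\<Sum>i\<in>I. cmod (deriv (f i) z))"
definition "phi j z = cnj (f j z) * inverse (S z)"
definition "dphi j z = cnj (f j z) * (- A z / (S z)\<^sup>2)"
definition "psi j z = cnj (deriv (f j) z) * inverse (S z) - cnj (f j z) * (B z * (inverse (S z) * inverse (S z)))"
definition "chi j z = cnj (deriv (f j) z) * (- A z / (S z)\<^sup>2) - cnj (f j z) *
   (T z * (inverse (S z) * inverse (S z)) + B z * ((- A z / (S z)\<^sup>2) * inverse (S z) + inverse (S z) * (- A z / (S z)\<^sup>2)))"
definition "G j k z = phi j z * psi k z"
definition "dG j k z = dphi j z * psi k z + phi j z * chi k z"

lemma hold: "i \<in> I \<Longrightarrow> deriv (f i) holomorphic_on ball 0 R"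
  using hol by (simp add: holomorphic_deriv)

lemma S_eq: "S z = of_real (\<Sum>i\<in>I. (cmod (f i z))\<^sup>2)"
  unfolding S_def complex_mult_cnj_cmod of_real_sum ..

lemma S_ge: "z \<in> ball 0 R \<Longrightarrow> cmod (S z) \<ge> d"
  using low[of z] d unfolding S_eq norm_of_real by linarith

lemma S_nz: "z \<in> ball 0 R \<Longrightarrow> S z \<noteq> 0"
  using S_ge d by fastforce

lemma wirt_f: "i \<in> I \<Longrightarrow> wirt R (f i) (deriv (f i)) (\<lambda>_. 0)"
  by (intro wirt_holomorphic hol)

lemma wirt_f': "i \<in> I \<Longrightarrow> wirt R (deriv (f i)) (deriv (deriv (f i))) (\<lambda>_. 0)"
  by (intro wirt_holomorphic hold)

lemma wirt_S: "wirt R S A B"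
proof -
  have "wirt R S (\<lambda>z. \<Sum>i\<in>I. deriv (f i) z * cnj (f i z) + f i z * cnj 0) (\<lambda>z. \<Sum>i\<in>I. 0 * cnj (f i z) + f i z * cnj (deriv (f i) z))"
    unfolding S_def by (intro wirt_sum fin wirt_mult wirt_cnj wirt_f)
  then show ?thesis unfolding A_def B_def by simp
qed

lemma wirt_B: "\<exists>b. wirt R B T b"
proof -
  have "wirt R B (\<lambda>z. \<Sum>i\<in>I. deriv (f i) z * cnj (deriv (f i) z) + f i z * cnj 0) (\<lambda>z. \<Sum>i\<in>I. 0 * cnj (deriv (f i) z) + f i z * cnj (deriv (deriv (f i)) z))"
    unfolding B_def by (intro wirt_sum fin wirt_mult wirt_cnj wirt_f wirt_f')
  then show ?thesis unfolding T_def by auto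
qed

lemma wirt_invS: "wirt R (\<lambda>z. inverse (S z)) (\<lambda>z. - A z / (S z)\<^sup>2) (\<lambda>z. - B z / (S z)\<^sup>2)"
  by (intro wirt_inverse wirt_S S_nz)

lemma wirt_phi: "j \<in> I \<Longrightarrow> wirt R (phi j) (dphi j) (psi j)"
  using wirt_mult[OF wirt_cnj[OF wirt_f] wirt_invS, of j]
  unfolding phi_def dphi_def psi_def by (simp add: divide_inverse power2_eq_square)

lemma wirt_psi: "j \<in> I \<Longrightarrow> \<exists>b. wirt R (psi j) (chi j) b"
proof -
  assume j: "j \<in> I"
  obtain b where b: "wirt R B T b" using wirt_B ..
  from wirt_diff[OF wirt_mult[OF wirt_cnj[OF wirt_f'[OF j]] wirt_invS]
     wirt_mult[OF wirt_cnj[OF wirt_f[OF j]] wirt_mult[OF b wirt_mult[OF wirt_invS wirt_invS]]]]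
  show ?thesis unfolding psi_def chi_def by auto
qed

lemma wirt_G: "j \<in> I \<Longrightarrow> k \<in> I \<Longrightarrow> \<exists>b. wirt R (G j k) (dG j k) b"
  using wirt_mult[OF wirt_phi] wirt_psi unfolding G_def dG_def by blast

lemma sum_f_phi: "z \<in> ball 0 R \<Longrightarrow> (\<Sum>k\<in>I. f k z * phi k z) = 1"
  using S_nz[of z] unfolding phi_def S_def by (simp add: sum_distrib_right[symmetric] mult.assoc[symmetric])

text \<open>The derivative of \<open>sum_f_phi\<close> with respect to \<open>cnj z\<close>; the
  holomorphic factors \<open>f k\<close> contribute nothing to it.\<close>

lemma sum_f_psi: "z \<in> ball 0 R \<Longrightarrow> (\<Sum>k\<in>I. f k z * psi k z) = 0"
proof -
  assume z: "z \<in> ball 0 R"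
  have "wirt R (\<lambda>z. \<Sum>k\<in>I. f k z * phi k z) (\<lambda>z. \<Sum>k\<in>I. deriv (f k) z * phi k z + f k z * dphi k z) (\<lambda>z. \<Sum>k\<in>I. 0 * phi k z + f k z * psi k z)"
    by (intro wirt_sum fin wirt_mult wirt_f wirt_phi)
  moreover have "wirt R (\<lambda>z. \<Sum>k\<in>I. f k z * phi k z) (\<lambda>_. 0) (\<lambda>_. 0)"
    by (rule wirt_cong[OF wirt_const[of R 1]]) (auto simp: sum_f_phi)
  ultimately have "(\<Sum>k\<in>I. 0 * phi k z + f k z * psi k z) = 0" using wirt_unique(2)[OF _ _ z] by blast
  then show ?thesis by simp
qed

text \<open>The Koszul step: after expanding \<open>G\<close>, one sum is an instance of
  \<open>sum_f_psi\<close> and the other of \<open>sum_f_phi\<close>. Consequently, if d-bar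
  \<open>b j k = G j k\<close>, adding the sum of \<open>f k * (b j k - b k j)\<close> to
  \<open>phi j\<close> cancels \<open>psi j\<close>, and antisymmetry leaves the corona equation
  intact.\<close>

lemma psi_eq: "z \<in> ball 0 R \<Longrightarrow> psi j z = - (\<Sum>k\<in>I. f k z * (G j k z - G k j z))"
proof -
  assume z: "z \<in> ball 0 R"
  have "(\<Sum>k\<in>I. f k z * (G j k z - G k j z)) = phi j z * (\<Sum>k\<in>I. f k z * psi k z) - psi j z * (\<Sum>k\<in>I. f k z * phi k z)"
    unfolding G_def sum_distrib_left sum_subtractf[symmetric] by (intro sum.cong refl) (simp add: algebra_simps)
  then show ?thesis using sum_f_psi[OF z] sum_f_phi[OF z] by simp
qed

text \<open>Differentiate both sides of \<open>psi_eq\<close> with respect to \<open>z\<close> and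
  use the uniqueness of Wirtinger derivatives.\<close>

lemma chi_eq:
  assumes "z \<in> ball 0 R" "j \<in> I"
  shows "chi j z = - (\<Sum>k\<in>I. deriv (f k) z * (G j k z - G k j z) + f k z * (dG j k z - dG k j z))"
proof -
  have "\<exists>b. \<forall>k\<in>I. wirt R (\<lambda>z. f k z * (G j k z - G k j z)) (\<lambda>z. deriv (f k) z * (G j k z - G k j z) + f k z * (dG j k z - dG k j z)) (b k)"
  proof (intro bchoice ballI)
    fix k assume k: "k \<in> I"
    obtain b1 b2 where "wirt R (G j k) (dG j k) b1" "wirt R (G k j) (dG k j) b2"
      using wirt_G k assms(2) by blast
    from wirt_mult[OF wirt_f[OF k] wirt_diff[OF this]]
    show "\<exists>b. wirt R (\<lambda>z. f k z * (G j k z - G k j z)) (\<lambda>z. deriv (f k) z * (G j k z - G k j z) + f k z * (dG j k z - dG k j z)) b"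
      by blast
  qed
  then obtain b where b: "\<And>k. k \<in> I \<Longrightarrow> wirt R (\<lambda>z. f k z * (G j k z - G k j z)) (\<lambda>z. deriv (f k) z * (G j k z - G k j z) + f k z * (dG j k z - dG k j z)) (b k)"
    by blast
  have "wirt R (\<lambda>z. 0 - (\<Sum>k\<in>I. f k z * (G j k z - G k j z))) (\<lambda>z. 0 - (\<Sum>k\<in>I. deriv (f k) z * (G j k z - G k j z) + f k z * (dG j k z - dG k j z))) (\<lambda>z. 0 - (\<Sum>k\<in>I. b k z))"
    by (intro wirt_diff wirt_const wirt_sum fin b)
  then have "wirt R (psi j) (\<lambda>z. 0 - (\<Sum>k\<in>I. deriv (f k) z * (G j k z - G k j z) + f k z * (dG j k z - dG k j z))) (\<lambda>z. 0 - (\<Sum>k\<in>I. b k z))"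
    by (rule wirt_cong) (auto simp: psi_eq)
  moreover obtain b' where "wirt R (psi j) (chi j) b'" using wirt_psi[OF assms(2)] ..
  ultimately have "chi j z = 0 - (\<Sum>k\<in>I. deriv (f k) z * (G j k z - G k j z) + f k z * (dG j k z - dG k j z))"
    using wirt_unique(1)[OF _ _ assms(1)] by blast
  then show ?thesis by simp
qed

definition "\<kappa> = 1 / d"

lemma kp: "\<kappa> > 0" using d by (simp add: \<kappa>_def)

lemma s_nonneg: "s z \<ge> 0" unfolding s_def by (simp add: sum_nonneg)

lemma f'_le_s: "j \<in> I \<Longrightarrow> cmod (deriv (f j) z) \<le> s z"
  unfolding s_def using fin by (intro member_le_sum) auto

lemma iS_le: "z \<in> ball 0 R \<Longrightarrow> cmod (inverse (S z)) \<le> \<kappa>"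
  using S_ge[of z] d by (simp add: \<kappa>_def norm_divide inverse_eq_divide frac_le)

lemma AB_le: "z \<in> ball 0 R \<Longrightarrow> cmod (A z) \<le> s z" "z \<in> ball 0 R \<Longrightarrow> cmod (B z) \<le> s z"
  and T_le: "cmod (T z) \<le> s z * s z"
proof -
  show "cmod (A z) \<le> s z" if "z \<in> ball 0 R"
    unfolding A_def s_def using f1[OF _ that] by (intro sum_norm_le) (simp add: norm_mult mult_left_le)
  show "cmod (B z) \<le> s z" if "z \<in> ball 0 R"
    unfolding B_def s_def using f1[OF _ that] by (intro sum_norm_le) (simp add: norm_mult mult_left_le_one_le)
  have "cmod (T z) \<le> (\<Sum>i\<in>I. cmod (deriv (f i) z) * s z)"
    unfolding T_def by (intro sum_norm_le) (auto simp: norm_mult f'_le_s intro: mult_left_mono)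
  also have "\<dots> = s z * s z" by (simp add: s_def sum_distrib_right)
  finally show "cmod (T z) \<le> s z * s z" .
qed

lemma AS_le: "z \<in> ball 0 R \<Longrightarrow> cmod (- A z / (S z)\<^sup>2) \<le> s z * (\<kappa> * \<kappa>)"
proof -
  assume z: "z \<in> ball 0 R"
  have "cmod (- A z / (S z)\<^sup>2) = cmod (A z) * (cmod (inverse (S z)) * cmod (inverse (S z)))"
    by (simp add: norm_mult norm_divide norm_inverse power2_eq_square divide_inverse)
  also have "\<dots> \<le> s z * (\<kappa> * \<kappa>)"
    using AB_le(1)[OF z] iS_le[OF z] s_nonneg kp by (intro mult_mono) auto
  finally show ?thesis .
qed

lemma norm_mult_mono: "cmod x \<le> a \<Longrightarrow> cmod y \<le> b \<Longrightarrow> cmod (x * y) \<le> a * b"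
  unfolding norm_mult by (intro mult_mono) (auto intro: order_trans[OF norm_ge_zero])

lemma norm_add_mono: "cmod x \<le> a \<Longrightarrow> cmod y \<le> b \<Longrightarrow> cmod (x + y) \<le> a + b"
  and norm_diff_mono: "cmod x \<le> a \<Longrightarrow> cmod y \<le> b \<Longrightarrow> cmod (x - y) \<le> a + b"
  using norm_triangle_ineq[of x y] norm_triangle_ineq4[of x y] by linarith+

lemma bounds:
  assumes z: "z \<in> ball 0 R" and j: "j \<in> I"
  shows "cmod (phi j z) \<le> \<kappa>" "cmod (dphi j z) \<le> \<kappa>\<^sup>2 * s z"
    "cmod (psi j z) \<le> (\<kappa> + \<kappa>\<^sup>2) * s z" "cmod (chi j z) \<le> (2 * \<kappa>\<^sup>2 + 2 * \<kappa>^3) * (s z)\<^sup>2"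
proof -
  have cf: "cmod (cnj (f j z)) \<le> 1" using f1[OF j z] by simp
  have cf': "cmod (cnj (deriv (f j) z)) \<le> s z" using f'_le_s[OF j] by simp
  note i = iS_le[OF z] and AS = AS_le[OF z] and B = AB_le(2)[OF z] and T = T_le[of z]
  show "cmod (phi j z) \<le> \<kappa>"
    using norm_mult_mono[OF cf i] by (simp add: phi_def)
  show "cmod (dphi j z) \<le> \<kappa>\<^sup>2 * s z"
    using norm_mult_mono[OF cf AS] by (simp add: dphi_def power2_eq_square mult_ac)
  show "cmod (psi j z) \<le> (\<kappa> + \<kappa>\<^sup>2) * s z"
    using norm_diff_mono[OF norm_mult_mono[OF cf' i] norm_mult_mono[OF cf norm_mult_mono[OF B norm_mult_mono[OF i i]]]]
    by (simp add: psi_def power2_eq_square algebra_simps)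
  show "cmod (chi j z) \<le> (2 * \<kappa>\<^sup>2 + 2 * \<kappa>^3) * (s z)\<^sup>2"
    using norm_diff_mono[OF norm_mult_mono[OF cf' AS] norm_mult_mono[OF cf norm_add_mono[OF norm_mult_mono[OF T norm_mult_mono[OF i i]] norm_mult_mono[OF B norm_add_mono[OF norm_mult_mono[OF AS i] norm_mult_mono[OF i AS]]]]]]
    unfolding chi_def by (rule order_trans) (simp add: power2_eq_square power3_eq_cube algebra_simps)
qed

definition "K1 = \<kappa> * (\<kappa> + \<kappa>\<^sup>2)"
definition "K2 = \<kappa>\<^sup>2 * (\<kappa> + \<kappa>\<^sup>2) + \<kappa> * (2 * \<kappa>\<^sup>2 + 2 * \<kappa>^3)"
text \<open>The factors \<open>5\<close> and \<open>6\<close> are those of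
  \<open>littlewood_paley\<close>; the additional factor \<open>card I\<close> in the second term
  comes from Cauchy-Schwarz for the square of \<open>s\<close>.\<close>

definition "C0 = K1 * (5 * card I) + K2 * (6 * (real (card I))\<^sup>2)"

lemma K_nonneg: "K1 \<ge> 0" "K2 \<ge> 0" "C0 \<ge> 0"
  using kp by (auto simp: K1_def K2_def C0_def)

text \<open>Each derivative of an \<open>f i\<close> costs one factor \<open>s\<close>, so
  \<open>G\<close> is of first and \<open>dG\<close> of second order in \<open>s\<close>. These are
  the orders that \<open>littlewood_paley\<close> can integrate against \<open>deriv h\<close> and
  \<open>h\<close>.\<close>

lemma G_le:
  assumes z: "z \<in> ball 0 R" and j: "j \<in> I" and k: "k \<in> I"
  shows "cmod (G j k z) \<le> K1 * s z" "cmod (dG j k z) \<le> K2 * (s z)\<^sup>2"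
proof -
  note b = bounds[OF z j] and c = bounds[OF z k]
  show "cmod (G j k z) \<le> K1 * s z"
    using norm_mult_mono[OF b(1) c(3)] by (simp add: G_def K1_def mult.assoc)
  show "cmod (dG j k z) \<le> K2 * (s z)\<^sup>2"
    using norm_add_mono[OF norm_mult_mono[OF b(2) c(3)] norm_mult_mono[OF b(1) c(4)]]
    unfolding dG_def by (rule order_trans) (simp add: K2_def power2_eq_square power3_eq_cube algebra_simps)
qed

text \<open>By Green's formula, \<open>ell j k h\<close> is the mean of \<open>h * b j k\<close> over the circle for every solution
  \<open>b j k\<close> that vanishes at \<open>0\<close>. A Hahn--Banach extension of \<open>ell j k\<close> replaces a bounded solution.\<close>

definition "ell j k h = Jint (\<lambda>z. deriv h z * G j k z + h z * dG j k z)"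

lemma sub_ball: "r > 1 \<Longrightarrow> cball 0 1 \<subseteq> ball (0::complex) r" by auto

lemma cont:
  assumes "j \<in> I" "k \<in> I"
  shows "continuous_on (cball 0 1) (G j k)" "continuous_on (cball 0 1) (dG j k)" "continuous_on (cball 0 1) (phi j)"
    "continuous_on (cball 0 1) (chi j)" "continuous_on (cball 0 1) (psi j)" "continuous_on (cball 0 1) (f j)" "continuous_on (cball 0 1) (deriv (f j))"
proof -
  obtain b where b: "wirt R (G j k) (dG j k) b" using wirt_G[OF assms] ..
  obtain c where c: "wirt R (psi j) (chi j) c" using wirt_psi[OF assms(1)] ..
  show "continuous_on (cball 0 1) (G j k)" "continuous_on (cball 0 1) (dG j k)" "continuous_on (cball 0 1) (phi j)"
    "continuous_on (cball 0 1) (chi j)" "continuous_on (cball 0 1) (psi j)" "continuous_on (cball 0 1) (f j)" "continuous_on (cball 0 1) (deriv (f j))"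
    using wirtD[OF b] wirtD[OF c] wirtD[OF wirt_phi[OF assms(1)]] wirtD[OF wirt_f[OF assms(1)]] continuous_on_subset sub_ball[OF R] by metis+
qed

lemma cont_hol:
  assumes "r > 1" "h holomorphic_on ball 0 r"
  shows "continuous_on (cball 0 1) h" "continuous_on (cball 0 1) (deriv h)"
  using assms(2) holomorphic_deriv[OF assms(2) open_ball] sub_ball[OF assms(1)]
  by (meson holomorphic_on_imp_continuous_on holomorphic_on_subset)+

text \<open>The two terms of the integrand are dominated by sums over \<open>I\<close> of the two
  integrands in \<open>littlewood_paley\<close>. A bound by the L1 norm of \<open>h\<close> on the
  circle is what makes \<open>ell\<close> behave like integration against a bounded
  function.\<close>

lemma ell_bound:
  assumes "1 < r" "r \<le> R" "h holomorphic_on ball 0 r" "j \<in> I" "k \<in> I"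
  shows "cmod (ell j k h) \<le> C0 * rmean (\<lambda>z. cmod (h z))"
proof -
  note ch = cont_hol[OF assms(1,3)]
  define m where "m = rmean (\<lambda>z. cmod (h z))"
  have fr: "f i holomorphic_on ball 0 r" "\<And>z. z \<in> ball 0 r \<Longrightarrow> cmod (f i z) \<le> 1" if "i \<in> I" for i
    using hol[OF that] f1[OF that] assms(2) by (auto elim: holomorphic_on_subset)
  have cs: "continuous_on (cball 0 1) s"
    unfolding s_def by (intro continuous_intros cont(7)) (use assms in auto)
  let ?g1 = "\<lambda>i z. cmod (deriv h z) * cmod (deriv (f i) z)" and ?g2 = "\<lambda>i z. cmod (h z) * (cmod (deriv (f i) z))\<^sup>2"
  have c1: "continuous_on (cball 0 1) (?g1 i)" "continuous_on (cball 0 1) (?g2 i)" if "i \<in> I" for i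
    by (intro continuous_intros ch cont(7)[OF that that])+
  have c2: "continuous_on (cball 0 1) (\<lambda>z. K1 * (\<Sum>i\<in>I. ?g1 i z))" "continuous_on (cball 0 1) (\<lambda>z. (K2 * card I) * (\<Sum>i\<in>I. ?g2 i z))"
    by (intro continuous_intros ch cont(7); assumption)+
  have "cmod (ell j k h) \<le> Jr (\<lambda>z. K1 * (\<Sum>i\<in>I. ?g1 i z) + (K2 * card I) * (\<Sum>i\<in>I. ?g2 i z))"
    unfolding ell_def
  proof (rule norm_Jint_le)
    show "continuous_on (cball 0 1) (\<lambda>z. deriv h z * G j k z + h z * dG j k z)"
      by (intro continuous_intros ch cont assms)
    show "continuous_on (cball 0 1) (\<lambda>z. K1 * (\<Sum>i\<in>I. ?g1 i z) + (K2 * card I) * (\<Sum>i\<in>I. ?g2 i z))"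
      by (intro continuous_on_add c2)
    fix z :: complex assume "z \<in> cball 0 1"
    then have z: "z \<in> ball 0 R" using R by auto
    have "cmod (deriv h z * G j k z + h z * dG j k z) \<le> cmod (deriv h z) * (K1 * s z) + cmod (h z) * (K2 * (s z)\<^sup>2)"
      by (intro norm_add_mono norm_mult_mono G_le z assms order_refl)
    moreover have "cmod (deriv h z) * (K1 * s z) = K1 * (\<Sum>i\<in>I. ?g1 i z)"
      by (simp add: s_def sum_distrib_left mult_ac)
    moreover have "cmod (h z) * (K2 * (s z)\<^sup>2) \<le> cmod (h z) * (K2 * (card I * (\<Sum>i\<in>I. (cmod (deriv (f i) z))\<^sup>2)))"
    proof -
      have "(s z)\<^sup>2 \<le> card I * (\<Sum>i\<in>I. (cmod (deriv (f i) z))\<^sup>2)"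
        using Cauchy_Schwarz_ineq_sum[of "\<lambda>_. 1" "\<lambda>i. cmod (deriv (f i) z)" I] by (simp add: s_def)
      then show ?thesis using K_nonneg by (intro mult_left_mono) auto
    qed
    moreover have "cmod (h z) * (K2 * (card I * (\<Sum>i\<in>I. (cmod (deriv (f i) z))\<^sup>2))) = (K2 * card I) * (\<Sum>i\<in>I. ?g2 i z)"
      by (simp add: sum_distrib_left mult_ac)
    ultimately show "cmod (deriv h z * G j k z + h z * dG j k z) \<le> K1 * (\<Sum>i\<in>I. ?g1 i z) + (K2 * card I) * (\<Sum>i\<in>I. ?g2 i z)"
      by linarith
  qed
  also have "\<dots> = K1 * (\<Sum>i\<in>I. Jr (?g1 i)) + (K2 * card I) * (\<Sum>i\<in>I. Jr (?g2 i))"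
    by (simp only: Jr_add[OF c2] Jr_cmult Jr_sum[OF fin c1(1)] Jr_sum[OF fin c1(2)])
  also have "\<dots> \<le> K1 * (\<Sum>i\<in>I. 5 * m) + (K2 * card I) * (\<Sum>i\<in>I. 6 * m)"
    unfolding m_def using K_nonneg littlewood_paley[OF assms(1,3) fr] by (intro add_mono mult_left_mono sum_mono) auto
  also have "\<dots> = C0 * m" by (simp add: C0_def power2_eq_square algebra_simps)
  finally show ?thesis by (simp add: m_def)
qed

lemma ell_linear:
  assumes "1 < r" "h holomorphic_on ball 0 r" "g holomorphic_on ball 0 r" "j \<in> I" "k \<in> I"
  shows "ell j k (\<lambda>z. h z + c * g z) = ell j k h + c * ell j k g"
proof -
  note ch = cont_hol[OF assms(1,2)] and cg = cont_hol[OF assms(1,3)]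
  have "ell j k (\<lambda>z. h z + c * g z) = Jint (\<lambda>z. (deriv h z * G j k z + h z * dG j k z) + c * (deriv g z * G j k z + g z * dG j k z))"
    unfolding ell_def
  proof (rule Jint_cong)
    fix z :: complex assume "z \<in> cball 0 1"
    then have z: "z \<in> ball 0 r" using assms by auto
    then have "(h has_field_derivative deriv h z) (at z)" "(g has_field_derivative deriv g z) (at z)"
      using assms by (auto intro!: holomorphic_derivI)
    then have "((\<lambda>z. h z + c * g z) has_field_derivative (deriv h z + c * deriv g z)) (at z)"
      by (auto intro!: derivative_eq_intros)
    then have "deriv (\<lambda>z. h z + c * g z) z = deriv h z + c * deriv g z" by (rule DERIV_imp_deriv)
    then show "deriv (\<lambda>z. h z + c * g z) z * G j k z + (h z + c * g z) * dG j k z = (deriv h z * G j k z + h z * dG j k z) + c * (deriv g z * G j k z + g z * dG j k z)"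
      by (simp add: algebra_simps)
  qed
  also have "\<dots> = ell j k h + c * ell j k g"
    unfolding ell_def Jint_cmult[symmetric] by (intro Jint_add continuous_intros ch cg cont assms)
  finally show ?thesis .
qed

text \<open>Green's formula turns the mean of \<open>phi j * q\<close> into an area integral of
  \<open>chi j * q + psi j * deriv q\<close>, and \<open>psi_eq\<close> and \<open>chi_eq\<close>
  express this integrand by \<open>G\<close> and \<open>dG\<close>. In Wolff's terms, the corrected
  function annihilates the analytic functions vanishing at \<open>0\<close>, that is, it has no
  negative Fourier coefficients.\<close>

lemma mean_identity:
  assumes "1 < r" "r \<le> R" "q holomorphic_on ball 0 r" "q 0 = 0" "j \<in> I"
  shows "cmean (\<lambda>z. phi j z * q z) 1 + (\<Sum>k\<in>I. ell j k (\<lambda>z. f k z * q z) - ell k j (\<lambda>z. f k z * q z)) = 0"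
proof -
  note cq = cont_hol[OF assms(1,3)]
  obtain b where b: "wirt R (psi j) (chi j) b" using wirt_psi[OF assms(5)] ..
  have wq: "wirt r q (deriv q) (\<lambda>_. 0)" by (rule wirt_holomorphic[OF assms(3)])
  have w1: "wirt r (\<lambda>z. phi j z * q z) (\<lambda>z. dphi j z * q z + phi j z * deriv q z) (\<lambda>z. psi j z * q z)"
    using wirt_mult[OF wirt_mono[OF wirt_phi[OF assms(5)] assms(2)] wq] by simp
  have w2: "wirt r (\<lambda>z. psi j z * q z) (\<lambda>z. chi j z * q z + psi j z * deriv q z) (\<lambda>z. b z * q z)"
    using wirt_mult[OF wirt_mono[OF b assms(2)] wq] by simp
  have gr: "cmean (\<lambda>z. phi j z * q z) 1 = Jint (\<lambda>z. chi j z * q z + psi j z * deriv q z)"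
    using green[OF w1 w2 assms(1)] assms(4) by simp
  let ?h = "\<lambda>j k z. (deriv (f k) z * q z + f k z * deriv q z) * G j k z + (f k z * q z) * dG j k z"
  let ?h' = "\<lambda>j k z. (deriv (f k) z * q z + f k z * deriv q z) * G k j z + (f k z * q z) * dG k j z"
  have e: "ell j' k' (\<lambda>z. f k z * q z) = Jint (\<lambda>z. (deriv (f k) z * q z + f k z * deriv q z) * G j' k' z + (f k z * q z) * dG j' k' z)" if "k \<in> I" for k j' k'
    unfolding ell_def
  proof (rule Jint_cong)
    fix z :: complex assume "z \<in> cball 0 1"
    then have z: "z \<in> ball 0 r" "z \<in> ball 0 R" using assms by auto
    then have "(f k has_field_derivative deriv (f k) z) (at z)" "(q has_field_derivative deriv q z) (at z)"
      using assms hol[OF that] by (auto intro!: holomorphic_derivI)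
    then have "((\<lambda>z. f k z * q z) has_field_derivative (deriv (f k) z * q z + f k z * deriv q z)) (at z)"
      by (auto intro!: derivative_eq_intros)
    then have "deriv (\<lambda>z. f k z * q z) z = deriv (f k) z * q z + f k z * deriv q z" by (rule DERIV_imp_deriv)
    then show "deriv (\<lambda>z. f k z * q z) z * G j' k' z + f k z * q z * dG j' k' z = (deriv (f k) z * q z + f k z * deriv q z) * G j' k' z + (f k z * q z) * dG j' k' z"
      by simp
  qed
  have ch: "continuous_on (cball 0 1) (?h j k)" "continuous_on (cball 0 1) (?h' j k)" if "k \<in> I" for k
    by (intro continuous_intros cq cont[OF assms(5) that] cont[OF that assms(5)])+
  have "(\<Sum>k\<in>I. ell j k (\<lambda>z. f k z * q z) - ell k j (\<lambda>z. f k z * q z)) = (\<Sum>k\<in>I. Jint (\<lambda>z. ?h j k z + (-1) * ?h' j k z))"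
  proof (rule sum.cong[OF refl])
    fix k assume k: "k \<in> I"
    have "Jint (\<lambda>z. ?h j k z + (-1) * ?h' j k z) = Jint (?h j k) + Jint (\<lambda>z. (-1) * ?h' j k z)"
      by (intro Jint_add continuous_on_mult continuous_on_const ch k)
    also have "\<dots> = Jint (?h j k) - Jint (?h' j k)" unfolding Jint_cmult by simp
    finally show "ell j k (\<lambda>z. f k z * q z) - ell k j (\<lambda>z. f k z * q z) = Jint (\<lambda>z. ?h j k z + (-1) * ?h' j k z)"
      by (simp only: e[OF k])
  qed
  also have "\<dots> = Jint (\<lambda>z. \<Sum>k\<in>I. ?h j k z + (-1) * ?h' j k z)"
    by (intro Jint_sum[symmetric] fin continuous_on_add continuous_on_mult continuous_on_const ch)
  also have "\<dots> = Jint (\<lambda>z. (-1) * (chi j z * q z + psi j z * deriv q z))"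
  proof (rule Jint_cong)
    fix z :: complex assume "z \<in> cball 0 1"
    then have z: "z \<in> ball 0 R" using R by auto
    have "(\<Sum>k\<in>I. ?h j k z + (-1) * ?h' j k z) = q z * (\<Sum>k\<in>I. deriv (f k) z * (G j k z - G k j z) + f k z * (dG j k z - dG k j z)) + deriv q z * (\<Sum>k\<in>I. f k z * (G j k z - G k j z))"
      unfolding sum_distrib_left sum.distrib[symmetric] by (intro sum.cong refl) (simp add: algebra_simps)
    then show "(\<Sum>k\<in>I. ?h j k z + (-1) * ?h' j k z) = (-1) * (chi j z * q z + psi j z * deriv q z)"
      by (simp add: chi_eq[OF z assms(5)] psi_eq[OF z, of j])
  qed
  also have "\<dots> = - Jint (\<lambda>z. chi j z * q z + psi j z * deriv q z)" unfolding Jint_cmult by simp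
  finally show ?thesis using gr by simp
qed

end

section \<open>The Cauchy and Poisson kernels\<close>

lemma kernel_nz:
  assumes "cmod z < 1" "w \<in> sphere 0 1"
  shows "1 - z * cnj w \<noteq> 0"
proof
  assume "1 - z * cnj w = 0"
  then have "cmod (z * cnj w) = 1" by (metis eq_iff_diff_eq_0 norm_one)
  then show False using assms by (simp add: norm_mult)
qed

lemma continuous_on_kernel:
  assumes "cmod z < 1"
  shows "continuous_on (sphere 0 1) (\<lambda>w. 1 / (1 - z * cnj w))"
  using kernel_nz[OF assms] by (intro continuous_intros) auto

text \<open>On the circle this is \<open>w / (w - z)\<close>, so the mean of \<open>f\<close> times
  this kernel is the Cauchy integral of \<open>f\<close> at \<open>z\<close>.\<close>

definition cauchy_ker :: "complex \<Rightarrow> Linf" where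
  "cauchy_ker z = abs_Linf (\<lambda>w. 1 / (1 - z * cnj w))"

lemma cmean_holomorphic:
  assumes "R > 1" "h holomorphic_on ball 0 R"
  shows "cmean h 1 = h 0"
  using green[OF wirt_holomorphic[OF assms(2)] wirt_const assms(1)] by (simp add: Jint_def case_prod_unfold)

lemma cont_sphere_hol:
  assumes "R > 1" "h holomorphic_on ball 0 R"
  shows "continuous_on (sphere 0 1) h"
proof -
  have "sphere 0 1 \<subseteq> ball (0::complex) R" using assms(1) by auto
  then show ?thesis using assms(2) holomorphic_on_imp_continuous_on holomorphic_on_subset by blast
qed

lemma fourier_0_abs:
  assumes "continuous_on (sphere 0 1) u"
  shows "fourier (abs_Linf u) 0 = cmean u 1"
  using assms by (simp add: abs_Linf_simps ess_bdd_continuous circle_integral_cmean)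

text \<open>The radius is also kept below \<open>R\<close> when \<open>R > 1\<close>; for other
  \<open>R\<close> this would contradict \<open>r > 1\<close>, hence the disjunction.\<close>

lemma cauchy_kernel_hol:
  assumes "cmod z < 1"
  obtains r where "r > 1" "r \<le> R \<or> \<not> R > 1" "(\<lambda>w. 1 / (1 - cnj z * w)) holomorphic_on ball 0 r"
proof -
  define r0 where "r0 = (if z = 0 then 2 else 1 / cmod z)"
  define r where "r = (if R > 1 then min R r0 else r0)"
  have r0: "r0 > 1" using assms by (auto simp: r0_def)
  have "1 - cnj z * w \<noteq> 0" if "w \<in> ball 0 r" for w
  proof
    assume "1 - cnj z * w = 0"
    then have "cmod (cnj z * w) = 1" by (metis eq_iff_diff_eq_0 norm_one)
    then have "cmod z * cmod w = 1" by (simp add: norm_mult)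
    moreover have "cmod w < r0" using that by (auto simp: r_def split: if_splits)
    ultimately show False using assms by (auto simp: r0_def field_simps split: if_splits)
  qed
  then have "(\<lambda>w. 1 / (1 - cnj z * w)) holomorphic_on ball 0 r"
    by (intro holomorphic_intros) auto
  then show ?thesis using that[of r] r0 by (auto simp: r_def)
qed

text \<open>Adding the conjugate kernel without its constant term turns the Cauchy kernel into the
  Poisson kernel, which is positive with mean \<open>1\<close>. The Cauchy kernel alone has an L1
  norm that is unbounded as \<open>z\<close> approaches the circle.\<close>

lemma L1n_poisson:
  assumes z1: "cmod z < 1"
  shows "L1n (cauchy_ker z + abs_Linf (\<lambda>w. 1 / (1 - cnj z * w) - 1)) = 1"
proof -
  obtain r where r: "r > 1" "(\<lambda>w. 1 / (1 - cnj z * w)) holomorphic_on ball 0 r"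
    using cauchy_kernel_hol[OF z1, of 2 thesis] by auto
  define E where "E w = 1 / (1 - cnj z * w)" for w
  have cE0: "continuous_on (sphere 0 1) E" unfolding E_def by (rule cont_sphere_hol[OF r])
  have bk: "ess_bdd (\<lambda>w. 1 / (1 - z * cnj w))"
    by (rule ess_bdd_continuous[OF continuous_on_kernel[OF z1]])
  have bq: "ess_bdd (\<lambda>w. E w - 1)"
    by (rule ess_bdd_continuous) (intro continuous_intros cE0)
  have eq: "cauchy_ker z + abs_Linf (\<lambda>w. E w - 1) = abs_Linf (\<lambda>w. of_real (2 * Re (E w) - 1))"
  proof -
    have "cauchy_ker z + abs_Linf (\<lambda>w. E w - 1) = abs_Linf (\<lambda>w. 1 / (1 - z * cnj w) + (E w - 1))"
      unfolding cauchy_ker_def by (rule abs_Linf_simps(1)[OF bk bq])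
    also have "\<dots> = abs_Linf (\<lambda>w. of_real (2 * Re (E w) - 1))"
    proof (rule abs_Linf_cong)
      fix w :: complex
      have "1 / (1 - z * cnj w) = cnj (E w)" by (simp add: E_def)
      moreover have "cnj (E w) + E w = of_real (2 * Re (E w))" by (simp add: complex_eq_iff)
      ultimately show "1 / (1 - z * cnj w) + (E w - 1) = of_real (2 * Re (E w) - 1)" by (simp add: algebra_simps)
    next
      show "ess_bdd (\<lambda>w. 1 / (1 - z * cnj w) + (E w - 1))" by (rule ess_bdd_add[OF bk bq])
      show "ess_bdd (\<lambda>w. of_real (2 * Re (E w) - 1))"
        by (rule ess_bdd_continuous) (intro continuous_intros cE0)
    qed
    finally show ?thesis .
  qed
  have pos: "2 * Re (E w) - 1 \<ge> 0" if "w \<in> sphere 0 1" for w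
  proof -
    define a where "a = cnj z * w"
    have a: "cmod a < 1" using that z1 by (simp add: a_def norm_mult)
    then have "1 - a \<noteq> 0" by auto
    have "Re (1 / (1 - a)) = (1 - Re a) / (cmod (1 - a))\<^sup>2"
      by (simp add: Re_divide cmod_power2)
    moreover have "1 / 2 * (cmod (1 - a))\<^sup>2 \<le> 1 - Re a"
    proof -
      have "(cmod (1 - a))\<^sup>2 = 1 - 2 * Re a + (cmod a)\<^sup>2" unfolding cmod_power2 by (simp add: power2_eq_square algebra_simps)
      moreover have "(cmod a)\<^sup>2 \<le> 1" using a by (simp add: power_le_one)
      ultimately show ?thesis by simp
    qed
    moreover have "(cmod (1 - a))\<^sup>2 > 0" using \<open>1 - a \<noteq> 0\<close> by simp
    ultimately have "Re (1 / (1 - a)) \<ge> 1 / 2" by (simp only: pos_le_divide_eq)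
    then show ?thesis by (simp add: E_def a_def)
  qed
  have cE: "continuous_on (sphere 0 1) (\<lambda>w. 2 * Re (E w) - 1)" by (intro continuous_intros cE0)
  have "L1n (cauchy_ker z + abs_Linf (\<lambda>w. E w - 1)) = (LINT w|circle. cmod (of_real (2 * Re (E w) - 1)))"
    unfolding eq by (rule L1n_abs[OF ess_bdd_continuous[OF continuous_on_of_real[OF cE]]])
  also have "\<dots> = (LINT w|circle. 2 * Re (E w) - 1)"
    by (rule Bochner_Integration.integral_cong[OF refl]) (use pos in \<open>simp only: norm_of_real abs_of_nonneg space_circle\<close>)
  also have "\<dots> = rmean (\<lambda>w. 2 * Re (E w) - 1)" by (rule circle_integral_rmean[OF cE])
  also have "\<dots> = Re (cmean (\<lambda>w. 2 * E w - 1) 1)"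
  proof -
    have "continuous_on (sphere 0 1) (\<lambda>w. 2 * E w - 1)" by (intro continuous_intros cE0)
    from Re_cmean[OF this] show ?thesis by simp
  qed
  also have "cmean (\<lambda>w. 2 * E w - 1) 1 = 2 * E 0 - 1"
    by (rule cmean_holomorphic[OF r(1)]) (intro holomorphic_intros r(2)[folded E_def])
  finally show ?thesis by (simp add: E_def)
qed

section \<open>Extension of the functionals and the corona theorem for smooth data\<close>

context corona_data
begin

definition "Hol = {h. \<exists>r>1. r \<le> R \<and> h holomorphic_on ball 0 r}"

lemma Hol_comb: "h \<in> Hol \<Longrightarrow> g \<in> Hol \<Longrightarrow> (\<lambda>z. h z + c * g z) \<in> Hol"
proof -
  assume "h \<in> Hol" "g \<in> Hol"
  then obtain r t where "r > 1" "r \<le> R" "h holomorphic_on ball 0 r" "t > 1" "t \<le> R" "g holomorphic_on ball 0 t"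
    by (auto simp: Hol_def)
  then show ?thesis unfolding Hol_def
    by (intro CollectI exI[of _ "min r t"] conjI holomorphic_intros) (auto elim!: holomorphic_on_subset)
qed

lemma Hol_common: "h \<in> Hol \<Longrightarrow> g \<in> Hol \<Longrightarrow> \<exists>r>1. r \<le> R \<and> h holomorphic_on ball 0 r \<and> g holomorphic_on ball 0 r"
proof -
  assume "h \<in> Hol" "g \<in> Hol"
  then obtain r t where "r > 1" "r \<le> R" "h holomorphic_on ball 0 r" "t > 1" "t \<le> R" "g holomorphic_on ball 0 t"
    by (auto simp: Hol_def)
  then show ?thesis
    by (intro exI[of _ "min r t"] conjI) (auto elim!: holomorphic_on_subset)
qed

lemma Hol_cont: "h \<in> Hol \<Longrightarrow> continuous_on (sphere 0 1) h"
  unfolding Hol_def using cont_sphere_hol by blast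

lemma Hol_bdd: "h \<in> Hol \<Longrightarrow> ess_bdd h"
  by (intro ess_bdd_continuous Hol_cont)

lemma f_Hol: "i \<in> I \<Longrightarrow> f i \<in> Hol"
  using hol R unfolding Hol_def by auto

lemma Hol_mult: "h \<in> Hol \<Longrightarrow> g \<in> Hol \<Longrightarrow> (\<lambda>z. h z * g z) \<in> Hol"
  using Hol_common[of h g] unfolding Hol_def by (auto intro!: holomorphic_intros)

lemma const_Hol: "(\<lambda>_. c) \<in> Hol"
  using R unfolding Hol_def by (auto intro!: holomorphic_intros)

lemma ell_L1n:
  assumes "h \<in> Hol" "j \<in> I" "k \<in> I"
  shows "cmod (ell j k h) \<le> C0 * L1n (abs_Linf h)"
proof -
  obtain r where "r > 1" "r \<le> R" "h holomorphic_on ball 0 r" using assms by (auto simp: Hol_def)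
  moreover have "L1n (abs_Linf h) = rmean (\<lambda>z. cmod (h z))"
    using assms(1) by (simp add: L1n_abs Hol_bdd circle_integral_rmean continuous_on_norm Hol_cont)
  ultimately show ?thesis using ell_bound assms by simp
qed

lemma ell_comb: "h \<in> Hol \<Longrightarrow> g \<in> Hol \<Longrightarrow> j \<in> I \<Longrightarrow> k \<in> I \<Longrightarrow> ell j k (\<lambda>z. h z + c * g z) = ell j k h + c * ell j k g"
  using Hol_common[of h g] ell_linear by blast

text \<open>The area integrals defining \<open>ell j k\<close> use \<open>h\<close> inside the disk;
  the L1 bound shows that they depend only on the class of \<open>h\<close> on the circle, and it is
  also the gauge for the Hahn-Banach theorem. An extension is required because the functional will
  be applied to Cauchy kernels, which are not analytic in the variable on the circle.\<close>

lemma ell_ext: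
  assumes "j \<in> I" "k \<in> I"
  shows "\<exists>L. (\<forall>x y. L (x + y) = L x + L y) \<and> (\<forall>c x. L (Linf_cscale c x) = c * L x) \<and>
    (\<forall>x. cmod (L x) \<le> C0 * L1n x) \<and> (\<forall>h\<in>Hol. L (abs_Linf h) = ell j k h)"
proof -
  define M where "M = abs_Linf ` Hol"
  define rp where "rp x = (SOME h. h \<in> Hol \<and> abs_Linf h = x)" for x
  have rp: "rp x \<in> Hol" "abs_Linf (rp x) = x" if "x \<in> M" for x
    using someI_ex[of "\<lambda>h. h \<in> Hol \<and> abs_Linf h = x"] that unfolding M_def rp_def by auto
  have wd: "ell j k h = ell j k g" if "h \<in> Hol" "g \<in> Hol" "abs_Linf h = abs_Linf g" for h g
  proof -
    have "abs_Linf (\<lambda>z. h z + (-1) * g z) = abs_Linf h - abs_Linf g"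
      using Hol_bdd[OF that(1)] Hol_bdd[OF that(2)] by (simp add: abs_Linf_simps)
    then have "L1n (abs_Linf (\<lambda>z. h z + (-1) * g z)) = 0"
      using that by (simp add: zero_abs_Linf L1n_abs ess_bdd_const)
    then have "ell j k (\<lambda>z. h z + (-1) * g z) = 0"
      using ell_L1n[OF Hol_comb[OF that(1,2), of "-1"] assms] by simp
    then show ?thesis using ell_comb[OF that(1,2) assms, of "-1"] by simp
  qed
  have Lr: "ell j k (rp (abs_Linf h)) = ell j k h" if "h \<in> Hol" for h
    using wd[OF rp(1) that rp(2)] that by (auto simp: M_def)
  obtain L where L: "\<And>x y. L (x + y) = L x + L y" "\<And>c x. L (Linf_cscale c x) = c * L x"
    "\<And>x. cmod (L x) \<le> C0 * L1n x" "\<And>x. x \<in> M \<Longrightarrow> L x = ell j k (rp x)"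
  proof (rule Hahn_Banach_complex[of Linf_cscale "\<lambda>x. C0 * L1n x" M "\<lambda>x. ell j k (rp x)"])
    show "C0 * L1n (x + y) \<le> C0 * L1n x + C0 * L1n y" for x y
      using mult_left_mono[OF L1n_triangle[of x y] K_nonneg(3)] by (simp add: distrib_left)
    show "C0 * L1n (Linf_cscale c x) = cmod c * (C0 * L1n x)" for c x by (simp add: L1n_scale)
    show "0 \<in> M" unfolding M_def zero_abs_Linf by (rule imageI[OF const_Hol])
    have M_comb: "abs_Linf h + Linf_cscale c (abs_Linf g) = abs_Linf (\<lambda>z. h z + c * g z)" if "h \<in> Hol" "g \<in> Hol" for h g c
      using that by (simp add: abs_Linf_simps Hol_bdd ess_bdd_cmult)
    show "x + y \<in> M" if "x \<in> M" "y \<in> M" for x y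
      using that M_comb[of _ _ 1] Hol_comb[of _ _ 1] Linf_cscale_real[of 1] unfolding M_def by (auto simp: image_iff)
    show "Linf_cscale c x \<in> M" if xM: "x \<in> M" for c x
    proof -
      obtain h where h: "h \<in> Hol" "x = abs_Linf h" using xM by (auto simp: M_def)
      have "Linf_cscale c x = abs_Linf (\<lambda>z. 0 + c * h z)" using h by (simp add: abs_Linf_simps Hol_bdd)
      then show ?thesis using Hol_comb[OF const_Hol h(1)] unfolding M_def by blast
    qed
    show "ell j k (rp (x + y)) = ell j k (rp x) + ell j k (rp y)" if "x \<in> M" "y \<in> M" for x y
    proof -
      have "x + y = abs_Linf (\<lambda>z. rp x z + 1 * rp y z)"
        using M_comb[OF rp(1)[OF that(1)] rp(1)[OF that(2)], of 1] Linf_cscale_real[of 1] by (simp add: rp that)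
      then show ?thesis using Lr[OF Hol_comb[OF rp(1)[OF that(1)] rp(1)[OF that(2)], of 1]] ell_comb[OF rp(1)[OF that(1)] rp(1)[OF that(2)] assms, of 1]
        by simp
    qed
    show "ell j k (rp (Linf_cscale c x)) = c * ell j k (rp x)" if "x \<in> M" for c x
    proof -
      note r = rp[OF that]
      have "Linf_cscale c x = abs_Linf (\<lambda>z. 0 + c * rp x z)" using abs_Linf_simps(4)[OF Hol_bdd[OF r(1)]] r(2) by simp
      then have "ell j k (rp (Linf_cscale c x)) = ell j k (\<lambda>z. 0 + c * rp x z)"
        using Lr[OF Hol_comb[OF const_Hol[of 0] r(1), of c]] by simp
      also have "\<dots> = ell j k (\<lambda>z. 0) + c * ell j k (rp x)" by (rule ell_comb[OF const_Hol r(1) assms])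
      also have "ell j k (\<lambda>z. 0) = 0" by (simp add: ell_def Jint_def case_prod_unfold)
      finally show ?thesis by simp
    qed
    show "cmod (ell j k (rp x)) \<le> C0 * L1n x" if "x \<in> M" for x
      using ell_L1n[OF rp(1)[OF that] assms] rp(2)[OF that] by simp
  qed ((simp add: Linf_cscale_add Linf_cscale_add' Linf_cscale_cscale Linf_cscale_real; fail) | blast)+
  moreover have "L (abs_Linf h) = ell j k h" if "h \<in> Hol" for h
    using L(4)[of "abs_Linf h"] Lr[OF that] that by (auto simp: M_def)
  ultimately show ?thesis by blast
qed

text \<open>\<open>Gam j v\<close> imitates the mean of \<open>v\<close> times Wolff's corrected
  function, with \<open>L j k\<close> in place of integration against \<open>b j k\<close>, and
  \<open>g j\<close> is its Cauchy integral. By \<open>mean_identity\<close>, \<open>Gam j\<close>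
  annihilates the members of \<open>Hol\<close> that vanish at \<open>0\<close>. Therefore the
  Cauchy kernel may be replaced by the Poisson kernel, which gives a bound uniform in
  \<open>z\<close>, and \<open>f j\<close> times the kernel may be replaced by \<open>f j z\<close>
  times the kernel, which gives the equation.\<close>

theorem corona_smooth:
  "\<exists>g. (\<forall>j\<in>I. g j holomorphic_on ball 0 1 \<and> (\<forall>z\<in>ball 0 1. cmod (g j z) \<le> \<kappa> + 2 * card I * C0)) \<and>
     (\<forall>z\<in>ball 0 1. (\<Sum>j\<in>I. f j z * g j z) = 1)"
proof -
  have "\<forall>j k. \<exists>L. j \<in> I \<longrightarrow> k \<in> I \<longrightarrow> (\<forall>x y. L (x + y) = L x + L y) \<and> (\<forall>c x. L (Linf_cscale c x) = c * L x) \<and>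
    (\<forall>x. cmod (L x) \<le> C0 * L1n x) \<and> (\<forall>h\<in>Hol. L (abs_Linf h) = ell j k h)"
    using ell_ext by blast
  then obtain L where "\<forall>j k. j \<in> I \<longrightarrow> k \<in> I \<longrightarrow> (\<forall>x y. L j k (x + y) = L j k x + L j k y) \<and> (\<forall>c x. L j k (Linf_cscale c x) = c * L j k x) \<and>
    (\<forall>x. cmod (L j k x) \<le> C0 * L1n x) \<and> (\<forall>h\<in>Hol. L j k (abs_Linf h) = ell j k h)"
    by metis
  then have L_add: "\<And>j k x y. j \<in> I \<Longrightarrow> k \<in> I \<Longrightarrow> L j k (x + y) = L j k x + L j k y"
    and L_sc: "\<And>j k c x. j \<in> I \<Longrightarrow> k \<in> I \<Longrightarrow> L j k (Linf_cscale c x) = c * L j k x"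
    and L_le: "\<And>j k x. j \<in> I \<Longrightarrow> k \<in> I \<Longrightarrow> cmod (L j k x) \<le> C0 * L1n x"
    and L_ell: "\<And>j k h. j \<in> I \<Longrightarrow> k \<in> I \<Longrightarrow> h \<in> Hol \<Longrightarrow> L j k (abs_Linf h) = ell j k h"
    by blast+
  define F where "F i = abs_Linf (f i)" for i
  define P where "P j = abs_Linf (phi j)" for j
  define C' where "C' = \<kappa> + 2 * card I * C0"
  define Gam where "Gam j v = fourier (P j * v) 0 + (\<Sum>k\<in>I. L j k (F k * v) - L k j (F k * v))" for j v
  have cphi: "continuous_on (sphere 0 1) (phi j)" if "j \<in> I" for j
    using cont(3)[OF that that] by (rule continuous_on_subset) auto
  have bphi: "ess_bdd (phi j)" if "j \<in> I" for j using ess_bdd_continuous[OF cphi[OF that]] .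
  have sb: "z \<in> sphere 0 1 \<Longrightarrow> z \<in> ball 0 R" for z :: complex using R by auto
  have nP: "norm (P j) \<le> \<kappa>" if "j \<in> I" for j
    unfolding P_def by (rule continuous_imp_ess_bdd_AE[OF cphi[OF that]]) (intro bounds(1) sb that)
  have nF: "norm (F j) \<le> 1" if "j \<in> I" for j
    unfolding F_def by (rule continuous_imp_ess_bdd_AE[OF Hol_cont[OF f_Hol[OF that]]]) (intro f1 sb that)
  have C'p: "C' \<ge> 0" using kp K_nonneg by (simp add: C'_def)
  have Gam_add: "Gam j (x + y) = Gam j x + Gam j y" if "j \<in> I" for j x y
    unfolding Gam_def distrib_left fourier_add using that
    by (simp add: L_add sum.distrib sum_subtractf)
  have Gam_sc: "Gam j (Linf_cscale c x) = c * Gam j x" if "j \<in> I" for j c x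
  proof -
    have m: "a * Linf_cscale c x = Linf_cscale c (a * x)" for a
      using Linf_cscale_mult[of c x a] by (simp add: mult.commute)
    show ?thesis unfolding Gam_def m fourier_cscale using that
      by (simp add: L_sc sum_distrib_left algebra_simps)
  qed
  have Gam_le: "cmod (Gam j x) \<le> C' * L1n x" if j: "j \<in> I" for j x
  proof -
    have FL: "C0 * L1n (F k * x) \<le> C0 * L1n x" if "k \<in> I" for k
    proof (rule mult_left_mono[OF _ K_nonneg(3)])
      show "L1n (F k * x) \<le> L1n x"
        using L1n_mult_le[of "F k" x] mult_right_mono[OF nF[OF that] L1n_nonneg[of x]] by simp
    qed
    have "cmod (fourier (P j * x) 0) \<le> norm (P j) * L1n x"
      using mean_le_L1n[of "P j * x"] L1n_mult_le[of "P j" x] by linarith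
    also have "\<dots> \<le> \<kappa> * L1n x" by (intro mult_right_mono nP j L1n_nonneg)
    finally have 1: "cmod (fourier (P j * x) 0) \<le> \<kappa> * L1n x" .
    have 2: "cmod (\<Sum>k\<in>I. L j k (F k * x) - L k j (F k * x)) \<le> (\<Sum>k\<in>I. C0 * L1n x + C0 * L1n x)"
      by (intro sum_norm_le norm_diff_mono order_trans[OF L_le FL] j)
    show ?thesis using norm_add_mono[OF 1 2] by (simp add: Gam_def C'_def algebra_simps)
  qed
  have Gam_0: "Gam j (abs_Linf q) = 0" if j: "j \<in> I" and q: "q \<in> Hol" "q 0 = 0" for j q
  proof -
    obtain r where r: "r > 1" "r \<le> R" "q holomorphic_on ball 0 r" using q by (auto simp: Hol_def)
    have Fq: "F k * abs_Linf q = abs_Linf (\<lambda>z. f k z * q z)" if "k \<in> I" for k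
      unfolding F_def by (rule abs_Linf_simps(3)[OF Hol_bdd[OF f_Hol[OF that]] Hol_bdd[OF q(1)]])
    have "P j * abs_Linf q = abs_Linf (\<lambda>z. phi j z * q z)"
      unfolding P_def by (rule abs_Linf_simps(3)[OF bphi[OF j] Hol_bdd[OF q(1)]])
    then have "fourier (P j * abs_Linf q) 0 = cmean (\<lambda>z. phi j z * q z) 1"
      by (simp add: fourier_0_abs continuous_on_mult cphi j Hol_cont q)
    moreover have "(\<Sum>k\<in>I. L j k (F k * abs_Linf q) - L k j (F k * abs_Linf q)) = (\<Sum>k\<in>I. ell j k (\<lambda>z. f k z * q z) - ell k j (\<lambda>z. f k z * q z))"
      by (intro sum.cong refl) (simp add: Fq L_ell j Hol_mult f_Hol q)
    ultimately show ?thesis using mean_identity[OF r q(2) j] by (simp add: Gam_def)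
  qed
  define g where "g j z = Gam j (cauchy_ker z)" for j z
  have bk: "ess_bdd (\<lambda>w. 1 / (1 - z * cnj w))" if "cmod z < 1" for z
    by (rule ess_bdd_continuous[OF continuous_on_kernel[OF that]])
  show ?thesis
  proof (intro exI[of _ g] conjI ballI)
    fix j z assume j: "j \<in> I" and z: "z \<in> ball (0::complex) 1"
    then have z1: "cmod z < 1" by simp
    obtain r where r: "r > 1" "r \<le> R" "(\<lambda>w. 1 / (1 - cnj z * w)) holomorphic_on ball 0 r"
      using cauchy_kernel_hol[OF z1, of R thesis] R by blast
    define E where "E w = 1 / (1 - cnj z * w)" for w
    have E: "E \<in> Hol" using r unfolding Hol_def E_def by auto
    define q where "q w = E w + (-1) * 1" for w
    have q: "q \<in> Hol" unfolding q_def[abs_def] by (rule Hol_comb[OF E const_Hol])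
    have q0: "q 0 = 0" by (simp add: q_def E_def)
    have "L1n (cauchy_ker z + abs_Linf q) = 1"
      using L1n_poisson[OF z1] by (simp add: q_def[abs_def] E_def)
    moreover have "g j z = Gam j (cauchy_ker z + abs_Linf q)"
      by (simp add: g_def Gam_add j Gam_0 q q0)
    ultimately show "cmod (g j z) \<le> \<kappa> + 2 * card I * C0" using Gam_le[OF j, of "cauchy_ker z + abs_Linf q"]
      by (simp add: C'_def)
  next
    fix z assume "z \<in> ball (0::complex) 1"
    then have z1: "cmod z < 1" by simp
    let ?e = "cauchy_ker z"
    have "f j z * g j z = Gam j (F j * ?e)" if j: "j \<in> I" for j
    proof -
      \<comment> \<open>On the circle the kernel is \<open>w / (w - z)\<close>. So
        \<open>F j * ?e\<close> differs from \<open>f j z\<close> times the kernel by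
        \<open>w\<close> times the difference quotient of \<open>f j\<close>, which is analytic and
        vanishes at \<open>0\<close>.\<close>
      define q0 where "q0 w = (if w = z then deriv (f j) z else (f j w - f j z) / (w - z))" for w
      have "q0 holomorphic_on ball 0 R"
        unfolding q0_def by (rule pole_lemma_open[OF hol[OF j] open_ball])
      then have q: "(\<lambda>w. w * q0 w) \<in> Hol" using R unfolding Hol_def by (auto intro!: holomorphic_intros)
      have "F j * ?e = Linf_cscale (f j z) ?e + abs_Linf (\<lambda>w. w * q0 w)"
      proof -
        have 1: "F j * ?e = abs_Linf (\<lambda>w. f j w * (1 / (1 - z * cnj w)))"
          unfolding F_def cauchy_ker_def by (rule abs_Linf_simps(3)[OF Hol_bdd[OF f_Hol[OF j]] bk[OF z1]])
        have 2: "Linf_cscale (f j z) ?e + abs_Linf (\<lambda>w. w * q0 w) = abs_Linf (\<lambda>w. f j z * (1 / (1 - z * cnj w)) + w * q0 w)"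
          unfolding cauchy_ker_def by (simp only: abs_Linf_simps(4)[OF bk[OF z1]] abs_Linf_simps(1)[OF ess_bdd_cmult[OF bk[OF z1]] Hol_bdd[OF q]])
        show ?thesis unfolding 1 2
        proof (rule abs_Linf_cong)
          fix w :: complex assume w: "w \<in> sphere 0 1"
          then have "w \<noteq> z" "w \<noteq> 0" using z1 by auto
          have "w * cnj w = 1" using w by (simp add: complex_mult_cnj_cmod)
          then have "w * (1 - z * cnj w) = w - z" by (simp add: algebra_simps)
          then have "1 / (1 - z * cnj w) = w / (w - z)"
            using \<open>w \<noteq> z\<close> \<open>w \<noteq> 0\<close> by (metis mult_divide_mult_cancel_left mult.right_neutral)
          moreover define c where "c = 1 / (w - z)"
          ultimately have e: "1 / (1 - z * cnj w) = w * c" by simp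
          have "q0 w = (f j w - f j z) * c" using \<open>w \<noteq> z\<close> by (simp add: q0_def c_def)
          then show "f j w * (1 / (1 - z * cnj w)) = f j z * (1 / (1 - z * cnj w)) + w * q0 w"
            by (simp only: e) (simp add: algebra_simps)
        qed (intro ess_bdd_mult ess_bdd_add ess_bdd_cmult bk z1 Hol_bdd f_Hol j ess_bdd_const q)+
      qed
      then show ?thesis by (simp add: Gam_add Gam_sc j g_def Gam_0[OF j q])
    qed
    then have "(\<Sum>j\<in>I. f j z * g j z) = (\<Sum>j\<in>I. Gam j (F j * ?e))" by (intro sum.cong) auto
    also have "\<dots> = (\<Sum>j\<in>I. fourier (P j * (F j * ?e)) 0) + (\<Sum>j\<in>I. \<Sum>k\<in>I. L j k (F k * (F j * ?e)) - L k j (F k * (F j * ?e)))"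
      unfolding Gam_def sum.distrib ..
    \<comment> \<open>The correction is antisymmetric in \<open>j\<close> and \<open>k\<close>,
      while the product of \<open>F k\<close> and \<open>F j\<close> is symmetric.\<close>
    also have "(\<Sum>j\<in>I. \<Sum>k\<in>I. L j k (F k * (F j * ?e)) - L k j (F k * (F j * ?e))) = 0"
    proof -
      have "(\<Sum>j\<in>I. \<Sum>k\<in>I. L k j (F k * (F j * ?e))) = (\<Sum>j\<in>I. \<Sum>k\<in>I. L j k (F k * (F j * ?e)))"
        by (subst sum.swap) (simp add: mult.left_commute)
      then show ?thesis by (simp add: sum_subtractf)
    qed
    also have "(\<Sum>j\<in>I. fourier (P j * (F j * ?e)) 0) = fourier ((\<Sum>j\<in>I. P j * F j) * ?e) 0"
    proof -
      have z0: "fourier 0 0 = 0" using fourier_diff[of 0 0 0] by simp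
      have "fourier (\<Sum>j\<in>I'. h j) 0 = (\<Sum>j\<in>I'. fourier (h j) 0)" if "finite I'" for I' :: "'i set" and h
        using that by (induction I' rule: finite_induct) (auto simp: fourier_add z0)
      then show ?thesis using fin by (simp add: sum_distrib_right mult.assoc)
    qed
    also have "(\<Sum>j\<in>I. P j * F j) = 1"
    proof -
      have "(\<Sum>j\<in>I'. P j * F j) = abs_Linf (\<lambda>w. \<Sum>j\<in>I'. phi j w * f j w) \<and> ess_bdd (\<lambda>w. \<Sum>j\<in>I'. phi j w * f j w)" if "finite I'" "I' \<subseteq> I" for I'
        using that
      proof (induction I' rule: finite_induct)
        case empty
        then show ?case by (simp add: zero_abs_Linf ess_bdd_const)
      next
        case (insert i I')
        then have i: "i \<in> I" by simp
        have b: "ess_bdd (\<lambda>w. phi i w * f i w)" by (intro ess_bdd_mult bphi i Hol_bdd f_Hol)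
        have "P i * F i = abs_Linf (\<lambda>w. phi i w * f i w)"
          unfolding P_def F_def by (rule abs_Linf_simps(3)[OF bphi[OF i] Hol_bdd[OF f_Hol[OF i]]])
        then show ?case using insert b by (simp add: abs_Linf_simps ess_bdd_add)
      qed
      from this[OF fin subset_refl] have "(\<Sum>j\<in>I. P j * F j) = abs_Linf (\<lambda>w. \<Sum>j\<in>I. phi j w * f j w)" "ess_bdd (\<lambda>w. \<Sum>j\<in>I. phi j w * f j w)" by auto
      moreover have "abs_Linf (\<lambda>w. \<Sum>j\<in>I. phi j w * f j w) = abs_Linf (\<lambda>_. 1)"
        by (rule abs_Linf_cong) (use calculation sum_f_phi sb in \<open>auto simp: ess_bdd_const mult.commute\<close>)
      ultimately show ?thesis by (simp add: one_abs_Linf)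
    qed
    also have "fourier (1 * ?e) 0 = 1"
    proof -
      obtain r where r: "r > 1" "(\<lambda>w. 1 / (1 - cnj z * w)) holomorphic_on ball 0 r"
        using cauchy_kernel_hol[OF z1, of R thesis] R by blast
      have "fourier (1 * ?e) 0 = (LINT w|circle. 1 / (1 - z * cnj w))"
        by (simp add: cauchy_ker_def abs_Linf_simps bk z1)
      also have "\<dots> = (LINT w|circle. cnj (1 / (1 - cnj z * w)))" by simp
      also have "\<dots> = cnj (LINT w|circle. 1 / (1 - cnj z * w))" by (rule Bochner_Integration.integral_cnj)
      also have "(LINT w|circle. 1 / (1 - cnj z * w)) = cmean (\<lambda>w. 1 / (1 - cnj z * w)) 1"
        by (rule circle_integral_cmean[OF cont_sphere_hol[OF r]])
      also have "\<dots> = 1" using cmean_holomorphic[OF r] by simp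
      finally show ?thesis by simp
    qed
    finally show "(\<Sum>j\<in>I. f j z * g j z) = 1" by simp
  next
    fix j assume j: "j \<in> I"
    show "g j holomorphic_on ball 0 1"
      unfolding holomorphic_on_open[OF open_ball]
    proof (intro ballI exI)
      fix z assume "z \<in> ball (0::complex) 1"
      then have z1: "cmod z < 1" by simp
      \<comment> \<open>\<open>D\<close> is the derivative of the kernel with respect to
        \<open>z\<close>, and \<open>b\<close> is half the distance from \<open>z\<close> to the
        circle, so the denominators below have modulus at least \<open>b\<close>. The second-order
        remainder of the kernel is exact, namely \<open>(y - z)^2\<close> times \<open>m\<close>,
        and \<open>Gam j\<close> is bounded on it.\<close>
      define D where "D = abs_Linf (\<lambda>w. (1 / (1 - z * cnj w)) * (1 / (1 - z * cnj w)) * cnj w)"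
      define b where "b = (1 - cmod z) / 2"
      have b: "b > 0" using z1 by (simp add: b_def)
      define K where "K = C' / b ^ 3"
      have key: "cmod (g j y - g j z - Gam j D * (y - z)) \<le> K * (cmod (y - z) * cmod (y - z))" if y: "cmod (y - z) < b" for y
      proof -
        have y1: "cmod y < 1" "1 - cmod y \<ge> b" using y z1 norm_triangle_ineq2[of y z] by (auto simp: b_def)
        define m where "m w = (1 / (1 - y * cnj w)) * (1 / (1 - z * cnj w)) * (1 / (1 - z * cnj w)) * (cnj w * cnj w)" for w
        have cm: "continuous_on (sphere 0 1) m" unfolding m_def
          by (intro continuous_on_mult continuous_on_kernel y1 z1 continuous_on_cnj continuous_on_id)
        have bD: "ess_bdd (\<lambda>w. (1 / (1 - z * cnj w)) * (1 / (1 - z * cnj w)) * cnj w)"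
          by (intro ess_bdd_continuous continuous_on_mult continuous_on_kernel z1 continuous_on_cnj continuous_on_id)
        have lowb: "cmod (1 / (1 - x * cnj w)) \<le> 1 / b" if "cmod x \<le> 1 - b" "w \<in> sphere 0 1" for x w
        proof -
          have "b \<le> cmod (1 - x * cnj w)"
            using norm_triangle_ineq2[of 1 "x * cnj w"] that by (simp add: norm_mult)
          then show ?thesis using b by (simp add: norm_divide frac_le)
        qed
        have "cmod z \<le> 1 - b" using z1 by (simp add: b_def field_simps)
        have nm: "norm (abs_Linf m) \<le> 1 / b ^ 3"
        proof (rule continuous_imp_ess_bdd_AE[OF cm])
          fix w :: complex assume w: "w \<in> sphere 0 1"
          have "cmod (m w) \<le> (1 / b) * (1 / b) * (1 / b) * (1 * 1)"
            unfolding m_def by (intro norm_mult_mono lowb w) (use y1 \<open>cmod z \<le> 1 - b\<close> w in auto)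
          then show "cmod (m w) \<le> 1 / b ^ 3" by (simp add: power3_eq_cube)
        qed
        have "cauchy_ker y = cauchy_ker z + (Linf_cscale (y - z) D + Linf_cscale ((y - z) * (y - z)) (abs_Linf m))"
        proof -
          have 1: "cauchy_ker z + (Linf_cscale (y - z) D + Linf_cscale ((y - z) * (y - z)) (abs_Linf m)) =
             abs_Linf (\<lambda>w. 1 / (1 - z * cnj w) + ((y - z) * ((1 / (1 - z * cnj w)) * (1 / (1 - z * cnj w)) * cnj w) + ((y - z) * (y - z)) * m w))"
            unfolding cauchy_ker_def D_def
            by (simp only: abs_Linf_simps bD bk[OF z1] ess_bdd_cmult ess_bdd_add ess_bdd_continuous[OF cm])
          show ?thesis unfolding 1 unfolding cauchy_ker_def
          proof (rule abs_Linf_cong)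
            fix w :: complex assume w: "w \<in> sphere 0 1"
            have "1 - y * cnj w \<noteq> 0" "1 - z * cnj w \<noteq> 0"
              by (rule kernel_nz[OF y1(1) w], rule kernel_nz[OF z1 w])
            then show "1 / (1 - y * cnj w) = 1 / (1 - z * cnj w) + ((y - z) * ((1 / (1 - z * cnj w)) * (1 / (1 - z * cnj w)) * cnj w) + ((y - z) * (y - z)) * m w)"
            proof -
              define a b where "a = 1 - y * cnj w" and "b = 1 - z * cnj w"
              have ab: "a \<noteq> 0" "b \<noteq> 0" using \<open>1 - y * cnj w \<noteq> 0\<close> \<open>1 - z * cnj w \<noteq> 0\<close> by (simp_all add: a_def b_def)
              define t where "t = (y - z) * cnj w"
              have t: "t = b - a" by (simp add: a_def b_def t_def algebra_simps)
              have "1 / a = 1 / b + (t * ((1 / b) * (1 / b)) + t * t * ((1 / a) * (1 / b) * (1 / b)))"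
                unfolding t using ab by (simp add: field_simps)
              moreover have "(y - z) * ((1 / b) * (1 / b) * cnj w) = t * ((1 / b) * (1 / b))"
                "((y - z) * (y - z)) * ((1 / a) * (1 / b) * (1 / b) * (cnj w * cnj w)) = t * t * ((1 / a) * (1 / b) * (1 / b))"
                by (simp_all add: t_def)
              ultimately show ?thesis unfolding m_def a_def[symmetric] b_def[symmetric] by (simp only:)
            qed
          qed (intro bk y1 z1 bD ess_bdd_add ess_bdd_cmult ess_bdd_continuous[OF cm])+
        qed
        then have "g j y - g j z - Gam j D * (y - z) = (y - z) * (y - z) * Gam j (abs_Linf m)"
          by (simp add: g_def Gam_add Gam_sc j)
        moreover have "cmod (Gam j (abs_Linf m)) \<le> K"
        proof -
          have "cmod (Gam j (abs_Linf m)) \<le> C' * L1n (abs_Linf m)" by (rule Gam_le[OF j])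
          also have "\<dots> \<le> C' * (1 / b^3)" using order_trans[OF L1n_le_norm nm] C'p by (rule mult_left_mono)
          finally show ?thesis by (simp add: K_def)
        qed
        ultimately show ?thesis by (simp add: norm_mult mult.commute mult_right_mono)
      qed
      have Kp: "K \<ge> 0" using C'p b by (simp add: K_def)
      show "(g j has_field_derivative Gam j D) (at z)"
        unfolding has_field_derivative_def has_derivative_at_alt
      proof (intro conjI allI impI)
        show "bounded_linear ((*) (Gam j D))" by (rule bounded_linear_mult_right)
        fix e :: real assume e: "e > 0"
        define t where "t = min b (e / (K + 1))"
        have t: "t > 0" using b e Kp by (simp add: t_def)
        show "\<exists>t>0. \<forall>y. cmod (y - z) < t \<longrightarrow> cmod (g j y - g j z - Gam j D * (y - z)) \<le> e * cmod (y - z)"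
        proof (intro exI[of _ t] conjI allI impI t)
          fix y assume y: "cmod (y - z) < t"
          then have "cmod (y - z) < b" "cmod (y - z) \<le> e / (K + 1)" by (auto simp: t_def)
          then have "cmod (g j y - g j z - Gam j D * (y - z)) \<le> K * (cmod (y - z) * cmod (y - z))" by (intro key)
          also have "\<dots> = (K * cmod (y - z)) * cmod (y - z)" by simp
          also have "\<dots> \<le> e * cmod (y - z)"
          proof (rule mult_right_mono)
            have "K * cmod (y - z) \<le> (K + 1) * (e / (K + 1))"
              using \<open>cmod (y - z) \<le> e / (K + 1)\<close> Kp by (intro mult_mono) auto
            then show "K * cmod (y - z) \<le> e" using Kp by simp
          qed simp
          finally show "cmod (g j y - g j z - Gam j D * (y - z)) \<le> e * cmod (y - z)" .
        qed
      qed
    qed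
  qed
qed

end


section \<open>Uniqueness of Fourier coefficients\<close>

lemma borel_Int_circle: "A \<in> sets borel \<Longrightarrow> A \<inter> sphere 0 1 \<in> sets circle"
  unfolding sets_circle sets_restrict_space by (subst Int_commute) (rule imageI)

lemma ess_bdd_indicator:
  assumes "ess_bdd f" "A \<in> sets circle"
  shows "ess_bdd (\<lambda>z. f z * indicator A z)"
proof (rule ess_bdd_mult[OF assms(1)])
  show "ess_bdd (indicator A :: complex \<Rightarrow> complex)"
    by (rule ess_bddI[where C = 1]) (use assms(2) in \<open>auto intro!: AE_I2 borel_measurable_indicator simp: indicator_def\<close>)
qed

lemma circle_integral_norm_le:
  assumes "ess_bdd f" "continuous_on (sphere 0 1) g" "\<And>z. z \<in> sphere 0 1 \<Longrightarrow> cmod (g z) \<le> e"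
  shows "cmod (LINT z|circle. f z * g z) \<le> ess_norm f * e"
proof -
  have fg: "ess_bdd (\<lambda>z. f z * g z)" by (rule ess_bdd_mult[OF assms(1) ess_bdd_continuous[OF assms(2)]])
  have "cmod (LINT z|circle. f z * g z) \<le> (LINT z|circle. cmod (f z * g z))" by (rule integral_norm_bound)
  also have "\<dots> \<le> (LINT z|circle. ess_norm f * e)"
  proof (rule integral_mono_AE)
    show "integrable circle (\<lambda>z. cmod (f z * g z))" by (rule ess_bdd_norm_integrable[OF fg])
    have "AE z in circle. cmod (g z) \<le> e" using assms(3) by (intro AE_I2) simp
    with ess_norm_AE[OF assms(1)] show "AE z in circle. cmod (f z * g z) \<le> ess_norm f * e"
      by eventually_elim (simp add: norm_mult mult_mono' ess_norm_nonneg[OF assms(1)])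
  qed simp
  finally show ?thesis using circle.prob_space by simp
qed

context
  fixes f :: "complex \<Rightarrow> complex"
  assumes f: "ess_bdd f" and zero: "\<And>n::int. (LINT z|circle. f z * z powi n) = 0"
begin

text \<open>Requiring the condition for all shifts \<open>n\<close> makes this space closed under
  multiplication by powers of \<open>z\<close>, hence by polynomials in the real and imaginary parts
  of \<open>z\<close>.\<close>

definition "annih = {v. continuous_on (sphere 0 1) v \<and> (\<forall>n::int. (LINT z|circle. f z * (v z * z powi n)) = 0)}"

lemma cont_powi: "continuous_on (sphere 0 1) (\<lambda>z :: complex. z powi n)"
  by (intro continuous_intros) auto

lemma annih_integrable: "continuous_on (sphere 0 1) v \<Longrightarrow> integrable circle (\<lambda>z. f z * (v z * z powi n))"
  by (intro ess_bdd_integrable ess_bdd_mult f ess_bdd_continuous continuous_on_mult cont_powi)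

lemma annih_add: "u \<in> annih \<Longrightarrow> v \<in> annih \<Longrightarrow> (\<lambda>z. u z + v z) \<in> annih"
  unfolding annih_def using Bochner_Integration.integral_add[OF annih_integrable annih_integrable]
  by (auto intro!: continuous_intros simp: distrib_left distrib_right)

lemma annih_cmult: "u \<in> annih \<Longrightarrow> (\<lambda>z. c * u z) \<in> annih"
proof -
  assume u: "u \<in> annih"
  have "(LINT z|circle. f z * (c * u z * z powi n)) = c * (LINT z|circle. f z * (u z * z powi n))" for n
    by (subst integral_mult_right_zero[symmetric]) (simp add: mult_ac)
  then show ?thesis using u unfolding annih_def by (auto intro!: continuous_intros)
qed

lemma annih_powi: "u \<in> annih \<Longrightarrow> (\<lambda>z. z powi k * u z) \<in> annih"
proof -
  assume u: "u \<in> annih"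
  have "(LINT z|circle. f z * (z powi k * u z * z powi n)) = (LINT z|circle. f z * (u z * z powi (k + n)))" for n
  proof (rule Bochner_Integration.integral_cong[OF refl])
    fix z assume "z \<in> space circle"
    then have "z \<noteq> 0" by auto
    then show "f z * (z powi k * u z * z powi n) = f z * (u z * z powi (k + n))" by (simp add: power_int_add)
  qed
  then show ?thesis using u unfolding annih_def by (auto intro!: continuous_on_mult cont_powi)
qed

lemma annih_cong: "u \<in> annih \<Longrightarrow> (\<And>z. z \<in> sphere 0 1 \<Longrightarrow> v z = u z) \<Longrightarrow> v \<in> annih"
proof -
  assume u: "u \<in> annih" and e: "\<And>z. z \<in> sphere 0 1 \<Longrightarrow> v z = u z"
  have "continuous_on (sphere 0 1) v" using u continuous_on_eq[of "sphere 0 1" u v] e by (simp add: annih_def)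
  moreover have "(LINT z|circle. f z * (v z * z powi n)) = (LINT z|circle. f z * (u z * z powi n))" for n
    by (rule Bochner_Integration.integral_cong[OF refl]) (simp add: e)
  ultimately show ?thesis using u by (auto simp: annih_def)
qed

lemma annih_real_polynomial:
  assumes "real_polynomial_function q"
  shows "\<forall>v\<in>annih. (\<lambda>z. of_real (q z) * v z) \<in> annih"
  using assms
proof (induction q rule: real_polynomial_function.induct)
  case (linear q)
  show ?case
  proof
    fix v assume v: "v \<in> annih"
    \<comment> \<open>A real linear functional is determined by its values at \<open>1\<close> and
      \<open>\<i>\<close>, and on the circle the coordinates of \<open>z\<close> are
      \<open>(z + 1/z) / 2\<close> and \<open>(z - 1/z) / (2 * \<i>)\<close>.\<close>
    have e: "of_real (q z) = of_real ((q 1)) * ((z + inverse z) / 2) + of_real (q \<i>) * ((z - inverse z) / (2 * \<i>))" if "z \<in> sphere 0 1" for z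
    proof -
      have "q z = q (Re z *\<^sub>R 1 + Im z *\<^sub>R \<i>)" by (metis complex_eq scaleR_conv_of_real mult.commute mult.right_neutral)
      also have "\<dots> = Re z * q 1 + Im z * q \<i>"
        using linear by (simp add: bounded_linear.linear linear_add linear_scale)
      finally have 1: "q z = Re z * q 1 + Im z * q \<i>" .
      have "z * cnj z = 1" using that by (simp add: complex_mult_cnj_cmod)
      then have "inverse z = cnj z" by (metis inverse_unique)
      then have "(z + inverse z) / 2 = of_real (Re z)" "(z - inverse z) / (2 * \<i>) = of_real (Im z)"
        by (auto simp: complex_eq_iff Re_divide Im_divide)
      then show ?thesis by (simp add: 1)
    qed
    have "(\<lambda>z. of_real (q 1) / 2 * (z powi 1 * v z + z powi (-1) * v z) + of_real (q \<i>) / (2 * \<i>) * (z powi 1 * v z + (-1) * (z powi (-1) * v z))) \<in> annih"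
      by (intro annih_add annih_cmult annih_powi v)
    then show "(\<lambda>z. of_real (q z) * v z) \<in> annih"
    proof (rule annih_cong)
      fix z :: complex assume z: "z \<in> sphere 0 1"
      have "z powi (-1) = inverse z" by (simp add: power_int_minus)
      then show "of_real (q z) * v z = of_real (q 1) / 2 * (z powi 1 * v z + z powi (-1) * v z) + of_real (q \<i>) / (2 * \<i>) * (z powi 1 * v z + (-1) * (z powi (-1) * v z))"
        unfolding e[OF z] by (simp only:) (simp add: field_simps)
    qed
  qed
next
  case (const c)
  then show ?case by (auto intro: annih_cmult)
next
  case (add p q)
  show ?case
  proof
    fix v assume "v \<in> annih"
    then have "(\<lambda>z. of_real (p z) * v z + of_real (q z) * v z) \<in> annih" using add by (intro annih_add) auto
    then show "(\<lambda>z. of_real (p z + q z) * v z) \<in> annih" by (simp add: distrib_right)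
  qed
next
  case (mult p q)
  show ?case
  proof
    fix v assume "v \<in> annih"
    from bspec[OF mult.IH(1) bspec[OF mult.IH(2) this]]
    have "(\<lambda>z. of_real (p z) * (of_real (q z) * v z)) \<in> annih" .
    then show "(\<lambda>z. of_real (p z * q z) * v z) \<in> annih" by (simp add: mult.assoc)
  qed
qed

lemma annih_one: "(\<lambda>_. 1) \<in> annih"
  using zero by (simp add: annih_def)

lemma annih_integral: "v \<in> annih \<Longrightarrow> (LINT z|circle. f z * v z) = 0"
proof -
  assume "v \<in> annih"
  then have "(LINT z|circle. f z * (v z * z powi 0)) = 0" unfolding annih_def by blast
  then show ?thesis by simp
qed

lemma annih_polynomial: "polynomial_function (p :: complex \<Rightarrow> complex) \<Longrightarrow> p \<in> annih"
proof -
  assume p: "polynomial_function p"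
  have "real_polynomial_function (Re \<circ> p)" "real_polynomial_function (Im \<circ> p)"
    using p bounded_linear_Re bounded_linear_Im unfolding polynomial_function_def by blast+
  then have "(\<lambda>z. of_real ((Re \<circ> p) z) * 1) \<in> annih" "(\<lambda>z. of_real ((Im \<circ> p) z) * 1) \<in> annih"
    using annih_one by (auto dest!: annih_real_polynomial)
  from annih_add[OF this(1) annih_cmult[OF this(2), of \<i>]]
  show ?thesis by (simp add: complex_eq[symmetric])
qed

lemma annih_continuous:
  assumes "continuous_on (sphere 0 1) g"
  shows "(LINT z|circle. f z * g z) = 0"
proof -
  have "cmod (LINT z|circle. f z * g z) \<le> ess_norm f * e" if e: "e > 0" for e
  proof -
    obtain p where p: "polynomial_function p" "\<And>x. x \<in> sphere 0 1 \<Longrightarrow> cmod (g x - p x) < e"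
      using Stone_Weierstrass_polynomial_function[OF compact_sphere assms e] by blast
    have cp: "continuous_on (sphere 0 1) p" using annih_polynomial[OF p(1)] by (simp add: annih_def)
    have i: "integrable circle (\<lambda>z. f z * h z)" if "continuous_on (sphere 0 1) h" for h
      by (rule ess_bdd_integrable[OF ess_bdd_mult[OF f ess_bdd_continuous[OF that]]])
    have "(LINT z|circle. f z * (g z - p z)) = (LINT z|circle. f z * g z) - (LINT z|circle. f z * p z)"
      unfolding right_diff_distrib by (rule Bochner_Integration.integral_diff[OF i[OF assms] i[OF cp]])
    then have "(LINT z|circle. f z * g z) = (LINT z|circle. f z * (g z - p z))"
      using annih_integral[OF annih_polynomial[OF p(1)]] by simp
    also have "cmod \<dots> \<le> ess_norm f * e"
      by (rule circle_integral_norm_le[OF f]) (use p(2) in \<open>auto intro!: continuous_intros assms cp less_imp_le\<close>)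
    finally show ?thesis .
  qed
  note * = this
  have "cmod (LINT z|circle. f z * g z) \<le> e" if "e > 0" for e
  proof -
    have "ess_norm f * (e / (ess_norm f + 1)) \<le> e"
      using that ess_norm_nonneg[OF f] by (simp add: field_simps)
    then show ?thesis using *[of "e / (ess_norm f + 1)"] that ess_norm_nonneg[OF f] by (simp add: add_nonneg_pos)
  qed
  then show ?thesis by (meson dense_ge norm_le_zero_iff)
qed

lemma annih_closed:
  assumes K: "closed K"
  shows "(LINT z|circle. f z * indicator K z) = 0"
proof (cases "K = {}")
  case True
  then show ?thesis by simp
next
  case False
  \<comment> \<open>Continuous functions with values in the unit interval, equal to \<open>1\<close>
    on \<open>K\<close> and decreasing to its indicator.\<close>
  define g where "g n z = max 0 (1 - real n * infdist z K)" for n and z :: complex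
  have cg: "continuous_on UNIV (g n)" for n
    unfolding g_def by (intro continuous_intros)
  have [measurable]: "f \<in> borel_measurable circle" by (rule ess_bdd_measurable[OF f])
  have cgs: "continuous_on (sphere 0 1) (\<lambda>z. complex_of_real (g n z))" for n
    using cg[of n] by (intro continuous_on_of_real) (rule continuous_on_subset, auto)
  have lim: "(\<lambda>n. f z * of_real (g n z)) \<longlonglongrightarrow> f z * indicator K z" for z
  proof (cases "z \<in> K")
    case True
    then have "g n z = 1" for n by (simp add: g_def)
    then show ?thesis using True by simp
  next
    case False
    then have d: "infdist z K > 0" using K \<open>K \<noteq> {}\<close> by (metis in_closed_iff_infdist_zero infdist_nonneg less_eq_real_def)
    have "eventually (\<lambda>n. real n * infdist z K > 1) sequentially"
      using filterlim_tendsto_pos_mult_at_top[OF tendsto_const d filterlim_real_sequentially]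
      by (simp add: filterlim_at_top_dense mult.commute)
    then have "eventually (\<lambda>n. f z * of_real (g n z) = f z * indicator K z) sequentially"
      by eventually_elim (use False in \<open>simp add: g_def\<close>)
    then show ?thesis by (rule tendsto_eventually)
  qed
  have "(\<lambda>n. LINT z|circle. f z * of_real (g n z)) \<longlonglongrightarrow> (LINT z|circle. f z * indicator K z)"
  proof (rule integral_dominated_convergence[where w = "\<lambda>_. ess_norm f"])
    show "(\<lambda>z. f z * of_real (g n z)) \<in> borel_measurable circle" for n
      using borel_measurable_circle_continuous[OF cgs[of n]] by measurable
    have "(indicator (K \<inter> sphere 0 1) :: complex \<Rightarrow> complex) \<in> borel_measurable circle"
      using borel_Int_circle[of K] K by (intro borel_measurable_indicator) simp
    moreover have "(indicator K :: complex \<Rightarrow> complex) \<in> borel_measurable circle \<longleftrightarrow> (indicator (K \<inter> sphere 0 1) :: complex \<Rightarrow> complex) \<in> borel_measurable circle"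
      by (rule measurable_cong) (auto simp: indicator_def)
    ultimately have [measurable]: "(indicator K :: complex \<Rightarrow> complex) \<in> borel_measurable circle" by simp
    show "(\<lambda>z. f z * indicator K z) \<in> borel_measurable circle" by measurable
    show "AE z in circle. (\<lambda>n. f z * of_real (g n z)) \<longlonglongrightarrow> f z * indicator K z" using lim by simp
    show "AE z in circle. cmod (f z * of_real (g n z)) \<le> ess_norm f" for n
      using ess_norm_AE[OF f]
    proof eventually_elim
      case (elim z)
      have "\<bar>g n z\<bar> \<le> 1" unfolding g_def by (auto simp: infdist_nonneg)
      then have "cmod (f z) * \<bar>g n z\<bar> \<le> cmod (f z)" by (simp add: mult_left_le)
      then show ?case using elim by (simp add: norm_mult)
    qed
  qed simp
  moreover have "(LINT z|circle. f z * of_real (g n z)) = 0" for n by (rule annih_continuous[OF cgs])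
  ultimately show ?thesis by (simp add: LIMSEQ_const_iff)
qed

lemma annih_borel:
  assumes "B \<in> sets borel"
  shows "(LINT z|circle. f z * indicator B z) = 0"
proof -
  have "Int_stable (Collect (closed :: complex set \<Rightarrow> bool))" by (auto simp: Int_stable_def)
  moreover have "Collect (closed :: complex set \<Rightarrow> bool) \<subseteq> Pow UNIV" by simp
  moreover have "B \<in> sigma_sets UNIV (Collect closed)" using assms unfolding borel_eq_closed by simp
  ultimately show ?thesis
  proof (induction rule: sigma_sets_induct_disjoint)
    case (basic A)
    then show ?case using annih_closed by simp
  next
    case empty
    then show ?case by simp
  next
    case (compl A)
    have A: "A \<in> sets borel" using compl(1) unfolding borel_eq_closed by simp
    have m: "A \<inter> sphere 0 1 \<in> sets circle" by (rule borel_Int_circle[OF A])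
    have e: "(LINT z|circle. f z * indicator A z) = (LINT z|circle. f z * indicator (A \<inter> sphere 0 1) z)"
      by (rule Bochner_Integration.integral_cong[OF refl]) (auto simp: indicator_def)
    have "(LINT z|circle. f z * indicator (UNIV - A) z) = (LINT z|circle. f z - f z * indicator (A \<inter> sphere 0 1) z)"
      by (rule Bochner_Integration.integral_cong[OF refl]) (auto simp: indicator_def)
    also have "\<dots> = (LINT z|circle. f z) - (LINT z|circle. f z * indicator (A \<inter> sphere 0 1) z)"
      by (intro Bochner_Integration.integral_diff ess_bdd_integrable f ess_bdd_indicator m)
    finally show ?case using compl e zero[of 0] by simp
  next
    case (union A)
    have A: "A i \<in> sets borel" for i using union(2)[of ] unfolding borel_eq_closed by auto
    have m: "A i \<inter> sphere 0 1 \<in> sets circle" for i by (rule borel_Int_circle[OF A])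
    have U: "(\<Union>i. A i \<inter> sphere 0 1) \<in> sets circle" using m by blast
    have e: "(LINT z|circle. f z * indicator B z) = (LINT z:(B \<inter> sphere 0 1)|circle. f z)" for B
      unfolding set_lebesgue_integral_def
      by (rule Bochner_Integration.integral_cong[OF refl]) (auto simp: indicator_def)
    have "(LINT z:(\<Union>i. A i \<inter> sphere 0 1)|circle. f z) = (\<Sum>i. LINT z:(A i \<inter> sphere 0 1)|circle. f z)"
    proof (rule lebesgue_integral_countable_add[OF m])
      show "A i \<inter> sphere 0 1 \<inter> (A j \<inter> sphere 0 1) = {}" if "i \<noteq> j" for i j
        using union(1) that by (auto simp: disjoint_family_on_def)
      show "set_integrable circle (\<Union>i. A i \<inter> sphere 0 1) f"
      proof -
        have "(\<lambda>z. f z * indicator (\<Union>i. A i \<inter> sphere 0 1) z) = (\<lambda>z. indicat_real (\<Union>i. A i \<inter> sphere 0 1) z *\<^sub>R f z)"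
          by (auto simp: fun_eq_iff indicator_def)
        then show ?thesis using ess_bdd_integrable[OF ess_bdd_indicator[OF f U]] by (simp only: set_integrable_def)
      qed
    qed
    also have "\<dots> = 0" using union(3) e by simp
    finally show ?case unfolding e by simp
  qed
qed

lemma annih_AE: "AE z in circle. f z = 0"
proof -
  have r: "AE z in circle. g (f z) = 0" if g: "bounded_linear g" for g :: "complex \<Rightarrow> real"
  proof -
    have gf: "integrable circle (\<lambda>z. g (f z))" by (rule integrable_bounded_linear[OF g ess_bdd_integrable[OF f]])
    have "AE z in circle. g (f z) = (\<lambda>_. 0) z"
    proof (rule density_unique_real[OF gf])
      fix A assume A: "A \<in> sets circle"
      then obtain B where B: "B \<in> sets borel" "A = sphere 0 1 \<inter> B" unfolding sets_circle sets_restrict_space by auto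
      have "(LINT z:A|circle. g (f z)) = (LINT z|circle. g (f z * indicator B z))"
        unfolding set_lebesgue_integral_def
        by (rule Bochner_Integration.integral_cong[OF refl]) (auto simp: B(2) indicator_def linear_0[OF bounded_linear.linear[OF g]])
      also have "\<dots> = g (LINT z|circle. f z * indicator B z)"
      proof (rule integral_bounded_linear[OF g])
        have "integrable circle (\<lambda>z. f z * indicator A z)" by (rule ess_bdd_integrable[OF ess_bdd_indicator[OF f A]])
        moreover have "integrable circle (\<lambda>z. f z * indicator A z) = integrable circle (\<lambda>z. f z * indicator B z)"
          by (rule Bochner_Integration.integrable_cong[OF refl]) (auto simp: B(2) indicator_def)
        ultimately show "integrable circle (\<lambda>z. f z * indicator B z)" by simp
      qed
      also have "\<dots> = 0" using annih_borel[OF B(1)] by (simp add: linear_0[OF bounded_linear.linear[OF g]])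
      finally show "(LINT z:A|circle. g (f z)) = (LINT z:A|circle. 0)" by simp
    qed simp
    then show ?thesis by simp
  qed
  from r[OF bounded_linear_Re] r[OF bounded_linear_Im] show ?thesis
    by eventually_elim (simp add: complex_eq_iff)
qed

end

lemma fourier_unique:
  assumes "\<And>n. fourier F n = fourier G n"
  shows "F = G"
proof -
  obtain f where f: "ess_bdd f" "F - G = abs_Linf f" by (rule Linf_cases)
  have "(LINT z|circle. f z * z powi n) = 0" for n
    using assms[of "-n"] fourier_diff[of F G "-n"] abs_Linf_simps(6)[OF f(1), of "-n"] by (simp add: f(2))
  from annih_AE[OF f(1) this] have "abs_Linf f = 0"
    by (simp add: zero_abs_Linf abs_Linf_eq_iff f ess_bdd_const)
  then show ?thesis using f(2) by simp
qed


section \<open>Bounded analytic functions\<close>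

lemma ess_bdd_powi: "ess_bdd (\<lambda>z. z powi n)"
  by (rule ess_bdd_continuous) (intro continuous_intros, auto)

lemma circle_powi_neg: "z \<in> sphere 0 1 \<Longrightarrow> z powi (- n) = cnj (z powi n)"
proof -
  assume z: "z \<in> sphere 0 1"
  then have "z * cnj z = 1" by (simp add: complex_mult_cnj_cmod)
  then have "inverse z = cnj z" by (rule inverse_unique)
  moreover have "cnj (z powi n) = cnj z powi n" by (cases "n \<ge> 0") (simp_all add: power_int_def)
  ultimately show ?thesis by (metis power_int_inverse power_int_minus)
qed

lemma integral_powi: "(LINT z|circle. z powi n) = (if n = 0 then 1 else 0)"
proof -
  have 1: "(LINT z|circle. z ^ k) = (if k = 0 then 1 else 0)" for k :: nat
  proof -
    have h: "(\<lambda>z::complex. z ^ k) holomorphic_on ball 0 2" by (intro holomorphic_intros)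
    have "(LINT z|circle. z ^ k) = cmean (\<lambda>z. z ^ k) 1"
      by (rule circle_integral_cmean[OF cont_sphere_hol[OF _ h]]) simp
    also have "\<dots> = 0 ^ k" by (rule cmean_holomorphic[OF _ h]) simp
    finally show ?thesis by (simp add: power_0_left)
  qed
  show ?thesis
  proof (cases "n \<ge> 0")
    case True
    then show ?thesis using 1[of "nat n"] by (simp add: power_int_def)
  next
    case False
    define m where "m = - n"
    have m: "m > 0" "n = - m" using False by (simp_all add: m_def)
    have "(LINT z|circle. z powi n) = (LINT z|circle. cnj (z ^ nat m))"
      by (rule Bochner_Integration.integral_cong[OF refl]) (use m circle_powi_neg[of _ m] in \<open>simp add: power_int_def\<close>)
    also have "\<dots> = cnj (LINT z|circle. z ^ nat m)" by (rule Bochner_Integration.integral_cnj)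
    finally show ?thesis using 1[of "nat m"] m by simp
  qed
qed

lemma integral_power_series:
  assumes a: "summable (\<lambda>k. cmod (a k))" and u: "ess_bdd u"
  shows "(\<lambda>k. a k * (LINT z|circle. z ^ k * u z)) sums (LINT z|circle. (\<Sum>k. a k * z ^ k) * u z)"
proof -
  have bk: "ess_bdd (\<lambda>z. a k * (z ^ k * u z))" for k
    by (intro ess_bdd_cmult ess_bdd_mult u ess_bdd_continuous) (intro continuous_intros)
  have nb: "AE z in circle. cmod (a k * (z ^ k * u z)) \<le> cmod (a k) * ess_norm u" for k
  proof -
    have "AE z in circle. cmod z = 1" by (rule AE_I2) simp
    with ess_norm_AE[OF u] show ?thesis
      by eventually_elim (simp add: norm_mult norm_power mult_left_mono)
  qed
  have S: "(\<lambda>k. LINT z|circle. a k * (z ^ k * u z)) sums (LINT z|circle. (\<Sum>k. a k * (z ^ k * u z)))"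
  proof (rule sums_integral)
    show "integrable circle (\<lambda>z. a k * (z ^ k * u z))" for k by (rule ess_bdd_integrable[OF bk])
    have "AE z in circle. \<forall>k. cmod (a k * (z ^ k * u z)) \<le> cmod (a k) * ess_norm u"
      using nb by (simp add: AE_all_countable)
    then show "AE z in circle. summable (\<lambda>k. cmod (a k * (z ^ k * u z)))"
    proof eventually_elim
      case (elim z)
      show ?case by (rule summable_comparison_test'[OF summable_mult2[OF a, of "ess_norm u"]]) (use elim in simp)
    qed
    show "summable (\<lambda>k. LINT z|circle. cmod (a k * (z ^ k * u z)))"
    proof (rule summable_comparison_test'[OF summable_mult2[OF a, of "ess_norm u"]])
      fix k
      have "(LINT z|circle. cmod (a k * (z ^ k * u z))) \<le> (LINT z|circle. cmod (a k) * ess_norm u)"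
        by (rule integral_mono_AE) (use nb ess_bdd_norm_integrable[OF bk] in auto)
      then show "norm (LINT z|circle. cmod (a k * (z ^ k * u z))) \<le> cmod (a k) * ess_norm u"
        using circle.prob_space by simp
    qed
  qed
  have "(LINT z|circle. (\<Sum>k. a k * (z ^ k * u z))) = (LINT z|circle. (\<Sum>k. a k * z ^ k) * u z)"
  proof (rule Bochner_Integration.integral_cong[OF refl])
    fix z assume z: "z \<in> space circle"
    have "summable (\<lambda>k. a k * z ^ k)"
      by (rule summable_norm_cancel) (use a z in \<open>simp add: norm_mult norm_power\<close>)
    then show "(\<Sum>k. a k * (z ^ k * u z)) = (\<Sum>k. a k * z ^ k) * u z"
      by (simp add: suminf_mult2 mult.assoc)
  qed
  then show ?thesis using S by simp
qed

text \<open>A bounded analytic function together with its Taylor coefficients. Its boundary function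
  will be obtained from the L2 convergence of its dilates on the circle.\<close>

locale disc_series =
  fixes a :: "nat \<Rightarrow> complex" and F :: "complex \<Rightarrow> complex" and C :: real
  assumes sums: "\<And>z. z \<in> ball 0 1 \<Longrightarrow> (\<lambda>n. a n * z ^ n) sums F z"
    and C: "\<And>z. z \<in> ball 0 1 \<Longrightarrow> cmod (F z) \<le> C"
begin

lemma hol: "F holomorphic_on ball 0 1"
  by (rule power_series_holomorphic[of 0 1 a]) (use sums in simp)

lemma summable_r: "0 \<le> r \<Longrightarrow> r < 1 \<Longrightarrow> summable (\<lambda>k. cmod (a k * of_real r ^ k))"
proof -
  assume r: "0 \<le> r" "r < 1"
  have "summable (\<lambda>n. a n * of_real ((1 + r) / 2) ^ n)"
    using sums[of "of_real ((1 + r) / 2)"] r by (auto simp: sums_iff simp del: of_real_divide of_real_add)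
  then show ?thesis by (rule powser_insidea) (use r in \<open>simp del: of_real_divide of_real_add\<close>)
qed

lemma in_ball:
  fixes z :: complex
  shows "0 \<le> r \<Longrightarrow> r < 1 \<Longrightarrow> z \<in> sphere 0 1 \<Longrightarrow> of_real r * z \<in> ball 0 1"
  by (simp add: norm_mult)

lemma F_r_eq: "0 \<le> r \<Longrightarrow> r < 1 \<Longrightarrow> z \<in> sphere 0 1 \<Longrightarrow> (\<Sum>k. (a k * of_real r ^ k) * z ^ k) = F (of_real r * z)"
  using sums[OF in_ball] by (simp add: sums_iff power_mult_distrib mult.assoc)

lemma cont_r: "0 \<le> r \<Longrightarrow> r < 1 \<Longrightarrow> continuous_on (sphere 0 1) (\<lambda>z. F (of_real r * z))"
  by (rule continuous_on_compose2[OF holomorphic_on_imp_continuous_on[OF hol]])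
     (auto intro!: continuous_intros simp: norm_mult)

lemma bdd_r: "0 \<le> r \<Longrightarrow> r < 1 \<Longrightarrow> ess_bdd (\<lambda>z. F (of_real r * z))"
  by (rule ess_bdd_continuous[OF cont_r])

lemma integral_r:
  assumes "0 \<le> r" "r < 1" "ess_bdd u"
  shows "(\<lambda>k. a k * of_real r ^ k * (LINT z|circle. z ^ k * u z)) sums (LINT z|circle. F (of_real r * z) * u z)"
proof -
  have "(LINT z|circle. (\<Sum>k. (a k * of_real r ^ k) * z ^ k) * u z) = (LINT z|circle. F (of_real r * z) * u z)"
    by (rule Bochner_Integration.integral_cong[OF refl]) (use F_r_eq[OF assms(1,2)] in simp)
  then show ?thesis using integral_power_series[OF summable_r[OF assms(1,2)] assms(3)] by simp
qed

lemma coeff_r: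
  assumes "0 \<le> r" "r < 1"
  shows "(LINT z|circle. F (of_real r * z) * z powi (- n)) = (if n \<ge> 0 then a (nat n) * of_real r ^ nat n else 0)"
proof -
  have "a k * of_real r ^ k * (LINT z|circle. z ^ k * z powi (- n)) = (if int k = n then a k * of_real r ^ k else 0)" for k
  proof -
    have "(LINT z|circle. z ^ k * z powi (- n)) = (LINT z|circle. z powi (int k - n))"
    proof (rule Bochner_Integration.integral_cong[OF refl])
      fix z :: complex assume "z \<in> space circle"
      then have "z \<noteq> 0" by auto
      then show "z ^ k * z powi (- n) = z powi (int k - n)" by (simp add: power_int_diff power_int_minus divide_inverse)
    qed
    then show ?thesis by (simp add: integral_powi)
  qed
  then have s: "(\<lambda>k. if int k = n then a k * of_real r ^ k else 0) sums (LINT z|circle. F (of_real r * z) * z powi (- n))"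
    using integral_r[OF assms ess_bdd_powi[of "- n"]] by simp
  show ?thesis
  proof (cases "n \<ge> 0")
    case True
    have "(\<lambda>k. if k = nat n then a k * of_real r ^ k else 0) sums (a (nat n) * of_real r ^ nat n)"
      by (rule sums_single)
    moreover have "(\<lambda>k. if k = nat n then a k * of_real r ^ k else 0) = (\<lambda>k. if int k = n then a k * of_real r ^ k else 0)"
      using True by (auto simp: fun_eq_iff)
    ultimately have "(\<lambda>k. if int k = n then a k * of_real r ^ k else 0) sums (a (nat n) * of_real r ^ nat n)" by simp
    from sums_unique2[OF s this] show ?thesis by (simp only: True if_True)
  next
    case False
    then have "(\<lambda>k. if int k = n then a k * of_real r ^ k else 0) = (\<lambda>k. 0)" by (auto simp: fun_eq_iff)
    then have "(\<lambda>k. if int k = n then a k * of_real r ^ k else 0) sums 0" by simp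
    from sums_unique2[OF s this] show ?thesis by (simp only: False if_False)
  qed
qed

text \<open>By Parseval, \<open>m (r * s)\<close> is the inner product on the circle of the dilates
  of \<open>F\<close> by \<open>r\<close> and by \<open>s\<close>.\<close>

definition "m t = (\<Sum>k. (cmod (a k))\<^sup>2 * t ^ k)"

lemma ip:
  assumes r: "0 \<le> r" "r < 1" and s: "0 \<le> s" "s < 1"
  shows "(\<lambda>k. (cmod (a k))\<^sup>2 * (r * s) ^ k) sums m (r * s)"
    and "(LINT z|circle. F (of_real r * z) * cnj (F (of_real s * z))) = of_real (m (r * s))"
proof -
  have b: "ess_bdd (\<lambda>z. cnj (F (of_real s * z)))"
    by (rule ess_bdd_continuous) (intro continuous_on_cnj cont_r s)
  have "(LINT z|circle. z ^ k * cnj (F (of_real s * z))) = cnj (a k) * of_real s ^ k" for k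
  proof -
    have "(LINT z|circle. z ^ k * cnj (F (of_real s * z))) = (LINT z|circle. cnj (F (of_real s * z) * z powi (- int k)))"
    proof (rule Bochner_Integration.integral_cong[OF refl])
      fix z assume "z \<in> space circle"
      then have "z powi (- int k) = cnj (z powi int k)" by (intro circle_powi_neg) simp
      then show "z ^ k * cnj (F (of_real s * z)) = cnj (F (of_real s * z) * z powi (- int k))" by simp
    qed
    also have "\<dots> = cnj (LINT z|circle. F (of_real s * z) * z powi (- int k))" by (rule Bochner_Integration.integral_cnj)
    finally show ?thesis unfolding coeff_r[OF s] by simp
  qed
  then have "(\<lambda>k. a k * of_real r ^ k * (cnj (a k) * of_real s ^ k)) sums (LINT z|circle. F (of_real r * z) * cnj (F (of_real s * z)))"
    using integral_r[OF r b] by simp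
  moreover have "a k * of_real r ^ k * (cnj (a k) * of_real s ^ k) = of_real ((cmod (a k))\<^sup>2 * (r * s) ^ k)" for k
  proof -
    have "a k * of_real r ^ k * (cnj (a k) * of_real s ^ k) = (a k * cnj (a k)) * of_real ((r * s) ^ k)"
      by (simp add: power_mult_distrib mult_ac)
    then show ?thesis by (simp add: complex_mult_cnj_cmod)
  qed
  ultimately have 1: "(\<lambda>k. of_real ((cmod (a k))\<^sup>2 * (r * s) ^ k)) sums (LINT z|circle. F (of_real r * z) * cnj (F (of_real s * z)))"
    by simp
  from sums_Re[OF this] have "summable (\<lambda>k. (cmod (a k))\<^sup>2 * (r * s) ^ k)" by (simp add: sums_iff del: of_real_mult of_real_power)
  then show 2: "(\<lambda>k. (cmod (a k))\<^sup>2 * (r * s) ^ k) sums m (r * s)" unfolding m_def by (rule summable_sums)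
  show "(LINT z|circle. F (of_real r * z) * cnj (F (of_real s * z))) = of_real (m (r * s))"
    using sums_unique2[OF 1 sums_of_real[OF 2]] .
qed

lemma m_mono:
  assumes "0 \<le> r" "r < 1" "0 \<le> s" "s < 1" "0 \<le> r'" "r' < 1" "0 \<le> s'" "s' < 1" "r * s \<le> r' * s'"
  shows "m (r * s) \<le> m (r' * s')"
  by (rule sums_le[OF _ ip(1)[OF assms(1-4)] ip(1)[OF assms(5-8)]])
     (intro mult_left_mono power_mono assms mult_nonneg_nonneg; simp)

lemma C_nonneg: "C \<ge> 0" using C[of 0] norm_ge_zero[of "F 0"] by (simp add: order_trans[OF norm_ge_zero])

lemma m_le: "0 \<le> r \<Longrightarrow> r < 1 \<Longrightarrow> m (r * r) \<le> C\<^sup>2"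
proof -
  assume r: "0 \<le> r" "r < 1"
  have "cmod (LINT z|circle. F (of_real r * z) * cnj (F (of_real r * z))) \<le> ess_norm (\<lambda>z. F (of_real r * z)) * C"
    by (rule circle_integral_norm_le[OF bdd_r[OF r]]) (intro continuous_on_cnj cont_r r, use C in_ball r in simp)
  also have "\<dots> \<le> C * C"
  proof (rule mult_right_mono[OF _ C_nonneg])
    show "ess_norm (\<lambda>z. F (of_real r * z)) \<le> C"
      by (rule ess_norm_le(1)[OF bdd_r[OF r]]) (use C in_ball[OF r] in \<open>auto intro!: AE_I2\<close>)
  qed
  finally show ?thesis unfolding ip(2)[OF r r] by (simp add: power2_eq_square)
qed

text \<open>Expanding the square gives \<open>m (r * r) + m (s * s) - 2 * m (r * s)\<close>, and
  \<open>m (r * r) \<le> m (r * s)\<close> because \<open>m\<close> has nonnegative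
  coefficients.\<close>

lemma L2_diff:
  assumes r: "0 \<le> r" "r < 1" and s: "0 \<le> s" "s < 1" and rs: "r \<le> s"
  shows "(LINT z|circle. (cmod (F (of_real r * z) - F (of_real s * z)))\<^sup>2) \<le> m (s * s) - m (r * r)"
proof -
  have b: "integrable circle (\<lambda>z. F (of_real r * z) * cnj (F (of_real s * z)))" if "0 \<le> r" "r < 1" "0 \<le> s" "s < 1" for r s
    by (intro ess_bdd_integrable ess_bdd_continuous continuous_on_mult continuous_on_cnj cont_r that)
  have "complex_of_real (LINT z|circle. (cmod (F (of_real r * z) - F (of_real s * z)))\<^sup>2) = (LINT z|circle. of_real ((cmod (F (of_real r * z) - F (of_real s * z)))\<^sup>2))"
    by (rule integral_complex_of_real[symmetric])
  also have "\<dots> = (LINT z|circle. (F (of_real r * z) * cnj (F (of_real r * z)) - F (of_real r * z) * cnj (F (of_real s * z))) -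
     (F (of_real s * z) * cnj (F (of_real r * z)) - F (of_real s * z) * cnj (F (of_real s * z))))"
    unfolding complex_mult_cnj_cmod[symmetric]
    by (rule Bochner_Integration.integral_cong[OF refl]) (simp add: algebra_simps)
  also have "\<dots> = (of_real (m (r * r)) - of_real (m (r * s))) - (of_real (m (s * r)) - of_real (m (s * s)))"
    by (simp add: Bochner_Integration.integral_diff b r s ip(2))
  also have "\<dots> = of_real (m (r * r) + m (s * s) - 2 * m (r * s))" by (simp add: mult.commute)
  finally have "(LINT z|circle. (cmod (F (of_real r * z) - F (of_real s * z)))\<^sup>2) = m (r * r) + m (s * s) - 2 * m (r * s)"
    by (simp only: of_real_eq_iff)
  moreover have "m (r * r) \<le> m (r * s)" by (rule m_mono) (use r s rs in \<open>auto intro: mult_left_mono\<close>)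
  ultimately show ?thesis by simp
qed

definition "\<rho> j = 1 - 1 / (real j + 2)"

lemma \<rho>: "0 \<le> \<rho> j" "\<rho> j < 1" by (auto simp: \<rho>_def field_simps)
lemma \<rho>_mono: "i \<le> j \<Longrightarrow> \<rho> i \<le> \<rho> j" by (auto simp: \<rho>_def field_simps)
lemma \<rho>_lim: "\<rho> \<longlonglongrightarrow> 1" unfolding \<rho>_def by real_asymp

text \<open>The numbers \<open>m (\<rho> j * \<rho> j)\<close> increase and are bounded by the
  square of \<open>C\<close>. So \<open>L2_diff\<close> makes the dilates a Cauchy sequence in L2,
  hence in L1, and a subsequence converges almost everywhere.\<close>

lemma boundary_function:
  obtains f q where "ess_bdd f" "strict_mono q" "AE z in circle. (\<lambda>i. F (of_real (\<rho> (q i)) * z)) \<longlonglongrightarrow> f z"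
    "AE z in circle. cmod (f z) \<le> C"
proof -
  define s where "s j z = F (of_real (\<rho> j) * z)" for j z
  have int: "integrable circle (s j)" for j unfolding s_def by (rule ess_bdd_integrable[OF bdd_r[OF \<rho>]])
  have "incseq (\<lambda>j. m (\<rho> j * \<rho> j))"
    by (rule incseq_SucI, rule m_mono) (use \<rho> \<rho>_mono[of _ "Suc _"] in \<open>auto intro!: mult_mono\<close>)
  then obtain l where l: "(\<lambda>j. m (\<rho> j * \<rho> j)) \<longlonglongrightarrow> l"
    using incseq_convergent[of "\<lambda>j. m (\<rho> j * \<rho> j)" "C\<^sup>2"] m_le[OF \<rho>] by blast
  then have cau: "Cauchy (\<lambda>j. m (\<rho> j * \<rho> j))" by (rule LIMSEQ_imp_Cauchy)
  \<comment> \<open>A substitute for Cauchy-Schwarz: \<open>t \<le> e / 2 + t^2 / (2 * e)\<close>,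
    where \<open>e\<close> will be the desired accuracy.\<close>
  have L1: "(LINT z|circle. cmod (s i z - s j z)) \<le> e / 2 + (1 / (2 * e)) * \<bar>m (\<rho> i * \<rho> i) - m (\<rho> j * \<rho> j)\<bar>" if "e > 0" for i j e
  proof -
    have ib: "integrable circle (\<lambda>z. (cmod (s i z - s j z))\<^sup>2)" "integrable circle (\<lambda>z. cmod (s i z - s j z))"
    proof -
      have cs: "continuous_on (sphere 0 1) (s k)" for k unfolding s_def by (intro cont_r \<rho>)
      have c: "continuous_on (sphere 0 1) (\<lambda>z. s i z - s j z)" by (intro continuous_on_diff cs)
      then have "integrable circle (\<lambda>z. complex_of_real ((cmod (s i z - s j z))\<^sup>2))"
        by (intro ess_bdd_integrable ess_bdd_continuous continuous_intros cs)
      from integrable_Re[OF this] show "integrable circle (\<lambda>z. (cmod (s i z - s j z))\<^sup>2)" by simp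
      show "integrable circle (\<lambda>z. cmod (s i z - s j z))" by (rule ess_bdd_norm_integrable[OF ess_bdd_continuous[OF c]])
    qed
    have "(LINT z|circle. cmod (s i z - s j z)) \<le> (LINT z|circle. e / 2 + (1 / (2 * e)) * (cmod (s i z - s j z))\<^sup>2)"
    proof (rule integral_mono)
      fix z
      have "0 \<le> (cmod (s i z - s j z) - e)\<^sup>2 / (2 * e)" using that by simp
      also have "\<dots> = e / 2 + (1 / (2 * e)) * (cmod (s i z - s j z))\<^sup>2 - cmod (s i z - s j z)"
        using that by (simp add: power2_eq_square field_simps)
      finally show "cmod (s i z - s j z) \<le> e / 2 + (1 / (2 * e)) * (cmod (s i z - s j z))\<^sup>2" by simp
    qed (use ib in \<open>auto intro!: Bochner_Integration.integrable_add\<close>)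
    also have "\<dots> = e / 2 + (1 / (2 * e)) * (LINT z|circle. (cmod (s i z - s j z))\<^sup>2)"
      using ib circle.prob_space by (simp add: Bochner_Integration.integral_add)
    also have "(LINT z|circle. (cmod (s i z - s j z))\<^sup>2) \<le> \<bar>m (\<rho> i * \<rho> i) - m (\<rho> j * \<rho> j)\<bar>"
    proof (cases "i \<le> j")
      case True
      then show ?thesis using L2_diff[OF \<rho> \<rho> \<rho>_mono[OF True]] by (simp add: s_def)
    next
      case False
      then have "j \<le> i" by simp
      from L2_diff[OF \<rho> \<rho> \<rho>_mono[OF this]] show ?thesis by (simp add: s_def norm_minus_commute)
    qed
    finally show ?thesis using that by (simp add: mult_left_mono divide_right_mono)
  qed
  have "\<exists>N. \<forall>i\<ge>N. \<forall>j\<ge>N. (LINT z|circle. cmod (s i z - s j z)) < e" if e: "e > 0" for e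
  proof -
    obtain N where N: "\<And>i j. i \<ge> N \<Longrightarrow> j \<ge> N \<Longrightarrow> \<bar>m (\<rho> i * \<rho> i) - m (\<rho> j * \<rho> j)\<bar> < e\<^sup>2 / 2"
      using CauchyD[OF cau, of "e\<^sup>2 / 2"] e by (auto simp: real_norm_def)
    show ?thesis
    proof (intro exI[of _ N] allI impI)
      fix i j assume "i \<ge> N" "j \<ge> N"
      then have "(1 / (2 * e)) * \<bar>m (\<rho> i * \<rho> i) - m (\<rho> j * \<rho> j)\<bar> \<le> (1 / (2 * e)) * (e\<^sup>2 / 2)"
        using N e by (intro mult_left_mono) (auto intro: less_imp_le)
      also have "\<dots> = e / 4" using e by (simp add: power2_eq_square)
      finally show "(LINT z|circle. cmod (s i z - s j z)) < e" using L1[OF e, of i j] e by linarith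
    qed
  qed
  from cauchy_L1_AE_cauchy_subseq[OF int this]
  obtain q where q: "strict_mono q" "AE z in circle. Cauchy (\<lambda>i. s (q i) z)" by blast
  define f where "f z = lim (\<lambda>i. s (q i) z)" for z
  have lim: "AE z in circle. (\<lambda>i. s (q i) z) \<longlonglongrightarrow> f z"
    using q(2) by eventually_elim (simp add: f_def Cauchy_convergent_iff convergent_LIMSEQ_iff)
  have meas: "f \<in> borel_measurable circle"
    unfolding f_def by (rule borel_measurable_lim_metric) (use int in \<open>auto simp: integrable_iff_bounded\<close>)
  have "AE z in circle. z \<in> sphere 0 1" by (rule AE_I2) simp
  with lim have bd: "AE z in circle. cmod (f z) \<le> C"
  proof eventually_elim
    case (elim z)
    show ?case
      by (rule LIMSEQ_le_const2[OF tendsto_norm[OF elim(1)]]) (use C in_ball[OF \<rho> elim(2)] in \<open>auto simp: s_def\<close>)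
  qed
  show ?thesis by (rule that[OF ess_bddI[OF meas bd] q(1) lim[unfolded s_def] bd])
qed

lemma limit_integral:
  assumes "ess_bdd f" "strict_mono q" "AE z in circle. (\<lambda>i. F (of_real (\<rho> (q i)) * z)) \<longlonglongrightarrow> f z" "ess_bdd u"
  shows "(\<lambda>i. LINT z|circle. F (of_real (\<rho> (q i)) * z) * u z) \<longlonglongrightarrow> (LINT z|circle. f z * u z)"
proof (rule integral_dominated_convergence[where w = "\<lambda>z. C * cmod (u z)"])
  show "(\<lambda>z. f z * u z) \<in> borel_measurable circle" by (rule ess_bdd_measurable[OF ess_bdd_mult[OF assms(1,4)]])
  show "(\<lambda>z. F (of_real (\<rho> (q i)) * z) * u z) \<in> borel_measurable circle" for i
    by (rule ess_bdd_measurable[OF ess_bdd_mult[OF bdd_r[OF \<rho>] assms(4)]])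
  show "integrable circle (\<lambda>z. C * cmod (u z))" using ess_bdd_norm_integrable[OF assms(4)] by simp
  show "AE z in circle. (\<lambda>i. F (of_real (\<rho> (q i)) * z) * u z) \<longlonglongrightarrow> f z * u z"
    using assms(3) by eventually_elim (intro tendsto_intros)
  show "AE z in circle. cmod (F (of_real (\<rho> (q i)) * z) * u z) \<le> C * cmod (u z)" for i
    by (rule AE_I2) (use C in_ball[OF \<rho>] in \<open>auto simp: norm_mult intro!: mult_right_mono\<close>)
qed

lemma boundary_coeff:
  assumes "ess_bdd f" "strict_mono q" "AE z in circle. (\<lambda>i. F (of_real (\<rho> (q i)) * z)) \<longlonglongrightarrow> f z"
  shows "fourier (abs_Linf f) n = (if n \<ge> 0 then a (nat n) else 0)"
proof -
  have "(\<lambda>i. LINT z|circle. F (of_real (\<rho> (q i)) * z) * z powi (-n)) \<longlonglongrightarrow> fourier (abs_Linf f) n"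
    using limit_integral[OF assms ess_bdd_powi] by (simp add: abs_Linf_simps assms)
  moreover have "(\<lambda>i. a (nat n) * of_real (\<rho> (q i)) ^ nat n) \<longlonglongrightarrow> a (nat n) * of_real 1 ^ nat n"
    by (intro tendsto_mult tendsto_const tendsto_power tendsto_of_real LIMSEQ_subseq_LIMSEQ[OF \<rho>_lim assms(2), unfolded o_def])
  then have "(\<lambda>i. if n \<ge> 0 then a (nat n) * of_real (\<rho> (q i)) ^ nat n else 0) \<longlonglongrightarrow> (if n \<ge> 0 then a (nat n) else 0)"
    by (cases "n \<ge> 0") simp_all
  ultimately show ?thesis unfolding coeff_r[OF \<rho>] by (rule LIMSEQ_unique)
qed

end

text \<open>The bound by the norm uses that \<open>v\<close> has no negative coefficients: the
  integral of \<open>v\<close> times \<open>E - 1\<close> is then zero, and adding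
  \<open>E - 1\<close> to the Cauchy kernel produces the Poisson kernel, whose L1 norm is
  \<open>1\<close>.\<close>

lemma fourier_Hinf_sums:
  assumes "v \<in> Hinf" "cmod z < 1"
  shows "(\<lambda>n. fourier v (int n) * z ^ n) sums disk_ext v z" and "disk_ext v z = fourier (v * cauchy_ker z) 0"
    and "cmod (disk_ext v z) \<le> norm v"
proof -
  obtain f where f: "ess_bdd f" "v = abs_Linf f" by (rule Linf_cases)
  have bk: "ess_bdd (\<lambda>w. 1 / (1 - z * cnj w))" by (rule ess_bdd_continuous[OF continuous_on_kernel[OF assms(2)]])
  have bcf: "ess_bdd (\<lambda>w. cnj (f w))"
  proof -
    have "cnj \<in> borel_measurable borel" by (intro borel_measurable_continuous_onI continuous_intros)
    from measurable_compose[OF ess_bdd_measurable[OF f(1)] this] show ?thesis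
      using f(1) unfolding ess_bdd_def by simp
  qed
  have sm: "summable (\<lambda>k. cmod (x ^ k))" if "cmod x < 1" for x :: complex
    using that by (simp add: norm_power summable_geometric)
  have geo: "(\<Sum>k. x ^ k * w ^ k) = 1 / (1 - x * w)" if "cmod x < 1" "w \<in> sphere 0 1" for x w :: complex
    using suminf_geometric[of "x * w"] that by (simp add: norm_mult power_mult_distrib)
  have A: "(\<lambda>k. z ^ k * fourier v (int k)) sums (LINT w|circle. 1 / (1 - z * cnj w) * f w)"
  proof -
    have "(\<lambda>k. cnj z ^ k * (LINT w|circle. w ^ k * cnj (f w))) sums (LINT w|circle. (\<Sum>k. cnj z ^ k * w ^ k) * cnj (f w))"
      by (rule integral_power_series) (use sm[of "cnj z"] assms bcf in simp_all)
    from bounded_linear.sums[OF bounded_linear_cnj this]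
    have "(\<lambda>k. z ^ k * cnj (LINT w|circle. w ^ k * cnj (f w))) sums cnj (LINT w|circle. (\<Sum>k. cnj z ^ k * w ^ k) * cnj (f w))"
      by simp
    moreover have "cnj (LINT w|circle. w ^ k * cnj (f w)) = fourier v (int k)" for k
    proof -
      have "cnj (LINT w|circle. w ^ k * cnj (f w)) = (LINT w|circle. cnj (w ^ k * cnj (f w)))"
        by (rule Bochner_Integration.integral_cnj[symmetric])
      also have "\<dots> = (LINT w|circle. f w * w powi (- int k))"
        by (rule Bochner_Integration.integral_cong[OF refl]) (simp add: circle_powi_neg mult.commute)
      finally show ?thesis by (simp add: f abs_Linf_simps)
    qed
    moreover have "cnj (LINT w|circle. (\<Sum>k. cnj z ^ k * w ^ k) * cnj (f w)) = (LINT w|circle. 1 / (1 - z * cnj w) * f w)"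
    proof -
      have "cnj (LINT w|circle. (\<Sum>k. cnj z ^ k * w ^ k) * cnj (f w)) = (LINT w|circle. cnj ((\<Sum>k. cnj z ^ k * w ^ k) * cnj (f w)))"
        by (rule Bochner_Integration.integral_cnj[symmetric])
      also have "\<dots> = (LINT w|circle. 1 / (1 - z * cnj w) * f w)"
        by (rule Bochner_Integration.integral_cong[OF refl]) (use geo[of "cnj z"] assms in simp)
      finally show ?thesis .
    qed
    ultimately show ?thesis by simp
  qed
  show 1: "(\<lambda>n. fourier v (int n) * z ^ n) sums disk_ext v z"
    using A unfolding disk_ext_def by (simp add: mult.commute sums_iff)
  have vk: "v * cauchy_ker z = abs_Linf (\<lambda>w. f w * (1 / (1 - z * cnj w)))"
    unfolding f cauchy_ker_def by (rule abs_Linf_simps(3)[OF f(1) bk])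
  have fk: "ess_bdd (\<lambda>w. f w * (1 / (1 - z * cnj w)))" by (rule ess_bdd_mult[OF f(1) bk])
  show 2: "disk_ext v z = fourier (v * cauchy_ker z) 0"
  proof -
    have "fourier (v * cauchy_ker z) 0 = (LINT w|circle. 1 / (1 - z * cnj w) * f w)"
      unfolding vk abs_Linf_simps(6)[OF fk] by (rule Bochner_Integration.integral_cong[OF refl]) simp
    then show ?thesis using A unfolding disk_ext_def by (simp add: sums_iff mult.commute)
  qed
  obtain r where r: "r > 1" "(\<lambda>w. 1 / (1 - cnj z * w)) holomorphic_on ball 0 r"
    using cauchy_kernel_hol[OF assms(2), of 2 thesis] by auto
  define E where "E w = 1 / (1 - cnj z * w)" for w
  have cE: "continuous_on (sphere 0 1) E" unfolding E_def by (rule cont_sphere_hol[OF r])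
  have bE: "ess_bdd E" "ess_bdd (\<lambda>w. E w - 1)" by (rule ess_bdd_continuous, intro continuous_intros cE)+
  have B: "(\<lambda>k. cnj z ^ k * fourier v (- int k)) sums (LINT w|circle. E w * f w)"
  proof -
    have "(\<lambda>k. cnj z ^ k * (LINT w|circle. w ^ k * f w)) sums (LINT w|circle. (\<Sum>k. cnj z ^ k * w ^ k) * f w)"
      by (rule integral_power_series) (use sm[of "cnj z"] assms f(1) in simp_all)
    moreover have "(LINT w|circle. (\<Sum>k. cnj z ^ k * w ^ k) * f w) = (LINT w|circle. E w * f w)"
      by (rule Bochner_Integration.integral_cong[OF refl]) (use geo[of "cnj z"] assms in \<open>simp add: E_def\<close>)
    moreover have "(LINT w|circle. w ^ k * f w) = fourier v (- int k)" for k
      by (simp add: f abs_Linf_simps mult.commute)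
    ultimately show ?thesis by simp
  qed
  have "(\<lambda>k. cnj z ^ k * fourier v (- int k)) = (\<lambda>k. if k = 0 then fourier v 0 else 0)"
    using assms(1) by (auto simp: fun_eq_iff Hinf_def)
  then have "(\<lambda>k. cnj z ^ k * fourier v (- int k)) sums fourier v 0" using sums_single[of 0 "\<lambda>_. fourier v 0"] by simp
  then have "(LINT w|circle. E w * f w) = fourier v 0" using B sums_unique2 by blast
  also have "\<dots> = (LINT w|circle. f w)" by (simp add: f abs_Linf_simps)
  finally have Ef: "(LINT w|circle. E w * f w) = (LINT w|circle. f w)" .
  have "fourier (v * abs_Linf (\<lambda>w. E w - 1)) 0 = (LINT w|circle. f w * (E w - 1))"
    unfolding f by (simp add: abs_Linf_simps f(1) bE ess_bdd_mult)
  also have "\<dots> = (LINT w|circle. E w * f w - f w)"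
    by (rule Bochner_Integration.integral_cong[OF refl]) (simp add: algebra_simps)
  also have "\<dots> = (LINT w|circle. E w * f w) - (LINT w|circle. f w)"
    by (intro Bochner_Integration.integral_diff ess_bdd_integrable ess_bdd_mult bE f)
  finally have 0: "fourier (v * abs_Linf (\<lambda>w. E w - 1)) 0 = 0" using Ef by simp
  have "disk_ext v z = fourier (v * (cauchy_ker z + abs_Linf (\<lambda>w. E w - 1))) 0"
    by (simp add: distrib_left fourier_add 0 2)
  then have "cmod (disk_ext v z) \<le> L1n (v * (cauchy_ker z + abs_Linf (\<lambda>w. E w - 1)))" using mean_le_L1n by simp
  also have "\<dots> \<le> norm v * L1n (cauchy_ker z + abs_Linf (\<lambda>w. E w - 1))" by (rule L1n_mult_le)
  finally show "cmod (disk_ext v z) \<le> norm v" using L1n_poisson[OF assms(2)] by (simp add: E_def)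
qed

lemma Hinf_disc_series: "v \<in> Hinf \<Longrightarrow> disc_series (\<lambda>n. fourier v (int n)) (disk_ext v) (norm v)"
  by unfold_locales (use fourier_Hinf_sums in auto)

lemma disk_ext_holomorphic: "v \<in> Hinf \<Longrightarrow> disk_ext v holomorphic_on ball 0 1"
  using disc_series.hol[OF Hinf_disc_series] .

lemma disk_ext_le: "v \<in> Hinf \<Longrightarrow> z \<in> ball 0 1 \<Longrightarrow> cmod (disk_ext v z) \<le> norm v"
  using fourier_Hinf_sums(3) by simp

lemma disk_ext_inj:
  assumes "v \<in> Hinf" "w \<in> Hinf" "\<And>z. z \<in> ball 0 1 \<Longrightarrow> disk_ext v z = disk_ext w z"
  shows "v = w"
proof (rule fourier_unique)
  fix n
  interpret v: disc_series "\<lambda>n. fourier v (int n)" "disk_ext v" "norm v" by (rule Hinf_disc_series[OF assms(1)])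
  interpret w: disc_series "\<lambda>n. fourier w (int n)" "disk_ext w" "norm w" by (rule Hinf_disc_series[OF assms(2)])
  show "fourier v n = fourier w n"
  proof (cases "n \<ge> 0")
    case True
    have "(LINT z|circle. disk_ext v (of_real (1/2) * z) * z powi (- n)) = (LINT z|circle. disk_ext w (of_real (1/2) * z) * z powi (- n))"
      by (rule Bochner_Integration.integral_cong[OF refl]) (simp add: assms(3))
    then show ?thesis using v.coeff_r[of "1/2" n] w.coeff_r[of "1/2" n] True by simp
  next
    case False
    then show ?thesis using assms by (simp add: Hinf_def)
  qed
qed

lemma Hinf_of_holomorphic:
  assumes hol: "F holomorphic_on ball 0 1" and C: "\<And>z. z \<in> ball 0 1 \<Longrightarrow> cmod (F z) \<le> C"
  obtains v where "v \<in> Hinf" "norm v \<le> C" "\<And>z. z \<in> ball 0 1 \<Longrightarrow> disk_ext v z = F z"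
proof -
  interpret disc_series "\<lambda>n. (deriv ^^ n) F 0 / fact n" F C
    by unfold_locales (use holomorphic_power_series[OF hol] C in auto)
  obtain f q where f: "ess_bdd f" "strict_mono q" "AE z in circle. (\<lambda>i. F (of_real (\<rho> (q i)) * z)) \<longlonglongrightarrow> f z"
    "AE z in circle. cmod (f z) \<le> C" by (rule boundary_function)
  show ?thesis
  proof
    show "abs_Linf f \<in> Hinf" using boundary_coeff[OF f(1-3)] by (simp add: Hinf_def)
    show "norm (abs_Linf f) \<le> C" using f by (simp add: norm_abs_Linf_le_iff)
    show "disk_ext (abs_Linf f) z = F z" if "z \<in> ball 0 1" for z
      using sums[OF that] unfolding disk_ext_def boundary_coeff[OF f(1-3)] by (simp add: sums_iff)
  qed
qed

text \<open>The Fourier series of \<open>v\<close> need not converge on the circle. So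
  \<open>v\<close> is replaced by its dilates, whose series can be integrated term by term against
  \<open>w\<close>; only finitely many terms survive because \<open>w\<close> has no negative
  coefficients, and in a finite sum the radius may tend to \<open>1\<close>. The outcome is the
  Cauchy product of the coefficients.\<close>

lemma Hinf_mult:
  assumes "v \<in> Hinf" "w \<in> Hinf"
  shows "v * w \<in> Hinf" "z \<in> ball 0 1 \<Longrightarrow> disk_ext (v * w) z = disk_ext v z * disk_ext w z"
proof -
  interpret disc_series "\<lambda>n. fourier v (int n)" "disk_ext v" "norm v" by (rule Hinf_disc_series[OF assms(1)])
  obtain f q where f: "ess_bdd f" "strict_mono q" "AE z in circle. (\<lambda>i. disk_ext v (of_real (\<rho> (q i)) * z)) \<longlonglongrightarrow> f z"
    by (rule boundary_function)
  have v: "v = abs_Linf f"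
    by (rule fourier_unique) (use boundary_coeff[OF f] assms(1) in \<open>simp add: Hinf_def\<close>)
  obtain g where g: "ess_bdd g" "w = abs_Linf g" by (rule Linf_cases)
  have key: "fourier (v * w) n = (if n \<ge> 0 then \<Sum>k\<le>nat n. fourier v (int k) * fourier w (n - int k) else 0)" for n
  proof -
    have u: "ess_bdd (\<lambda>z. g z * z powi (- n))" by (rule ess_bdd_mult[OF g(1) ess_bdd_powi])
    have "fourier (v * w) n = (LINT z|circle. f z * (g z * z powi (- n)))"
      unfolding v g by (simp add: abs_Linf_simps f g ess_bdd_mult mult.assoc)
    then have lim: "(\<lambda>i. LINT z|circle. disk_ext v (of_real (\<rho> (q i)) * z) * (g z * z powi (- n))) \<longlonglongrightarrow> fourier (v * w) n"
      using limit_integral[OF f u] by simp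
    have "(LINT z|circle. z ^ k * (g z * z powi (- n))) = fourier w (n - int k)" for k
    proof -
      have "(LINT z|circle. z ^ k * (g z * z powi (- n))) = (LINT z|circle. g z * z powi (- (n - int k)))"
      proof (rule Bochner_Integration.integral_cong[OF refl])
        fix z :: complex assume "z \<in> space circle"
        then have "z \<noteq> 0" by auto
        then have "z powi (- (n - int k)) = z ^ k * z powi (- n)" by (simp add: power_int_diff power_int_minus divide_inverse)
        then show "z ^ k * (g z * z powi (- n)) = g z * z powi (- (n - int k))" by simp
      qed
      then show ?thesis by (simp add: g abs_Linf_simps)
    qed
    then have S: "(\<lambda>k. fourier v (int k) * of_real (\<rho> j) ^ k * fourier w (n - int k)) sums (LINT z|circle. disk_ext v (of_real (\<rho> j) * z) * (g z * z powi (- n)))" for j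
      using integral_r[OF \<rho> u, of j] by simp
    define K where "K = (if n \<ge> 0 then {..nat n} else {})"
    have fw: "fourier w (n - int k) = 0" if "k \<notin> K" for k
    proof -
      have "n - int k < 0" using that by (auto simp: K_def split: if_splits)
      then show ?thesis using assms(2) by (simp add: Hinf_def)
    qed
    have "(\<lambda>k. fourier v (int k) * of_real (\<rho> j) ^ k * fourier w (n - int k)) sums (\<Sum>k\<in>K. fourier v (int k) * of_real (\<rho> j) ^ k * fourier w (n - int k))" for j
      by (rule sums_finite) (auto simp: K_def fw[unfolded K_def] split: if_splits)
    then have "(LINT z|circle. disk_ext v (of_real (\<rho> j) * z) * (g z * z powi (- n))) = (\<Sum>k\<in>K. fourier v (int k) * of_real (\<rho> j) ^ k * fourier w (n - int k))" for j
      using S sums_unique2 by blast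
    then have "(\<lambda>i. \<Sum>k\<in>K. fourier v (int k) * of_real (\<rho> (q i)) ^ k * fourier w (n - int k)) \<longlonglongrightarrow> fourier (v * w) n"
      using lim by simp
    moreover have "(\<lambda>i. \<Sum>k\<in>K. fourier v (int k) * of_real (\<rho> (q i)) ^ k * fourier w (n - int k)) \<longlonglongrightarrow> (\<Sum>k\<in>K. fourier v (int k) * of_real 1 ^ k * fourier w (n - int k))"
      by (intro tendsto_sum tendsto_mult tendsto_const tendsto_power tendsto_of_real LIMSEQ_subseq_LIMSEQ[OF \<rho>_lim f(2), unfolded o_def])
    ultimately have "fourier (v * w) n = (\<Sum>k\<in>K. fourier v (int k) * of_real 1 ^ k * fourier w (n - int k))"
      using LIMSEQ_unique by blast
    then show ?thesis by (simp add: K_def)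
  qed
  show 1: "v * w \<in> Hinf" using key by (simp add: Hinf_def)
  assume z: "z \<in> ball 0 1"
  then have z1: "cmod z < 1" by simp
  have sn: "summable (\<lambda>n. cmod (fourier x (int n) * z ^ n))" if "x \<in> Hinf" for x
  proof -
    interpret x: disc_series "\<lambda>n. fourier x (int n)" "disk_ext x" "norm x" by (rule Hinf_disc_series[OF that])
    show ?thesis using x.summable_r[of "cmod z"] z1 by (simp add: norm_mult norm_power)
  qed
  have "(\<lambda>n. \<Sum>i\<le>n. (fourier v (int i) * z ^ i) * (fourier w (int (n - i)) * z ^ (n - i))) sums
    ((\<Sum>n. fourier v (int n) * z ^ n) * (\<Sum>n. fourier w (int n) * z ^ n))"
    by (rule Cauchy_product_sums[OF sn[OF assms(1)] sn[OF assms(2)]])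
  moreover have "(\<Sum>i\<le>n. (fourier v (int i) * z ^ i) * (fourier w (int (n - i)) * z ^ (n - i))) = fourier (v * w) (int n) * z ^ n" for n
  proof -
    have "(\<Sum>i\<le>n. (fourier v (int i) * z ^ i) * (fourier w (int (n - i)) * z ^ (n - i))) = (\<Sum>i\<le>n. fourier v (int i) * fourier w (int n - int i) * z ^ n)"
    proof (rule sum.cong[OF refl])
      fix i assume "i \<in> {..n}"
      then have "i \<le> n" by simp
      then have "z ^ n = z ^ i * z ^ (n - i)" by (simp add: power_add[symmetric])
      then show "(fourier v (int i) * z ^ i) * (fourier w (int (n - i)) * z ^ (n - i)) = fourier v (int i) * fourier w (int n - int i) * z ^ n"
        using \<open>i \<le> n\<close> by (simp add: of_nat_diff mult_ac)
    qed
    then show ?thesis by (simp add: key sum_distrib_right)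
  qed
  ultimately have "(\<lambda>n. fourier (v * w) (int n) * z ^ n) sums (disk_ext v z * disk_ext w z)"
    by (simp add: disk_ext_def)
  then show "disk_ext (v * w) z = disk_ext v z * disk_ext w z"
    unfolding disk_ext_def[of "v * w"] by (simp add: sums_iff)
qed

lemma Hinf_comb:
  assumes "v \<in> Hinf" "w \<in> Hinf"
  shows "v + w \<in> Hinf" "Linf_cscale c v \<in> Hinf" "v - w \<in> Hinf"
    "z \<in> ball 0 1 \<Longrightarrow> disk_ext (v + w) z = disk_ext v z + disk_ext w z"
    "z \<in> ball 0 1 \<Longrightarrow> disk_ext (Linf_cscale c v) z = c * disk_ext v z"
    "z \<in> ball 0 1 \<Longrightarrow> disk_ext (v - w) z = disk_ext v z - disk_ext w z"
proof -
  show H: "v + w \<in> Hinf" "Linf_cscale c v \<in> Hinf" "v - w \<in> Hinf"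
    using assms by (auto simp: Hinf_def fourier_add fourier_cscale fourier_diff)
  assume z: "z \<in> ball 0 1"
  then have z1: "cmod z < 1" by simp
  note s = fourier_Hinf_sums(1)[OF assms(1) z1] fourier_Hinf_sums(1)[OF assms(2) z1]
  show "disk_ext (v + w) z = disk_ext v z + disk_ext w z"
    using sums_unique2[OF fourier_Hinf_sums(1)[OF H(1) z1]] sums_add[OF s] by (simp add: fourier_add distrib_right)
  show "disk_ext (Linf_cscale c v) z = c * disk_ext v z"
    using sums_unique2[OF fourier_Hinf_sums(1)[OF H(2) z1]] sums_mult[OF s(1), of c] by (simp add: fourier_cscale mult.assoc)
  show "disk_ext (v - w) z = disk_ext v z - disk_ext w z"
    using sums_unique2[OF fourier_Hinf_sums(1)[OF H(3) z1]] sums_diff[OF s] by (simp add: fourier_diff left_diff_distrib)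
qed

lemma Hinf_one: "1 \<in> Hinf" and disk_ext_one: "disk_ext 1 z = 1"
proof -
  have f: "fourier 1 n = (if n = 0 then 1 else 0)" for n
    using integral_powi[of "-n"] by (simp add: one_abs_Linf abs_Linf_simps ess_bdd_const)
  then show "1 \<in> Hinf" by (simp add: Hinf_def)
  have "(\<lambda>n. fourier 1 (int n) * z ^ n) = (\<lambda>n. if n = 0 then 1 else 0)" by (auto simp: f)
  then show "disk_ext 1 z = 1" unfolding disk_ext_def using sums_single[of 0 "\<lambda>_. 1::complex"] by (simp add: sums_iff)
qed

definition Zf :: Linf where "Zf = abs_Linf (\<lambda>z. z)"

lemma Zf_Hinf: "Zf \<in> Hinf" and disk_ext_Zf: "disk_ext Zf z = z"
proof -
  have b: "ess_bdd (\<lambda>z. z)" by (rule ess_bdd_continuous) (intro continuous_intros)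
  have f: "fourier Zf n = (if n = 1 then 1 else 0)" for n
  proof -
    have "fourier Zf n = (LINT z|circle. z powi (1 - n))"
      unfolding Zf_def abs_Linf_simps(6)[OF b]
    proof (rule Bochner_Integration.integral_cong[OF refl])
      fix z :: complex assume "z \<in> space circle"
      then have "z \<noteq> 0" by auto
      then show "z * z powi - n = z powi (1 - n)" by (simp add: power_int_diff power_int_minus divide_inverse)
    qed
    then show ?thesis by (simp add: integral_powi)
  qed
  then show "Zf \<in> Hinf" by (simp add: Hinf_def)
  have "(\<lambda>n. fourier Zf (int n) * z ^ n) = (\<lambda>n. if n = 1 then z ^ n else 0)" by (auto simp: f)
  then show "disk_ext Zf z = z" unfolding disk_ext_def using sums_single[of 1 "\<lambda>n. z ^ n"] by (simp add: sums_iff)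
qed


section \<open>Ultrafilter limits\<close>

definition ultra :: "'a filter \<Rightarrow> bool" where
  "ultra F \<longleftrightarrow> F \<noteq> bot \<and> (\<forall>P. eventually P F \<or> eventually (\<lambda>x. \<not> P x) F)"

text \<open>Zorn's lemma for the proper filters below \<open>F\<close>, with the order reversed so
  that a maximal element is a finest filter. The infimum of a chain stays proper because whatever
  holds eventually in it already does so in one member.\<close>

lemma ultra_exists:
  assumes "F \<noteq> (bot :: 'a filter)"
  obtains U where "U \<le> F" "ultra U"
proof -
  define A where "A = {G. G \<le> F \<and> G \<noteq> bot}"
  let ?P = "\<lambda>a b :: 'a filter. b \<le> a"
  have "\<exists>m\<in>A. \<forall>a\<in>A. a \<le> m \<longrightarrow> a = m"
  proof (rule predicate_Zorn)
    show "partial_order_on A (relation_of ?P A)"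
      by (auto simp: partial_order_on_def preorder_on_def refl_on_def trans_def antisym_def relation_of_def)
    fix C assume C: "C \<in> Chains (relation_of ?P A)"
    then have CA: "C \<subseteq> A" and lin: "\<And>x y. x \<in> C \<Longrightarrow> y \<in> C \<Longrightarrow> x \<le> y \<or> y \<le> x"
      unfolding Chains_def relation_of_def by blast+
    show "\<exists>u\<in>A. \<forall>a\<in>C. u \<le> a"
    proof (cases "C = {}")
      case True
      then show ?thesis using assms by (auto simp: A_def)
    next
      case False
      have "eventually (\<lambda>x. False) (Inf C) \<longleftrightarrow> (\<exists>b\<in>C. eventually (\<lambda>x. False) b)"
        by (rule eventually_Inf_base[OF False]) (use lin in \<open>metis inf.absorb1 inf.absorb2 order_refl\<close>)
      then have "Inf C \<noteq> bot" using CA by (auto simp: A_def trivial_limit_def)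
      moreover obtain c where "c \<in> C" using False by blast
      then have "Inf C \<le> F" using CA Inf_lower[of c C] by (auto simp: A_def intro: order_trans)
      ultimately show ?thesis by (auto simp: A_def intro: Inf_lower)
    qed
  qed
  then obtain U where U: "U \<in> A" and max: "\<And>a. a \<in> A \<Longrightarrow> a \<le> U \<Longrightarrow> a = U" by blast
  have "eventually P U \<or> eventually (\<lambda>x. \<not> P x) U" for P
  proof (cases "inf U (principal {x. P x}) = bot")
    case True
    then have "eventually (\<lambda>x. False) (inf U (principal {x. P x}))" by simp
    then show ?thesis by (simp add: eventually_inf_principal)
  next
    case False
    then have "inf U (principal {x. P x}) \<in> A" using U by (auto simp: A_def intro: order_trans[OF inf_le1])
    then have "inf U (principal {x. P x}) = U" using max by simp
    then have "U \<le> principal {x. P x}" by (metis inf_le2)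
    then show ?thesis by (simp add: le_principal)
  qed
  then show ?thesis using that U by (auto simp: A_def ultra_def)
qed

lemma ultraD: "ultra U \<Longrightarrow> U \<noteq> bot" "ultra U \<Longrightarrow> \<not> eventually P U \<longleftrightarrow> eventually (\<lambda>x. \<not> P x) U"
proof -
  show "ultra U \<Longrightarrow> U \<noteq> bot" by (simp add: ultra_def)
  assume u: "ultra U"
  show "\<not> eventually P U \<longleftrightarrow> eventually (\<lambda>x. \<not> P x) U"
  proof
    assume "eventually (\<lambda>x. \<not> P x) U"
    show "\<not> eventually P U"
    proof
      assume "eventually P U"
      with \<open>eventually (\<lambda>x. \<not> P x) U\<close> have "eventually (\<lambda>x. False) U" by eventually_elim simp
      then show False using u by (simp add: ultra_def trivial_limit_def)
    qed
  qed (use u in \<open>auto simp: ultra_def\<close>)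
qed

lemma ultra_filtermap: "ultra U \<Longrightarrow> ultra (filtermap f U)"
  by (auto simp: ultra_def eventually_filtermap filtermap_bot_iff)

lemma ultra_eq:
  assumes "ultra U" "ultra V" "\<And>P. eventually P U \<Longrightarrow> eventually P V"
  shows "U = V"
proof (rule filter_eqI)
  show "eventually P U = eventually P V" for P
    using assms(3)[of P] assms(3)[of "\<lambda>x. \<not> P x"] ultraD(2)[OF assms(1), of P] ultraD(2)[OF assms(2), of P] by blast
qed

lemma ultra_tendsto_compact:
  fixes f :: "'a \<Rightarrow> 'b::topological_space"
  assumes u: "ultra U" and K: "compact K" and ev: "eventually (\<lambda>x. f x \<in> K) U"
  obtains l where "l \<in> K" "(f \<longlongrightarrow> l) U"
proof -
  have "filtermap f U \<noteq> bot" using ultraD(1)[OF u] by (simp add: filtermap_bot_iff)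
  moreover have "eventually (\<lambda>y. y \<in> K) (filtermap f U)" using ev by (simp add: eventually_filtermap)
  ultimately obtain l where l: "l \<in> K" "inf (nhds l) (filtermap f U) \<noteq> bot"
    using K unfolding compact_filter by blast
  have "eventually (\<lambda>x. f x \<in> S) U" if "open S" "l \<in> S" for S
  proof (rule ccontr)
    assume "\<not> eventually (\<lambda>x. f x \<in> S) U"
    then have "eventually (\<lambda>y. y \<notin> S) (filtermap f U)"
      using ultraD(2)[OF u] by (simp add: eventually_filtermap)
    moreover have "eventually (\<lambda>y. y \<in> S) (nhds l)" using that by (simp add: eventually_nhds_in_open)
    ultimately have "eventually (\<lambda>y. False) (inf (nhds l) (filtermap f U))"
      unfolding eventually_inf by blast
    then show False using l(2) by (simp add: trivial_limit_def)
  qed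
  then show ?thesis using that[OF l(1)] by (simp add: tendsto_def)
qed

lemma ultra_tendsto_bounded:
  fixes f :: "'a \<Rightarrow> complex"
  assumes "ultra U" "eventually (\<lambda>x. cmod (f x) \<le> C) U"
  obtains l where "cmod l \<le> C" "(f \<longlongrightarrow> l) U"
  using ultra_tendsto_compact[OF assms(1) compact_cball, of f 0 C] assms(2) by auto

lemma bounded_holomorphic_lipschitz:
  assumes f: "f holomorphic_on ball 0 1" and C: "\<And>z. z \<in> ball 0 1 \<Longrightarrow> cmod (f z) \<le> C"
    and r: "r < 1" "x \<in> cball 0 r" "y \<in> cball 0 r"
  shows "cmod (f x - f y) \<le> 2 * C / (1 - r) * cmod (x - y)"
proof (rule field_differentiable_bound[OF convex_cball _ _ r(2,3)])
  fix z :: complex assume z: "z \<in> cball 0 r"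
  define t where "t = (1 - r) / 2"
  have t: "t > 0" using r by (simp add: t_def)
  have sub: "cball z t \<subseteq> ball 0 1"
  proof
    fix w assume "w \<in> cball z t"
    then have "cmod (w - z) \<le> t" by (simp add: dist_norm norm_minus_commute)
    then have "cmod w \<le> t + r" using z norm_triangle_ineq[of "w - z" z] by simp
    then show "w \<in> ball 0 1" using r by (simp add: t_def field_simps)
  qed
  have "z \<in> ball 0 1" using sub t by (meson centre_in_cball less_imp_le subsetD)
  then show "(f has_field_derivative deriv f z) (at z within cball 0 r)"
    using holomorphic_derivI[OF f open_ball] by (blast intro: has_field_derivative_at_within)
  have "cmod ((deriv ^^ 1) f z) \<le> fact 1 * C / t ^ 1"
  proof (rule Cauchy_inequality[OF _ _ t])
    show "f holomorphic_on ball z t" using f sub ball_subset_cball by (meson holomorphic_on_subset order_trans)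
    show "continuous_on (cball z t) f" using f sub by (meson holomorphic_on_imp_continuous_on continuous_on_subset)
    show "cmod (f x) \<le> C" if "cmod (z - x) = t" for x using C sub that by (simp add: subset_eq dist_norm)
  qed
  then show "cmod (deriv f z) \<le> 2 * C / (1 - r)" using t by (simp add: t_def field_simps)
qed

section \<open>Limits of bounded families of holomorphic functions along a filter\<close>

context
  fixes F :: "'a filter" and f :: "'a \<Rightarrow> complex \<Rightarrow> complex" and g :: "complex \<Rightarrow> complex" and C :: real
  assumes F: "F \<noteq> bot"
    and hol: "eventually (\<lambda>k. f k holomorphic_on ball 0 1 \<and> (\<forall>z\<in>ball 0 1. cmod (f k z) \<le> C)) F"
    and lim: "\<And>z. z \<in> ball 0 1 \<Longrightarrow> ((\<lambda>k. f k z) \<longlongrightarrow> g z) F"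
begin

lemma limit_bound: "z \<in> ball 0 1 \<Longrightarrow> cmod (g z) \<le> C"
  by (rule tendsto_upperbound[OF tendsto_norm[OF lim] _ F]) (use hol in \<open>auto elim: eventually_mono\<close>)

lemma limit_lipschitz:
  assumes r: "r < 1" "x \<in> cball 0 r" "y \<in> cball 0 r"
  shows "cmod (g x - g y) \<le> 2 * C / (1 - r) * cmod (x - y)"
proof (rule tendsto_upperbound[OF tendsto_norm[OF tendsto_diff[OF lim lim]] _ F])
  show "eventually (\<lambda>k. cmod (f k x - f k y) \<le> 2 * C / (1 - r) * cmod (x - y)) F"
    using hol by eventually_elim (intro bounded_holomorphic_lipschitz r; blast)
qed (use r in auto)

text \<open>On a smaller disk all \<open>f k\<close> share one Lipschitz constant, so the points may
  move while the limit is taken.\<close>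

lemma limit_moving:
  assumes w: "(w \<longlongrightarrow> w0) F" and w0: "w0 \<in> ball 0 1"
  shows "((\<lambda>k. f k (w k)) \<longlongrightarrow> g w0) F"
proof -
  define r where "r = (1 + cmod w0) / 2"
  have r: "r < 1" "cmod w0 < r" using w0 by (auto simp: r_def)
  have "eventually (\<lambda>k. cmod (w k) < r) F"
    using tendsto_norm[OF w] r(2) by (rule order_tendstoD)
  then have "eventually (\<lambda>k. cmod (f k (w k) - f k w0) \<le> 2 * C / (1 - r) * cmod (w k - w0)) F"
    using hol
  proof eventually_elim
    case (elim k)
    then show ?case using r by (intro bounded_holomorphic_lipschitz) auto
  qed
  note ev = this
  have "((\<lambda>k. 2 * C / (1 - r) * cmod (w k - w0)) \<longlongrightarrow> 2 * C / (1 - r) * cmod (w0 - w0)) F"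
    by (intro tendsto_intros w)
  then have "((\<lambda>k. 2 * C / (1 - r) * cmod (w k - w0)) \<longlongrightarrow> 0) F" by simp
  with ev have "((\<lambda>k. f k (w k) - f k w0) \<longlongrightarrow> 0) F"
    by (rule Lim_null_comparison)
  from tendsto_add[OF this lim[OF w0]] show ?thesis by simp
qed

text \<open>The common Lipschitz bound upgrades pointwise convergence to uniform convergence on
  small closed disks, through a finite net; a uniform limit of holomorphic functions is
  holomorphic.\<close>

lemma limit_holomorphic: "g holomorphic_on ball 0 1"
proof -
  have "g field_differentiable (at z)" if z: "z \<in> ball 0 1" for z
  proof -
    define t where "t = (1 - cmod z) / 2"
    define r where "r = (1 + cmod z) / 2"
    have t: "t > 0" "r < 1" "t + cmod z = r" using z by (auto simp: t_def r_def field_simps)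
    have sub: "cball z t \<subseteq> cball 0 r"
    proof
      fix x assume "x \<in> cball z t"
      then have "cmod (x - z) \<le> t" by (simp add: dist_norm norm_minus_commute)
      then show "x \<in> cball 0 r" using norm_triangle_ineq[of "x - z" z] t by simp
    qed
    have sub1: "cball z t \<subseteq> ball 0 1" using sub t by auto
    define L where "L = 2 * \<bar>C\<bar> / (1 - r)"
    have L: "L \<ge> 0" using t by (simp add: L_def)
    have LL: "2 * C / (1 - r) * a \<le> L * a" if "a \<ge> 0" for a
      unfolding L_def using that t by (intro mult_right_mono divide_right_mono) auto
    have ul: "uniform_limit (cball z t) f g F"
      unfolding uniform_limit_iff
    proof (intro allI impI)
      fix e :: real assume e: "e > 0"
      define dl where "dl = e / (3 * (L + 1))"
      have dl: "dl > 0" using e L by (simp add: dl_def)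
      have Ldl: "L * dl \<le> e / 3"
      proof -
        have "L * dl \<le> (L + 1) * dl" using dl by simp
        also have "\<dots> = e / 3"
        proof -
          have "L + 1 \<noteq> 0" using L by linarith
          then show ?thesis unfolding dl_def by (metis divide_divide_eq_right mult.commute nonzero_mult_divide_mult_cancel_right times_divide_eq_right mult_divide_mult_cancel_left)
        qed
        finally show ?thesis .
      qed
      obtain T where T: "finite T" "T \<subseteq> cball z t" "cball z t \<subseteq> (\<Union>x\<in>T. ball x dl)"
      proof (rule compactE_image[OF compact_cball[of z t], of "cball z t" "\<lambda>x. ball x dl"])
        show "cball z t \<subseteq> (\<Union>x\<in>cball z t. ball x dl)" using dl by (meson UN_I centre_in_ball subsetI)
      qed auto
      have "eventually (\<lambda>k. \<forall>x\<in>T. dist (f k x) (g x) < e / 3) F"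
        using T sub1 e by (intro eventually_ball_finite ballI tendstoD[OF lim]) auto
      then show "eventually (\<lambda>k. \<forall>x\<in>cball z t. dist (f k x) (g x) < e) F"
        using hol
      proof eventually_elim
        case (elim k)
        show ?case
        proof
          fix x assume x: "x \<in> cball z t"
          then obtain y where y: "y \<in> T" "dist y x < dl" using T(3) by auto
          have xy: "x \<in> cball 0 r" "y \<in> cball 0 r" using x y T(2) sub by auto
          have "cmod (f k x - f k y) \<le> L * cmod (x - y)"
            by (rule order_trans[OF bounded_holomorphic_lipschitz LL]) (use elim t xy in auto)
          also have "\<dots> \<le> L * dl" using y L by (intro mult_left_mono) (auto simp: dist_norm norm_minus_commute)
          finally have 1: "cmod (f k x - f k y) \<le> e / 3" using Ldl by simp
          have "cmod (g x - g y) \<le> L * cmod (x - y)"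
            by (rule order_trans[OF limit_lipschitz LL]) (use t xy in auto)
          also have "\<dots> \<le> L * dl" using y L by (intro mult_left_mono) (auto simp: dist_norm norm_minus_commute)
          finally have 2: "cmod (g x - g y) \<le> e / 3" using Ldl by simp
          have 3: "cmod (f k y - g y) < e / 3" using elim y(1) by (auto simp: dist_norm)
          have "f k x - g x = ((f k x - f k y) + (f k y - g y)) - (g x - g y)" by simp
          then have "cmod (f k x - g x) \<le> cmod ((f k x - f k y) + (f k y - g y)) + cmod (g x - g y)"
            by (metis norm_triangle_ineq4)
          then have "cmod (f k x - g x) \<le> cmod (f k x - f k y) + cmod (f k y - g y) + cmod (g x - g y)"
            using norm_triangle_ineq[of "f k x - f k y" "f k y - g y"] by linarith
          then show "dist (f k x) (g x) < e" using 1 2 3 by (simp add: dist_norm)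
        qed
      qed
    qed
    have "eventually (\<lambda>k. continuous_on (cball z t) (f k) \<and> f k holomorphic_on ball z t) F"
      using hol
    proof eventually_elim
      case (elim k)
      then show ?case
        using sub1 ball_subset_cball[of z t] by (meson holomorphic_on_imp_continuous_on holomorphic_on_subset order_trans)
    qed
    from holomorphic_uniform_limit[OF this ul F] have "g holomorphic_on ball z t" by blast
    then show ?thesis using t(1) by (meson centre_in_ball holomorphic_on_imp_differentiable_at open_ball)
  qed
  then show ?thesis by (simp add: holomorphic_on_def field_differentiable_at_within)
qed

end

text \<open>The dilated data satisfy \<open>corona_data\<close> with the same \<open>d\<close>, so
  their solutions are bounded independently of the dilation, and an ultrafilter limit of these
  solves the original equation.\<close>

theorem corona_disc:
  fixes f :: "'i \<Rightarrow> complex \<Rightarrow> complex"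
  assumes fin: "finite I" and hol: "\<And>i. i \<in> I \<Longrightarrow> f i holomorphic_on ball 0 1"
    and f1: "\<And>i z. i \<in> I \<Longrightarrow> z \<in> ball 0 1 \<Longrightarrow> cmod (f i z) \<le> 1"
    and d: "d > 0" and low: "\<And>z. z \<in> ball 0 1 \<Longrightarrow> d \<le> (\<Sum>i\<in>I. (cmod (f i z))\<^sup>2)"
  obtains g C where "\<And>i. i \<in> I \<Longrightarrow> g i holomorphic_on ball 0 1" "\<And>i z. i \<in> I \<Longrightarrow> z \<in> ball 0 1 \<Longrightarrow> cmod (g i z) \<le> C"
    "\<And>z. z \<in> ball 0 1 \<Longrightarrow> (\<Sum>i\<in>I. f i z * g i z) = 1"
proof -
  define \<rho> where "\<rho> m = 1 - 1 / (real m + 2)" for m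
  have \<rho>: "0 < \<rho> m" "\<rho> m < 1" for m by (auto simp: \<rho>_def field_simps)
  have \<rho>lim: "\<rho> \<longlonglongrightarrow> 1" unfolding \<rho>_def by real_asymp
  have sub: "of_real (\<rho> m) * z \<in> ball 0 1" if "z \<in> ball 0 (1 / \<rho> m)" for m and z :: complex
    using that \<rho>[of m] by (simp add: norm_mult field_simps)
  have cd: "corona_data (1 / \<rho> m) d I (\<lambda>i z. f i (of_real (\<rho> m) * z))" for m
  proof
    show "1 / \<rho> m > 1" using \<rho>[of m] by simp
    show "(\<lambda>z. f i (of_real (\<rho> m) * z)) holomorphic_on ball 0 (1 / \<rho> m)" if "i \<in> I" for i
    proof -
      have "(f i \<circ> (\<lambda>z. of_real (\<rho> m) * z)) holomorphic_on ball 0 (1 / \<rho> m)"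
        by (rule holomorphic_on_compose_gen[OF _ hol[OF that]]) (use sub in \<open>auto intro!: holomorphic_intros\<close>)
      then show ?thesis by (simp add: o_def)
    qed
  qed (use fin f1 d low sub in auto)
  define C where "C = corona_data.\<kappa> d + 2 * card I * corona_data.C0 d I"
  have "\<forall>m. \<exists>g. (\<forall>j\<in>I. g j holomorphic_on ball 0 1 \<and> (\<forall>z\<in>ball 0 1. cmod (g j z) \<le> C)) \<and>
     (\<forall>z\<in>ball 0 1. (\<Sum>j\<in>I. f j (of_real (\<rho> m) * z) * g j z) = 1)"
    unfolding C_def using corona_data.corona_smooth[OF cd] by blast
  from choice[OF this] obtain G where GG: "\<And>m. (\<forall>j\<in>I. G m j holomorphic_on ball 0 1 \<and> (\<forall>z\<in>ball 0 1. cmod (G m j z) \<le> C)) \<and>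
     (\<forall>z\<in>ball 0 1. (\<Sum>j\<in>I. f j (of_real (\<rho> m) * z) * G m j z) = 1)" by blast
  have G: "\<And>m j. j \<in> I \<Longrightarrow> G m j holomorphic_on ball 0 1" "\<And>m j z. j \<in> I \<Longrightarrow> z \<in> ball 0 1 \<Longrightarrow> cmod (G m j z) \<le> C"
    "\<And>m z. z \<in> ball 0 1 \<Longrightarrow> (\<Sum>j\<in>I. f j (of_real (\<rho> m) * z) * G m j z) = 1"
    using GG by blast+
  obtain U :: "nat filter" where U: "U \<le> sequentially" "ultra U" using ultra_exists[OF sequentially_bot] .
  have "\<exists>l. j \<in> I \<longrightarrow> z \<in> ball 0 1 \<longrightarrow> ((\<lambda>m. G m j z) \<longlongrightarrow> l) U" for j z
  proof (cases "j \<in> I \<and> z \<in> ball 0 1")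
    case True
    then have "eventually (\<lambda>m. cmod (G m j z) \<le> C) U" using G(2) by simp
    then obtain l where "((\<lambda>m. G m j z) \<longlongrightarrow> l) U" by (rule ultra_tendsto_bounded[OF U(2)])
    then show ?thesis by blast
  qed auto
  then have "\<forall>j z. \<exists>l. j \<in> I \<longrightarrow> z \<in> ball 0 1 \<longrightarrow> ((\<lambda>m. G m j z) \<longlongrightarrow> l) U" by blast
  then obtain g where "\<forall>j z. j \<in> I \<longrightarrow> z \<in> ball 0 1 \<longrightarrow> ((\<lambda>m. G m j z) \<longlongrightarrow> g j z) U"
    unfolding choice_iff by blast
  then have g: "\<And>j z. j \<in> I \<Longrightarrow> z \<in> ball 0 1 \<Longrightarrow> ((\<lambda>m. G m j z) \<longlongrightarrow> g j z) U" by blast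
  note gl = limit_holomorphic limit_bound
  show ?thesis
  proof (rule that[of g C])
    fix i assume i: "i \<in> I"
    have ev: "eventually (\<lambda>m. G m i holomorphic_on ball 0 1 \<and> (\<forall>z\<in>ball 0 1. cmod (G m i z) \<le> C)) U"
      using G i by auto
    show "g i holomorphic_on ball 0 1" by (rule limit_holomorphic[OF ultraD(1)[OF U(2)] ev g[OF i]])
    show "cmod (g i z) \<le> C" if "z \<in> ball 0 1" for z by (rule limit_bound[OF ultraD(1)[OF U(2)] ev g[OF i] that])
  next
    fix z assume z: "z \<in> ball (0::complex) 1"
    have "((\<lambda>m. \<Sum>j\<in>I. f j (of_real (\<rho> m) * z) * G m j z) \<longlongrightarrow> (\<Sum>j\<in>I. f j z * g j z)) U"
    proof (intro tendsto_sum tendsto_mult g z)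
      fix j assume j: "j \<in> I"
      have "((\<lambda>m. of_real (\<rho> m) * z) \<longlongrightarrow> of_real 1 * z) U"
        by (intro tendsto_mult tendsto_of_real tendsto_const tendsto_mono[OF U(1) \<rho>lim])
      moreover have "isCont (f j) z" using hol[OF j] z
        by (meson continuous_on_eq_continuous_at holomorphic_on_imp_continuous_on open_ball)
      ultimately show "((\<lambda>m. f j (of_real (\<rho> m) * z)) \<longlongrightarrow> f j z) U"
        using isCont_tendsto_compose[of z "f j" "\<lambda>m. of_real (\<rho> m) * z" U] by simp
    qed
    then have "((\<lambda>m. 1::complex) \<longlongrightarrow> (\<Sum>j\<in>I. f j z * g j z)) U" using G(3)[OF z] by simp
    then show "(\<Sum>j\<in>I. f j z * g j z) = 1"
      using tendsto_unique[OF ultraD(1)[OF U(2)] _ tendsto_const] by blast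
  qed
qed

text \<open>The sets of all \<open>k\<close> in \<open>S\<close> that approximate \<open>t\<close>
  on finitely many \<open>f\<close> form a filter base, and any finer ultrafilter works. It will be
  used with \<open>S\<close> the open disk, for arbitrary characters, and with \<open>S\<close> the
  set of all indices, for a thin point.\<close>

lemma ultra_realize:
  fixes ev :: "'a \<Rightarrow> 'b \<Rightarrow> complex"
  assumes approx: "\<And>\<F> e. finite \<F> \<Longrightarrow> \<F> \<subseteq> A \<Longrightarrow> e > 0 \<Longrightarrow> \<exists>k\<in>S. \<forall>f\<in>\<F>. cmod (ev k f - t f) < e"
  obtains U where "ultra U" "eventually (\<lambda>k. k \<in> S) U" "\<And>f. f \<in> A \<Longrightarrow> ((\<lambda>k. ev k f) \<longlongrightarrow> t f) U"
proof -
  define B where "B = {\<F>. finite \<F> \<and> \<F> \<subseteq> A} \<times> {0::real<..}"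
  define N where "N p = {k\<in>S. \<forall>f\<in>fst p. cmod (ev k f - t f) < snd p}" for p
  define F where "F = (INF p\<in>B. principal (N p))"
  have B0: "B \<noteq> {}" by (auto simp: B_def intro!: exI[of _ "{}"] exI[of _ 1])
  have ev: "eventually P F \<longleftrightarrow> (\<exists>p\<in>B. eventually P (principal (N p)))" for P
    unfolding F_def
  proof (rule eventually_INF_base[OF B0])
    fix p q assume "p \<in> B" "q \<in> B"
    then show "\<exists>x\<in>B. principal (N x) \<le> inf (principal (N p)) (principal (N q))"
      by (intro bexI[of _ "(fst p \<union> fst q, min (snd p) (snd q))"]) (auto simp: B_def N_def)
  qed
  have "F \<noteq> bot"
  proof
    assume "F = bot"
    then have "eventually (\<lambda>_. False) F" by simp
    then obtain p where "p \<in> B" "N p = {}" unfolding ev eventually_principal by auto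
    then obtain k where "k \<in> S" "\<forall>f\<in>fst p. cmod (ev k f - t f) < snd p" using approx[of "fst p" "snd p"] by (auto simp: B_def)
    then have "k \<in> N p" by (simp add: N_def)
    then show False using \<open>N p = {}\<close> by simp
  qed
  then obtain U where U: "U \<le> F" "ultra U" by (rule ultra_exists)
  show ?thesis
  proof (rule that[OF U(2)])
    have "eventually (\<lambda>k. k \<in> S) F"
      unfolding ev eventually_principal by (rule bexI[of _ "({}, 1)"]) (auto simp: B_def N_def)
    then show "eventually (\<lambda>k. k \<in> S) U" using U(1) by (simp add: le_filter_def)
    fix f assume f: "f \<in> A"
    show "((\<lambda>k. ev k f) \<longlongrightarrow> t f) U"
    proof (rule tendstoI)
      fix e :: real assume "e > 0"
      then have "eventually (\<lambda>k. dist (ev k f) (t f) < e) F"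
        unfolding ev eventually_principal using f by (intro bexI[of _ "({f}, e)"]) (auto simp: B_def N_def dist_norm)
      then show "eventually (\<lambda>k. dist (ev k f) (t f) < e) U" using U(1) by (simp add: le_filter_def)
    qed
  qed
qed

section \<open>Characters of the algebra of bounded analytic functions\<close>

text \<open>The conditions on a character of \<open>Hinf\<close> without extensionality, so that
  characters of \<open>HinfC\<close> and limits of point evaluations satisfy them without being
  restricted first.\<close>

definition hchar :: "(Linf \<Rightarrow> complex) \<Rightarrow> bool" where
  "hchar \<psi> \<longleftrightarrow> \<psi> 1 = 1 \<and> (\<forall>f\<in>Hinf. \<forall>g\<in>Hinf. \<psi> (f + g) = \<psi> f + \<psi> g \<and> \<psi> (f * g) = \<psi> f * \<psi> g) \<and>
     (\<forall>c. \<forall>f\<in>Hinf. \<psi> (Linf_cscale c f) = c * \<psi> f)"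

lemma hcharD:
  assumes "hchar \<psi>"
  shows "\<psi> 1 = 1" "f \<in> Hinf \<Longrightarrow> g \<in> Hinf \<Longrightarrow> \<psi> (f + g) = \<psi> f + \<psi> g" "f \<in> Hinf \<Longrightarrow> g \<in> Hinf \<Longrightarrow> \<psi> (f * g) = \<psi> f * \<psi> g"
    "f \<in> Hinf \<Longrightarrow> \<psi> (Linf_cscale c f) = c * \<psi> f" "f \<in> Hinf \<Longrightarrow> g \<in> Hinf \<Longrightarrow> \<psi> (f - g) = \<psi> f - \<psi> g"
proof -
  show "\<psi> 1 = 1" "f \<in> Hinf \<Longrightarrow> g \<in> Hinf \<Longrightarrow> \<psi> (f + g) = \<psi> f + \<psi> g" "f \<in> Hinf \<Longrightarrow> g \<in> Hinf \<Longrightarrow> \<psi> (f * g) = \<psi> f * \<psi> g"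
    "f \<in> Hinf \<Longrightarrow> \<psi> (Linf_cscale c f) = c * \<psi> f" for f g c
    using assms by (auto simp: hchar_def)
  assume fg: "f \<in> Hinf" "g \<in> Hinf"
  have "\<psi> ((f - g) + g) = \<psi> (f - g) + \<psi> g" using assms fg Hinf_comb(3) by (simp only: hchar_def)
  then show "\<psi> (f - g) = \<psi> f - \<psi> g" by simp
qed

lemma Hinf_cscale: "v \<in> Hinf \<Longrightarrow> Linf_cscale c v \<in> Hinf"
  and disk_ext_cscale: "v \<in> Hinf \<Longrightarrow> z \<in> ball 0 1 \<Longrightarrow> disk_ext (Linf_cscale c v) z = c * disk_ext v z"
  using Hinf_comb(2,5)[of v v] by auto

lemma Hinf_const: "Linf_cscale c 1 \<in> Hinf" and disk_ext_const: "z \<in> ball 0 1 \<Longrightarrow> disk_ext (Linf_cscale c 1) z = c"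
  using Hinf_comb(2,5)[OF Hinf_one Hinf_one] disk_ext_one by auto

lemma hchar_const: "hchar \<psi> \<Longrightarrow> \<psi> (Linf_cscale c 1) = c"
  using hcharD(1)[of \<psi>] hcharD(4)[of \<psi> 1 c] Hinf_one by simp

text \<open>If \<open>cmod (\<psi> f)\<close> exceeded \<open>C\<close>, then
  \<open>\<psi> f - f\<close> would be bounded away from zero on the disk and hence invertible in
  \<open>Hinf\<close>, although \<open>\<psi>\<close> maps it to \<open>0\<close>.\<close>

lemma hchar_le:
  assumes \<psi>: "hchar \<psi>" and f: "f \<in> Hinf" and C: "\<And>z. z \<in> ball 0 1 \<Longrightarrow> cmod (disk_ext f z) \<le> C"
  shows "cmod (\<psi> f) \<le> C"
proof (rule ccontr)
  assume "\<not> cmod (\<psi> f) \<le> C"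
  then have gt: "cmod (\<psi> f) > C" by simp
  define c where "c = \<psi> f"
  have low: "cmod (c - disk_ext f z) \<ge> cmod c - C" if "z \<in> ball 0 1" for z
    using C[OF that] norm_triangle_ineq2[of c "disk_ext f z"] by linarith
  then have nz: "c - disk_ext f z \<noteq> 0" if "z \<in> ball 0 1" for z using gt that by (fastforce simp: c_def)
  obtain G where G: "G \<in> Hinf" "\<And>z. z \<in> ball 0 1 \<Longrightarrow> disk_ext G z = 1 / (c - disk_ext f z)"
  proof (rule Hinf_of_holomorphic[of "\<lambda>z. 1 / (c - disk_ext f z)" "1 / (cmod c - C)"])
    show "(\<lambda>z. 1 / (c - disk_ext f z)) holomorphic_on ball 0 1"
      by (intro holomorphic_intros disk_ext_holomorphic f nz)
    show "cmod (1 / (c - disk_ext f z)) \<le> 1 / (cmod c - C)" if "z \<in> ball 0 1" for z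
      using low[OF that] gt by (simp add: norm_divide c_def frac_le)
  qed blast
  define h where "h = Linf_cscale c 1 - f"
  have h: "h \<in> Hinf" unfolding h_def by (rule Hinf_comb(3)[OF Hinf_const f])
  have "h * G = 1"
  proof (rule disk_ext_inj[OF Hinf_mult(1)[OF h G(1)] Hinf_one])
    fix z :: complex assume z: "z \<in> ball 0 1"
    have "disk_ext h z = c - disk_ext f z" unfolding h_def by (simp add: Hinf_comb(6)[OF Hinf_const f z] disk_ext_const[OF z])
    then show "disk_ext (h * G) z = disk_ext 1 z" using nz[OF z] by (simp add: Hinf_mult(2)[OF h G(1) z] G(2)[OF z] disk_ext_one)
  qed
  then have "\<psi> h * \<psi> G = 1" using hcharD(1,3)[OF \<psi>] h G(1) by metis
  moreover have "\<psi> h = 0" unfolding h_def by (simp add: hcharD(5)[OF \<psi> Hinf_const f] hchar_const[OF \<psi>] c_def)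
  ultimately show False by simp
qed

lemma hchar_norm_le: "hchar \<psi> \<Longrightarrow> f \<in> Hinf \<Longrightarrow> cmod (\<psi> f) \<le> norm f"
  by (rule hchar_le) (auto intro: disk_ext_le)

lemma Hinf_sum:
  assumes "finite I" "\<And>i. i \<in> I \<Longrightarrow> v i \<in> Hinf"
  shows "(\<Sum>i\<in>I. v i) \<in> Hinf" "z \<in> ball 0 1 \<Longrightarrow> disk_ext (\<Sum>i\<in>I. v i) z = (\<Sum>i\<in>I. disk_ext (v i) z)"
    "hchar \<psi> \<Longrightarrow> \<psi> (\<Sum>i\<in>I. v i) = (\<Sum>i\<in>I. \<psi> (v i))"
proof -
  have 0: "0 \<in> Hinf" "disk_ext 0 z = 0" by (simp_all add: Hinf_def disk_ext_def, simp_all add: zero_abs_Linf abs_Linf_simps ess_bdd_const)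
  have \<psi>0: "\<psi> 0 = 0" if "hchar \<psi>" using hcharD(2)[OF that 0(1) 0(1)] by simp
  have "(\<Sum>i\<in>I. v i) \<in> Hinf \<and> (z \<in> ball 0 1 \<longrightarrow> disk_ext (\<Sum>i\<in>I. v i) z = (\<Sum>i\<in>I. disk_ext (v i) z)) \<and> (hchar \<psi> \<longrightarrow> \<psi> (\<Sum>i\<in>I. v i) = (\<Sum>i\<in>I. \<psi> (v i)))"
    using assms
  proof (induction I rule: finite_induct)
    case empty
    then show ?case using 0 \<psi>0 by simp
  next
    case (insert i I)
    then show ?case using Hinf_comb(1,4)[of "v i" "\<Sum>i\<in>I. v i"] hcharD(2)[of \<psi> "v i" "\<Sum>i\<in>I. v i"] by auto
  qed
  then show "(\<Sum>i\<in>I. v i) \<in> Hinf" "z \<in> ball 0 1 \<Longrightarrow> disk_ext (\<Sum>i\<in>I. v i) z = (\<Sum>i\<in>I. disk_ext (v i) z)"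
    "hchar \<psi> \<Longrightarrow> \<psi> (\<Sum>i\<in>I. v i) = (\<Sum>i\<in>I. \<psi> (v i))" by auto
qed

text \<open>Density of the disk, from the corona theorem: if no point approximates
  \<open>\<psi>\<close> on the finite set, the functions \<open>f - \<psi> f\<close> have no common
  near-zero and generate the unit ideal; but \<open>\<psi>\<close> vanishes on all of them.\<close>

lemma hchar_approx:
  assumes \<psi>: "hchar \<psi>" and fin: "finite \<F>" and sub: "\<F> \<subseteq> Hinf" and e: "e > 0"
  shows "\<exists>z\<in>ball 0 1. \<forall>f\<in>\<F>. cmod (disk_ext f z - \<psi> f) < e"
proof (rule ccontr)
  assume "\<not> ?thesis"
  then have far: "\<exists>f\<in>\<F>. cmod (disk_ext f z - \<psi> f) \<ge> e" if "z \<in> ball 0 1" for z using that by (meson not_less)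
  \<comment> \<open>\<open>corona_disc\<close> asks for functions bounded by \<open>1\<close>.
    \<open>M\<close> bounds every \<open>f - \<psi> f\<close>, and the summand \<open>1\<close>
    keeps it positive.\<close>
  define M where "M = 1 + (\<Sum>f\<in>\<F>. 2 * norm f)"
  have M1: "M \<ge> 1" unfolding M_def by (simp add: sum_nonneg)
  have fM: "2 * norm f \<le> M" if "f \<in> \<F>" for f
    using member_le_sum[of f \<F> "\<lambda>f. 2 * norm f"] that fin by (simp add: M_def)
  define u where "u f = Linf_cscale (of_real (1 / M)) (f - Linf_cscale (\<psi> f) 1)" for f
  have uH: "u f \<in> Hinf" if "f \<in> \<F>" for f
    unfolding u_def using sub that by (intro Hinf_comb(2) Hinf_comb(3) Hinf_const Hinf_one) auto
  have ud: "disk_ext (u f) z = of_real (1 / M) * (disk_ext f z - \<psi> f)" if "f \<in> \<F>" "z \<in> ball 0 1" for f z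
    unfolding u_def using sub that
    by (subst Hinf_comb(5)[OF Hinf_comb(3)[OF _ Hinf_const] Hinf_one]) (auto simp: Hinf_comb(6)[OF _ Hinf_const] disk_ext_const)
  have u\<psi>: "\<psi> (u f) = 0" if "f \<in> \<F>" for f
    unfolding u_def using sub that
    by (subst hcharD(4)[OF \<psi> Hinf_comb(3)[OF _ Hinf_const]]) (auto simp: hcharD(5)[OF \<psi> _ Hinf_const] hchar_const[OF \<psi>])
  obtain g C where g: "\<And>i. i \<in> \<F> \<Longrightarrow> g i holomorphic_on ball 0 1" "\<And>i z. i \<in> \<F> \<Longrightarrow> z \<in> ball 0 1 \<Longrightarrow> cmod (g i z) \<le> C"
    "\<And>z. z \<in> ball 0 1 \<Longrightarrow> (\<Sum>i\<in>\<F>. disk_ext (u i) z * g i z) = 1"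
  proof (rule corona_disc[OF fin, of "\<lambda>i. disk_ext (u i)" "(e / M)\<^sup>2"])
    show "disk_ext (u i) holomorphic_on ball 0 1" if "i \<in> \<F>" for i by (rule disk_ext_holomorphic[OF uH[OF that]])
    show "cmod (disk_ext (u i) z) \<le> 1" if "i \<in> \<F>" "z \<in> ball 0 1" for i z
    proof -
      have "cmod (disk_ext i z - \<psi> i) \<le> norm i + norm i"
        using norm_triangle_ineq4[of "disk_ext i z" "\<psi> i"] disk_ext_le[of i z] hchar_norm_le[OF \<psi>, of i] sub that by (auto simp: subset_eq)
      also have "\<dots> \<le> M" using fM[OF that(1)] by simp
      finally show ?thesis unfolding ud[OF that] using M1 by (simp add: norm_mult norm_divide field_simps)
    qed
    show "(e / M)\<^sup>2 > 0" using e M1 by simp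
    show "(e / M)\<^sup>2 \<le> (\<Sum>i\<in>\<F>. (cmod (disk_ext (u i) z))\<^sup>2)" if z: "z \<in> ball 0 1" for z
    proof -
      obtain f where f: "f \<in> \<F>" "cmod (disk_ext f z - \<psi> f) \<ge> e" using far[OF z] by blast
      have "e / M \<le> cmod (disk_ext (u f) z)" unfolding ud[OF f(1) z] using f(2) M1 by (simp add: norm_mult norm_divide divide_right_mono)
      then have "(e / M)\<^sup>2 \<le> (cmod (disk_ext (u f) z))\<^sup>2" using e M1 by (intro power_mono) auto
      also have "\<dots> \<le> (\<Sum>i\<in>\<F>. (cmod (disk_ext (u i) z))\<^sup>2)"
        using member_le_sum[of f \<F> "\<lambda>i. (cmod (disk_ext (u i) z))\<^sup>2"] f fin by simp
      finally show ?thesis .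
    qed
  qed blast
  have "\<exists>G. G \<in> Hinf \<and> (\<forall>z\<in>ball 0 1. disk_ext G z = g i z)" if "i \<in> \<F>" for i
    using Hinf_of_holomorphic[OF g(1)[OF that] g(2)[OF that]] by metis
  then obtain G where G: "\<And>i. i \<in> \<F> \<Longrightarrow> G i \<in> Hinf" "\<And>i z. i \<in> \<F> \<Longrightarrow> z \<in> ball 0 1 \<Longrightarrow> disk_ext (G i) z = g i z"
    by metis
  have uG: "u i * G i \<in> Hinf" if "i \<in> \<F>" for i by (rule Hinf_mult(1)[OF uH[OF that] G(1)[OF that]])
  have "(\<Sum>i\<in>\<F>. u i * G i) = 1"
  proof (rule disk_ext_inj[OF Hinf_sum(1)[OF fin uG] Hinf_one])
    fix z :: complex assume z: "z \<in> ball 0 1"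
    have "disk_ext (\<Sum>i\<in>\<F>. u i * G i) z = (\<Sum>i\<in>\<F>. disk_ext (u i * G i) z)" by (rule Hinf_sum(2)[OF fin uG z])
    also have "\<dots> = (\<Sum>i\<in>\<F>. disk_ext (u i) z * g i z)"
      by (intro sum.cong refl) (simp add: Hinf_mult(2)[OF uH G(1) z] G(2)[OF _ z])
    finally show "disk_ext (\<Sum>i\<in>\<F>. u i * G i) z = disk_ext 1 z" by (simp add: g(3)[OF z] disk_ext_one)
  qed
  then have "1 = (\<Sum>i\<in>\<F>. \<psi> (u i * G i))" using Hinf_sum(3)[of \<F> "\<lambda>i. u i * G i" \<psi>, OF fin uG \<psi>] hcharD(1)[OF \<psi>] by simp
  also have "\<dots> = 0" by (intro sum.neutral ballI) (simp add: hcharD(3)[OF \<psi> uH G(1)] u\<psi>)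
  finally show False by simp
qed

lemma hchar_ultra:
  assumes "hchar \<psi>"
  obtains U where "ultra U" "eventually (\<lambda>z. z \<in> ball 0 1) U" "\<And>f. f \<in> Hinf \<Longrightarrow> ((\<lambda>z. disk_ext f z) \<longlongrightarrow> \<psi> f) U"
  by (rule ultra_realize[of Hinf "ball 0 1" "\<lambda>z f. disk_ext f z" \<psi>]) (use hchar_approx[OF assms] in auto)

text \<open>Multiplying by a high power of the function \<open>(1 + cnj \<lambda> z) / 2\<close>, which peaks at \<open>\<lambda>\<close>, shows
  that a character over \<open>\<lambda>\<close> only sees the boundary behaviour near \<open>\<lambda>\<close>.\<close>

lemma hchar_local:
  assumes \<psi>: "hchar \<psi>" and lam: "\<psi> Zf = lam" "cmod lam = 1" and f: "ess_bdd \<phi>" "abs_Linf \<phi> \<in> Hinf"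
    and Q: "continuous_on (sphere 0 1) Q" "Q lam = 0" and bd: "AE z in circle. cmod (\<phi> z) \<le> M + Q z" and M: "M \<ge> 0"
  shows "cmod (\<psi> (abs_Linf \<phi>)) \<le> M"
proof (rule field_le_epsilon)
  fix e :: real assume e: "e > 0"
  define N where "N = ess_norm \<phi>"
  have N: "N \<ge> 0" using ess_norm_nonneg[OF f(1)] by (simp add: N_def)
  have "lam \<in> sphere 0 1" using lam by simp
  then obtain d0 where d0: "d0 > 0" "\<And>z. z \<in> sphere 0 1 \<Longrightarrow> dist z lam < d0 \<Longrightarrow> dist (Q z) (Q lam) < e"
    using Q(1) e unfolding continuous_on_iff by blast
  define d where "d = min d0 1"
  have d: "d > 0" "d \<le> 1" "d \<le> d0" using d0 by (auto simp: d_def)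
  \<comment> \<open>By \<open>psq\<close> below, \<open>t\<close> bounds the squared modulus of the
    peaking function at distance at least \<open>d\<close> from \<open>lam\<close>.\<close>
  define t where "t = 1 - d\<^sup>2 / 4"
  have "d\<^sup>2 \<le> 1" using d by (simp add: power_le_one)
  then have t: "0 < t" "t < 1" using d by (auto simp: t_def)
  obtain n where n: "N * t ^ n < M + e"
  proof -
    have "(\<lambda>n. N * t ^ n) \<longlonglongrightarrow> N * 0" using t by (intro tendsto_intros) (auto intro: LIMSEQ_power_zero)
    then have "eventually (\<lambda>n. N * t ^ n < M + e) sequentially" using M e by (intro order_tendstoD) auto
    then show ?thesis using that by (auto simp: eventually_sequentially)
  qed
  define p where "p z = (1 + cnj lam * z) / 2" for z
  define P where "P = Linf_cscale (1 / 2) (1 + Linf_cscale (cnj lam) Zf)"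
  have cp: "continuous_on (sphere 0 1) (\<lambda>z. p z ^ k)" for k unfolding p_def by (intro continuous_intros) auto
  have bp: "ess_bdd (\<lambda>z. p z ^ k)" for k by (rule ess_bdd_continuous[OF cp])
  have PH: "P \<in> Hinf" unfolding P_def by (intro Hinf_comb(1) Hinf_cscale Hinf_one Zf_Hinf)
  have bz: "ess_bdd (\<lambda>z. z)" by (rule ess_bdd_continuous) (intro continuous_intros)
  have Pp: "P = abs_Linf p"
    unfolding P_def p_def Zf_def one_abs_Linf by (simp add: abs_Linf_simps ess_bdd_const ess_bdd_add ess_bdd_cmult bz)
  have "\<psi> P = 1"
    unfolding P_def using lam
    by (simp add: hcharD[OF \<psi>] Hinf_comb(1) Hinf_cscale Hinf_one Zf_Hinf complex_mult_cnj_cmod mult.commute[of "cnj lam"])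
  have Pn: "P ^ k \<in> Hinf \<and> \<psi> (P ^ k) = 1 \<and> P ^ k = abs_Linf (\<lambda>z. p z ^ k)" for k
  proof (induction k)
    case 0
    then show ?case using Hinf_one hcharD(1)[OF \<psi>] by (simp add: one_abs_Linf)
  next
    case (Suc k)
    then have IH: "P ^ k \<in> Hinf" "\<psi> (P ^ k) = 1" "P ^ k = abs_Linf (\<lambda>z. p z ^ k)" by auto
    have "P ^ Suc k = abs_Linf p * abs_Linf (\<lambda>z. p z ^ k)" by (simp only: power_Suc IH(3), simp only: Pp)
    also have "\<dots> = abs_Linf (\<lambda>z. p z ^ Suc k)" using abs_Linf_simps(3)[OF bp[of 1] bp[of k]] by simp
    finally have "P ^ Suc k = abs_Linf (\<lambda>z. p z ^ Suc k)" .
    moreover have "P ^ Suc k \<in> Hinf" unfolding power_Suc by (rule Hinf_mult(1)[OF PH IH(1)])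
    moreover have "\<psi> (P ^ Suc k) = 1" unfolding power_Suc hcharD(3)[OF \<psi> PH IH(1)] using IH(2) \<open>\<psi> P = 1\<close> by simp
    ultimately show ?case by blast
  qed
  \<comment> \<open>The parallelogram law for the unit vectors \<open>z\<close> and
    \<open>lam\<close>, since \<open>cmod (1 + cnj lam * z) = cmod (z + lam)\<close>.\<close>
  have psq: "(cmod (p z))\<^sup>2 = 1 - (cmod (z - lam))\<^sup>2 / 4" if "z \<in> sphere 0 1" for z
  proof -
    have z: "z * cnj z = 1" "lam * cnj lam = 1" using that lam by (simp_all add: complex_mult_cnj_cmod)
    have "complex_of_real ((cmod (p z))\<^sup>2 + (cmod (z - lam))\<^sup>2 / 4) = p z * cnj (p z) + (z - lam) * cnj (z - lam) / 4"
      by (simp only: complex_mult_cnj_cmod of_real_add of_real_divide of_real_numeral)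
    also have "\<dots> = (1 + cnj lam * z + lam * cnj z + (lam * cnj lam) * (z * cnj z)) / 4 + (z * cnj z - z * cnj lam - lam * cnj z + lam * cnj lam) / 4"
      by (simp add: p_def field_simps)
    also have "\<dots> = 1" by (simp add: z field_simps)
    finally have "(cmod (p z))\<^sup>2 + (cmod (z - lam))\<^sup>2 / 4 = 1" using of_real_eq_1_iff by blast
    then show ?thesis by simp
  qed
  have "norm (P ^ (2 * n) * abs_Linf \<phi>) \<le> M + e"
  proof -
    have eq: "P ^ (2 * n) * abs_Linf \<phi> = abs_Linf (\<lambda>z. p z ^ (2 * n) * \<phi> z)" using Pn[of "2 * n"] by (simp add: abs_Linf_simps bp f)
    have "AE z in circle. z \<in> sphere 0 1" by (rule AE_I2) simp
    with bd ess_norm_AE[OF f(1)] have "AE z in circle. cmod (p z ^ (2 * n) * \<phi> z) \<le> M + e"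
    proof eventually_elim
      case (elim z)
      have pe: "cmod (p z ^ (2 * n)) = ((cmod (p z))\<^sup>2) ^ n" by (simp add: norm_power power_mult)
      show ?case
      proof (cases "dist z lam < d")
        case True
        then have "\<bar>Q z\<bar> < e" using d0(2)[OF elim(3)] d Q(2) by (simp add: dist_real_def)
        then have "cmod (\<phi> z) \<le> M + e" using elim(1) by linarith
        moreover have "((cmod (p z))\<^sup>2) ^ n \<le> 1" by (rule power_le_one[OF zero_le_power2]) (use psq[OF elim(3)] in simp)
        ultimately show ?thesis unfolding norm_mult pe by (meson mult_left_le_one_le norm_ge_zero order_trans zero_le_power zero_le_power2)
      next
        case False
        then have "d \<le> cmod (z - lam)" by (simp add: dist_norm)
        then have "d\<^sup>2 \<le> (cmod (z - lam))\<^sup>2" using d by (intro power_mono) auto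
        then have "(cmod (p z))\<^sup>2 \<le> t" using psq[OF elim(3)] by (simp add: t_def)
        then have "((cmod (p z))\<^sup>2) ^ n * cmod (\<phi> z) \<le> t ^ n * N"
          using elim(2) t by (intro mult_mono power_mono) (auto simp: N_def)
        then show ?thesis using n unfolding norm_mult pe by (simp add: mult.commute)
      qed
    qed
    then show ?thesis unfolding eq by (subst norm_abs_Linf_le_iff) (auto intro: ess_bdd_mult bp f)
  qed
  moreover have PnH: "P ^ (2 * n) \<in> Hinf" and Pn1: "\<psi> (P ^ (2 * n)) = 1" using Pn by blast+
  have "\<psi> (P ^ (2 * n) * abs_Linf \<phi>) = \<psi> (abs_Linf \<phi>)"
    unfolding hcharD(3)[OF \<psi> PnH f(2)] Pn1 by simp
  ultimately show "cmod (\<psi> (abs_Linf \<phi>)) \<le> M + e"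
    using hchar_norm_le[OF \<psi> Hinf_mult(1)[OF PnH f(2)]] by simp
qed

section \<open>Characters of the sum of \<open>Hinf\<close> and the continuous functions\<close>

lemma HinfC_I: "f \<in> Hinf \<Longrightarrow> continuous_on (sphere 0 1) g \<Longrightarrow> f + abs_Linf g \<in> HinfC"
  unfolding HinfC_def CT_def by blast

lemma HinfC_cases:
  assumes "h \<in> HinfC"
  obtains f g where "f \<in> Hinf" "continuous_on (sphere 0 1) g" "h = f + abs_Linf g"
  using assms unfolding HinfC_def CT_def by blast

lemma Hinf_sub: "f \<in> Hinf \<Longrightarrow> f \<in> HinfC"
  using HinfC_I[of f "\<lambda>_. 0"] by (simp add: zero_abs_Linf[symmetric])

lemma Hinf_zero: "0 \<in> Hinf"
  using Hinf_comb(3)[OF Hinf_one Hinf_one] by simp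

lemma CT_sub: "continuous_on (sphere 0 1) g \<Longrightarrow> abs_Linf g \<in> HinfC"
  using HinfC_I[OF Hinf_zero] by simp

lemma HinfC_add: "h \<in> HinfC \<Longrightarrow> k \<in> HinfC \<Longrightarrow> h + k \<in> HinfC"
proof -
  assume "h \<in> HinfC" "k \<in> HinfC"
  then obtain f g f' g' where *: "f \<in> Hinf" "continuous_on (sphere 0 1) g" "h = f + abs_Linf g"
    "f' \<in> Hinf" "continuous_on (sphere 0 1) g'" "k = f' + abs_Linf g'" by (metis HinfC_cases)
  have e: "h + k = (f + f') + abs_Linf (\<lambda>z. g z + g' z)" using * by (simp add: abs_Linf_simps(1)[symmetric] ess_bdd_continuous)
  show ?thesis unfolding e by (intro HinfC_I Hinf_comb(1) continuous_on_add *)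
qed

lemma HinfC_cscale: "h \<in> HinfC \<Longrightarrow> Linf_cscale c h \<in> HinfC"
proof -
  assume "h \<in> HinfC"
  then obtain f g where *: "f \<in> Hinf" "continuous_on (sphere 0 1) g" "h = f + abs_Linf g" by (metis HinfC_cases)
  have e: "Linf_cscale c h = Linf_cscale c f + abs_Linf (\<lambda>z. c * g z)" using * by (simp add: Linf_cscale_add abs_Linf_simps(4) ess_bdd_continuous)
  show ?thesis unfolding e by (intro HinfC_I Hinf_cscale continuous_on_mult continuous_on_const *)
qed

lemma HinfC_diff: "h \<in> HinfC \<Longrightarrow> k \<in> HinfC \<Longrightarrow> h - k \<in> HinfC"
  using HinfC_add[OF _ HinfC_cscale[of k "-1"]] Linf_cscale_real[of "-1" k] by simp

lemma HinfC_const: "Linf_cscale c 1 \<in> HinfC"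
  by (rule Hinf_sub[OF Hinf_const])

lemma charD:
  assumes "y \<in> characters A"
  shows "y \<in> extensional A" "y 1 = 1" "f \<in> A \<Longrightarrow> g \<in> A \<Longrightarrow> y (f + g) = y f + y g" "f \<in> A \<Longrightarrow> g \<in> A \<Longrightarrow> y (f * g) = y f * y g"
    "f \<in> A \<Longrightarrow> y (Linf_cscale c f) = c * y f"
  using assms by (auto simp: characters_def)

text \<open>A character of a linear space is multiplicative with the junk value \<open>undefined\<close> outside the
  space, so the mere existence of a character forces the space to be an algebra.\<close>

lemma HinfC_mult:
  assumes y: "y \<in> characters HinfC" and "f \<in> HinfC" "g \<in> HinfC"
  shows "f * g \<in> HinfC"
proof -
  have shift: "(f + Linf_cscale c 1) * g \<notin> HinfC" if "f * g \<notin> HinfC" "g \<in> HinfC" for f g c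
  proof
    assume "(f + Linf_cscale c 1) * g \<in> HinfC"
    then have "(f + Linf_cscale c 1) * g - Linf_cscale c g \<in> HinfC" by (rule HinfC_diff[OF _ HinfC_cscale[OF that(2)]])
    moreover have "(f + Linf_cscale c 1) * g - Linf_cscale c g = f * g" by (simp add: distrib_right Linf_cscale_mult)
    ultimately show False using that by simp
  qed
  \<comment> \<open>Both \<open>f * g\<close> and \<open>(f + 1) * g\<close> lie outside the space
    and share the same junk value, so \<open>(y f + 1) * y g = y f * y g\<close>.\<close>
  have zero: "y g = 0" if fg: "f * g \<notin> HinfC" "f \<in> HinfC" "g \<in> HinfC" for f g
  proof -
    have u: "y k = undefined" if "k \<notin> HinfC" for k using charD(1)[OF y] that by (simp add: extensional_def)
    have "y ((f + Linf_cscale 1 1) * g) = (y f + 1) * y g"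
      using charD(3)[OF y fg(2) HinfC_const, of 1] charD(4)[OF y HinfC_add[OF fg(2) HinfC_const] fg(3)] charD(5)[OF y Hinf_sub[OF Hinf_one], of 1] charD(2)[OF y] by simp
    moreover have "y (f * g) = y f * y g" by (rule charD(4)[OF y fg(2,3)])
    moreover have "y ((f + Linf_cscale 1 1) * g) = y (f * g)" using u[OF shift[OF fg(1,3)]] u[OF fg(1)] by simp
    ultimately show ?thesis by (simp add: algebra_simps)
  qed
  show ?thesis
  proof (rule ccontr)
    assume n: "f * g \<notin> HinfC"
    \<comment> \<open>For \<open>g + 1\<close> the same argument gives \<open>y g + 1 = 0\<close>,
      whereas for \<open>g\<close> itself it gives \<open>y g = 0\<close>.\<close>
    let ?g = "g + Linf_cscale 1 1"
    have gf: "g * f \<notin> HinfC" using n by (simp add: mult.commute)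
    have "?g * f \<notin> HinfC" by (rule shift[OF gf assms(2)])
    then have "f * ?g \<notin> HinfC" by (simp add: mult.commute)
    then have "y ?g = 0" by (rule zero[OF _ assms(2) HinfC_add[OF assms(3) HinfC_const]])
    moreover have "y ?g = y g + 1"
      using charD(3)[OF y assms(3) HinfC_const, of 1] charD(5)[OF y Hinf_sub[OF Hinf_one], of 1] charD(2)[OF y] by simp
    ultimately show False using zero[OF n assms(2,3)] by simp
  qed
qed

lemma char_hchar: "y \<in> characters HinfC \<Longrightarrow> hchar y"
  unfolding hchar_def by (intro conjI ballI allI charD[where A = HinfC] Hinf_sub; assumption)

lemma char_CT_mult: "continuous_on (sphere 0 1) g \<Longrightarrow> continuous_on (sphere 0 1) h \<Longrightarrow> abs_Linf g * abs_Linf h = abs_Linf (\<lambda>z. g z * h z)"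
  by (simp add: abs_Linf_simps ess_bdd_continuous)

lemma char_CT_inverse:
  assumes y: "y \<in> characters HinfC" and g: "continuous_on (sphere 0 1) g" and nz: "\<And>z. z \<in> sphere 0 1 \<Longrightarrow> g z \<noteq> 0"
  shows "y (abs_Linf g) \<noteq> 0"
proof
  assume 0: "y (abs_Linf g) = 0"
  have gi: "continuous_on (sphere 0 1) (\<lambda>z. inverse (g z))" by (intro continuous_intros g) (use nz in auto)
  have "abs_Linf g * abs_Linf (\<lambda>z. inverse (g z)) = abs_Linf (\<lambda>z. g z * inverse (g z))" by (rule char_CT_mult[OF g gi])
  also have "\<dots> = 1" unfolding one_abs_Linf
    by (rule abs_Linf_cong) (auto intro!: ess_bdd_continuous continuous_on_mult g gi simp: nz)
  finally have 1: "abs_Linf g * abs_Linf (\<lambda>z. inverse (g z)) = 1" .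
  have "y (abs_Linf g * abs_Linf (\<lambda>z. inverse (g z))) = 0"
    unfolding charD(4)[OF y CT_sub[OF g] CT_sub[OF gi]] 0 by simp
  then show False unfolding 1 charD(2)[OF y] by simp
qed

text \<open>If \<open>z - lam\<close> and \<open>g - c\<close> have no common zero on the circle,
  the sum \<open>h\<close> of their squared moduli is invertible among the continuous functions. But
  \<open>h\<close> lies in the ideal generated by the two, on which \<open>y\<close>
  vanishes.\<close>

lemma char_CT:
  assumes y: "y \<in> characters HinfC" and g: "continuous_on (sphere 0 1) g"
  shows "y (abs_Linf g) = g (y Zf)" "cmod (y Zf) = 1"
proof -
  have lin: "y (abs_Linf (\<lambda>z. u z - c)) = y (abs_Linf u) - c" if u: "continuous_on (sphere 0 1) u" for u c
  proof -
    have "abs_Linf (\<lambda>z. u z - c) = abs_Linf u + Linf_cscale (- c) 1"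
      by (simp add: one_abs_Linf abs_Linf_simps ess_bdd_const ess_bdd_continuous[OF u])
    then show ?thesis using charD(3)[OF y CT_sub[OF u] HinfC_const] charD(5)[OF y Hinf_sub[OF Hinf_one]] charD(2)[OF y] by simp
  qed
  have id: "continuous_on (sphere 0 1) (\<lambda>z::complex. z)" by (intro continuous_intros)
  define lam where "lam = y Zf"
  have Z0: "y (abs_Linf (\<lambda>z. z - lam)) = 0" using lin[OF id] by (simp add: lam_def Zf_def)
  have cm: "continuous_on (sphere 0 1) (\<lambda>z. z - lam)" by (intro continuous_intros)
  show 1: "cmod (y Zf) = 1"
  proof (rule ccontr)
    assume "cmod (y Zf) \<noteq> 1"
    then have "z - lam \<noteq> 0" if "z \<in> sphere 0 1" for z using that by (auto simp: lam_def)
    from char_CT_inverse[OF y cm this] show False using Z0 by simp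
  qed
  show "y (abs_Linf g) = g (y Zf)"
  proof (rule ccontr)
    assume ne: "y (abs_Linf g) \<noteq> g (y Zf)"
    define c where "c = y (abs_Linf g)"
    have cg: "continuous_on (sphere 0 1) (\<lambda>z. g z - c)" by (intro continuous_intros g)
    have g0: "y (abs_Linf (\<lambda>z. g z - c)) = 0" using lin[OF g] by (simp add: c_def)
    have cj: "continuous_on (sphere 0 1) (\<lambda>z. cnj (z - lam))" "continuous_on (sphere 0 1) (\<lambda>z. cnj (g z - c))"
      by (intro continuous_on_cnj cm cg)+
    define h where "h z = (z - lam) * cnj (z - lam) + (g z - c) * cnj (g z - c)" for z
    have ch: "continuous_on (sphere 0 1) h" unfolding h_def by (intro continuous_on_add continuous_on_mult cm cg cj)
    have "y (abs_Linf h) = 0"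
    proof -
      have "abs_Linf h = abs_Linf (\<lambda>z. z - lam) * abs_Linf (\<lambda>z. cnj (z - lam)) + abs_Linf (\<lambda>z. g z - c) * abs_Linf (\<lambda>z. cnj (g z - c))"
        unfolding char_CT_mult[OF cm cj(1)] char_CT_mult[OF cg cj(2)] h_def
        by (rule abs_Linf_simps(1)[symmetric]) (intro ess_bdd_continuous continuous_on_mult cm cg cj)+
      moreover have "abs_Linf (\<lambda>z. z - lam) * abs_Linf (\<lambda>z. cnj (z - lam)) \<in> HinfC" "abs_Linf (\<lambda>z. g z - c) * abs_Linf (\<lambda>z. cnj (g z - c)) \<in> HinfC"
        unfolding char_CT_mult[OF cm cj(1)] char_CT_mult[OF cg cj(2)] by (intro CT_sub continuous_on_mult cm cg cj)+
      ultimately show ?thesis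
        using charD(4)[OF y CT_sub[OF cm] CT_sub[OF cj(1)]] charD(4)[OF y CT_sub[OF cg] CT_sub[OF cj(2)]] Z0 g0 charD(3)[OF y] by simp
    qed
    moreover have "y (abs_Linf h) \<noteq> 0"
    proof (rule char_CT_inverse[OF y ch])
      fix z :: complex assume z: "z \<in> sphere 0 1"
      have "h z = of_real ((cmod (z - lam))\<^sup>2 + (cmod (g z - c))\<^sup>2)" unfolding h_def complex_mult_cnj_cmod by simp
      moreover have "z \<noteq> lam \<or> g z \<noteq> c" using ne by (auto simp: lam_def c_def)
      then have "(cmod (z - lam))\<^sup>2 + (cmod (g z - c))\<^sup>2 > 0" by (metis add_nonneg_pos add_pos_nonneg norm_eq_zero right_minus_eq zero_le_power2 zero_less_power2)
      ultimately show "h z \<noteq> 0" by (metis less_irrefl of_real_eq_0_iff)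
    qed
    ultimately show False by simp
  qed
qed

lemma char_eq:
  assumes "y \<in> characters HinfC" "f \<in> Hinf" "continuous_on (sphere 0 1) g"
  shows "y (f + abs_Linf g) = y f + g (y Zf)"
  using charD(3)[OF assms(1) Hinf_sub[OF assms(2)] CT_sub[OF assms(3)]] char_CT(1)[OF assms(1,3)] by simp

lemma char_unique:
  assumes "y \<in> characters HinfC" "y' \<in> characters HinfC" "\<And>f. f \<in> Hinf \<Longrightarrow> y f = y' f"
  shows "y = y'"
proof (rule extensionalityI[OF charD(1)[OF assms(1)] charD(1)[OF assms(2)]])
  fix h assume "h \<in> HinfC"
  then obtain f g where fg: "f \<in> Hinf" "continuous_on (sphere 0 1) g" "h = f + abs_Linf g" by (rule HinfC_cases)
  show "y h = y' h"
    unfolding fg(3) char_eq[OF assms(1) fg(1,2)] char_eq[OF assms(2) fg(1,2)] assms(3)[OF fg(1)] assms(3)[OF Zf_Hinf] ..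
qed

text \<open>Near \<open>\<psi> Zf\<close> the continuous \<open>g\<close> is almost the constant
  \<open>g (\<psi> Zf)\<close>, so \<open>hchar_local\<close> applies to \<open>f\<close> plus this
  constant, with error \<open>cmod (c - g z)\<close>. The estimate involves \<open>\<psi>\<close> on
  \<open>Hinf\<close> only and can therefore serve to construct the extension.\<close>

lemma hchar_local':
  assumes \<psi>: "hchar \<psi>" and lam: "cmod (\<psi> Zf) = 1" and f: "f \<in> Hinf" and g: "continuous_on (sphere 0 1) g"
    and nm: "norm (f + abs_Linf g) \<le> M"
  shows "cmod (\<psi> f + g (\<psi> Zf)) \<le> M"
proof -
  obtain p where p: "ess_bdd p" "f = abs_Linf p" by (rule Linf_cases)
  define lam where "lam = \<psi> Zf"
  define c where "c = g lam"
  have fc: "f + Linf_cscale c 1 = abs_Linf (\<lambda>z. p z + c)"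
    by (simp add: p one_abs_Linf abs_Linf_simps ess_bdd_const)
  have bg: "ess_bdd g" by (rule ess_bdd_continuous[OF g])
  have "cmod (\<psi> (abs_Linf (\<lambda>z. p z + c))) \<le> M"
  proof (rule hchar_local[OF \<psi>])
    show "\<psi> Zf = lam" "cmod lam = 1" using lam by (simp_all add: lam_def)
    show "ess_bdd (\<lambda>z. p z + c)" by (intro ess_bdd_add p ess_bdd_const)
    show "abs_Linf (\<lambda>z. p z + c) \<in> Hinf" unfolding fc[symmetric] by (intro Hinf_comb(1) f Hinf_const)
    show "continuous_on (sphere 0 1) (\<lambda>z. cmod (c - g z))" by (intro continuous_intros g)
    show "cmod (c - g lam) = 0" by (simp add: c_def)
    have "AE z in circle. cmod (p z + g z) \<le> M"
      using nm unfolding p(2) abs_Linf_simps(1)[OF p(1) bg] by (subst (asm) norm_abs_Linf_le_iff) (auto intro: ess_bdd_add p bg)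
    then show "AE z in circle. cmod (p z + c) \<le> M + cmod (c - g z)"
    proof eventually_elim
      case (elim z)
      have "p z + c = (p z + g z) + (c - g z)" by simp
      then show ?case using elim norm_triangle_ineq[of "p z + g z" "c - g z"] by simp
    qed
    show "M \<ge> 0" using nm norm_ge_zero order_trans by blast
  qed
  moreover have "\<psi> (f + Linf_cscale c 1) = \<psi> f + c" using hcharD(2)[OF \<psi> f Hinf_const] hchar_const[OF \<psi>] by simp
  ultimately have "cmod (\<psi> f + c) \<le> M" unfolding fc by simp
  then show ?thesis by (simp add: c_def lam_def)
qed

lemma char_norm_le:
  assumes y: "y \<in> characters HinfC" and h: "h \<in> HinfC"
  shows "cmod (y h) \<le> norm h"
proof -
  obtain f g where fg: "f \<in> Hinf" "continuous_on (sphere 0 1) g" "h = f + abs_Linf g" using h by (rule HinfC_cases)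
  show ?thesis using hchar_local'[OF char_hchar[OF y] char_CT(2)[OF y fg(2)] fg(1,2), of "norm h"] char_eq[OF y fg(1,2)] fg(3) by simp
qed

text \<open>The only candidate maps \<open>f + g\<close> to \<open>\<psi> f + g (\<psi> Zf)\<close>.
  That it is well defined and multiplicative follows by localisation at \<open>\<psi> Zf\<close>.
  The hypothesis \<open>ex\<close> provides, through \<open>HinfC_mult\<close>, that products stay
  in the space.\<close>

lemma hchar_extend:
  assumes \<psi>: "hchar \<psi>" and lam: "cmod (\<psi> Zf) = 1" and ex: "characters HinfC \<noteq> {}"
  obtains y where "y \<in> characters HinfC" "\<And>f. f \<in> Hinf \<Longrightarrow> y f = \<psi> f"
proof -
  define lm where "lm = \<psi> Zf"
  define dec where "dec h = (SOME fg. fst fg \<in> Hinf \<and> continuous_on (sphere 0 1) (snd fg) \<and> h = fst fg + abs_Linf (snd fg))" for h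
  have dec: "fst (dec h) \<in> Hinf" "continuous_on (sphere 0 1) (snd (dec h))" "h = fst (dec h) + abs_Linf (snd (dec h))" if hC: "h \<in> HinfC" for h
  proof -
    obtain f g where "f \<in> Hinf" "continuous_on (sphere 0 1) g" "h = f + abs_Linf g" using hC by (rule HinfC_cases)
    then have "\<exists>fg. fst fg \<in> Hinf \<and> continuous_on (sphere 0 1) (snd fg) \<and> h = fst fg + abs_Linf (snd fg)" by (intro exI[of _ "(f, g)"]) simp
    from someI_ex[OF this] show "fst (dec h) \<in> Hinf" "continuous_on (sphere 0 1) (snd (dec h))" "h = fst (dec h) + abs_Linf (snd (dec h))" unfolding dec_def by blast+
  qed
  define y where "y = restrict (\<lambda>h. \<psi> (fst (dec h)) + snd (dec h) lm) HinfC"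
  have wd: "\<psi> f + g lm = \<psi> f' + g' lm" if "f \<in> Hinf" "continuous_on (sphere 0 1) g" "f' \<in> Hinf" "continuous_on (sphere 0 1) g'" "f + abs_Linf g = f' + abs_Linf g'" for f g f' g'
  proof -
    have "(f - f') + abs_Linf (\<lambda>z. g z - g' z) = (f + abs_Linf g) - (f' + abs_Linf g')"
      unfolding abs_Linf_simps(2)[OF ess_bdd_continuous[OF that(2)] ess_bdd_continuous[OF that(4)], symmetric] by (simp add: algebra_simps)
    then have "norm ((f - f') + abs_Linf (\<lambda>z. g z - g' z)) \<le> 0" using that(5) by simp
    from hchar_local'[OF \<psi> lam Hinf_comb(3)[OF that(1,3)] _ this]
    have "\<psi> (f - f') + (g lm - g' lm) = 0" unfolding lm_def by (simp add: continuous_on_diff that)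
    then show ?thesis using hcharD(5)[OF \<psi> that(1,3)] by (simp add: algebra_simps)
  qed
  have ye: "y (f + abs_Linf g) = \<psi> f + g lm" if "f \<in> Hinf" "continuous_on (sphere 0 1) g" for f g
  proof -
    have h: "f + abs_Linf g \<in> HinfC" by (rule HinfC_I[OF that])
    show ?thesis unfolding y_def using h wd[OF dec(1,2)[OF h] that dec(3)[OF h, symmetric]] by simp
  qed
  have yH: "y f = \<psi> f" if "f \<in> Hinf" for f using ye[OF that continuous_on_const[of _ 0]] by (simp add: zero_abs_Linf[symmetric])
  obtain y0 where y0: "y0 \<in> characters HinfC" using ex by blast
  have "y \<in> characters HinfC"
    unfolding characters_def
  proof (intro CollectI conjI ballI allI)
    show "y \<in> extensional HinfC" by (simp add: y_def)
    show "y 1 = 1" using yH[OF Hinf_one] hcharD(1)[OF \<psi>] by simp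
    fix h k assume "h \<in> HinfC" "k \<in> HinfC"
    then obtain f g f' g' where *: "f \<in> Hinf" "continuous_on (sphere 0 1) g" "h = f + abs_Linf g"
      "f' \<in> Hinf" "continuous_on (sphere 0 1) g'" "k = f' + abs_Linf g'" by (metis HinfC_cases)
    have e: "h + k = (f + f') + abs_Linf (\<lambda>z. g z + g' z)" using * by (simp add: abs_Linf_simps(1)[symmetric] ess_bdd_continuous)
    have yh: "y h = \<psi> f + g lm" "y k = \<psi> f' + g' lm" unfolding *(3,6) by (rule ye[OF *(1,2)], rule ye[OF *(4,5)])
    show "y (h + k) = y h + y k"
      unfolding e ye[OF Hinf_comb(1)[OF *(1,4)] continuous_on_add[OF *(2,5)]] yh hcharD(2)[OF \<psi> *(1,4)] by simp
    have "h * k \<in> HinfC" by (rule HinfC_mult[OF y0 \<open>h \<in> HinfC\<close> \<open>k \<in> HinfC\<close>])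
    then obtain F G where FG: "F \<in> Hinf" "continuous_on (sphere 0 1) G" "h * k = F + abs_Linf G" by (rule HinfC_cases)
    define c c' where "c = g lm" and "c' = g' lm"
    \<comment> \<open>\<open>P\<close> is the product with \<open>g\<close> and \<open>g'\<close>
      frozen at their values at \<open>lm\<close>. It differs little from \<open>h * k\<close> near
      \<open>lm\<close>, and localisation then shows that the candidate value at
      \<open>h * k\<close> is \<open>\<psi> P\<close>.\<close>
    define P where "P = (f + Linf_cscale c 1) * (f' + Linf_cscale c' 1)"
    have P: "P \<in> Hinf" unfolding P_def by (intro Hinf_mult(1) Hinf_comb(1) * Hinf_const)
    have "\<psi> P = (\<psi> f + c) * (\<psi> f' + c')"
      unfolding P_def using * Hinf_const[of c] Hinf_const[of c'] by (simp add: hcharD(2,3)[OF \<psi>] Hinf_comb(1) hchar_const[OF \<psi>])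
    moreover have "\<psi> (F - P) + G lm = 0"
    proof -
      obtain p p' where p: "ess_bdd p" "f = abs_Linf p" "ess_bdd p'" "f' = abs_Linf p'" by (metis Linf_cases)
      obtain q where q: "ess_bdd q" "F = abs_Linf q" by (rule Linf_cases)
      have b: "ess_bdd g" "ess_bdd g'" "ess_bdd G" using * FG by (auto intro: ess_bdd_continuous)
      note bs = b p(1,3) q(1) ess_bdd_const ess_bdd_add ess_bdd_mult ess_bdd_diff ess_bdd_cmult
      have e1: "F - P + Linf_cscale (G lm) 1 = abs_Linf (\<lambda>z. q z - (p z + c) * (p' z + c') + G lm)"
        unfolding P_def p q one_abs_Linf by (simp add: abs_Linf_simps bs)
      have "abs_Linf (\<lambda>z. (p z + g z) * (p' z + g' z)) = abs_Linf (\<lambda>z. q z + G z)"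
        using FG(3) unfolding *(3,6) p q by (simp add: abs_Linf_simps bs)
      then have ae: "AE z in circle. (p z + g z) * (p' z + g' z) = q z + G z"
        by (subst (asm) abs_Linf_eq_iff) (auto intro!: bs)
      define N N' where "N = ess_norm p" and "N' = ess_norm p'"
      have "cmod (\<psi> (abs_Linf (\<lambda>z. q z - (p z + c) * (p' z + c') + G lm))) \<le> 0"
      proof (rule hchar_local[OF \<psi>])
        show "\<psi> Zf = lm" "cmod lm = 1" using lam by (simp_all add: lm_def)
        show "ess_bdd (\<lambda>z. q z - (p z + c) * (p' z + c') + G lm)" by (intro bs)
        show "abs_Linf (\<lambda>z. q z - (p z + c) * (p' z + c') + G lm) \<in> Hinf"
          unfolding e1[symmetric] by (intro Hinf_comb(1) Hinf_comb(3) FG P Hinf_const)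
        let ?Q = "\<lambda>z. cmod (G lm - G z) + (N + cmod c) * cmod (g' z - c') + cmod (g z - c) * (N' + cmod (g' z))"
        show "continuous_on (sphere 0 1) ?Q" by (intro continuous_intros * FG)
        show "?Q lm = 0" by (simp add: c_def c'_def)
        show "AE z in circle. cmod (q z - (p z + c) * (p' z + c') + G lm) \<le> 0 + ?Q z"
          using ae ess_norm_AE[OF p(1)] ess_norm_AE[OF p(3)]
        proof eventually_elim
          case (elim z)
          have "q z - (p z + c) * (p' z + c') + G lm = (G lm - G z) + (p z + c) * (g' z - c') + (g z - c) * (p' z + g' z)"
            using elim(1) by (simp add: algebra_simps) 
          then have "cmod (q z - (p z + c) * (p' z + c') + G lm) \<le> cmod (G lm - G z) + cmod ((p z + c) * (g' z - c')) + cmod ((g z - c) * (p' z + g' z))"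
            by (simp only:) (intro norm_triangle_mono order_refl)
          also have "cmod ((p z + c) * (g' z - c')) \<le> (N + cmod c) * cmod (g' z - c')"
            unfolding norm_mult using elim(2) norm_triangle_ineq[of "p z" c] by (intro mult_right_mono) (auto simp: N_def)
          also have "cmod ((g z - c) * (p' z + g' z)) \<le> cmod (g z - c) * (N' + cmod (g' z))"
            unfolding norm_mult using elim(3) norm_triangle_ineq[of "p' z" "g' z"] by (intro mult_left_mono) (auto simp: N'_def)
          finally show ?case by simp
        qed
      qed simp
      then have "\<psi> (F - P + Linf_cscale (G lm) 1) = 0" unfolding e1 by simp
      then show ?thesis using hcharD(2)[OF \<psi> Hinf_comb(3)[OF FG(1) P] Hinf_const] hchar_const[OF \<psi>] by simp
    qed
    ultimately show "y (h * k) = y h * y k"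
      unfolding FG(3) ye[OF FG(1,2)] yh using hcharD(5)[OF \<psi> FG(1) P] by (simp add: c_def c'_def algebra_simps)
  next
    fix c h assume "h \<in> HinfC"
    then obtain f g where *: "f \<in> Hinf" "continuous_on (sphere 0 1) g" "h = f + abs_Linf g" by (rule HinfC_cases)
    have e: "Linf_cscale c h = Linf_cscale c f + abs_Linf (\<lambda>z. c * g z)" using * by (simp add: Linf_cscale_add abs_Linf_simps(4) ess_bdd_continuous)
    have yh: "y h = \<psi> f + g lm" unfolding *(3) by (rule ye[OF *(1,2)])
    show "y (Linf_cscale c h) = c * y h"
      unfolding e ye[OF Hinf_cscale[OF *(1)] continuous_on_mult[OF continuous_on_const *(2)]] yh hcharD(4)[OF \<psi> *(1)] by (simp add: distrib_left)
  qed
  then show ?thesis using that yH by blast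
qed

section \<open>The Gelfand topology\<close>

lemma topspace_gelfand: "topspace (gelfand A) = characters A"
  by (auto simp: gelfand_def topspace_product_topology PiE_def characters_def)

lemma gelfand_eval: "f \<in> A \<Longrightarrow> continuous_map (gelfand A) euclidean (\<lambda>y. y f)"
  unfolding gelfand_def
  by (rule continuous_map_from_subtopology[OF continuous_map_product_projection])

lemma openin_gelfand_basic:
  assumes "finite \<F>" "\<F> \<subseteq> A"
  shows "openin (gelfand A) {y \<in> characters A. \<forall>f\<in>\<F>. cmod (y f - t f) < e}"
proof -
  have 1: "openin (gelfand A) {y \<in> topspace (gelfand A). y f \<in> ball (t f) e}" if "f \<in> \<F>" for f
    using that assms by (intro openin_continuous_map_preimage[OF gelfand_eval]) auto
  have "openin (gelfand A) (topspace (gelfand A) \<inter> (\<Inter>f\<in>\<F>. {y \<in> topspace (gelfand A). y f \<in> ball (t f) e}))"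
    using assms(1) 1
  proof (induction \<F> rule: finite_induct)
    case empty
    then show ?case by simp
  next
    case (insert f \<F>)
    have "openin (gelfand A) ({y \<in> topspace (gelfand A). y f \<in> ball (t f) e} \<inter> (topspace (gelfand A) \<inter> (\<Inter>f\<in>\<F>. {y \<in> topspace (gelfand A). y f \<in> ball (t f) e})))"
      by (rule openin_Int) (use insert in blast)+
    then show ?case by (simp add: Int_left_commute)
  qed
  moreover have "topspace (gelfand A) \<inter> (\<Inter>f\<in>\<F>. {y \<in> topspace (gelfand A). y f \<in> ball (t f) e}) = {y \<in> characters A. \<forall>f\<in>\<F>. cmod (y f - t f) < e}"
    by (auto simp: topspace_gelfand dist_norm norm_minus_commute)
  ultimately show ?thesis by simp
qed

lemma gelfand_nbhd:
  assumes "openin (gelfand A) U" "y \<in> U"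
  obtains \<F> e where "finite \<F>" "\<F> \<subseteq> A" "e > 0" "{y' \<in> characters A. \<forall>f\<in>\<F>. cmod (y' f - y f) < e} \<subseteq> U"
proof -
  obtain T where T: "openin (product_topology (\<lambda>_. euclidean) A) T" "U = T \<inter> characters A"
    using assms(1) unfolding gelfand_def openin_subtopology by blast
  have "y \<in> T" using assms(2) T(2) by simp
  with T(1)[unfolded openin_product_topology_alt]
  have "\<exists>X. finite {i \<in> A. X i \<noteq> topspace euclidean} \<and> (\<forall>i\<in>A. openin euclidean (X i)) \<and> y \<in> Pi\<^sub>E A X \<and> Pi\<^sub>E A X \<subseteq> T"
    by (rule bspec)
  then obtain X where X: "finite {i \<in> A. X i \<noteq> UNIV}" "\<And>i. i \<in> A \<Longrightarrow> open (X i)" "y \<in> Pi\<^sub>E A X" "Pi\<^sub>E A X \<subseteq> T"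
    unfolding topspace_euclidean open_openin[symmetric] by (elim exE conjE) (rule that; blast)
  let ?F = "{i \<in> A. X i \<noteq> UNIV}"
  have "\<exists>e>0. ball (y i) e \<subseteq> X i" if "i \<in> ?F" for i
      proof -
    have "open (X i)" "y i \<in> X i" using X(2,3) that by (auto simp: PiE_def Pi_def)
    then show ?thesis by (meson open_contains_ball)
  qed
  then have "\<forall>i\<in>?F. \<exists>e>0. ball (y i) e \<subseteq> X i" by (rule ballI)
  from bchoice[OF this] obtain d where "\<forall>i\<in>?F. d i > 0 \<and> ball (y i) (d i) \<subseteq> X i" by (rule exE)
  then have d: "d i > 0" "ball (y i) (d i) \<subseteq> X i" if "i \<in> ?F" for i
    using that by (simp_all only: Ball_def)
  define e where "e = Min (insert 1 (d ` ?F))"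
  have e: "e > 0" "\<And>i. i \<in> ?F \<Longrightarrow> e \<le> d i"
    unfolding e_def using X(1) d(1) by (auto simp: Min_gr_iff)
  show ?thesis
  proof (rule that[OF X(1) _ e(1)])
    show "{y' \<in> characters A. \<forall>f\<in>?F. cmod (y' f - y f) < e} \<subseteq> U"
    proof
      fix y' assume y': "y' \<in> {y' \<in> characters A. \<forall>f\<in>?F. cmod (y' f - y f) < e}"
      have "y' i \<in> X i" if "i \<in> A" for i
      proof (cases "X i = UNIV")
        case False
        then have i: "i \<in> ?F" using that by simp
        then have "cmod (y' i - y i) < e" using y' by blast
        then have "y' i \<in> ball (y i) (d i)" using e(2)[OF i] by (simp add: dist_norm norm_minus_commute)
        then show ?thesis using d(2)[OF i] by blast
      qed simp
      then have "y' \<in> Pi\<^sub>E A X" using y' charD(1)[of y' A] by (auto simp: PiE_def)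
      then show "y' \<in> U" using X(4) T(2) y' by auto
    qed
  qed auto
qed

lemma gelfand_closureD:
  assumes "y \<in> gelfand A closure_of S" "finite \<F>" "\<F> \<subseteq> A" "e > 0"
  shows "y \<in> characters A" "\<exists>p\<in>S. \<forall>f\<in>\<F>. cmod (p f - y f) < e"
proof -
  show y: "y \<in> characters A" using assms(1) by (simp add: in_closure_of topspace_gelfand)
  define N where "N = {y' \<in> characters A. \<forall>f\<in>\<F>. cmod (y' f - y f) < e}"
  have "y \<in> N" using y assms(4) by (simp add: N_def)
  moreover have "openin (gelfand A) N" unfolding N_def by (rule openin_gelfand_basic[OF assms(2,3)])
  ultimately obtain p where "p \<in> S" "p \<in> N" using assms(1) unfolding in_closure_of by meson
  then show "\<exists>p\<in>S. \<forall>f\<in>\<F>. cmod (p f - y f) < e" by (auto simp: N_def)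
qed

lemma gelfand_closureI:
  assumes "y \<in> characters A" "S \<subseteq> characters A"
    "\<And>\<F> e. finite \<F> \<Longrightarrow> \<F> \<subseteq> A \<Longrightarrow> e > 0 \<Longrightarrow> \<exists>p\<in>S. \<forall>f\<in>\<F>. cmod (p f - y f) < e"
  shows "y \<in> gelfand A closure_of S"
  unfolding in_closure_of topspace_gelfand
proof (intro conjI allI impI assms(1))
  fix T assume "y \<in> T \<and> openin (gelfand A) T"
  then have T: "openin (gelfand A) T" "y \<in> T" by auto
  obtain \<F> e where *: "finite \<F>" "\<F> \<subseteq> A" "e > 0" "{y' \<in> characters A. \<forall>f\<in>\<F>. cmod (y' f - y f) < e} \<subseteq> T"
    by (rule gelfand_nbhd[OF T])
  obtain p where p: "p \<in> S" "\<forall>f\<in>\<F>. cmod (p f - y f) < e" using assms(3)[OF *(1-3)] by auto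
  then have "p \<in> T" using *(4) assms(2) by auto
  then show "\<exists>p. p \<in> S \<and> p \<in> T" using p(1) by auto
qed

section \<open>Thin sequences\<close>

text \<open>The automorphism of the disk that takes \<open>a\<close> to \<open>0\<close>. Its
  modulus is the pseudohyperbolic distance of \<open>a\<close> and \<open>z\<close>, and
  \<open>bl (- a)\<close> is its inverse, which takes \<open>0\<close> to \<open>a\<close>.\<close>

definition bl :: "complex \<Rightarrow> complex \<Rightarrow> complex" where
  "bl a z = (z - a) / (1 - cnj a * z)"

lemma bl_denom: "cmod a < 1 \<Longrightarrow> cmod z \<le> 1 \<Longrightarrow> 1 - cnj a * z \<noteq> 0"
proof
  assume *: "cmod a < 1" "cmod z \<le> 1" "1 - cnj a * z = 0"
  then have "cmod (cnj a * z) = 1" by (metis eq_iff_diff_eq_0 norm_one)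
  then have "cmod a * cmod z = 1" by (simp add: norm_mult)
  moreover have "cmod a * cmod z \<le> cmod a * 1" using * by (intro mult_left_mono) auto
  ultimately show False using * by simp
qed

lemma bl_id: "(cmod (1 - cnj a * z))\<^sup>2 - (cmod (z - a))\<^sup>2 = (1 - (cmod a)\<^sup>2) * (1 - (cmod z)\<^sup>2)"
  unfolding cmod_power2 by (simp add: power2_eq_square algebra_simps)

lemma one_minus_bl:
  assumes "cmod a < 1" "cmod z \<le> 1"
  shows "1 - (cmod (bl a z))\<^sup>2 = (1 - (cmod a)\<^sup>2) * (1 - (cmod z)\<^sup>2) / (cmod (1 - cnj a * z))\<^sup>2"
proof -
  have "(cmod (1 - cnj a * z))\<^sup>2 > 0" using bl_denom[OF assms] by simp
  moreover have "(cmod (bl a z))\<^sup>2 = (cmod (z - a))\<^sup>2 / (cmod (1 - cnj a * z))\<^sup>2"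
    by (simp only: bl_def norm_divide power_divide)
  ultimately show ?thesis unfolding bl_id[symmetric] by (simp add: diff_divide_distrib)
qed

lemma bl_le1: "cmod a < 1 \<Longrightarrow> cmod z \<le> 1 \<Longrightarrow> cmod (bl a z) \<le> 1"
proof -
  assume a: "cmod a < 1" "cmod z \<le> 1"
  then have "(cmod a)\<^sup>2 \<le> 1" "(cmod z)\<^sup>2 \<le> 1" by (simp_all add: power_le_one)
  then have "1 - (cmod (bl a z))\<^sup>2 \<ge> 0" unfolding one_minus_bl[OF a] by simp
  then show ?thesis by (simp add: power2_le_imp_le[of _ 1, simplified])
qed

lemma bl_less1: "cmod a < 1 \<Longrightarrow> cmod z < 1 \<Longrightarrow> cmod (bl a z) < 1"
proof -
  assume a: "cmod a < 1" "cmod z < 1"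
  then have "(cmod a)\<^sup>2 < 1" "(cmod z)\<^sup>2 < 1" by (simp_all add: power_less_one_iff abs_square_less_1)
  moreover have "(cmod (1 - cnj a * z))\<^sup>2 > 0" using bl_denom[of a z] a by simp
  ultimately have "1 - (cmod (bl a z))\<^sup>2 > 0" using one_minus_bl[of a z] a by simp
  then show ?thesis by (simp add: power2_less_imp_less[of _ 1, simplified])
qed

lemma bl_sphere: "cmod a < 1 \<Longrightarrow> cmod z = 1 \<Longrightarrow> cmod (bl a z) = 1"
  using one_minus_bl[of a z] by (simp add: power2_eq_1_iff) (smt (verit) norm_ge_zero)

lemma bl_holomorphic: "cmod a < 1 \<Longrightarrow> bl a holomorphic_on ball 0 1"
  unfolding bl_def[abs_def] using bl_denom[of a] by (intro holomorphic_intros) (auto intro: less_imp_le)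

lemma bl_inverse: "cmod a < 1 \<Longrightarrow> cmod z < 1 \<Longrightarrow> bl (- a) (bl a z) = z"
  and bl_inverse': "cmod a < 1 \<Longrightarrow> cmod z < 1 \<Longrightarrow> bl a (bl (- a) z) = z"
proof -
  have *: "bl (- a) (bl a z) = z" if a: "cmod a < 1" "cmod z < 1" for a z
  proof -
    define D where "D = 1 - cnj a * z"
    have D: "D \<noteq> 0" using bl_denom[of a z] a by (simp add: D_def)
    have "a * cnj a \<noteq> 1"
    proof
      assume "a * cnj a = 1"
      then have "(cmod a)\<^sup>2 = 1" unfolding complex_mult_cnj_cmod by (metis of_real_eq_1_iff)
      then show False using a by (simp add: power2_eq_1_iff) (smt (verit) norm_ge_zero)
    qed
    have 1: "bl a z = (z - a) / D" by (simp add: bl_def D_def)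
    have "bl a z + a = (z - a + a * D) / D" using D by (simp add: 1 field_simps)
    also have "z - a + a * D = z * (1 - a * cnj a)" by (simp add: D_def algebra_simps)
    finally have n: "bl a z + a = z * (1 - a * cnj a) / D" .
    have "1 + cnj a * bl a z = (D + cnj a * (z - a)) / D" using D by (simp add: 1 field_simps)
    also have "D + cnj a * (z - a) = 1 - a * cnj a" by (simp add: D_def algebra_simps)
    finally have d: "1 + cnj a * bl a z = (1 - a * cnj a) / D" .
    have "bl (- a) (bl a z) = (bl a z + a) / (1 + cnj a * bl a z)" by (simp add: bl_def[of "- a"])
    then show ?thesis unfolding n d using D \<open>a * cnj a \<noteq> 1\<close> by simp
  qed
  show "cmod a < 1 \<Longrightarrow> cmod z < 1 \<Longrightarrow> bl (- a) (bl a z) = z" by (rule *)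
  show "cmod a < 1 \<Longrightarrow> cmod z < 1 \<Longrightarrow> bl a (bl (- a) z) = z" using *[of "- a" z] by simp
qed

lemma bl_self: "bl a a = 0" and bl_zero: "bl a 0 = - a" and bl_minus_zero: "bl (- a) 0 = a"
  by (simp_all add: bl_def)

text \<open>The Schwarz lemma at \<open>a\<close>, as a lower bound: a function that is almost unimodular at \<open>a\<close> is
  almost unimodular on pseudohyperbolic disks around \<open>a\<close>.\<close>

lemma schwarz_pick_lower:
  assumes hol: "F holomorphic_on ball 0 1" and F1: "\<And>z. z \<in> ball 0 1 \<Longrightarrow> cmod (F z) \<le> 1"
    and a: "cmod a < 1" and z: "cmod z < 1" and D: "1 - \<eta> \<le> cmod (F a)" and r: "cmod (bl a z) \<le> r" "r < 1"
  shows "1 - 3 * \<eta> / (1 - r) \<le> cmod (F z)"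
proof -
  have r0: "r \<ge> 0" using r(1) norm_ge_zero order_trans by blast
  define w where "w = bl a z"
  have w: "cmod w \<le> r" "cmod w < 1" using r by (auto simp: w_def)
  \<comment> \<open>The factor \<open>t\<close> keeps \<open>G\<close> strictly inside the disk, so
    that it can be composed with \<open>bl c\<close> and Schwarz's lemma applies to
    \<open>H\<close>; at the end \<open>t\<close> tends to \<open>1\<close>.\<close>
  have step: "1 - 3 * (1 - t * (1 - \<eta>)) / (1 - r) \<le> t * cmod (F z)" if t: "0 < t" "t < 1" "\<eta> \<le> 1" for t :: real
  proof -
    define G where "G u = of_real t * F (bl (- a) u)" for u
    have ma: "cmod (- a) < 1" using a by simp
    have Gh: "G holomorphic_on ball 0 1"
      unfolding G_def
    proof (intro holomorphic_intros)
      have "(F \<circ> bl (- a)) holomorphic_on ball 0 1"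
        by (rule holomorphic_on_compose_gen[OF bl_holomorphic[OF ma] hol]) (use bl_less1[OF ma] in auto)
      then show "(\<lambda>u. F (bl (- a) u)) holomorphic_on ball 0 1" by (simp add: o_def)
    qed
    have Gt: "cmod (G u) \<le> t" if "cmod u < 1" for u
      using F1[of "bl (- a) u"] bl_less1[OF ma that] t by (simp add: G_def norm_mult mult_left_le)
    define c where "c = G 0"
    have c: "cmod c \<le> t" "cmod c < 1" using Gt[of 0] t by (auto simp: c_def)
    have cF: "cmod c = t * cmod (F a)" using t by (simp add: c_def G_def bl_minus_zero norm_mult)
    define H where "H u = bl c (G u)" for u
    have "(bl c \<circ> G) holomorphic_on ball 0 1"
      by (rule holomorphic_on_compose_gen[OF Gh bl_holomorphic[OF c(2)]]) (use le_less_trans[OF Gt t(2)] in auto)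
    then have Hh: "H holomorphic_on ball 0 1" by (simp add: H_def[abs_def] o_def)
    have H0: "H 0 = 0" by (simp add: H_def c_def[symmetric] bl_self)
    have H1: "cmod (H u) < 1" if "cmod u < 1" for u
      unfolding H_def using bl_less1[OF c(2)] Gt[OF that] t by simp
    have Hw: "cmod (H w) \<le> cmod w" by (rule Schwarz_Lemma(1)[OF Hh H0 H1 w(2)])
    define v where "v = G w"
    have v: "v = of_real t * F z" by (simp add: v_def G_def w_def bl_inverse[OF a z])
    have vt: "cmod v \<le> 1" using Gt[OF w(2)] t by (simp add: v_def)
    have nz: "cmod (1 - cnj c * v) > 0" using bl_denom[OF c(2) vt] by simp
    have "cmod (v - c) \<le> r * cmod (1 - cnj c * v)"
    proof -
      have "cmod (v - c) / cmod (1 - cnj c * v) \<le> r" using Hw w by (simp add: H_def bl_def norm_divide v_def)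
      then show ?thesis using nz by (simp add: divide_le_eq)
    qed
    \<comment> \<open>This expresses the denominator by \<open>cmod (v - c)\<close> again, so that
      the inequality can be solved for this quantity; the factor \<open>1 - r\<close> of the
      conclusion arises here.\<close>
    also have "cmod (1 - cnj c * v) \<le> (1 - (cmod c)\<^sup>2) + cmod (v - c)"
    proof -
      have "1 - cnj c * v = of_real (1 - (cmod c)\<^sup>2) - cnj c * (v - c)"
        using complex_norm_square[of c] by (simp add: algebra_simps)
      then have "cmod (1 - cnj c * v) \<le> cmod (of_real (1 - (cmod c)\<^sup>2)) + cmod (cnj c * (v - c))" by (metis norm_triangle_ineq4)
      moreover have "(cmod c)\<^sup>2 \<le> 1" using c by (simp add: power_le_one)
      moreover have "cmod (cnj c * (v - c)) \<le> 1 * cmod (v - c)" unfolding norm_mult using c by (intro mult_right_mono) auto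
      ultimately show ?thesis by (simp only: norm_of_real abs_of_nonneg)
    qed
    finally have "cmod (v - c) \<le> r * ((1 - (cmod c)\<^sup>2) + cmod (v - c))" using r0 by (simp add: mult_left_mono)
    then have "cmod (v - c) * (1 - r) \<le> r * (1 - (cmod c)\<^sup>2)" by (simp add: algebra_simps)
    also have "\<dots> \<le> 1 * (1 - (cmod c)\<^sup>2)" using r c by (intro mult_right_mono) (auto simp: power_le_one)
    also have "\<dots> = (1 - cmod c) * (1 + cmod c)" by (simp add: power2_eq_square algebra_simps)
    also have "\<dots> \<le> (1 - cmod c) * 2" using c by (intro mult_left_mono) auto
    finally have "cmod (v - c) \<le> (1 - cmod c) * 2 / (1 - r)" using r by (simp add: le_divide_eq)
    moreover have "cmod c \<le> cmod v + cmod (v - c)" using norm_triangle_ineq2[of c v] by (simp add: norm_minus_commute)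
    moreover define Y where "Y = (1 - cmod c) / (1 - r)"
    moreover have "(1 - cmod c) * 2 / (1 - r) = 2 * Y" by (simp add: Y_def)
    moreover have "(1 - cmod c) \<le> Y" unfolding Y_def using c r r0 by (simp add: le_divide_eq mult_left_le)
    ultimately have "cmod v \<ge> 1 - 3 * Y" by linarith
    then have "cmod v \<ge> 1 - 3 * (1 - cmod c) / (1 - r)" by (simp add: Y_def)
    moreover have "3 * (1 - cmod c) / (1 - r) \<le> 3 * (1 - t * (1 - \<eta>)) / (1 - r)"
      using D t r cF by (intro divide_right_mono) (auto intro: mult_left_mono)
    ultimately show ?thesis using t by (simp add: v norm_mult)
  qed
  show ?thesis
  proof (cases "\<eta> \<le> 1")
    case True
    have "((\<lambda>t. t * cmod (F z) - (1 - 3 * (1 - t * (1 - \<eta>)) / (1 - r))) \<longlongrightarrow> 1 * cmod (F z) - (1 - 3 * (1 - 1 * (1 - \<eta>)) / (1 - r))) (at_left 1)"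
      using r by (intro tendsto_intros) auto
    moreover have "eventually (\<lambda>t::real. 0 < t \<and> t < 1) (at_left 1)"
      using eventually_at_left_real[of 0 1] by (auto elim: eventually_mono)
    then have "eventually (\<lambda>t. 0 \<le> t * cmod (F z) - (1 - 3 * (1 - t * (1 - \<eta>)) / (1 - r))) (at_left 1)"
      by eventually_elim (use step True in force)
    ultimately have "0 \<le> 1 * cmod (F z) - (1 - 3 * (1 - 1 * (1 - \<eta>)) / (1 - r))"
      by (rule tendsto_lowerbound) simp
    then show ?thesis by simp
  next
    case False
    then have "3 * \<eta> / (1 - r) \<ge> 3 * \<eta>" using r r0 by (simp add: le_divide_eq mult_left_le)
    then have "1 - 3 * \<eta> / (1 - r) \<le> 0" using False by linarith
    then show ?thesis using norm_ge_zero[of "F z"] by linarith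
  qed
qed

section \<open>Finite Blaschke products with multiplicities\<close>

lemma prod_power_ge:
  fixes x :: "'i \<Rightarrow> real"
  assumes "finite J" "\<And>j. j \<in> J \<Longrightarrow> 0 \<le> x j \<and> x j \<le> 1"
  shows "1 - (\<Sum>j\<in>J. real (q j) * (1 - x j)) \<le> (\<Prod>j\<in>J. x j ^ q j)"
  using assms
proof (induction J rule: finite_induct)
  case empty
  then show ?case by simp
next
  case (insert i J)
  define A B where "A = x i ^ q i" and "B = (\<Prod>j\<in>J. x j ^ q j)"
  have xi: "0 \<le> x i" "x i \<le> 1" using insert by auto
  have A: "0 \<le> A" "A \<le> 1" using xi by (auto simp: A_def power_le_one)
  have B: "B \<le> 1" unfolding B_def using insert by (intro prod_le_1) (auto simp: power_le_one)
  have "1 - real (q i) * (1 - x i) \<le> A"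
    using Bernoulli_inequality[of "x i - 1" "q i"] xi by (simp add: A_def algebra_simps)
  moreover have "A * B \<ge> A + B - 1"
  proof -
    have "(1 - A) * (1 - B) \<ge> 0" using A B by simp
    then show ?thesis by (simp add: algebra_simps)
  qed
  moreover have "1 - (\<Sum>j\<in>J. real (q j) * (1 - x j)) \<le> B" unfolding B_def using insert by auto
  ultimately have "1 - (real (q i) * (1 - x i) + (\<Sum>j\<in>J. real (q j) * (1 - x j))) \<le> A * B" by linarith
  then show ?case using insert by (simp add: A_def B_def)
qed

definition bprod :: "(nat \<Rightarrow> complex) \<Rightarrow> (nat \<Rightarrow> nat) \<Rightarrow> nat set \<Rightarrow> complex \<Rightarrow> complex" where
  "bprod z q J w = (\<Prod>j\<in>J. bl (z j) w ^ q j)"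

lemma norm_bprod: "cmod (bprod z q J w) = (\<Prod>j\<in>J. cmod (bl (z j) w) ^ q j)"
  by (simp add: bprod_def prod_norm[symmetric] norm_power)

lemma bprod_holomorphic: "(\<And>j. cmod (z j) < 1) \<Longrightarrow> bprod z q J holomorphic_on ball 0 1"
  unfolding bprod_def[abs_def] by (intro holomorphic_intros bl_holomorphic)

lemma bprod_le1: "(\<And>j. cmod (z j) < 1) \<Longrightarrow> cmod w \<le> 1 \<Longrightarrow> cmod (bprod z q J w) \<le> 1"
  unfolding norm_bprod by (intro prod_le_1 conjI power_le_one bl_le1) auto

text \<open>The maximum principle for the reciprocal on the closed disk without the pseudohyperbolic
  disks of radius \<open>r k\<close>. A frontier point lies either on the unit circle, where the
  product is unimodular, or on one of the circles \<open>cmod (bl (z k) w) = r k\<close>, where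
  \<open>bd\<close> applies.\<close>

lemma bprod_max_principle:
  assumes z: "\<And>j. cmod (z j) < 1" and J: "finite J" and r: "\<And>j. j \<in> J \<Longrightarrow> 0 < r j"
    and c: "0 < c" "c \<le> 1"
    and bd: "\<And>k w. k \<in> J \<Longrightarrow> cmod w < 1 \<Longrightarrow> cmod (bl (z k) w) = r k \<Longrightarrow> c \<le> cmod (bprod z q J w)"
    and w: "cmod w < 1" "\<And>k. k \<in> J \<Longrightarrow> r k \<le> cmod (bl (z k) w)"
  shows "c \<le> cmod (bprod z q J w)"
proof -
  define T where "T = {w \<in> cball 0 1. \<forall>k\<in>J. r k \<le> cmod (bl (z k) w)}"
  have cbl: "continuous_on (cball 0 1) (bl (z k))" for k
    unfolding bl_def[abs_def] using bl_denom[OF z] by (intro continuous_intros) auto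
  have clT: "closed T"
  proof -
    have "T = cball 0 1 \<inter> (\<Inter>k\<in>J. {w \<in> cball 0 1. r k \<le> cmod (bl (z k) w)})" by (auto simp: T_def)
    moreover have "closed {w \<in> cball 0 1. r k \<le> cmod (bl (z k) w)}" for k
    proof -
      have "continuous_on (cball 0 1) (\<lambda>w. cmod (bl (z k) w))" by (intro continuous_on_norm cbl)
      from continuous_closed_preimage[OF this closed_cball closed_atLeast[of "r k"]]
      show ?thesis by (simp add: vimage_def Int_def)
    qed
    ultimately show ?thesis by auto
  qed
  have nz: "bprod z q J v \<noteq> 0" if "v \<in> T" for v
  proof -
    have "bl (z k) v \<noteq> 0" if "k \<in> J" for k using r[OF that] \<open>v \<in> T\<close> that by (force simp: T_def)
    then show ?thesis unfolding bprod_def using J by simp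
  qed
  have cB: "continuous_on (cball 0 1) (bprod z q J)"
    unfolding bprod_def[abs_def] by (intro continuous_intros cbl)
  have Tsub: "T \<subseteq> cball 0 1" by (auto simp: T_def)
  have "cmod (inverse (bprod z q J w)) \<le> 1 / c"
  proof (rule maximum_modulus_frontier[of "\<lambda>w. inverse (bprod z q J w)" T])
    have sub: "interior T \<subseteq> ball 0 1" using interior_mono[OF Tsub] by (simp add: interior_cball)
    have "bprod z q J holomorphic_on interior T" by (rule holomorphic_on_subset[OF bprod_holomorphic[OF z] sub])
    then show "(\<lambda>w. inverse (bprod z q J w)) holomorphic_on interior T"
      by (rule holomorphic_on_inverse) (use nz interior_subset[of T] in blast)
    show "continuous_on (closure T) (\<lambda>w. inverse (bprod z q J w))"
      unfolding closure_closed[OF clT] using nz by (intro continuous_intros continuous_on_subset[OF cB Tsub]) auto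
    show "bounded T" using bounded_subset[OF bounded_cball Tsub] .
    show "w \<in> T" using w by (auto simp: T_def)
    fix v assume v: "v \<in> frontier T"
    then have vT: "v \<in> T" and vi: "v \<notin> interior T" using clT by (auto simp: frontier_def)
    have "c \<le> cmod (bprod z q J v)"
    proof (cases "cmod v = 1")
      case True
      then show ?thesis using c by (simp add: norm_bprod bl_sphere z)
    next
      case False
      then have v1: "cmod v < 1" using vT by (auto simp: T_def)
      have "\<exists>k\<in>J. cmod (bl (z k) v) = r k"
      proof (rule ccontr)
        assume "\<not> ?thesis"
        then have gt: "r k < cmod (bl (z k) v)" if "k \<in> J" for k using vT that by (force simp: T_def)
        define O' where "O' = ball 0 1 \<inter> (\<Inter>k\<in>J. {w \<in> ball 0 1. r k < cmod (bl (z k) w)})"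
        have "open {w \<in> ball 0 1. r k < cmod (bl (z k) w)}" for k
        proof -
          have "continuous_on (ball 0 1) (\<lambda>w. cmod (bl (z k) w))"
            by (intro continuous_intros continuous_on_subset[OF cbl]) auto
          from continuous_open_preimage[OF this open_ball open_greaterThan[of "r k"]]
          show ?thesis by (simp add: vimage_def Int_def)
        qed
        then have "open O'" unfolding O'_def using J by (intro open_Int open_ball open_INT) auto
        moreover have "O' \<subseteq> T" by (auto simp: O'_def T_def intro: less_imp_le)
        moreover have "v \<in> O'" using v1 gt by (auto simp: O'_def)
        ultimately show False using vi interior_maximal by blast
      qed
      then show ?thesis using bd v1 by blast
    qed
    then show "cmod (inverse (bprod z q J v)) \<le> 1 / c" using c by (simp add: norm_divide inverse_eq_divide frac_le)
  qed
  moreover have "cmod (bprod z q J w) > 0" using nz[of w] w by (auto simp: T_def)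
  ultimately show ?thesis using c by (simp add: norm_divide norm_inverse field_simps)
qed

section \<open>Thin sequences and slowly growing multiplicities\<close>

locale thin_seq =
  fixes z :: "nat \<Rightarrow> complex"
  assumes thin: "thin_sequence z"
begin

lemma z1: "cmod (z k) < 1"
proof -
  have "z k \<in> ball 0 1" using thin unfolding thin_sequence_def by blast
  then show ?thesis by simp
qed

definition "e k j = 1 - cmod (bl (z j) (z k))"

lemma e_nonneg: "e k j \<ge> 0" and e_le1: "e k j \<le> 1"
  using bl_le1[OF z1, of "z k" j] z1[of k] by (auto simp: e_def)

definition "pp k N = (\<Prod>j\<in>{..<N} - {k}. cmod (bl (z j) (z k)))"

lemma pp_thin: "thin_prod z k = lim (pp k)"
proof -
  have "cmod ((z j - z k) / (1 - cnj (z j) * z k)) = cmod (bl (z j) (z k))" for j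
    by (simp add: bl_def norm_divide norm_minus_commute)
  then show ?thesis by (simp add: thin_prod_def pp_def[abs_def])
qed

lemma pp_decseq: "decseq (pp k)"
proof (rule decseq_SucI)
  fix N
  show "pp k (Suc N) \<le> pp k N"
  proof (cases "N = k")
    case True
    then show ?thesis by (simp add: pp_def lessThan_Suc insert_Diff_if)
  next
    case False
    then have "pp k (Suc N) = cmod (bl (z N) (z k)) * pp k N" by (simp add: pp_def lessThan_Suc insert_Diff_if)
    also have "\<dots> \<le> 1 * pp k N"
      using bl_le1[OF z1, of "z k" N] z1[of k] by (intro mult_right_mono) (auto simp: pp_def intro: prod_nonneg)
    finally show ?thesis by simp
  qed
qed

lemma pp_lim: "pp k \<longlonglongrightarrow> thin_prod z k"
proof -
  have "0 \<le> pp k N" for N by (auto simp: pp_def intro: prod_nonneg)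
  then have "convergent (pp k)" using decseq_convergent[OF pp_decseq, of 0 k] by (metis convergentI)
  then show ?thesis unfolding pp_thin by (rule convergent_LIMSEQ_iff[THEN iffD1])
qed

lemma thin_prod_pos: "thin_prod z k > 0"
proof -
  have nn: "thin_prod z j \<ge> 0" for j
    by (rule LIMSEQ_le_const[OF pp_lim]) (intro exI[of _ 0] allI impI, simp add: pp_def prod_nonneg)
  have "(INF k. thin_prod z k) \<le> thin_prod z k"
    by (rule cINF_lower) (auto intro!: bdd_belowI2 nn)
  then show ?thesis using thin by (simp add: thin_sequence_def)
qed

definition "s k = - ln (thin_prod z k)"

lemma s_nonneg: "s k \<ge> 0"
proof -
  have "thin_prod z k \<le> pp k 0" by (rule decseq_ge[OF pp_decseq pp_lim])
  then have "thin_prod z k \<le> 1" by (simp add: pp_def)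
  then show ?thesis using thin_prod_pos[of k] by (simp add: s_def)
qed

lemma s_lim: "s \<longlonglongrightarrow> 0"
proof -
  have "thin_prod z \<longlonglongrightarrow> 1" using thin by (simp add: thin_sequence_def)
  then have "(\<lambda>k. - ln (thin_prod z k)) \<longlonglongrightarrow> - ln 1" by (intro tendsto_intros) auto
  then show ?thesis by (simp add: s_def[abs_def])
qed

text \<open>From \<open>1 - t \<le> - ln t\<close>, because the finite products are at least their
  limit \<open>thin_prod z k\<close>.\<close>

lemma sum_e_le: "finite J \<Longrightarrow> k \<notin> J \<Longrightarrow> (\<Sum>j\<in>J. e k j) \<le> s k"
proof -
  assume J: "finite J" "k \<notin> J"
  obtain N where N: "J \<subseteq> {..<N}" using finite_nat_bounded[OF J(1)] by blast
  let ?I = "{..<N} - {k}"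
  have ge: "thin_prod z k \<le> pp k N" by (rule decseq_ge[OF pp_decseq pp_lim])
  have pos: "cmod (bl (z j) (z k)) > 0" if "j \<in> ?I" for j
  proof (rule ccontr)
    assume "\<not> ?thesis"
    then have "pp k N = 0" using that by (auto simp: pp_def)
    then show False using ge thin_prod_pos[of k] by simp
  qed
  have "(\<Sum>j\<in>J. e k j) \<le> (\<Sum>j\<in>?I. e k j)"
    using J N e_nonneg by (intro sum_mono2) auto
  also have "\<dots> \<le> (\<Sum>j\<in>?I. - ln (cmod (bl (z j) (z k))))"
  proof (rule sum_mono)
    fix j assume "j \<in> ?I"
    from ln_le_minus_one[OF pos[OF this]] show "e k j \<le> - ln (cmod (bl (z j) (z k)))" unfolding e_def by linarith
  qed
  also have "\<dots> = - ln (pp k N)"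
  proof -
    have "ln (pp k N) = (\<Sum>j\<in>?I. ln (cmod (bl (z j) (z k))))"
      unfolding pp_def by (rule ln_prod) (use pos in auto)
    then show ?thesis by (simp add: sum_negf)
  qed
  also have "\<dots> \<le> s k" unfolding s_def using ge thin_prod_pos[of k] by simp
  finally show ?thesis .
qed

text \<open>For large \<open>k\<close> the whole sum is at most \<open>s k\<close> and thus small;
  for the finitely many other \<open>k\<close> the series converges, and the largest of their
  cut-offs serves all.\<close>

lemma uniform_tail:
  assumes "\<epsilon> > 0"
  shows "\<exists>N. \<forall>k J. finite J \<longrightarrow> k \<notin> J \<longrightarrow> J \<subseteq> {N..} \<longrightarrow> (\<Sum>j\<in>J. e k j) \<le> \<epsilon>"
proof -
  have "eventually (\<lambda>k. s k < \<epsilon>) sequentially" by (rule order_tendstoD(2)[OF s_lim assms])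
  then obtain K where K: "\<And>k. k \<ge> K \<Longrightarrow> s k < \<epsilon>" by (auto simp: eventually_sequentially)
  have "\<exists>N. \<forall>J. finite J \<longrightarrow> k \<notin> J \<longrightarrow> J \<subseteq> {N..} \<longrightarrow> (\<Sum>j\<in>J. e k j) \<le> \<epsilon>" for k
  proof -
    define a where "a j = (if j = k then 0 else e k j)" for j
    have "summable a"
    proof (rule summableI_nonneg_bounded[of a "s k"])
      show "a n \<ge> 0" for n using e_nonneg by (simp add: a_def)
      fix n
      have "sum a {..<n} = sum (e k) ({..<n} - {k})" by (rule sum.mono_neutral_cong_right) (auto simp: a_def)
      then show "sum a {..<n} \<le> s k" using sum_e_le by simp
    qed
    then have "Cauchy (\<lambda>n. sum a {..<n})" by (simp add: summable_iff_convergent convergent_Cauchy)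
    then obtain N where N: "\<And>m n. m \<ge> N \<Longrightarrow> n \<ge> N \<Longrightarrow> dist (sum a {..<m}) (sum a {..<n}) < \<epsilon>"
      using assms unfolding Cauchy_def by blast
    show ?thesis
    proof (intro exI[of _ N] allI impI)
      fix J assume J: "finite J" "k \<notin> J" "J \<subseteq> {N..}"
      obtain M where M: "J \<subseteq> {..<M}" using finite_nat_bounded[OF J(1)] by blast
      have "(\<Sum>j\<in>J. e k j) = sum a J" using J by (intro sum.cong) (auto simp: a_def)
      also have "\<dots> \<le> sum a {N..<max M N}"
      proof (rule sum_mono2)
        show "J \<subseteq> {N..<max M N}"
        proof
          fix x assume "x \<in> J"
          then have "x \<in> {N..}" "x \<in> {..<M}" using J(3) M by blast+
          then show "x \<in> {N..<max M N}" by simp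
        qed
      qed (use e_nonneg in \<open>auto simp: a_def\<close>)
      also have "\<dots> = sum a {..<max M N} - sum a {..<N}" by (simp add: sum_diff_nat_ivl lessThan_atLeast0)
      also have "\<dots> \<le> \<epsilon>" using N[of "max M N" N] by (simp add: dist_real_def)
      finally show "(\<Sum>j\<in>J. e k j) \<le> \<epsilon>" .
    qed
  qed
  then have "\<forall>k. \<exists>N. \<forall>J. finite J \<longrightarrow> k \<notin> J \<longrightarrow> J \<subseteq> {N..} \<longrightarrow> (\<Sum>j\<in>J. e k j) \<le> \<epsilon>" by (rule allI)
  from choice[OF this] obtain N where "\<forall>k J. finite J \<longrightarrow> k \<notin> J \<longrightarrow> J \<subseteq> {N k..} \<longrightarrow> (\<Sum>j\<in>J. e k j) \<le> \<epsilon>" by (rule exE)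
  then have N: "\<And>k J. finite J \<Longrightarrow> k \<notin> J \<Longrightarrow> J \<subseteq> {N k..} \<Longrightarrow> (\<Sum>j\<in>J. e k j) \<le> \<epsilon>" by blast
  define M where "M = Max (insert 0 (N ` {..<K}))"
  have M: "N k \<le> M" if "k < K" for k unfolding M_def using that by (intro Max_ge) auto
  show ?thesis
  proof (intro exI[of _ M] allI impI)
    fix k J assume J: "finite J" "k \<notin> J" "J \<subseteq> {M..}"
    show "(\<Sum>j\<in>J. e k j) \<le> \<epsilon>"
    proof (cases "k < K")
      case True
      have "J \<subseteq> {N k..}" using J(3) M[OF True] by auto
      then show ?thesis by (rule N[OF J(1,2)])
    next
      case False
      then show ?thesis using sum_e_le[OF J(1,2)] K[of k] by linarith
    qed
  qed
qed

text \<open>\<open>p j - 1\<close> counts the \<open>m\<close> with \<open>N m \<le> j\<close>,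
  where \<open>N m\<close> is chosen such that sums over indices from \<open>N m\<close> on are at
  most \<open>(1/4) ^ m\<close>. After exchanging summations, the weighted sum is at most
  \<open>s k\<close> plus a series over \<open>m\<close> whose terms are bounded both by
  \<open>s k\<close> and by \<open>(1/4) ^ m\<close>, hence by
  \<open>sqrt (s k) * (1/2) ^ m\<close>. This is the origin of
  \<open>\<tau> k = 2 * sqrt (s k) + s k\<close>.\<close>

lemma slow_multiplicities:
  obtains p \<tau> where "\<And>j. p j \<ge> 1" "filterlim p at_top sequentially" "\<tau> \<longlonglongrightarrow> 0" "\<And>k. \<tau> k \<ge> 0"
    "\<And>k J. finite J \<Longrightarrow> k \<notin> J \<Longrightarrow> (\<Sum>j\<in>J. real (p j) * e k j) \<le> \<tau> k"
proof -
  have "\<forall>m. \<exists>N. \<forall>k J. finite J \<longrightarrow> k \<notin> J \<longrightarrow> J \<subseteq> {N..} \<longrightarrow> (\<Sum>j\<in>J. e k j) \<le> (1/4) ^ m"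
    by (intro allI uniform_tail) simp
  from choice[OF this] obtain N0 where "\<forall>m k J. finite J \<longrightarrow> k \<notin> J \<longrightarrow> J \<subseteq> {N0 m..} \<longrightarrow> (\<Sum>j\<in>J. e k j) \<le> (1/4) ^ m" by (rule exE)
  then have N0: "\<And>m k J. finite J \<Longrightarrow> k \<notin> J \<Longrightarrow> J \<subseteq> {N0 m..} \<Longrightarrow> (\<Sum>j\<in>J. e k j) \<le> (1/4) ^ m" by blast
  define N where "N m = max m (N0 m)" for m
  have N: "m \<le> N m" "N0 m \<le> N m" for m by (auto simp: N_def)
  define p where "p j = Suc (card {m. m \<le> j \<and> N m \<le> j})" for j
  define \<tau> where "\<tau> k = 2 * sqrt (s k) + s k" for k
  show ?thesis
  proof (rule that[of p \<tau>])
    show "p j \<ge> 1" for j by (simp add: p_def)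
    show "filterlim p at_top sequentially"
      unfolding filterlim_at_top
    proof
      fix n
      define M where "M = Max (insert n (N ` {..<n}))"
      have "n \<le> p j" if "j \<ge> M" for j
      proof -
        have "{..<n} \<subseteq> {m. m \<le> j \<and> N m \<le> j}"
        proof
          fix m assume "m \<in> {..<n}"
          then have "N m \<le> M" "n \<le> M" unfolding M_def by (auto intro: Max_ge)
          then show "m \<in> {m. m \<le> j \<and> N m \<le> j}" using that \<open>m \<in> {..<n}\<close> by auto
        qed
        then have "card {..<n} \<le> card {m. m \<le> j \<and> N m \<le> j}" by (intro card_mono) auto
        then show ?thesis by (simp add: p_def)
      qed
      then show "eventually (\<lambda>j. n \<le> p j) sequentially" by (auto simp: eventually_sequentially)
    qed
    have "\<tau> \<longlonglongrightarrow> 2 * sqrt 0 + 0" unfolding \<tau>_def by (intro tendsto_intros s_lim)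
    then show "\<tau> \<longlonglongrightarrow> 0" by simp
    show "\<tau> k \<ge> 0" for k using s_nonneg[of k] by (simp add: \<tau>_def)
    fix k J assume J: "finite J" "k \<notin> (J :: nat set)"
    obtain M where M: "J \<subseteq> {..<M}" using finite_nat_bounded[OF J(1)] by blast
    have pj: "real (p j) = 1 + (\<Sum>m<M. if N m \<le> j then 1 else 0)" if "j \<in> J" for j
    proof -
      have "(\<Sum>m<M. if N m \<le> j then 1 else 0 :: real) = real (card {m \<in> {..<M}. N m \<le> j})"
        by (simp add: sum.If_cases Int_def)
      moreover have "{m \<in> {..<M}. N m \<le> j} = {m. m \<le> j \<and> N m \<le> j}"
      proof -
        have "m < M" if "m \<le> j" for m using that M \<open>j \<in> J\<close> by (meson le_less_trans lessThan_iff subsetD)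
        moreover have "m \<le> j" if "N m \<le> j" for m using N(1)[of m] that by simp
        ultimately show ?thesis by auto
      qed
      ultimately show ?thesis by (simp add: p_def)
    qed
    have "(\<Sum>j\<in>J. real (p j) * e k j) = (\<Sum>j\<in>J. e k j + (\<Sum>m<M. if N m \<le> j then e k j else 0))"
      by (intro sum.cong refl) (auto simp: pj distrib_right sum_distrib_right intro!: sum.cong)
    also have "\<dots> = (\<Sum>j\<in>J. e k j) + (\<Sum>m<M. \<Sum>j\<in>J. if N m \<le> j then e k j else 0)"
      unfolding sum.distrib by (subst sum.swap) simp
    also have "(\<Sum>j\<in>J. e k j) \<le> s k" by (rule sum_e_le[OF J])
    also have "(\<Sum>m<M. \<Sum>j\<in>J. if N m \<le> j then e k j else 0) \<le> (\<Sum>m<M. sqrt (s k) * (1/2) ^ m)"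
    proof (rule sum_mono)
      fix m
      let ?J = "{j \<in> J. N m \<le> j}"
      define T where "T = (\<Sum>j\<in>?J. e k j)"
      have "(\<Sum>j\<in>J. if N m \<le> j then e k j else 0) = T" unfolding T_def using J by (simp add: sum.If_cases Int_def)
      moreover have "T \<ge> 0" unfolding T_def using e_nonneg by (intro sum_nonneg) auto
      moreover have "T \<le> s k" unfolding T_def using J by (intro sum_e_le) auto
      moreover have "T \<le> (1/4) ^ m" unfolding T_def using J N(2)[of m] by (intro N0) auto
      moreover have "T \<le> sqrt (s k) * (1/2) ^ m"
      proof (rule power2_le_imp_le)
        have "T\<^sup>2 \<le> s k * (1/4) ^ m" unfolding power2_eq_square using calculation by (intro mult_mono) auto
        also have "\<dots> = (sqrt (s k) * (1/2) ^ m)\<^sup>2"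
        proof -
          have "((1/2::real) ^ m)\<^sup>2 = (1/4) ^ m" unfolding power2_eq_square power_mult_distrib[symmetric] by simp
          then show ?thesis using s_nonneg[of k] by (simp only: power_mult_distrib real_sqrt_pow2)
        qed
        finally show "T\<^sup>2 \<le> (sqrt (s k) * (1/2) ^ m)\<^sup>2" .
      qed (use s_nonneg[of k] in simp)
      ultimately show "(\<Sum>j\<in>J. if N m \<le> j then e k j else 0) \<le> sqrt (s k) * (1/2) ^ m" by simp
    qed
    also have "\<dots> = sqrt (s k) * (\<Sum>m<M. (1/2) ^ m)" by (simp add: sum_distrib_left)
    also have "\<dots> \<le> sqrt (s k) * 2"
    proof (rule mult_left_mono)
      have "(\<Sum>m<M. (1/2::real) ^ m) \<le> (\<Sum>m. (1/2) ^ m)" by (rule sum_le_suminf) (auto intro: summable_geometric)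
      then show "(\<Sum>m<M. (1/2::real) ^ m) \<le> 2" by (simp add: suminf_geometric)
    qed (use s_nonneg[of k] in simp)
    finally show "(\<Sum>j\<in>J. real (p j) * e k j) \<le> \<tau> k" by (simp add: \<tau>_def)
  qed
qed

text \<open>The series of the \<open>e 0 j\<close> converges, so the pseudohyperbolic distance of
  \<open>z j\<close> from the fixed point \<open>z 0\<close> tends to \<open>1\<close>; that happens
  only at the unit circle.\<close>

lemma norm_z_lim: "(\<lambda>k. cmod (z k)) \<longlonglongrightarrow> 1"
proof -
  have "summable (\<lambda>j. e 0 (Suc j))"
  proof (rule summableI_nonneg_bounded[of _ "s 0"])
    fix n
    have "(\<Sum>j<n. e 0 (Suc j)) = (\<Sum>j\<in>Suc ` {..<n}. e 0 j)" by (simp add: sum.reindex)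
    also have "\<dots> \<le> s 0" by (rule sum_e_le) auto
    finally show "(\<Sum>j<n. e 0 (Suc j)) \<le> s 0" .
  qed (rule e_nonneg)
  then have "(\<lambda>j. e 0 (Suc j)) \<longlonglongrightarrow> 0" by (rule summable_LIMSEQ_zero)
  then have e0: "(\<lambda>j. e 0 j) \<longlonglongrightarrow> 0" by (rule LIMSEQ_imp_Suc)
  \<comment> \<open>\<open>8 = 4 * 2\<close>: the squared denominator in \<open>one_minus_bl\<close>
    is at most \<open>4\<close>, and \<open>1 + ?b\<close> is at most \<open>2\<close>.\<close>
  define C where "C = 8 / (1 - (cmod (z 0))\<^sup>2)"
  have z0: "1 - (cmod (z 0))\<^sup>2 > 0" using z1[of 0] by (simp add: abs_square_less_1)
  have bd: "\<bar>cmod (z j) - 1\<bar> \<le> C * e 0 j" for j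
  proof -
    let ?b = "cmod (bl (z j) (z 0))"
    have b: "?b \<le> 1" using bl_le1[OF z1, of "z 0" j] z1[of 0] by simp
    have "1 - ?b\<^sup>2 = (1 - (cmod (z j))\<^sup>2) * (1 - (cmod (z 0))\<^sup>2) / (cmod (1 - cnj (z j) * z 0))\<^sup>2"
      by (rule one_minus_bl[OF z1 less_imp_le[OF z1]])
    moreover have "cmod (1 - cnj (z j) * z 0) \<le> 2"
    proof -
      have "cmod (1 - cnj (z j) * z 0) \<le> 1 + cmod (z j) * cmod (z 0)" using norm_triangle_ineq4[of 1 "cnj (z j) * z 0"] by (simp add: norm_mult)
      also have "\<dots> \<le> 1 + 1 * 1" using z1[of j] z1[of 0] by (intro add_left_mono mult_mono) auto
      finally show ?thesis by simp
    qed
    then have "(cmod (1 - cnj (z j) * z 0))\<^sup>2 \<le> 2\<^sup>2" by (intro power_mono) auto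
    moreover have "(cmod (1 - cnj (z j) * z 0))\<^sup>2 > 0" using bl_denom[OF z1 less_imp_le[OF z1], of j 0] by simp
    moreover have "0 \<le> (1 - (cmod (z j))\<^sup>2) * (1 - (cmod (z 0))\<^sup>2)" using z0 z1[of j] by (simp add: power_le_one)
    ultimately have "(1 - (cmod (z j))\<^sup>2) * (1 - (cmod (z 0))\<^sup>2) / 4 \<le> 1 - ?b\<^sup>2"
      by (simp only:) (rule divide_left_mono, simp_all)
    also have "1 - ?b\<^sup>2 = (1 - ?b) * (1 + ?b)" by (simp add: power2_eq_square algebra_simps)
    also have "\<dots> \<le> (1 - ?b) * 2" using b by (intro mult_left_mono) auto
    finally have "(1 - (cmod (z j))\<^sup>2) * (1 - (cmod (z 0))\<^sup>2) \<le> 8 * e 0 j" by (simp add: e_def)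
    then have "1 - (cmod (z j))\<^sup>2 \<le> C * e 0 j" using z0 by (simp add: C_def field_simps)
    moreover have "(cmod (z j))\<^sup>2 \<le> cmod (z j)" using z1[of j] by (simp add: power2_eq_square mult_left_le)
    ultimately show ?thesis using z1[of j] by simp
  qed
  have "(\<lambda>j. C * e 0 j) \<longlonglongrightarrow> C * 0" by (intro tendsto_intros e0)
  then have "(\<lambda>j. C * e 0 j) \<longlonglongrightarrow> 0" by simp
  moreover have "eventually (\<lambda>j. norm (cmod (z j) - 1) \<le> C * e 0 j) sequentially" using bd by simp
  ultimately have "(\<lambda>j. cmod (z j) - 1) \<longlonglongrightarrow> 0" by (rule Lim_null_comparison[rotated])
  then show ?thesis by (simp add: LIM_zero_iff)
qed

end


section \<open>Thin points and analytic disks\<close>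

locale thin_slow = thin_seq +
  fixes p :: "nat \<Rightarrow> nat" and \<tau> :: "nat \<Rightarrow> real"
  assumes p1: "\<And>j. p j \<ge> 1" and p_lim: "filterlim p at_top sequentially" and \<tau>_lim: "\<tau> \<longlonglongrightarrow> 0"
    and \<tau>0: "\<And>k. \<tau> k \<ge> 0" and \<tau>_sum: "\<And>k J. finite J \<Longrightarrow> k \<notin> J \<Longrightarrow> (\<Sum>j\<in>J. real (p j) * e k j) \<le> \<tau> k"
begin

section \<open>Blaschke products with zeros along the thin sequence\<close>

lemma mz1: "cmod (- z k) < 1" using z1 by simp

text \<open>An ultrafilter limit of the finite products takes the place of a convergent product with
  unimodular normalising factors, as only moduli matter. The two estimates are those that survive
  the limit: each single factor bounds it above, and a lower bound common to all finite products
  remains valid.\<close>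

lemma ex_blaschke:
  "\<exists>v. v \<in> Hinf \<and> norm v \<le> 1 \<and> (\<forall>w\<in>ball 0 1. \<forall>k. cmod (disk_ext v w) \<le> cmod (bl (z k) w) ^ q k) \<and>
    (\<forall>w\<in>ball 0 1. \<forall>c. (\<forall>M. c \<le> cmod (bprod z q {..<M} w)) \<longrightarrow> c \<le> cmod (disk_ext v w))"
proof -
  obtain U :: "nat filter" where U: "U \<le> sequentially" "ultra U" using ultra_exists[OF sequentially_bot] .
  have "\<exists>l. w \<in> ball 0 1 \<longrightarrow> ((\<lambda>M. bprod z q {..<M} w) \<longlongrightarrow> l) U" for w
  proof (cases "w \<in> ball 0 1")
    case True
    then have "eventually (\<lambda>M. cmod (bprod z q {..<M} w) \<le> 1) U" using bprod_le1[OF z1, of w] by simp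
    then obtain l where "((\<lambda>M. bprod z q {..<M} w) \<longlongrightarrow> l) U" by (rule ultra_tendsto_bounded[OF U(2)])
    then show ?thesis by blast
  qed auto
  then have "\<forall>w. \<exists>l. w \<in> ball 0 1 \<longrightarrow> ((\<lambda>M. bprod z q {..<M} w) \<longlongrightarrow> l) U" by (rule allI)
  from choice[OF this] obtain F where "\<forall>w. w \<in> ball 0 1 \<longrightarrow> ((\<lambda>M. bprod z q {..<M} w) \<longlongrightarrow> F w) U" by (rule exE)
  then have F: "\<And>w. w \<in> ball 0 1 \<Longrightarrow> ((\<lambda>M. bprod z q {..<M} w) \<longlongrightarrow> F w) U" by blast
  have ev: "eventually (\<lambda>M. bprod z q {..<M} holomorphic_on ball 0 1 \<and> (\<forall>w\<in>ball 0 1. cmod (bprod z q {..<M} w) \<le> 1)) U"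
    using bprod_holomorphic[OF z1] bprod_le1[OF z1] by (intro always_eventually allI conjI ballI) auto
  obtain v where v: "v \<in> Hinf" "norm v \<le> 1" "\<And>w. w \<in> ball 0 1 \<Longrightarrow> disk_ext v w = F w"
    using Hinf_of_holomorphic[OF limit_holomorphic[OF ultraD(1)[OF U(2)] ev F] limit_bound[OF ultraD(1)[OF U(2)] ev F]] by blast
  show ?thesis
  proof (intro exI[of _ v] conjI ballI allI impI v(1,2))
    fix w k assume w: "w \<in> ball (0::complex) 1"
    have "eventually (\<lambda>M. k < M) U" using U(1) eventually_gt_at_top[of k] by (simp add: le_filter_def)
    then have "eventually (\<lambda>M. cmod (bprod z q {..<M} w) \<le> cmod (bl (z k) w) ^ q k) U"
    proof eventually_elim
      case (elim M)
      have "cmod (bprod z q {..<M} w) = cmod (bl (z k) w) ^ q k * cmod (bprod z q ({..<M} - {k}) w)"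
        unfolding norm_bprod using elim by (subst prod.remove[of _ k]) auto
      also have "\<dots> \<le> cmod (bl (z k) w) ^ q k * 1"
        using bprod_le1[OF z1, of w] w by (intro mult_left_mono) auto
      finally show ?case by simp
    qed
    then show "cmod (disk_ext v w) \<le> cmod (bl (z k) w) ^ q k"
      unfolding v(3)[OF w] by (rule tendsto_upperbound[OF tendsto_norm[OF F[OF w]] _ ultraD(1)[OF U(2)]])
  next
    fix w c assume w: "w \<in> ball (0::complex) 1" and c: "\<forall>M. c \<le> cmod (bprod z q {..<M} w)"
    show "c \<le> cmod (disk_ext v w)"
      unfolding v(3)[OF w] by (rule tendsto_lowerbound[OF tendsto_norm[OF F[OF w]] _ ultraD(1)[OF U(2)]]) (use c in simp)
  qed
qed

definition "B q = (SOME v. v \<in> Hinf \<and> norm v \<le> 1 \<and> (\<forall>w\<in>ball 0 1. \<forall>k. cmod (disk_ext v w) \<le> cmod (bl (z k) w) ^ q k) \<and>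
    (\<forall>w\<in>ball 0 1. \<forall>c. (\<forall>M. c \<le> cmod (bprod z q {..<M} w)) \<longrightarrow> c \<le> cmod (disk_ext v w)))"

lemma B: "B q \<in> Hinf" "norm (B q) \<le> 1" "w \<in> ball 0 1 \<Longrightarrow> cmod (disk_ext (B q) w) \<le> cmod (bl (z k) w) ^ q k"
  "w \<in> ball 0 1 \<Longrightarrow> (\<And>M. c \<le> cmod (bprod z q {..<M} w)) \<Longrightarrow> c \<le> cmod (disk_ext (B q) w)"
  using someI_ex[OF ex_blaschke[of q]] unfolding B_def[symmetric] by blast+

lemma bprod_center:
  assumes q: "\<And>j. q j \<le> p j" and J: "finite J" and k: "k \<notin> J"
  shows "1 - \<tau> k \<le> cmod (bprod z q J (z k))"
proof -
  have "(\<Sum>j\<in>J. real (q j) * (1 - cmod (bl (z j) (z k)))) \<le> (\<Sum>j\<in>J. real (p j) * e k j)"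
    unfolding e_def using q bl_le1[OF z1 less_imp_le[OF z1]] by (intro sum_mono mult_right_mono) auto
  also have "\<dots> \<le> \<tau> k" by (rule \<tau>_sum[OF J k])
  finally have "1 - \<tau> k \<le> 1 - (\<Sum>j\<in>J. real (q j) * (1 - cmod (bl (z j) (z k))))" by simp
  also have "\<dots> \<le> cmod (bprod z q J (z k))"
    unfolding norm_bprod by (rule prod_power_ge[OF J]) (use bl_le1[OF z1 less_imp_le[OF z1]] in auto)
  finally show ?thesis .
qed

lemma bprod_disk:
  assumes q: "\<And>j. q j \<le> p j" and J: "finite J" and k: "k \<notin> J" and w: "cmod w < 1" "cmod (bl (z k) w) \<le> r" "r < 1"
  shows "1 - 3 * \<tau> k / (1 - r) \<le> cmod (bprod z q J w)"
  by (rule schwarz_pick_lower[OF bprod_holomorphic[OF z1] _ z1 w(1) bprod_center[OF q J k] w(2,3)])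
     (use bprod_le1[OF z1] in auto)

lemma bprod_restrict: "finite J \<Longrightarrow> bprod z q J w = bprod z q {k\<in>J. q k \<ge> 1} w"
  unfolding bprod_def by (rule prod.mono_neutral_right) (auto simp: not_less_eq_eq)

lemma B_near:
  assumes q: "\<And>j. q j \<le> p j" and k: "q k = 0" and w: "cmod w \<le> r" "r < 1"
  shows "1 - 3 * \<tau> k / (1 - r) \<le> cmod (disk_ext (B q) (bl (- z k) w))"
proof (rule B(4))
  have w1: "cmod w < 1" using w by simp
  show b: "bl (- z k) w \<in> ball 0 1" using bl_less1[OF mz1 w1] by simp
  fix M
  have "bprod z q {..<M} (bl (- z k) w) = bprod z q {j\<in>{..<M}. q j \<ge> 1} (bl (- z k) w)" by (rule bprod_restrict) simp
  then show "1 - 3 * \<tau> k / (1 - r) \<le> cmod (bprod z q {..<M} (bl (- z k) w))"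
    using bprod_disk[OF q, of "{j\<in>{..<M}. q j \<ge> 1}" k "bl (- z k) w" r] k b w by (simp add: bl_inverse'[OF z1 w1])
qed

text \<open>On the circle of pseudohyperbolic radius \<open>r k\<close> around \<open>z k\<close>,
  the factor of index \<open>k\<close> has modulus \<open>r k ^ q k\<close>, and by
  \<open>bprod_disk\<close> the others contribute at least
  \<open>1 - 3 * \<tau> k / (1 - r k)\<close>. \<open>bprod_max_principle\<close> carries the bound
  to all points outside these disks, uniformly in the number of factors.\<close>

lemma B_far:
  assumes q: "\<And>j. q j \<le> p j" and r: "\<And>k. q k \<ge> 1 \<Longrightarrow> 0 < r k \<and> r k < 1 \<and> c \<le> r k ^ q k * (1 - 3 * \<tau> k / (1 - r k))"
    and c: "0 < c" "c \<le> 1" and w: "w \<in> ball 0 1" "\<And>k. q k \<ge> 1 \<Longrightarrow> r k \<le> cmod (bl (z k) w)"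
  shows "c \<le> cmod (disk_ext (B q) w)"
proof (rule B(4)[OF w(1)])
  fix M
  define J where "J = {k\<in>{..<M}. q k \<ge> 1}"
  have J: "finite J" by (simp add: J_def)
  have "c \<le> cmod (bprod z q J w)"
  proof (rule bprod_max_principle[OF z1 J _ c])
    show "0 < r j" if "j \<in> J" for j using r[of j] that by (simp add: J_def)
    show "cmod w < 1" using w by simp
    show "r k \<le> cmod (bl (z k) w)" if "k \<in> J" for k using w(2) that by (simp add: J_def)
    fix k v assume k: "k \<in> J" and v: "cmod v < 1" "cmod (bl (z k) v) = r k"
    have rk: "0 < r k" "r k < 1" "c \<le> r k ^ q k * (1 - 3 * \<tau> k / (1 - r k))" using r[of k] k by (auto simp: J_def)
    have "cmod (bprod z q J v) = r k ^ q k * cmod (bprod z q (J - {k}) v)"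
      unfolding norm_bprod using k J by (subst prod.remove[of _ k]) (auto simp: v)
    moreover have "1 - 3 * \<tau> k / (1 - r k) \<le> cmod (bprod z q (J - {k}) v)"
      by (rule bprod_disk[OF q _ _ v(1)]) (use J v rk in auto)
    then have "r k ^ q k * (1 - 3 * \<tau> k / (1 - r k)) \<le> r k ^ q k * cmod (bprod z q (J - {k}) v)"
      using rk by (intro mult_left_mono) auto
    ultimately show "c \<le> cmod (bprod z q J v)" using rk(3) by linarith
  qed
  then show "c \<le> cmod (bprod z q {..<M} w)" using bprod_restrict[of "{..<M}" q w] by (simp add: J_def)
qed

text \<open>The Hoffman map of the limit of \<open>z\<close> along \<open>V\<close>:
  \<open>bl (- z k) w\<close> is the point with coordinate \<open>w\<close> in the pseudohyperbolic
  picture centred at \<open>z k\<close>.\<close>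

definition "psi V w f = Lim V (\<lambda>k. disk_ext f (bl (- z k) w))"

lemma bl_ball: "w \<in> ball 0 1 \<Longrightarrow> bl (- z k) w \<in> ball 0 1"
  using bl_less1[OF mz1] by simp

lemma psi_lim:
  assumes V: "ultra V" and w: "w \<in> ball 0 1" and f: "f \<in> Hinf"
  shows "((\<lambda>k. disk_ext f (bl (- z k) w)) \<longlongrightarrow> psi V w f) V"
proof -
  have "eventually (\<lambda>k. cmod (disk_ext f (bl (- z k) w)) \<le> norm f) V" using disk_ext_le[OF f bl_ball[OF w]] by simp
  then obtain l where l: "((\<lambda>k. disk_ext f (bl (- z k) w)) \<longlongrightarrow> l) V" by (rule ultra_tendsto_bounded[OF V])
  then have "psi V w f = l" unfolding psi_def by (rule tendsto_Lim[OF ultraD(1)[OF V]])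
  then show ?thesis using l by simp
qed

lemma disk_comp: "f \<in> Hinf \<Longrightarrow> (\<lambda>w. disk_ext f (bl (- z k) w)) holomorphic_on ball 0 1 \<and> (\<forall>w\<in>ball 0 1. cmod (disk_ext f (bl (- z k) w)) \<le> norm f)"
proof (intro conjI ballI)
  assume f: "f \<in> Hinf"
  have "(disk_ext f \<circ> bl (- z k)) holomorphic_on ball 0 1"
    by (rule holomorphic_on_compose_gen[OF bl_holomorphic[OF mz1] disk_ext_holomorphic[OF f]]) (use bl_ball in auto)
  then show "(\<lambda>w. disk_ext f (bl (- z k) w)) holomorphic_on ball 0 1" by (simp add: o_def)
  show "cmod (disk_ext f (bl (- z k) w)) \<le> norm f" if "w \<in> ball 0 1" for w by (rule disk_ext_le[OF f bl_ball[OF that]])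
qed

lemma psi_hol: "ultra V \<Longrightarrow> f \<in> Hinf \<Longrightarrow> (\<lambda>w. psi V w f) holomorphic_on ball 0 1"
  using disk_comp by (intro limit_holomorphic[of V "\<lambda>k w. disk_ext f (bl (- z k) w)" "norm f"] ultraD(1) always_eventually allI psi_lim) auto

lemma psi_moving:
  assumes "ultra V" "f \<in> Hinf" "(W \<longlongrightarrow> w0) V" "w0 \<in> ball 0 1"
  shows "((\<lambda>k. disk_ext f (bl (- z k) (W k))) \<longlongrightarrow> psi V w0 f) V"
proof (rule limit_moving[of V "\<lambda>k w. disk_ext f (bl (- z k) w)" "norm f" "\<lambda>w. psi V w f", OF _ _ _ assms(3,4)])
  show "V \<noteq> bot" by (rule ultraD(1)[OF assms(1)])
  show "eventually (\<lambda>k. (\<lambda>w. disk_ext f (bl (- z k) w)) holomorphic_on ball 0 1 \<and> (\<forall>w\<in>ball 0 1. cmod (disk_ext f (bl (- z k) w)) \<le> norm f)) V"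
    using disk_comp[OF assms(2)] by simp
qed (rule psi_lim[OF assms(1) _ assms(2)])

lemma psi_hchar:
  assumes V: "ultra V" and w: "w \<in> ball 0 1"
  shows "hchar (psi V w)"
proof -
  note L = psi_lim[OF V w] and b = bl_ball[OF w]
  have u: "psi V w f = l" if "f \<in> Hinf" "((\<lambda>k. disk_ext f (bl (- z k) w)) \<longlongrightarrow> l) V" for f l
    using tendsto_unique[OF ultraD(1)[OF V] L[OF that(1)] that(2)] .
  show ?thesis
    unfolding hchar_def
  proof (intro conjI ballI allI)
    show "psi V w 1 = 1" by (rule u[OF Hinf_one]) (simp add: disk_ext_one)
    fix f g assume fg: "f \<in> Hinf" "g \<in> Hinf"
    show "psi V w (f + g) = psi V w f + psi V w g"
      by (rule u[OF Hinf_comb(1)[OF fg]]) (simp only: Hinf_comb(4)[OF fg b], intro tendsto_add L fg)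
    show "psi V w (f * g) = psi V w f * psi V w g"
      by (rule u[OF Hinf_mult(1)[OF fg]]) (simp only: Hinf_mult(2)[OF fg b], intro tendsto_mult L fg)
  next
    fix c f assume f: "f \<in> Hinf"
    show "psi V w (Linf_cscale c f) = c * psi V w f"
      by (rule u[OF Hinf_cscale[OF f]]) (simp only: disk_ext_cscale[OF f b], intro tendsto_mult tendsto_const L f)
  qed
qed

text \<open>As \<open>cmod (z k)\<close> tends to \<open>1\<close>, pseudohyperbolic disks of fixed
  radius around \<open>z k\<close> shrink in the Euclidean metric. So the whole disk lies over one
  point of the circle, and \<open>hchar_extend\<close> applies to all of its characters.\<close>

lemma psi_Zf:
  assumes V: "ultra V" "V \<le> sequentially" and w: "w \<in> ball 0 1"
  shows "psi V w Zf = psi V 0 Zf" "cmod (psi V 0 Zf) = 1"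
proof -
  have l0: "(z \<longlongrightarrow> psi V 0 Zf) V" using psi_lim[OF V(1) _ Zf_Hinf, of 0] by (simp add: disk_ext_Zf bl_minus_zero)
  have nl: "((\<lambda>k. cmod (z k)) \<longlongrightarrow> 1) V" by (rule tendsto_mono[OF V(2) norm_z_lim])
  show "cmod (psi V 0 Zf) = 1" by (rule tendsto_unique[OF ultraD(1)[OF V(1)] tendsto_norm[OF l0] nl])
  have lw: "((\<lambda>k. bl (- z k) w) \<longlongrightarrow> psi V w Zf) V" using psi_lim[OF V(1) w Zf_Hinf] by (simp add: disk_ext_Zf)
  have bd: "cmod (bl (- z k) w - z k) \<le> (1 - (cmod (z k))\<^sup>2) / (1 - cmod w)" for k
  proof -
    define D where "D = 1 + cnj (z k) * w"
    have D: "D \<noteq> 0" using bl_denom[OF mz1, of w k] w by (simp add: D_def)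
    have "cmod (cnj (z k) * w) \<le> 1 * cmod w" unfolding norm_mult using z1[of k] by (intro mult_right_mono) auto
    then have Dl: "1 - cmod w \<le> cmod D" using norm_triangle_ineq2[of 1 "- (cnj (z k) * w)"] by (simp add: D_def)
    have "bl (- z k) w = (w + z k) / D" by (simp add: bl_def D_def)
    then have "bl (- z k) w - z k = (w + z k - z k * D) / D" using D by (simp add: field_simps)
    also have "w + z k - z k * D = w * of_real (1 - (cmod (z k))\<^sup>2)"
      using complex_norm_square[of "z k"] by (simp add: D_def algebra_simps)
    finally have "cmod (bl (- z k) w - z k) = cmod w * \<bar>1 - (cmod (z k))\<^sup>2\<bar> / cmod D" by (simp only: norm_divide norm_mult norm_of_real)
    moreover have zp: "0 \<le> 1 - (cmod (z k))\<^sup>2" using z1[of k] by (simp add: power_le_one)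
    ultimately have "cmod (bl (- z k) w - z k) = cmod w * (1 - (cmod (z k))\<^sup>2) / cmod D" by simp
    also have "\<dots> \<le> (1 - (cmod (z k))\<^sup>2) / (1 - cmod w)"
      using zp w Dl by (intro frac_le) (auto intro: mult_left_le_one_le)
    finally show ?thesis .
  qed
  have "((\<lambda>k. (1 - (cmod (z k))\<^sup>2) / (1 - cmod w)) \<longlongrightarrow> (1 - 1\<^sup>2) / (1 - cmod w)) V"
    using w by (intro tendsto_intros nl) auto
  then have "((\<lambda>k. (1 - (cmod (z k))\<^sup>2) / (1 - cmod w)) \<longlongrightarrow> 0) V" by simp
  then have "((\<lambda>k. bl (- z k) w - z k) \<longlongrightarrow> 0) V" by (rule Lim_null_comparison[OF always_eventually[OF allI[OF bd]]])
  moreover have "((\<lambda>k. bl (- z k) w - z k) \<longlongrightarrow> psi V w Zf - psi V 0 Zf) V" by (intro tendsto_diff lw l0)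
  ultimately have "psi V w Zf - psi V 0 Zf = 0" using tendsto_unique[OF ultraD(1)[OF V(1)]] by blast
  then show "psi V w Zf = psi V 0 Zf" by simp
qed

lemma psi_B_lower:
  assumes V: "ultra V" "V \<le> sequentially" and q: "\<And>j. q j \<le> p j" and q0: "eventually (\<lambda>k. q k = 0) V" and w: "w \<in> ball 0 1"
  shows "1 \<le> cmod (psi V w (B q))"
proof -
  have "((\<lambda>k. 1 - 3 * \<tau> k / (1 - cmod w)) \<longlongrightarrow> 1 - 3 * 0 / (1 - cmod w)) V"
    using w by (intro tendsto_intros tendsto_mono[OF V(2) \<tau>_lim]) auto
  then have l: "((\<lambda>k. 1 - 3 * \<tau> k / (1 - cmod w)) \<longlongrightarrow> 1) V" by simp
  have "eventually (\<lambda>k. 1 - 3 * \<tau> k / (1 - cmod w) \<le> cmod (disk_ext (B q) (bl (- z k) w))) V"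
    using q0 by eventually_elim (rule B_near[OF q], use w in auto)
  then show ?thesis
    by (rule tendsto_le[OF ultraD(1)[OF V(1)] tendsto_norm[OF psi_lim[OF V(1) w B(1)]] l])
qed

text \<open>At the point with coordinate \<open>w\<close> around \<open>z k\<close> the product has
  modulus at most \<open>cmod w ^ q k\<close>, so a zero whose order is unbounded along
  \<open>V\<close> kills the whole disk and not only its centre.\<close>

lemma psi_B_zero:
  assumes V: "ultra V" and q: "filterlim q at_top V" and w: "w \<in> ball 0 1"
  shows "psi V w (B q) = 0"
proof -
  have "((\<lambda>n. cmod w ^ n) \<longlongrightarrow> 0) sequentially" using w by (intro LIMSEQ_power_zero) simp
  then have l: "((\<lambda>k. cmod w ^ q k) \<longlongrightarrow> 0) V" by (rule filterlim_compose[OF _ q])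
  have "eventually (\<lambda>k. norm (disk_ext (B q) (bl (- z k) w)) \<le> cmod w ^ q k) V"
  proof (intro always_eventually allI)
    fix k
    show "norm (disk_ext (B q) (bl (- z k) w)) \<le> cmod w ^ q k"
      using B(3)[OF bl_ball[OF w, of k], of q k] w by (simp add: bl_inverse'[OF z1])
  qed
  from Lim_null_comparison[OF this l] show ?thesis
    using tendsto_unique[OF ultraD(1)[OF V] psi_lim[OF V w B(1)]] by blast
qed

section \<open>Characters at which a product with simple zeros is small\<close>

definition "ind A = (\<lambda>k::nat. if k \<in> A then 1 else 0 :: nat)"

lemma ind_le: "ind A j \<le> p j" using p1[of j] by (simp add: ind_def)

lemma bl_tendsto_1:
  assumes a: "cmod a < 1" and G: "((\<lambda>\<zeta>. cmod \<zeta>) \<longlongrightarrow> 1) \<G>" "eventually (\<lambda>\<zeta>. \<zeta> \<in> ball 0 1) \<G>" and r: "0 < r" "r < 1"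
  shows "eventually (\<lambda>\<zeta>. r \<le> cmod (bl a \<zeta>)) \<G>"
proof -
  have "((\<lambda>\<zeta>. (1 - (cmod \<zeta>)\<^sup>2) / (1 - cmod a)\<^sup>2) \<longlongrightarrow> (1 - 1\<^sup>2) / (1 - cmod a)\<^sup>2) \<G>"
    using a by (intro tendsto_intros G) auto
  then have "((\<lambda>\<zeta>. (1 - (cmod \<zeta>)\<^sup>2) / (1 - cmod a)\<^sup>2) \<longlongrightarrow> 0) \<G>" by simp
  moreover have "0 < 1 - r\<^sup>2" using r by (simp add: power_less_one_iff)
  ultimately have "eventually (\<lambda>\<zeta>. (1 - (cmod \<zeta>)\<^sup>2) / (1 - cmod a)\<^sup>2 < 1 - r\<^sup>2) \<G>" by (rule order_tendstoD(2))
  with G(2) show ?thesis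
  proof eventually_elim
    case (elim \<zeta>)
    then have z: "cmod \<zeta> < 1" by simp
    have "cmod (cnj a * \<zeta>) \<le> cmod a * 1" unfolding norm_mult using z by (intro mult_mono) auto
    then have "1 - cmod a \<le> cmod (1 - cnj a * \<zeta>)" using norm_triangle_ineq2[of 1 "cnj a * \<zeta>"] by simp
    then have "(1 - cmod a)\<^sup>2 \<le> (cmod (1 - cnj a * \<zeta>))\<^sup>2" using a by (intro power_mono) auto
    moreover have "(1 - cmod a)\<^sup>2 > 0" using a by simp
    moreover have "(1 - (cmod a)\<^sup>2) * (1 - (cmod \<zeta>)\<^sup>2) \<le> 1 * (1 - (cmod \<zeta>)\<^sup>2)" using z by (intro mult_right_mono) (auto simp: power_le_one)
    moreover have "0 \<le> (1 - (cmod \<zeta>)\<^sup>2)" using z by (simp add: power_le_one)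
    ultimately have "1 - (cmod (bl a \<zeta>))\<^sup>2 \<le> (1 - (cmod \<zeta>)\<^sup>2) / (1 - cmod a)\<^sup>2"
      unfolding one_minus_bl[OF a less_imp_le[OF z]] by (intro frac_le) auto
    then have "r\<^sup>2 \<le> (cmod (bl a \<zeta>))\<^sup>2" using elim by linarith
    then show "r \<le> cmod (bl a \<zeta>)" by (rule power2_le_imp_le) simp
  qed
qed

text \<open>By \<open>B_far\<close>, the points of the open disk that approximate \<open>y\<close>
  must lie within a fixed pseudohyperbolic radius of some \<open>z k\<close> with \<open>k\<close>
  in \<open>A\<close>. Along an ultrafilter their indices give \<open>V\<close> and their
  coordinates converge to \<open>w0\<close>. The threshold \<open>N\<close> depends on
  \<open>\<gamma>\<close> only; this matters because \<open>A\<close> will later be chosen in terms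
  of \<open>V\<close>.\<close>

lemma small_on_disk:
  assumes \<gamma>: "\<gamma> < 1"
  shows "\<exists>N. \<forall>A y. A \<subseteq> {N..} \<longrightarrow> y \<in> characters HinfC \<longrightarrow> cmod (y (B (ind A))) \<le> \<gamma> \<longrightarrow>
    (\<exists>V w0. ultra V \<and> V \<le> sequentially \<and> eventually (\<lambda>k. k \<in> A) V \<and> w0 \<in> ball 0 1 \<and> (\<forall>f\<in>Hinf. y f = psi V w0 f))"
proof -
  \<comment> \<open>The square of \<open>r\<close> lies strictly between \<open>\<gamma>\<close> and
    \<open>1\<close>, and the maximum with \<open>0\<close> guarantees that the root is positive.
    Once \<open>\<tau> k < (1 - r)^2 / 3\<close>, the second factor in \<open>B_far\<close> is at
    least \<open>r\<close>, so \<open>r * r\<close> is an admissible lower bound.\<close>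
  define g where "g = max \<gamma> 0"
  define r where "r = sqrt ((1 + g) / 2)"
  have g: "0 \<le> g" "g < 1" "\<gamma> \<le> g" using \<gamma> by (auto simp: g_def)
  have rr: "r * r = (1 + g) / 2" using g by (simp add: r_def)
  have r: "0 < r" "r < 1" using g by (auto simp: r_def real_sqrt_lt_1_iff)
  have "eventually (\<lambda>k. \<tau> k < (1 - r)\<^sup>2 / 3) sequentially" using r by (intro order_tendstoD(2)[OF \<tau>_lim]) simp
  then obtain N where N: "\<And>k. k \<ge> N \<Longrightarrow> \<tau> k < (1 - r)\<^sup>2 / 3" by (auto simp: eventually_sequentially)
  show ?thesis
  proof (intro exI[of _ N] allI impI)
    fix A y assume A: "A \<subseteq> {N..}" and y: "y \<in> characters HinfC" and small: "cmod (y (B (ind A))) \<le> \<gamma>"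
    obtain \<G> where G: "ultra \<G>" "eventually (\<lambda>\<zeta>. \<zeta> \<in> ball 0 1) \<G>" "\<And>f. f \<in> Hinf \<Longrightarrow> ((\<lambda>\<zeta>. disk_ext f \<zeta>) \<longlongrightarrow> y f) \<G>"
      by (rule hchar_ultra[OF char_hchar[OF y]]) (use that in blast)
    have Gn: "((\<lambda>\<zeta>. cmod \<zeta>) \<longlongrightarrow> 1) \<G>"
      using tendsto_norm[OF G(3)[OF Zf_Hinf]] char_CT(2)[OF y continuous_on_const] by (simp add: disk_ext_Zf)
    have "((\<lambda>\<zeta>. cmod (disk_ext (B (ind A)) \<zeta>)) \<longlongrightarrow> cmod (y (B (ind A)))) \<G>" by (rule tendsto_norm[OF G(3)[OF B(1)]])
    moreover have "cmod (y (B (ind A))) < r * r" unfolding rr using small g by simp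
    ultimately have "eventually (\<lambda>\<zeta>. cmod (disk_ext (B (ind A)) \<zeta>) < r * r) \<G>" by (rule order_tendstoD(2))
    with G(2) have ex: "eventually (\<lambda>\<zeta>. \<exists>k\<in>A. cmod (bl (z k) \<zeta>) < r) \<G>"
    proof eventually_elim
      case (elim \<zeta>)
      show ?case
      proof (rule ccontr)
        assume n: "\<not> ?case"
        have "r * r \<le> cmod (disk_ext (B (ind A)) \<zeta>)"
        proof (rule B_far[of "ind A" "\<lambda>_. r", OF ind_le _ _ _ elim(1)])
          show "0 < r * r" "r * r \<le> 1" using r by (auto simp: mult_le_one)
          fix k assume k: "ind A k \<ge> 1"
          then have kA: "k \<in> A" by (auto simp: ind_def split: if_splits)
          then have "\<tau> k < (1 - r)\<^sup>2 / 3" using N A by auto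
          then have "3 * \<tau> k / (1 - r) \<le> 1 - r" using r by (simp add: divide_le_eq power2_eq_square)
          then have "r * r \<le> r * (1 - 3 * \<tau> k / (1 - r))" using r by (intro mult_left_mono) auto
          then show "0 < r \<and> r < 1 \<and> r * r \<le> r ^ ind A k * (1 - 3 * \<tau> k / (1 - r))" using r kA by (simp add: ind_def)
          show "r \<le> cmod (bl (z k) \<zeta>)" using n kA by (auto simp: not_less)
        qed
        then show False using elim(2) by simp
      qed
    qed
    \<comment> \<open>Each point close to \<open>y\<close> chooses an index whose disk contains it.
      The image of \<open>\<G>\<close> under \<open>\<kappa>\<close> is \<open>V\<close>, and the
      coordinates stay in a compact disk.\<close>
    define \<kappa> where "\<kappa> \<zeta> = (SOME k. k \<in> A \<and> cmod (bl (z k) \<zeta>) < r)" for \<zeta>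
    have \<kappa>: "eventually (\<lambda>\<zeta>. \<kappa> \<zeta> \<in> A \<and> cmod (bl (z (\<kappa> \<zeta>)) \<zeta>) < r) \<G>"
      using ex
    proof eventually_elim
      case (elim \<zeta>)
      then have "\<exists>k. k \<in> A \<and> cmod (bl (z k) \<zeta>) < r" by blast
      from someI_ex[OF this] show ?case unfolding \<kappa>_def .
    qed
    define V where "V = filtermap \<kappa> \<G>"
    have V: "ultra V" unfolding V_def by (rule ultra_filtermap[OF G(1)])
    \<comment> \<open>The points tend to the unit circle and so leave the disk of radius
      \<open>r\<close> around every fixed \<open>z j\<close>.\<close>
    have Vs: "V \<le> sequentially"
      unfolding le_sequentially V_def eventually_filtermap
    proof
      fix n
      have "eventually (\<lambda>\<zeta>. \<forall>j\<in>{..<n}. r \<le> cmod (bl (z j) \<zeta>)) \<G>"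
        by (intro eventually_ball_finite ballI bl_tendsto_1[OF z1 Gn G(2) r]) auto
      with \<kappa> show "eventually (\<lambda>\<zeta>. n \<le> \<kappa> \<zeta>) \<G>"
      proof eventually_elim
        case (elim \<zeta>)
        then show ?case by (meson lessThan_iff not_le)
      qed
    qed
    have VA: "eventually (\<lambda>k. k \<in> A) V" unfolding V_def eventually_filtermap using \<kappa> by (auto elim: eventually_mono)
    define W where "W \<zeta> = bl (z (\<kappa> \<zeta>)) \<zeta>" for \<zeta>
    have "eventually (\<lambda>\<zeta>. W \<zeta> \<in> cball 0 r) \<G>" using \<kappa> by (auto simp: W_def elim: eventually_mono)
    then obtain w0 where w0: "w0 \<in> cball 0 r" "(W \<longlongrightarrow> w0) \<G>" by (rule ultra_tendsto_compact[OF G(1) compact_cball])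
    have w01: "w0 \<in> ball 0 1" using w0 r by simp
    have "y f = psi V w0 f" if f: "f \<in> Hinf" for f
    proof -
      have "((\<lambda>\<zeta>. disk_ext f (bl (- z (\<kappa> \<zeta>)) (W \<zeta>))) \<longlongrightarrow> psi V w0 f) \<G>"
      proof (rule limit_moving[of \<G> "\<lambda>\<zeta> w. disk_ext f (bl (- z (\<kappa> \<zeta>)) w)" "norm f" "\<lambda>w. psi V w f", OF ultraD(1)[OF G(1)] _ _ w0(2) w01])
        show "eventually (\<lambda>\<zeta>. (\<lambda>w. disk_ext f (bl (- z (\<kappa> \<zeta>)) w)) holomorphic_on ball 0 1 \<and> (\<forall>w\<in>ball 0 1. cmod (disk_ext f (bl (- z (\<kappa> \<zeta>)) w)) \<le> norm f)) \<G>"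
          using disk_comp[OF f] by simp
        show "((\<lambda>\<zeta>. disk_ext f (bl (- z (\<kappa> \<zeta>)) w)) \<longlongrightarrow> psi V w f) \<G>" if "w \<in> ball 0 1" for w
          using psi_lim[OF V that f] unfolding V_def filterlim_filtermap .
      qed
      moreover have "eventually (\<lambda>\<zeta>. disk_ext f (bl (- z (\<kappa> \<zeta>)) (W \<zeta>)) = disk_ext f \<zeta>) \<G>"
        using G(2) by eventually_elim (simp add: W_def bl_inverse[OF z1])
      ultimately have "((\<lambda>\<zeta>. disk_ext f \<zeta>) \<longlongrightarrow> psi V w0 f) \<G>" by (simp cong: filterlim_cong add: filterlim_cong[OF refl refl])
      then show ?thesis using tendsto_unique[OF ultraD(1)[OF G(1)] G(3)[OF f]] by blast
    qed
    then show "\<exists>V w0. ultra V \<and> V \<le> sequentially \<and> eventually (\<lambda>k. k \<in> A) V \<and> w0 \<in> ball 0 1 \<and> (\<forall>f\<in>Hinf. y f = psi V w0 f)"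
      using V Vs VA w01 by blast
  qed
qed

end

text \<open>Scaling by \<open>t < 1\<close> supplies the strict bound that
  \<open>Schwarz_Lemma\<close> requires, and \<open>t\<close> may be arbitrarily close to
  \<open>1\<close>.\<close>

lemma schwarz_le:
  assumes "f holomorphic_on ball 0 1" "f 0 = 0" "\<And>w. w \<in> ball 0 1 \<Longrightarrow> cmod (f w) \<le> 1" "w \<in> ball 0 1"
  shows "cmod (f w) \<le> cmod w"
proof (rule field_le_mult_one_interval)
  fix t :: real assume t: "0 < t" "t < 1"
  have "cmod (of_real t * f w) \<le> cmod w"
  proof (rule Schwarz_Lemma(1)[of "\<lambda>w. of_real t * f w"])
    show "(\<lambda>w. of_real t * f w) holomorphic_on ball 0 1" by (intro holomorphic_intros assms)
    show "cmod (of_real t * f u) < 1" if "cmod u < 1" for u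
    proof -
      have "cmod (of_real t * f u) \<le> t * 1" unfolding norm_mult using t assms(3)[of u] that by (intro mult_mono) auto
      then show ?thesis using t by simp
    qed
  qed (use assms in auto)
  then show "t * cmod (f w) \<le> cmod w" using t by (simp add: norm_mult)
qed

section \<open>The disk through a thin point and its Gleason part\<close>

locale thin_pt = thin_slow +
  fixes x :: "Linf \<Rightarrow> complex" and U :: "nat filter"
  assumes x: "x \<in> characters HinfC" and U: "ultra U"
    and Ux: "\<And>f. f \<in> Hinf \<Longrightarrow> ((\<lambda>k. disk_ext f (z k)) \<longlongrightarrow> x f) U"
begin

text \<open>Otherwise \<open>U\<close> would live on finitely many indices, where
  \<open>cmod (z k)\<close> stays below some \<open>m < 1\<close>; but a character of
  \<open>HinfC\<close> has modulus \<open>1\<close> at \<open>Zf\<close>.\<close>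

lemma U_seq: "U \<le> sequentially"
  unfolding le_sequentially
proof (rule ccontr)
  assume "\<not> (\<forall>N. eventually (\<lambda>k. N \<le> k) U)"
  then obtain N where "\<not> eventually (\<lambda>k. N \<le> k) U" by blast
  then have ev: "eventually (\<lambda>k. k < N) U" using ultraD(2)[OF U] by (simp add: not_le)
  define m where "m = Max (insert 0 ((\<lambda>k. cmod (z k)) ` {..<N}))"
  have m: "m < 1" unfolding m_def using z1 by (subst Max_less_iff) auto
  have "eventually (\<lambda>k. cmod (z k) \<le> m) U" using ev by eventually_elim (auto simp: m_def intro: Max_ge)
  moreover have "((\<lambda>k. cmod (z k)) \<longlongrightarrow> 1) U"
    using tendsto_norm[OF Ux[OF Zf_Hinf]] char_CT(2)[OF x continuous_on_const] by (simp add: disk_ext_Zf)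
  ultimately have "1 \<le> m" using tendsto_upperbound ultraD(1)[OF U] by blast
  then show False using m by simp
qed

lemma x_psi: "f \<in> Hinf \<Longrightarrow> x f = psi U 0 f"
  using tendsto_unique[OF ultraD(1)[OF U] Ux psi_lim[OF U, of 0, unfolded bl_minus_zero]] by simp

definition "Lam w = (SOME y. y \<in> characters HinfC \<and> (\<forall>f\<in>Hinf. y f = psi U w f))"

lemma Lam:
  assumes w: "w \<in> ball 0 1"
  shows "Lam w \<in> characters HinfC" "f \<in> Hinf \<Longrightarrow> Lam w f = psi U w f"
proof -
  have "cmod (psi U w Zf) = 1" using psi_Zf[OF U U_seq w] by simp
  moreover have "characters HinfC \<noteq> {}" using x by auto
  ultimately obtain y where y: "y \<in> characters HinfC" "\<And>f. f \<in> Hinf \<Longrightarrow> y f = psi U w f"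
    by (rule hchar_extend[OF psi_hchar[OF U w]]) (use that in blast)
  have "\<exists>y. y \<in> characters HinfC \<and> (\<forall>f\<in>Hinf. y f = psi U w f)" by (intro exI[of _ y] conjI ballI y)
  from someI_ex[OF this] have L: "Lam w \<in> characters HinfC \<and> (\<forall>f\<in>Hinf. Lam w f = psi U w f)" unfolding Lam_def[symmetric] .
  show "Lam w \<in> characters HinfC" using L by simp
  show "f \<in> Hinf \<Longrightarrow> Lam w f = psi U w f" using L by simp
qed

lemma Lam_Zf: "w \<in> ball 0 1 \<Longrightarrow> Lam w Zf = x Zf"
  by (simp only: Lam(2) x_psi Zf_Hinf psi_Zf(1)[OF U U_seq, of w])

lemma Lam_0: "Lam 0 = x"
  by (rule char_unique[OF Lam(1) x]) (simp_all add: Lam(2) x_psi)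

lemma Lam_eq:
  assumes "w \<in> ball 0 1" "f \<in> Hinf" "continuous_on (sphere 0 1) g"
  shows "Lam w (f + abs_Linf g) = psi U w f + g (x Zf)"
  using char_eq[OF Lam(1)[OF assms(1)] assms(2,3)] by (simp only: Lam(2)[OF assms(1,2)] Lam_Zf[OF assms(1)])

lemma Lam_hol:
  assumes "h \<in> HinfC"
  shows "(\<lambda>w. Lam w h) holomorphic_on ball 0 1"
proof -
  obtain f g where fg: "f \<in> Hinf" "continuous_on (sphere 0 1) g" "h = f + abs_Linf g" using assms by (rule HinfC_cases)
  have "(\<lambda>w. psi U w f + g (x Zf)) holomorphic_on ball 0 1" by (intro holomorphic_intros psi_hol U fg)
  then show ?thesis by (rule holomorphic_transform) (simp add: fg Lam_eq)
qed

lemma HinfC_zero: "0 \<in> HinfC" by (rule Hinf_sub[OF Hinf_zero])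

lemma x_zero: "x 0 = 0" using charD(3)[OF x HinfC_zero HinfC_zero] by simp

text \<open>Schwarz's lemma in the variable \<open>w\<close> bounds the pseudohyperbolic distance of
  \<open>Lam w\<close> from \<open>x = Lam 0\<close> by \<open>cmod w\<close>.\<close>

lemma gleason_Lam:
  assumes w: "w \<in> ball 0 1"
  shows "Lam w \<in> gleason_part HinfC x"
proof -
  have "gleason_dist HinfC (Lam w) x \<le> cmod w"
    unfolding gleason_dist_def
  proof (rule cSUP_least)
    show "{f \<in> HinfC. norm f \<le> 1 \<and> x f = 0} \<noteq> {}"
      using HinfC_zero x_zero norm_zero by (intro ex_in_conv[THEN iffD1] exI[of _ 0]) simp
    fix f assume "f \<in> {f \<in> HinfC. norm f \<le> 1 \<and> x f = 0}"
    then have f: "f \<in> HinfC" "norm f \<le> 1" "x f = 0" by auto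
    show "cmod (Lam w f) \<le> cmod w"
      by (rule schwarz_le[of "\<lambda>w. Lam w f", OF Lam_hol[OF f(1)] _ _ w])
         (use f Lam_0 char_norm_le[OF Lam(1) f(1)] in \<open>auto intro: order_trans\<close>)
  qed
  then show ?thesis using w Lam(1)[OF w] by (simp add: gleason_part_def)
qed

lemma same_ultra:
  assumes V: "ultra V" and ne: "V \<noteq> U"
  obtains A where "eventually (\<lambda>k. k \<in> A) U" "eventually (\<lambda>k. k \<notin> A) V"
proof -
  obtain P where "eventually P U" "\<not> eventually P V" using ultra_eq[OF U V] ne by blast
  then have "eventually (\<lambda>k. k \<in> {k. P k}) U" "eventually (\<lambda>k. k \<notin> {k. P k}) V" using ultraD(2)[OF V] by auto
  then show ?thesis using that by blast
qed

lemma ev_tail: "eventually (\<lambda>k. k \<in> A) U \<Longrightarrow> eventually (\<lambda>k. k \<in> A \<inter> {N..}) U"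
  using U_seq by (auto simp: le_sequentially intro: eventually_conj)

lemma x_B_ind:
  assumes "eventually (\<lambda>k. k \<in> A) U"
  shows "x (B (ind A)) = 0"
proof -
  have "eventually (\<lambda>k. disk_ext (B (ind A)) (z k) = 0) U"
    using assms
  proof eventually_elim
    case (elim k)
    have "cmod (disk_ext (B (ind A)) (z k)) \<le> cmod (bl (z k) (z k)) ^ ind A k" by (rule B(3)) (use z1 in simp)
    then show ?case using elim by (simp add: ind_def bl_self)
  qed
  then have "((\<lambda>k. disk_ext (B (ind A)) (z k)) \<longlongrightarrow> 0) U" by (rule tendsto_eventually)
  then show ?thesis using tendsto_unique[OF ultraD(1)[OF U] Ux[OF B(1)]] by blast
qed

lemma Lam_uniqueI:
  assumes "y \<in> characters HinfC" "w \<in> ball 0 1" "\<And>f. f \<in> Hinf \<Longrightarrow> y f = psi U w f"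
  shows "y = Lam w"
  by (rule char_unique[OF assms(1) Lam(1)[OF assms(2)]]) (simp only: assms(3) Lam(2)[OF assms(2)])

text \<open>For every \<open>A\<close> in \<open>U\<close> the function \<open>B (ind A)\<close>
  vanishes at \<open>x\<close>, so its modulus is at most \<open>\<gamma> < 1\<close> at a point
  \<open>y\<close> of the part, and \<open>small_on_disk\<close> puts \<open>y\<close> on the disk
  of some \<open>V\<close>. If \<open>V\<close> were not \<open>U\<close>, a set in \<open>U\<close>
  but not in \<open>V\<close> would yield a product that is both small and, by
  \<open>psi_B_lower\<close>, unimodular at \<open>y\<close>.\<close>

lemma gleason_part_eq: "gleason_part HinfC x = Lam ` ball 0 1"
proof
  show "Lam ` ball 0 1 \<subseteq> gleason_part HinfC x" using gleason_Lam by blast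
  show "gleason_part HinfC x \<subseteq> Lam ` ball 0 1"
  proof
    fix y assume "y \<in> gleason_part HinfC x"
    then have y: "y \<in> characters HinfC" and d: "gleason_dist HinfC y x < 1" by (auto simp: gleason_part_def)
    define \<gamma> where "\<gamma> = gleason_dist HinfC y x"
    have le: "cmod (y v) \<le> \<gamma>" if "v \<in> Hinf" "norm v \<le> 1" "x v = 0" for v
      unfolding \<gamma>_def gleason_dist_def
    proof (rule cSUP_upper)
      show "v \<in> {f \<in> HinfC. norm f \<le> 1 \<and> x f = 0}" using that Hinf_sub by simp
      show "bdd_above ((\<lambda>f. cmod (y f)) ` {f \<in> HinfC. norm f \<le> 1 \<and> x f = 0})"
        by (rule bdd_aboveI2[of _ _ 1]) (use char_norm_le[OF y] in \<open>auto intro: order_trans\<close>)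
    qed
    have "\<gamma> < 1" using d by (simp add: \<gamma>_def)
    from small_on_disk[OF this] obtain N where N0: "\<forall>A y. A \<subseteq> {N..} \<longrightarrow> y \<in> characters HinfC \<longrightarrow> cmod (y (B (ind A))) \<le> \<gamma> \<longrightarrow>
      (\<exists>V w0. ultra V \<and> V \<le> sequentially \<and> eventually (\<lambda>k. k \<in> A) V \<and> w0 \<in> ball 0 1 \<and> (\<forall>f\<in>Hinf. y f = psi V w0 f))" by (rule exE)
    note N = N0[rule_format]
    have small: "cmod (y (B (ind (A \<inter> {N..})))) \<le> \<gamma>" if "eventually (\<lambda>k. k \<in> A) U" for A
      by (rule le[OF B(1,2) x_B_ind[OF ev_tail[OF that]]])
    obtain V w0 where V: "ultra V" "V \<le> sequentially" "w0 \<in> ball 0 1" "\<And>f. f \<in> Hinf \<Longrightarrow> y f = psi V w0 f"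
      using N[of "UNIV \<inter> {N..}" y] y small[of UNIV] by auto
    have "V = U"
    proof (rule ccontr)
      assume "V \<noteq> U"
      then obtain A where A: "eventually (\<lambda>k. k \<in> A) U" "eventually (\<lambda>k. k \<notin> A) V" by (rule same_ultra[OF V(1)])
      have "eventually (\<lambda>k. ind (A \<inter> {N..}) k = 0) V" using A(2) by eventually_elim (simp add: ind_def)
      from psi_B_lower[OF V(1,2) ind_le this V(3)] have "1 \<le> cmod (y (B (ind (A \<inter> {N..}))))" by (simp add: V(4) B(1))
      then show False using small[OF A(1)] d by (simp add: \<gamma>_def)
    qed
    then show "y \<in> Lam ` ball 0 1" using Lam_uniqueI[OF y V(3)] V(3,4) by blast
  qed
qed

definition "K = gelfand HinfC closure_of (Lam ` ball 0 1)"

lemma Lam_sub: "Lam ` ball 0 1 \<subseteq> characters HinfC" using Lam(1) by blast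

lemma K_analytic: "t_analytic HinfC K"
  unfolding t_analytic_def
proof (intro conjI ballI allI impI)
  show "K \<subseteq> characters HinfC" unfolding K_def using closure_of_subset_topspace topspace_gelfand by metis
  fix f O' \<phi> assume f: "f \<in> HinfC" and O': "openin (subtopology (gelfand HinfC) K) O'" "O' \<noteq> {}" and 0: "\<forall>\<phi>\<in>O'. \<phi> f = 0" and \<phi>: "\<phi> \<in> K"
  obtain T where T: "openin (gelfand HinfC) T" "O' = T \<inter> K" using O'(1) unfolding openin_subtopology by blast
  obtain \<phi>0 where \<phi>0: "\<phi>0 \<in> T" "\<phi>0 \<in> K" using O'(2) T(2) by blast
  then obtain w1 where w1: "w1 \<in> ball 0 1" "Lam w1 \<in> T" using T(1) unfolding K_def in_closure_of by blast
  have LK: "Lam w \<in> K" if "w \<in> ball 0 1" for w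
    unfolding K_def using closure_of_subset[of "Lam ` ball 0 1" "gelfand HinfC"] Lam_sub that by (auto simp: topspace_gelfand)
  obtain \<F> e' where F: "finite \<F>" "\<F> \<subseteq> HinfC" "e' > 0" "{y' \<in> characters HinfC. \<forall>f\<in>\<F>. cmod (y' f - Lam w1 f) < e'} \<subseteq> T"
    by (rule gelfand_nbhd[OF T(1) w1(2)])
  have "eventually (\<lambda>w. \<forall>h\<in>\<F>. dist (Lam w h) (Lam w1 h) < e') (at w1)"
  proof (intro eventually_ball_finite F ballI)
    fix h assume "h \<in> \<F>"
    then have "isCont (\<lambda>w. Lam w h) w1"
      using Lam_hol[of h] F(2) w1(1) by (meson continuous_on_eq_continuous_at holomorphic_on_imp_continuous_on open_ball subsetD)
    then show "eventually (\<lambda>w. dist (Lam w h) (Lam w1 h) < e') (at w1)" using F(3) by (auto simp: isCont_def dest: tendstoD)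
  qed
  then obtain \<delta> where \<delta>: "\<delta> > 0" "\<And>w. w \<noteq> w1 \<Longrightarrow> dist w w1 < \<delta> \<Longrightarrow> \<forall>h\<in>\<F>. dist (Lam w h) (Lam w1 h) < e'"
    unfolding eventually_at by auto
  define S where "S = ball w1 \<delta> \<inter> ball 0 1"
  have zS: "Lam w f = 0" if "w \<in> S" for w
  proof -
    have w: "w \<in> ball 0 1" "dist w w1 < \<delta>" using that by (auto simp: S_def dist_commute)
    have "\<forall>h\<in>\<F>. cmod (Lam w h - Lam w1 h) < e'" using \<delta>(2)[OF _ w(2)] F(3) by (cases "w = w1") (auto simp: dist_norm)
    then have "Lam w \<in> T" using F(4) Lam(1)[OF w(1)] by blast
    then show ?thesis using 0 T(2) LK[OF w(1)] by blast
  qed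
  have z: "Lam w f = 0" if "w \<in> ball 0 1" for w
  proof (rule analytic_continuation_open[of S "ball 0 1" "\<lambda>w. Lam w f" "\<lambda>_. 0"])
    have "w1 \<in> S" using w1(1) \<delta>(1) by (simp add: S_def)
    then show "S \<noteq> {}" by blast
  qed (use that zS in \<open>auto simp: S_def Lam_hol[OF f]\<close>)
  have "cmod (\<phi> f) \<le> 0"
  proof (rule field_le_epsilon)
    fix e :: real assume "e > 0"
    then obtain pt where "pt \<in> Lam ` ball 0 1" "\<forall>h\<in>{f}. cmod (pt h - \<phi> h) < e"
      using gelfand_closureD(2)[OF \<phi>[unfolded K_def], of "{f}" e] f by auto
    then show "cmod (\<phi> f) \<le> 0 + e" using z by auto
  qed
  then show "\<phi> f = 0" by simp
qed

section \<open>t-analytic sets containing the thin point\<close>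

context
  fixes E assumes E: "t_analytic HinfC E" and xE: "x \<in> E"
begin

lemma EsubC: "E \<subseteq> characters HinfC" using E by (simp add: t_analytic_def)

text \<open>The form in which t-analyticity is used: the points of \<open>E\<close> at which
  \<open>v\<close> is smaller than \<open>1/2\<close> form a relatively open set, and
  \<open>x\<close> belongs to it.\<close>

lemma E_vanish:
  assumes f: "f \<in> HinfC" and v: "v \<in> HinfC" "x v = 0" and z: "\<And>y. y \<in> E \<Longrightarrow> cmod (y v) < 1/2 \<Longrightarrow> y f = 0" and y: "y \<in> E"
  shows "y f = 0"
proof -
  define T where "T = {y \<in> characters HinfC. \<forall>h\<in>{v}. cmod (y h - 0) < 1/2}"
  have "openin (gelfand HinfC) T" unfolding T_def by (rule openin_gelfand_basic) (use v in auto)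
  then have "openin (subtopology (gelfand HinfC) E) (T \<inter> E)" unfolding openin_subtopology by blast
  moreover have "x \<in> T \<inter> E" using x xE v by (simp add: T_def)
  moreover have "\<forall>\<phi>\<in>T \<inter> E. \<phi> f = 0" using z by (auto simp: T_def)
  ultimately show ?thesis using E f y unfolding t_analytic_def by blast
qed

text \<open>One function \<open>v\<close>, the product with simple zeros from the index
  \<open>N\<close> on, confines nearby points of \<open>E\<close> to disks of ultrafilters
  \<open>V\<close>. The products that exclude the \<open>V\<close> other than \<open>U\<close> may
  depend on the point, since each of them vanishes on all of \<open>E\<close>.\<close>

lemma E_local:
  "\<exists>v. v \<in> Hinf \<and> x v = 0 \<and> (\<forall>y\<in>E. cmod (y v) < 1/2 \<longrightarrow> y \<in> Lam ` ball 0 1)"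
proof -
  have "1/2 < (1::real)" by simp
  from small_on_disk[OF this] obtain N where N0: "\<forall>A y. A \<subseteq> {N..} \<longrightarrow> y \<in> characters HinfC \<longrightarrow> cmod (y (B (ind A))) \<le> 1/2 \<longrightarrow>
    (\<exists>V w0. ultra V \<and> V \<le> sequentially \<and> eventually (\<lambda>k. k \<in> A) V \<and> w0 \<in> ball 0 1 \<and> (\<forall>f\<in>Hinf. y f = psi V w0 f))" by (rule exE)
  note N = N0[rule_format]
  have evN: "eventually (\<lambda>k. k \<in> {N..}) U" using U_seq by (simp add: le_sequentially)
  show ?thesis
  proof (intro exI[of _ "B (ind {N..})"] conjI B(1) x_B_ind[OF evN] ballI impI)
    fix y assume y: "y \<in> E" "cmod (y (B (ind {N..}))) < 1/2"
    have yC: "y \<in> characters HinfC" using y EsubC by blast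
    obtain V w0 where V: "ultra V" "V \<le> sequentially" "w0 \<in> ball 0 1" "\<And>f. f \<in> Hinf \<Longrightarrow> y f = psi V w0 f"
      using N[OF order_refl yC] y(2) by auto
    have "V = U"
    proof (rule ccontr)
      assume "V \<noteq> U"
      then obtain A0 where A0: "eventually (\<lambda>k. k \<in> A0) U" "eventually (\<lambda>k. k \<notin> A0) V" by (rule same_ultra[OF V(1)])
      define A where "A = A0 \<inter> {N..}"
      have AU: "eventually (\<lambda>k. k \<in> A) U" unfolding A_def by (rule ev_tail[OF A0(1)])
      \<comment> \<open>Full multiplicities on \<open>A\<close>, none outside. At points of
        \<open>E\<close> where the simple product over \<open>A\<close> is small, the ultrafilter
        contains \<open>A\<close>, and there \<open>q\<close> tends to infinity; along
        \<open>V\<close> it is eventually \<open>0\<close>.\<close>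
      define q where "q k = (if k \<in> A then p k else 0)" for k
      have q: "q j \<le> p j" for j by (simp add: q_def)
      have "y (B q) = 0"
      proof (rule E_vanish[OF Hinf_sub[OF B(1)] Hinf_sub[OF B(1)] x_B_ind[OF AU] _ y(1)])
        fix y' assume y': "y' \<in> E" "cmod (y' (B (ind A))) < 1/2"
        have AN: "A \<subseteq> {N..}" by (simp add: A_def)
        have "y' \<in> characters HinfC" using y'(1) EsubC by blast
        from N[OF AN this less_imp_le[OF y'(2)]] obtain V' w' where V': "ultra V'" "V' \<le> sequentially" "eventually (\<lambda>k. k \<in> A) V'" "w' \<in> ball 0 1" "\<And>f. f \<in> Hinf \<Longrightarrow> y' f = psi V' w' f"
          by blast
        have "filterlim q at_top V'"
          unfolding filterlim_at_top
        proof
          fix n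
          have "eventually (\<lambda>k. n \<le> p k) V'" using p_lim V'(2) unfolding filterlim_at_top le_filter_def by blast
          with V'(3) show "eventually (\<lambda>k. n \<le> q k) V'" by eventually_elim (simp add: q_def)
        qed
        from psi_B_zero[OF V'(1) this V'(4)] show "y' (B q) = 0" by (simp add: V'(5) B(1))
      qed
      moreover have "eventually (\<lambda>k. q k = 0) V" using A0(2) by eventually_elim (simp add: q_def A_def)
      from psi_B_lower[OF V(1,2) q this V(3)] have "1 \<le> cmod (y (B q))" by (simp add: V(4) B(1))
      ultimately show False by simp
    qed
    then show "y \<in> Lam ` ball 0 1" using Lam_uniqueI[OF yC V(3)] V(3,4) by blast
  qed
qed

lemma E_vanish':
  assumes f: "f \<in> HinfC" and z: "\<And>w. w \<in> ball 0 1 \<Longrightarrow> Lam w f = 0" and y: "y \<in> E"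
  shows "y f = 0"
proof -
  obtain v where v: "v \<in> Hinf" "x v = 0" "\<forall>y\<in>E. cmod (y v) < 1/2 \<longrightarrow> y \<in> Lam ` ball 0 1" using E_local by blast
  show ?thesis by (rule E_vanish[OF f Hinf_sub[OF v(1)] v(2) _ y]) (use v(3) z in auto)
qed

text \<open>A Gelfand neighbourhood of \<open>y\<close> that misses the disk is given by functions
  in \<open>HinfC\<close>, but estimates inside the disk need functions in \<open>Hinf\<close>. If
  \<open>y\<close> lies over the same point of the circle as \<open>x\<close>, the continuous parts
  take equal values at \<open>y\<close> and on the disk and cancel; otherwise \<open>Zf\<close>
  alone separates.\<close>

lemma separated:
  assumes y: "y \<in> characters HinfC" "y \<notin> K"
  obtains \<F> e' where "finite \<F>" "\<F> \<subseteq> Hinf" "e' > 0" "\<And>w. w \<in> ball 0 1 \<Longrightarrow> \<exists>f\<in>\<F>. e' \<le> cmod (psi U w f - y f)"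
proof (cases "y Zf = x Zf")
  case False
  show ?thesis
  proof (rule that[of "{Zf}" "cmod (x Zf - y Zf)"])
    show "\<exists>f\<in>{Zf}. cmod (x Zf - y Zf) \<le> cmod (psi U w f - y f)" if "w \<in> ball 0 1" for w
      using psi_Zf(1)[OF U U_seq that] x_psi[OF Zf_Hinf] by simp
  qed (use False Zf_Hinf in auto)
next
  case True
  obtain \<F> e' where F: "finite \<F>" "\<F> \<subseteq> HinfC" "e' > 0" "\<And>pt. pt \<in> Lam ` ball 0 1 \<Longrightarrow> \<exists>f\<in>\<F>. e' \<le> cmod (pt f - y f)"
    using gelfand_closureI[OF y(1) Lam_sub] y(2) unfolding K_def by (meson not_le)
  have "\<forall>h\<in>\<F>. \<exists>f. f \<in> Hinf \<and> (\<forall>w\<in>ball 0 1. Lam w h - y h = psi U w f - y f)"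
  proof
    fix h assume "h \<in> \<F>"
    then have "h \<in> HinfC" using F(2) by blast
    then obtain f g where fg: "f \<in> Hinf" "continuous_on (sphere 0 1) g" "h = f + abs_Linf g" by (rule HinfC_cases)
    have "\<forall>w\<in>ball 0 1. Lam w h - y h = psi U w f - y f"
      using Lam_eq[OF _ fg(1,2)] char_eq[OF y(1) fg(1,2)] True by (simp add: fg(3))
    then show "\<exists>f. f \<in> Hinf \<and> (\<forall>w\<in>ball 0 1. Lam w h - y h = psi U w f - y f)" using fg(1) by blast
  qed
  from bchoice[OF this] obtain c where c: "\<forall>h\<in>\<F>. c h \<in> Hinf \<and> (\<forall>w\<in>ball 0 1. Lam w h - y h = psi U w (c h) - y (c h))" by (rule exE)
  show ?thesis
  proof (rule that[of "c ` \<F>" e'])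
    fix w :: complex assume w: "w \<in> ball 0 1"
    then obtain h where "h \<in> \<F>" "e' \<le> cmod (Lam w h - y h)" using F(4)[of "Lam w"] by blast
    then show "\<exists>f\<in>c ` \<F>. e' \<le> cmod (psi U w f - y f)" using c w by auto
  qed (use F c in auto)
qed

text \<open>For each fixed radius, the pseudohyperbolic disk around \<open>z k\<close> avoids a
  neighbourhood of \<open>y\<close> for \<open>U\<close>-almost all \<open>k\<close>. A diagonal
  choice then lets the radii \<open>r k\<close> tend to \<open>1\<close> and the multiplicities
  \<open>q k\<close> to infinity along \<open>U\<close>, slowly enough for \<open>B_far\<close> to
  keep the product above \<open>1/4\<close> near \<open>y\<close>.\<close>

lemma E_sub_K: "E \<subseteq> K"
proof
  fix y assume yE: "y \<in> E"
  then have y: "y \<in> characters HinfC" using EsubC by blast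
  show "y \<in> K"
  proof (rule ccontr)
    assume "y \<notin> K"
    then obtain \<F> e' where F: "finite \<F>" "\<F> \<subseteq> Hinf" "e' > 0" "\<And>w. w \<in> ball 0 1 \<Longrightarrow> \<exists>f\<in>\<F>. e' \<le> cmod (psi U w f - y f)"
      using separated[OF y] by metis
    define P where "P n k \<longleftrightarrow> (\<forall>w\<in>cball 0 (1 - 1 / (real n + 2)). \<exists>f\<in>\<F>. e' / 2 \<le> cmod (disk_ext f (bl (- z k) w) - y f))" for n k
    have evP: "eventually (P n) U" for n
    proof (rule ccontr)
      assume "\<not> eventually (P n) U"
      then have ev: "eventually (\<lambda>k. \<not> P n k) U" using ultraD(2)[OF U] by simp
      \<comment> \<open>If \<open>P n\<close> failed along \<open>U\<close>, the offending
        coordinates \<open>W k\<close> would converge to some \<open>w0\<close>, and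
        \<open>Lam w0\<close> would be within \<open>e' / 2\<close> of \<open>y\<close> on all of
        \<open>\<F>\<close>.\<close>
      define W where "W k = (SOME w. w \<in> cball 0 (1 - 1 / (real n + 2)) \<and> (\<forall>f\<in>\<F>. cmod (disk_ext f (bl (- z k) w) - y f) < e' / 2))" for k
      have W: "eventually (\<lambda>k. W k \<in> cball 0 (1 - 1 / (real n + 2)) \<and> (\<forall>f\<in>\<F>. cmod (disk_ext f (bl (- z k) (W k)) - y f) < e' / 2)) U"
        using ev
      proof eventually_elim
        case (elim k)
        then have "\<exists>w. w \<in> cball 0 (1 - 1 / (real n + 2)) \<and> (\<forall>f\<in>\<F>. cmod (disk_ext f (bl (- z k) w) - y f) < e' / 2)"
          unfolding P_def by (auto simp: not_le)
        from someI_ex[OF this] show ?case unfolding W_def .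
      qed
      then have "eventually (\<lambda>k. W k \<in> cball 0 (1 - 1 / (real n + 2))) U" by (rule eventually_mono) blast
      then obtain w0 where w0: "w0 \<in> cball 0 (1 - 1 / (real n + 2))" "(W \<longlongrightarrow> w0) U" by (rule ultra_tendsto_compact[OF U compact_cball])
      have w01: "w0 \<in> ball 0 1"
      proof -
        have "1 / (real n + 2) > 0" by simp
        then show ?thesis using w0(1) unfolding mem_cball mem_ball by linarith
      qed
      obtain f where f: "f \<in> \<F>" "e' \<le> cmod (psi U w0 f - y f)" using F(4)[OF w01] by blast
      have "((\<lambda>k. cmod (disk_ext f (bl (- z k) (W k)) - y f)) \<longlongrightarrow> cmod (psi U w0 f - y f)) U"
        by (intro tendsto_norm tendsto_diff tendsto_const psi_moving U w0(2) w01) (use f F(2) in blast)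
      moreover have "eventually (\<lambda>k. cmod (disk_ext f (bl (- z k) (W k)) - y f) \<le> e' / 2) U"
        using W by (rule eventually_mono) (use f in \<open>auto intro: less_imp_le\<close>)
      ultimately have "cmod (psi U w0 f - y f) \<le> e' / 2" using tendsto_upperbound ultraD(1)[OF U] by blast
      then show False using f(2) F(3) by simp
    qed
    \<comment> \<open>The condition on \<open>\<tau> k\<close> makes the second factor in
      \<open>B_far\<close> at least \<open>1/2\<close> for a radius \<open>1 - 1 / (n + 1)\<close>,
      and \<open>n \<le> p k\<close> allows multiplicities up to \<open>n\<close>. Asking for
      \<open>P i\<close> with \<open>i < n\<close> matches this radius, as \<open>P (n - 1)\<close>
      refers to \<open>1 - 1 / (n + 1)\<close>.\<close>
    define Good where "Good n k \<longleftrightarrow> (\<forall>i<n. P i k) \<and> 6 * (real n + 1) * \<tau> k \<le> 1 \<and> n \<le> p k" for n k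
    have evG: "eventually (Good n) U" for n
    proof -
      have "eventually (\<lambda>k. \<forall>i\<in>{..<n}. P i k) U" by (intro eventually_ball_finite ballI evP) simp
      moreover have "((\<lambda>k. 6 * (real n + 1) * \<tau> k) \<longlongrightarrow> 6 * (real n + 1) * 0) U"
        by (intro tendsto_intros tendsto_mono[OF U_seq \<tau>_lim])
      then have "eventually (\<lambda>k. 6 * (real n + 1) * \<tau> k < 1) U" by (rule order_tendstoD(2)) simp
      moreover have "eventually (\<lambda>k. n \<le> p k) U" using p_lim U_seq unfolding filterlim_at_top le_filter_def by blast
      ultimately show ?thesis by eventually_elim (auto simp: Good_def)
    qed
    \<comment> \<open>The largest good \<open>n\<close> up to \<open>k\<close>; the cap at
      \<open>k\<close> makes the set finite. The default \<open>0\<close> leads to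
      \<open>q k = 0\<close>, so such a \<open>k\<close> contributes no factor.\<close>
    define m where "m k = Max (insert 0 {n. n \<le> k \<and> Good n k})" for k
    have m_ge: "n \<le> m k" if "n \<le> k" "Good n k" for n k unfolding m_def using that by (intro Max_ge) auto
    have m_good: "Good (m k) k" if "m k \<ge> 1" for k
    proof -
      have "m k \<in> insert 0 {n. n \<le> k \<and> Good n k}" unfolding m_def by (rule Max_in) auto
      then show ?thesis using that by auto
    qed
    have evm: "eventually (\<lambda>k. n \<le> m k) U" for n
    proof -
      have "eventually (\<lambda>k. n \<le> k) U" using U_seq by (simp add: le_sequentially)
      with evG[of n] show ?thesis by eventually_elim (rule m_ge)
    qed
    \<comment> \<open>Half of \<open>m k\<close>, so that Bernoulli's inequality yields
      \<open>r k ^ q k \<ge> 1/2\<close>; it still tends to infinity along \<open>U\<close>.\<close>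
    define q where "q k = m k div 2" for k
    define r where "r k = 1 - 1 / (real (m k) + 1)" for k
    have q1: "m k \<ge> 1 \<and> Good (m k) k" if "q k \<ge> 1" for k using that m_good[of k] by (auto simp: q_def)
    have qp: "q j \<le> p j" for j
    proof (cases "q j \<ge> 1")
      case True
      then have "m j \<le> p j" using q1 by (auto simp: Good_def)
      then show ?thesis by (simp add: q_def)
    qed simp
    have "filterlim q at_top U"
      unfolding filterlim_at_top
    proof
      fix n
      show "eventually (\<lambda>k. n \<le> q k) U" using evm[of "2 * n"] by eventually_elim (simp add: q_def)
    qed
    then have LB: "Lam w (B q) = 0" if "w \<in> ball 0 1" for w
      using psi_B_zero[OF U _ that] by (simp add: Lam(2)[OF that] B(1))
    have y0: "y (B q) = 0" by (rule E_vanish'[OF Hinf_sub[OF B(1)] LB yE])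
    obtain \<G> where G: "ultra \<G>" "eventually (\<lambda>\<zeta>. \<zeta> \<in> ball 0 1) \<G>" "\<And>f. f \<in> Hinf \<Longrightarrow> ((\<lambda>\<zeta>. disk_ext f \<zeta>) \<longlongrightarrow> y f) \<G>"
      by (rule hchar_ultra[OF char_hchar[OF y]]) (use that in blast)
    have "eventually (\<lambda>\<zeta>. \<forall>f\<in>\<F>. dist (disk_ext f \<zeta>) (y f) < e' / 2) \<G>"
      by (intro eventually_ball_finite F(1) ballI tendstoD[OF G(3)]) (use F(2,3) in auto)
    with G(2) have "eventually (\<lambda>\<zeta>. 1/4 \<le> cmod (disk_ext (B q) \<zeta>)) \<G>"
    proof eventually_elim
      case (elim \<zeta>)
      then have \<zeta>1: "cmod \<zeta> < 1" by simp
      show ?case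
      proof (rule B_far[OF qp _ _ _ elim(1)])
        fix k assume k: "q k \<ge> 1"
        have mk: "m k \<ge> 1" "Good (m k) k" using q1[OF k] by auto
        have rk: "0 < r k" "r k < 1" using mk(1) by (auto simp: r_def field_simps)
        have "1 - real (q k) * (1 / (real (m k) + 1)) \<le> r k ^ q k"
          using Bernoulli_inequality[of "- (1 / (real (m k) + 1))" "q k"] by (simp add: r_def)
        moreover have "real (q k) * (1 / (real (m k) + 1)) \<le> 1/2"
        proof -
          have "2 * q k \<le> m k" by (simp add: q_def)
          then have "2 * real (q k) \<le> real (m k) + 1" by linarith
          then show ?thesis by (simp add: divide_le_eq)
        qed
        ultimately have a: "1/2 \<le> r k ^ q k" by linarith
        have "3 * \<tau> k / (1 - r k) = 3 * (real (m k) + 1) * \<tau> k" by (simp add: r_def)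
        also have "\<dots> \<le> 1/2"
        proof -
          have "6 * (real (m k) + 1) * \<tau> k = 2 * (3 * (real (m k) + 1) * \<tau> k)" by simp
          moreover have "6 * (real (m k) + 1) * \<tau> k \<le> 1" using mk(2) by (simp only: Good_def)
          ultimately show ?thesis by linarith
        qed
        finally have b: "1/2 \<le> 1 - 3 * \<tau> k / (1 - r k)" by simp
        have "(1/2) * (1/2) \<le> r k ^ q k * (1 - 3 * \<tau> k / (1 - r k))" using a b rk by (intro mult_mono) auto
        then show "0 < r k \<and> r k < 1 \<and> 1/4 \<le> r k ^ q k * (1 - 3 * \<tau> k / (1 - r k))" using rk by simp
        show "r k \<le> cmod (bl (z k) \<zeta>)"
        proof (rule ccontr)
          assume "\<not> ?thesis"
          then have "cmod (bl (z k) \<zeta>) \<le> r k" by simp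
          \<comment> \<open>The radius \<open>r k\<close> belongs to the index
            \<open>m k - 1\<close> of \<open>P\<close>, which is covered because
            \<open>Good (m k) k\<close> includes all smaller indices.\<close>
          moreover have "r k = 1 - 1 / (real (m k - 1) + 2)" using mk(1) by (simp add: r_def of_nat_diff)
          ultimately have "bl (z k) \<zeta> \<in> cball 0 (1 - 1 / (real (m k - 1) + 2))" by simp
          moreover have "P (m k - 1) k" using mk by (simp add: Good_def)
          ultimately obtain f where "f \<in> \<F>" "e' / 2 \<le> cmod (disk_ext f (bl (- z k) (bl (z k) \<zeta>)) - y f)" unfolding P_def by blast
          then show False using elim(2) by (auto simp: bl_inverse[OF z1 \<zeta>1] dist_norm)
        qed
      qed auto
    qed
    then have "1/4 \<le> cmod (y (B q))"
      by (rule tendsto_lowerbound[OF tendsto_norm[OF G(3)[OF B(1)]] _ ultraD(1)[OF G(1)]])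
    then show False using y0 by simp
  qed
qed

end

end

theorem theorem5p12:
  fixes E :: "(Linf \<Rightarrow> complex) set" and x :: "Linf \<Rightarrow> complex"
  assumes "maximal_t_analytic HinfC E"
    and "thin_point x"
    and "x \<in> E"
  shows "E = gelfand HinfC closure_of gleason_part HinfC x"
proof -
  obtain z where z: "thin_sequence z" "restrict x Hinf \<in> gelfand Hinf closure_of range (\<lambda>n. disk_eval (z n))"
    and x: "x \<in> characters HinfC"
    using assms(2) unfolding thin_point_def by blast
  interpret thin_seq z by unfold_locales (rule z(1))
  obtain p \<tau> where p: "\<And>j. p j \<ge> 1" "filterlim p at_top sequentially" "\<tau> \<longlonglongrightarrow> 0" "\<And>k. \<tau> k \<ge> 0"
    "\<And>k J. finite J \<Longrightarrow> k \<notin> J \<Longrightarrow> (\<Sum>j\<in>J. real (p j) * e k j) \<le> \<tau> k"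
    by (rule slow_multiplicities) blast
  \<comment> \<open>Membership in the closure of the sequence gives approximation by the points
    \<open>z k\<close> themselves, so \<open>U\<close> can be an ultrafilter on the indices.\<close>
  have ap: "\<exists>k\<in>UNIV. \<forall>f\<in>\<F>. cmod (disk_ext f (z k) - x f) < e" if h: "finite \<F>" "\<F> \<subseteq> Hinf" "e > 0" for \<F> e
  proof -
    obtain pt where "pt \<in> range (\<lambda>n. disk_eval (z n))" "\<forall>f\<in>\<F>. cmod (pt f - restrict x Hinf f) < e"
      using gelfand_closureD(2)[OF z(2) h] by blast
    then obtain k where "\<forall>f\<in>\<F>. cmod (disk_eval (z k) f - restrict x Hinf f) < e" by blast
    then show ?thesis using h(2) by (intro bexI[of _ k]) (auto simp: disk_eval_def subset_eq)
  qed
  obtain U where U: "ultra U" "\<And>f. f \<in> Hinf \<Longrightarrow> ((\<lambda>k. disk_ext f (z k)) \<longlongrightarrow> x f) U"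
    by (rule ultra_realize[of Hinf UNIV "\<lambda>k f. disk_ext f (z k)" x, OF ap]) (use that in blast)+
  interpret thin_pt z p \<tau> x U
    by unfold_locales (use p x U in auto)
  have E: "t_analytic HinfC E" "\<And>F. t_analytic HinfC F \<Longrightarrow> E \<subseteq> F \<Longrightarrow> F = E"
    using assms(1) by (auto simp: maximal_t_analytic_def)
  have "K = E" by (rule E(2)[OF K_analytic E_sub_K[OF E(1) assms(3)]])
  then show ?thesis by (simp add: K_def gleason_part_eq)
qed

end
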